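(* Let $\delta>0$, $E\in(0,E_\delta)$, and let $W\in L^\infty(\mathbb R\times\mathcal S)$, $W\ge0$, $W$ not a.e. zero, satisfy $W(x_1,x_\ell)=O\big((1+|x_1|)^{-(3+\eta)/2}\big)$ (uniformly in $x_\ell$) for some $\eta>0$. Assume moreover that: (i) for a.e. $x_1\in\mathbb R$, $x_\ell\mapsto W(x_1,x_\ell)$ belongs to $C^4(\mathcal S)$ and vanishes in a neighborhood of the boundary $\partial\mathcal S$; (ii) $W(x_1,x_\ell)=0$ for a.e. $(x_1,x_\ell)\in I\times\mathcal S$, where $I$ is some unbounded subinterval of $\mathbb R$. Then there exists $\tilde g_0>0$ such that for all $g\in(0,\tilde g_0)$, the quasi-momentum $k$ of any guided state with energy $E$ belongs to $\mathcal C_g(E)$.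
   Context: Let $a_2,a_3\in\mathbb R^2$ be fixed nonzero orthogonal vectors, $\mathcal S=\{s_2a_2+s_3a_3:\ -1/2<s_j\le 1/2\}$, $b_j=2\pi a_j/|a_j|^2$, $\mathcal L^\perp=\mathbb Z b_2+\mathbb Z b_3$, $\mathcal B=\{t_2b_2+t_3b_3:\ -1/2<t_j\le 1/2\}$; $|\mathcal S|$, $|\mathcal B|$ denote areas. Points of $\mathbb R\times\mathcal S$ are $x=(x_1,x_\ell)$; $\mathcal H=L^2(\mathbb R\times\mathcal S)$. For $\delta\ge0$, $E_\delta=\frac{1}{4(1+\delta)}\min_{j=2,3}|b_j|^2$. For $k\in\mathcal B$, $H_0(k)=-\Delta$ in $\mathcal H$ with domain the set of $\varphi\in H^2(\mathbb R\times\mathcal S)$ satisfying $\varphi(x_1,x_\ell+a_j)=e^{\mathrm i\langle k,a_j\rangle}\varphi(x_1,x_\ell)$ and $\partial_j\varphi(x_1,x_\ell+a_j)=e^{\mathrm i\langle k,a_j\rangle}\partial_j\varphi(x_1,x_\ell)$ for $j=2,3$, whenever $x_\ell,x_\ell+a_j\in\partial\mathcal S$ ($\partial_j$ = derivative with respect to $s_j$). $H(k)=H_0(k)-gW^2$, $g>0$. A guided state with energy $E$ and quasi-momentum $k\in\mathcal B$ is a nonzero $u\in\mathcal H$ (in the domain of $H(k)$) with $H(k)u=Eu$. For $k\in\mathcal B$ with $|k|^2\neq E$, $\Gamma_k(E)$ is the integral operator in $\mathcal H$ with kernel $\mathrm i\beta W(x)W(y)\sum_{K\in\mathcal L^\perp}\frac{e^{\mathrm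 i\sqrt{E-|k+K|^2}|x_1-y_1|}}{\sqrt{E-|k+K|^2}}e^{\mathrm i\langle k+K,x_\ell-y_\ell\rangle}$, $\beta=\frac{|\mathcal B|}{8\pi^2}=\frac1{2|\mathcal S|}$, with the square root of nonnegative imaginary part (positive on positive reals). $\mathcal C_g(E)=\{k\in\mathcal B:\ |k|^2\ne E,\ 1-g\Gamma_k(E)\text{ is not boundedly invertible in }\mathcal H\}$. *)

theory Defs
  imports "HOL-Analysis.Analysis"
begin

definition cell :: "real^2 \<Rightarrow> real^2 \<Rightarrow> (real^2) set" where
  "cell v w = {s *\<^sub>R v + t *\<^sub>R w | s t. -1/2 < s \<and> s \<le> 1/2 \<and> -1/2 < t \<and> t \<le> 1/2}"

definition dual_vec :: "real^2 \<Rightarrow> real^2" where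
  "dual_vec a = (2 * pi / (norm a)\<^sup>2) *\<^sub>R a"

definition brillouin :: "real^2 \<Rightarrow> real^2 \<Rightarrow> (real^2) set" where
  "brillouin a2 a3 = cell (dual_vec a2) (dual_vec a3)"

definition dual_lattice :: "real^2 \<Rightarrow> real^2 \<Rightarrow> (real^2) set" where
  "dual_lattice a2 a3 = {of_int m *\<^sub>R dual_vec a2 + of_int n *\<^sub>R dual_vec a3 | m n. True}"

definition E_thr :: "real^2 \<Rightarrow> real^2 \<Rightarrow> real \<Rightarrow> real" where
  "E_thr a2 a3 \<delta> =
     1 / (4 * (1 + \<delta>)) * min ((norm (dual_vec a2))\<^sup>2) ((norm (dual_vec a3))\<^sup>2)"

definition strip :: "real^2 \<Rightarrow> real^2 \<Rightarrow> (real \<times> (real^2)) set" where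
  "strip a2 a3 = UNIV \<times> cell a2 a3"

text \<open>Elements of \<open>L\<^sup>2\<close> are represented by functions; equality in \<open>L\<^sup>2\<close> is equality almost
  everywhere.\<close>

definition L2 :: "'a measure \<Rightarrow> ('a \<Rightarrow> complex) set" where
  "L2 M = {f \<in> borel_measurable M. integrable M (\<lambda>x. (cmod (f x))\<^sup>2)}"

definition L2norm :: "'a measure \<Rightarrow> ('a \<Rightarrow> complex) \<Rightarrow> real" where
  "L2norm M f = sqrt (\<integral>x. (cmod (f x))\<^sup>2 \<partial>M)"

abbreviation hilb :: "real^2 \<Rightarrow> real^2 \<Rightarrow> (real \<times> (real^2)) measure" where
  "hilb a2 a3 \<equiv> lebesgue_on (strip a2 a3)"

text \<open>Compatibility with equality almost everywhere follows from linearity and boundedness.\<close>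

definition bounded_L2_op ::
    "'a measure \<Rightarrow> (('a \<Rightarrow> complex) \<Rightarrow> ('a \<Rightarrow> complex)) \<Rightarrow> bool" where
  "bounded_L2_op M T \<longleftrightarrow>
     (\<forall>f\<in>L2 M. T f \<in> L2 M) \<and>
     (\<forall>f\<in>L2 M. \<forall>h\<in>L2 M. AE x in M. T (\<lambda>y. f y + h y) x = T f x + T h x) \<and>
     (\<forall>f\<in>L2 M. \<forall>c. AE x in M. T (\<lambda>y. c * f y) x = c * T f x) \<and>
     (\<exists>C. \<forall>f\<in>L2 M. L2norm M (T f) \<le> C * L2norm M f)"

text \<open>\<open>A\<close> is regarded as an operator in \<open>L\<^sup>2\<close> with domain \<open>{f \<in> L\<^sup>2. A f \<in> L\<^sup>2}\<close>, so that its
  boundedness need not be part of the definition.\<close>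

definition boundedly_invertible ::
    "'a measure \<Rightarrow> (('a \<Rightarrow> complex) \<Rightarrow> ('a \<Rightarrow> complex)) \<Rightarrow> bool" where
  "boundedly_invertible M A \<longleftrightarrow>
     (\<exists>R. bounded_L2_op M R \<and>
          (\<forall>h\<in>L2 M. AE x in M. A (R h) x = h x) \<and>
          (\<forall>f\<in>L2 M. A f \<in> L2 M \<longrightarrow> (AE x in M. R (A f) x = f x)))"

text \<open>Meant for open sets \<open>S\<close>.\<close>

fun Ck_on :: "nat \<Rightarrow> 'a::euclidean_space set \<Rightarrow> ('a \<Rightarrow> 'b::real_normed_vector) \<Rightarrow> bool" where
  "Ck_on 0 S f \<longleftrightarrow> continuous_on S f"
| "Ck_on (Suc n) S f \<longleftrightarrow>
     f differentiable_on S \<and> (\<forall>b\<in>Basis. Ck_on n S (\<lambda>x. frechet_derivative f (at x) b))"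

definition test_fun :: "'a::euclidean_space set \<Rightarrow> ('a \<Rightarrow> complex) \<Rightarrow> bool" where
  "test_fun \<Omega> \<phi> \<longleftrightarrow>
     (\<forall>n. Ck_on n UNIV \<phi>) \<and> (\<exists>K. compact K \<and> K \<subseteq> \<Omega> \<and> (\<forall>x. x \<notin> K \<longrightarrow> \<phi> x = 0))"

text \<open>\<open>w\<close> is the weak derivative of \<open>u\<close> in direction \<open>v\<close> on the open set \<open>\<Omega>\<close>, and lies in
  \<open>L\<^sup>2(\<Omega>)\<close>.\<close>

definition has_weak_deriv ::
    "'a::euclidean_space set \<Rightarrow> 'a \<Rightarrow> ('a \<Rightarrow> complex) \<Rightarrow> ('a \<Rightarrow> complex) \<Rightarrow> bool" where
  "has_weak_deriv \<Omega> v u w \<longleftrightarrow>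
     w \<in> L2 (lebesgue_on \<Omega>) \<and>
     (\<forall>\<phi>. test_fun \<Omega> \<phi> \<longrightarrow>
        (\<integral>x. u x * frechet_derivative \<phi> (at x) v \<partial>lebesgue_on \<Omega>)
        = - (\<integral>x. w x * \<phi> x \<partial>lebesgue_on \<Omega>))"

definition weak_deriv ::
    "'a::euclidean_space set \<Rightarrow> 'a \<Rightarrow> ('a \<Rightarrow> complex) \<Rightarrow> ('a \<Rightarrow> complex)" where
  "weak_deriv \<Omega> v u = (SOME w. has_weak_deriv \<Omega> v u w)"

fun sobolev :: "nat \<Rightarrow> 'a::euclidean_space set \<Rightarrow> ('a \<Rightarrow> complex) \<Rightarrow> bool" where
  "sobolev 0 \<Omega> u \<longleftrightarrow> u \<in> L2 (lebesgue_on \<Omega>)"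
| "sobolev (Suc m) \<Omega> u \<longleftrightarrow>
     u \<in> L2 (lebesgue_on \<Omega>) \<and> (\<forall>b\<in>Basis. \<exists>w. has_weak_deriv \<Omega> b u w \<and> sobolev m \<Omega> w)"

definition weak_laplacian ::
    "'a::euclidean_space set \<Rightarrow> ('a \<Rightarrow> complex) \<Rightarrow> ('a \<Rightarrow> complex)" where
  "weak_laplacian \<Omega> u = (\<lambda>x. \<Sum>b\<in>Basis. weak_deriv \<Omega> b (weak_deriv \<Omega> b u) x)"

text \<open>The trace operator is the closure of the restriction map from \<open>H\<^sup>1(\<Omega>)\<close> to \<open>L\<^sup>2\<close> of a piece
  of the boundary, defined on restrictions to \<open>\<Omega>\<close> of smooth compactly supported functions on the
  whole space. The piece of the boundary is given by a parametrisation \<open>\<gamma>\<close> with parameter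
  measure \<open>P\<close>.\<close>

definition has_trace ::
    "'a::euclidean_space set \<Rightarrow> 'p measure \<Rightarrow> ('p \<Rightarrow> 'a) \<Rightarrow> ('a \<Rightarrow> complex) \<Rightarrow> ('p \<Rightarrow> complex) \<Rightarrow> bool"
  where
  "has_trace \<Omega> P \<gamma> u \<tau> \<longleftrightarrow>
     sobolev 1 \<Omega> u \<and> \<tau> \<in> L2 P \<and>
     (\<exists>U :: nat \<Rightarrow> 'a \<Rightarrow> complex.
        (\<forall>n. test_fun UNIV (U n)) \<and>
        (\<lambda>n. L2norm (lebesgue_on \<Omega>) (\<lambda>x. U n x - u x)) \<longlonglongrightarrow> 0 \<and>
        (\<forall>b\<in>Basis. (\<lambda>n. L2norm (lebesgue_on \<Omega>)
            (\<lambda>x. frechet_derivative (U n) (at x) b - weak_deriv \<Omega> b u x)) \<longlonglongrightarrow> 0) \<and>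
        (\<lambda>n. L2norm P (\<lambda>p. U n (\<gamma> p) - \<tau> p)) \<longlonglongrightarrow> 0)"

text \<open>\<open>a\<close> is the lattice vector across which the condition is imposed, \<open>a'\<close> the other one. The two
  opposite faces of \<open>\<real> \<times> \<S>\<close> are parametrised by \<open>(x\<^sub>1, s) \<in> \<real> \<times> [-1/2, 1/2]\<close>; up to a constant
  factor, the parameter measure is the surface measure.\<close>

definition quasi_periodic ::
    "real^2 \<Rightarrow> real^2 \<Rightarrow> real^2 \<Rightarrow> (real \<times> (real^2) \<Rightarrow> complex) \<Rightarrow> bool" where
  "quasi_periodic a a' k \<phi> \<longleftrightarrow>
     (let \<Omega> = interior (strip a a');
          P = lebesgue_on (UNIV \<times> {-1/2..1/2} :: (real \<times> real) set);
          face = (\<lambda>r (x1, s). (x1, r *\<^sub>R a + s *\<^sub>R a'))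
      in \<exists>\<tau>0 \<tau>1. has_trace \<Omega> P (face (-1/2)) \<phi> \<tau>0 \<and> has_trace \<Omega> P (face (1/2)) \<phi> \<tau>1 \<and>
           (AE p in P. \<tau>1 p = exp (\<i> * of_real (k \<bullet> a)) * \<tau>0 p))"

text \<open>The derivative with respect to \<open>s\<^sub>j\<close> is the directional derivative along \<open>(0, a\<^sub>j)\<close>.\<close>

definition dom_H :: "real^2 \<Rightarrow> real^2 \<Rightarrow> real^2 \<Rightarrow> (real \<times> (real^2) \<Rightarrow> complex) set" where
  "dom_H a2 a3 k =
     {\<phi> \<in> L2 (hilb a2 a3).
        sobolev 2 (interior (strip a2 a3)) \<phi> \<and>
        quasi_periodic a2 a3 k \<phi> \<and>
        quasi_periodic a2 a3 k (weak_deriv (interior (strip a2 a3)) (0, a2) \<phi>) \<and>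
        quasi_periodic a3 a2 k \<phi> \<and>
        quasi_periodic a3 a2 k (weak_deriv (interior (strip a2 a3)) (0, a3) \<phi>)}"

text \<open>The quasi-momentum \<open>k\<close> enters \<open>H(k)\<close> only through its domain \<^const>\<open>dom_H\<close>.\<close>

definition H_op ::
    "real^2 \<Rightarrow> real^2 \<Rightarrow> (real \<times> (real^2) \<Rightarrow> real) \<Rightarrow> real \<Rightarrow>
     (real \<times> (real^2) \<Rightarrow> complex) \<Rightarrow> (real \<times> (real^2) \<Rightarrow> complex)" where
  "H_op a2 a3 W g u =
     (\<lambda>x. - weak_laplacian (interior (strip a2 a3)) u x - of_real (g * (W x)\<^sup>2) * u x)"

definition guided_state ::
    "real^2 \<Rightarrow> real^2 \<Rightarrow> (real \<times> (real^2) \<Rightarrow> real) \<Rightarrow> real \<Rightarrow> real \<Rightarrow> real^2 \<Rightarrow>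
     (real \<times> (real^2) \<Rightarrow> complex) \<Rightarrow> bool" where
  "guided_state a2 a3 W g E k u \<longleftrightarrow>
     k \<in> brillouin a2 a3 \<and> u \<in> dom_H a2 a3 k \<and>
     \<not> (AE x in hilb a2 a3. u x = 0) \<and>
     (AE x in hilb a2 a3. H_op a2 a3 W g u x = of_real E * u x)"

text \<open>On real arguments \<^const>\<open>csqrt\<close> is the square root with nonnegative imaginary part that is
  positive on the positive reals. The series converges absolutely if \<open>fst x \<noteq> fst y\<close>.\<close>

definition Gamma_kernel ::
    "real^2 \<Rightarrow> real^2 \<Rightarrow> (real \<times> (real^2) \<Rightarrow> real) \<Rightarrow> real^2 \<Rightarrow> real \<Rightarrow>
     real \<times> (real^2) \<Rightarrow> real \<times> (real^2) \<Rightarrow> complex" where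
  "Gamma_kernel a2 a3 W k E x y =
     \<i> * of_real (measure lebesgue (brillouin a2 a3) / (8 * pi\<^sup>2)) * of_real (W x) * of_real (W y) *
     (\<Sum>\<^sub>\<infinity>K\<in>dual_lattice a2 a3.
        exp (\<i> * csqrt (of_real (E - (norm (k + K))\<^sup>2)) * of_real \<bar>fst x - fst y\<bar>)
          / csqrt (of_real (E - (norm (k + K))\<^sup>2))
        * exp (\<i> * of_real ((k + K) \<bullet> (snd x - snd y))))"

definition Gamma_op ::
    "real^2 \<Rightarrow> real^2 \<Rightarrow> (real \<times> (real^2) \<Rightarrow> real) \<Rightarrow> real^2 \<Rightarrow> real \<Rightarrow>
     (real \<times> (real^2) \<Rightarrow> complex) \<Rightarrow> (real \<times> (real^2) \<Rightarrow> complex)" where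
  "Gamma_op a2 a3 W k E f = (\<lambda>x. \<integral>y. Gamma_kernel a2 a3 W k E x y * f y \<partial>hilb a2 a3)"

definition C_set ::
    "real^2 \<Rightarrow> real^2 \<Rightarrow> (real \<times> (real^2) \<Rightarrow> real) \<Rightarrow> real \<Rightarrow> real \<Rightarrow> (real^2) set" where
  "C_set a2 a3 W g E =
     {k \<in> brillouin a2 a3. (norm k)\<^sup>2 \<noteq> E \<and>
        \<not> boundedly_invertible (hilb a2 a3)
            (\<lambda>f x. f x - of_real g * Gamma_op a2 a3 W k E f x)}"

end

theory Submission
  imports Defs
begin

text \<open>Expanding \<open>u\<close> in the plane waves \<open>exp(i\<langle>k + K, x\<^sub>l\<rangle>)\<close>, the equation \<open>H(k)u = Eu\<close> becomes the family of
  ordinary differential equations \<open>-u\<^sub>K'' + (|k + K|\<^sup>2 - E) u\<^sub>K = h\<^sub>K\<close> with \<open>h = gW\<^sup>2u\<close>. Since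
  \<open>E < E\<^sub>\<delta>\<close>, all modes \<open>K \<noteq> 0\<close> are evanescent, uniformly in \<open>k\<close>, and an \<open>L\<^sup>2\<close> solution has no homogeneous part,
  so \<open>u\<close> is the sum of the mode \<open>K = 0\<close> and of the convolution of \<open>h\<close> with the Green function of the
  evanescent modes.

  If \<open>|k|\<^sup>2 > E\<close>, the mode \<open>K = 0\<close> is evanescent as well, hence \<open>Wu = g\<Gamma>\<^sub>k(E)Wu\<close> and \<open>1 - g\<Gamma>\<^sub>k(E)\<close> is not
  injective. If \<open>|k|\<^sup>2 \<le> E\<close>, the square integrability of the mode \<open>K = 0\<close> forces it to be given by
  either of the one-sided fundamental solutions. Those bound it by \<open>\<integral>(1 + |x\<^sub>1|)|h|\<close> uniformly in
  \<open>x\<^sub>1\<close>, although each of them may grow linearly (for \<open>|k|\<^sup>2 = E\<close>). The weighted norm of \<open>h\<close> is then at most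
  \<open>O(g)\<close> times itself, with a constant that does not depend on \<open>k\<close>, and \<open>u\<close> vanishes for small \<open>g\<close>.\<close>

section \<open>Smooth functions on the line\<close>

text \<open>The coefficients u_K are never formed as functions of x_1. Derivatives and traces are
  only weak, so the equation is tested against a compactly supported function of x_1 times a
  conjugate plane wave, which gives for each mode an identity valid for all translates of the test
  function. Integrating it against a truncated fundamental solution replaces solving the
  differential equation; square integrability of \<open>u\<close> makes the truncation error vanish.
  Both sides of the decomposition then have equal pairings, and uniqueness of Fourier coefficients
  makes them equal almost everywhere. The series of the evanescent kernel need not converge
  absolutely where the two x_1 coordinates agree. The kernel is controlled through its L^1 norm in
  one variable, by a constant depending on the spectral gap alone. This dictates the weighted L^1
  norm of \<open>h\<close>, called \<open>M\<close>: multiplying |u| <= M + |F h| by g (1 + |x_1|)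
  W^2 costs the integral of (1 + |x_1|) W^2 in the first term and its supremum in the second. The
  decay exponent (3 + eta)/2 makes both finite.\<close>

fun Ck1 :: "nat \<Rightarrow> (real \<Rightarrow> complex) \<Rightarrow> bool" where
  "Ck1 0 f \<longleftrightarrow> continuous_on UNIV f"
| "Ck1 (Suc n) f \<longleftrightarrow> (\<exists>f'. (\<forall>x. (f has_vector_derivative f' x) (at x)) \<and> Ck1 n f')"

definition smooth1 :: "(real \<Rightarrow> complex) \<Rightarrow> bool" where
  "smooth1 f \<longleftrightarrow> (\<forall>n. Ck1 n f)"

lemma Ck1_SucD: "Ck1 (Suc n) f \<Longrightarrow> Ck1 n f"
proof (induction n arbitrary: f)
  case 0
  then show ?case
    by (auto simp: continuous_on_eq_continuous_at intro: has_vector_derivative_continuous)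
next
  case (Suc n)
  then show ?case by (metis Ck1.simps(2))
qed

lemma Ck1_add: "Ck1 n f \<Longrightarrow> Ck1 n g \<Longrightarrow> Ck1 n (\<lambda>x. f x + g x)"
proof (induction n arbitrary: f g)
  case 0 then show ?case by (auto intro: continuous_intros)
next
  case (Suc n)
  then obtain f' g' where "\<forall>x. (f has_vector_derivative f' x) (at x)" "Ck1 n f'"
    "\<forall>x. (g has_vector_derivative g' x) (at x)" "Ck1 n g'" by auto
  with Suc.IH show ?case by (auto intro!: exI[of _ "\<lambda>x. f' x + g' x"] derivative_intros)
qed

lemma Ck1_mult: "Ck1 n f \<Longrightarrow> Ck1 n g \<Longrightarrow> Ck1 n (\<lambda>x. f x * g x)"
proof (induction n arbitrary: f g)
  case 0 then show ?case by (auto intro: continuous_intros)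
next
  case (Suc n)
  then obtain f' g' where *: "\<forall>x. (f has_vector_derivative f' x) (at x)" "Ck1 n f'"
    "\<forall>x. (g has_vector_derivative g' x) (at x)" "Ck1 n g'" by auto
  have "Ck1 n (\<lambda>x. f x * g' x + f' x * g x)"
    using Suc * by (intro Ck1_add Suc.IH) (auto dest: Ck1_SucD simp del: Ck1.simps)
  with * show ?case
    by (auto intro!: exI[of _ "\<lambda>x. f x * g' x + f' x * g x"] has_vector_derivative_mult)
qed

lemma Ck1_const: "Ck1 n (\<lambda>x. c)"
  by (induction n arbitrary: c) (auto intro!: exI[of _ "\<lambda>x. 0"] derivative_intros)

lemma Ck1_affine: "Ck1 n f \<Longrightarrow> Ck1 n (\<lambda>x. f (c * x + d))"
proof (induction n arbitrary: f)
  case 0 then show ?case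
    by (auto intro!: continuous_on_compose2[of UNIV f] continuous_intros)
next
  case (Suc n)
  then obtain f' where *: "\<And>x. (f has_vector_derivative f' x) (at x)" "Ck1 n f'" by auto
  have "((\<lambda>x. f (c * x + d)) has_vector_derivative c *\<^sub>R f' (c * x + d)) (at x)" for x
  proof -
    have "((\<lambda>x. c * x + d) has_vector_derivative c) (at x)"
      by (auto intro!: derivative_eq_intros)
    from vector_diff_chain_at[OF this *(1)] show ?thesis by (simp add: o_def)
  qed
  moreover have "Ck1 n (\<lambda>x. of_real c * f' (c * x + d))"
    by (intro Ck1_mult Ck1_const Suc.IH *)
  ultimately show ?case
    by (auto intro!: exI[of _ "\<lambda>x. of_real c * f' (c * x + d)"] simp: scaleR_conv_of_real)
qed

lemma smooth1_mult: "smooth1 f \<Longrightarrow> smooth1 g \<Longrightarrow> smooth1 (\<lambda>x. f x * g x)"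
  by (simp add: smooth1_def Ck1_mult)

lemma smooth1_affine: "smooth1 f \<Longrightarrow> smooth1 (\<lambda>x. f (c * x + d))"
  by (simp add: smooth1_def Ck1_affine)

text \<open>The definition supplies a possibly different derivative for each order \<open>n\<close>;
  derivatives are unique, so all of them coincide and the common one lies in every
  \<open>Ck1 n\<close>.\<close>

lemma smooth1_deriv:
  assumes "smooth1 f"
  obtains f' where "smooth1 f'" "\<And>x. (f has_vector_derivative f' x) (at x)"
proof -
  have "\<exists>f'. (\<forall>x. (f has_vector_derivative f' x) (at x)) \<and> Ck1 n f'" for n
    using assms unfolding smooth1_def by (metis Ck1.simps(2))
  then obtain F where F: "\<And>n x. (f has_vector_derivative F n x) (at x)" "\<And>n. Ck1 n (F n)"
    by metis
  have "F n = F 0" for n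
    using F(1) by (intro ext) (metis vector_derivative_unique_at)
  then have "smooth1 (F 0)" unfolding smooth1_def using F(2) by metis
  with F(1) show thesis by (intro that)
qed

lemma smooth1_cont: "smooth1 f \<Longrightarrow> continuous_on UNIV f"
  by (metis smooth1_def Ck1.simps(1))

lemma smooth1_exp: "smooth1 (\<lambda>x. exp (c * of_real x))"
proof -
  have "Ck1 n (\<lambda>x. d * exp (c * of_real x))" for n d
  proof (induction n arbitrary: d)
    case 0 show ?case by (auto intro!: continuous_intros)
  next
    case (Suc n)
    have "((\<lambda>x. d * exp (c * of_real x)) has_vector_derivative (d * c) * exp (c * of_real x)) (at x)"
      for x :: real
      by (intro has_vector_derivative_real_field) (auto intro!: derivative_eq_intros)
    with Suc[of "d * c"] show ?case
      by (auto intro!: exI[of _ "\<lambda>x. d * c * exp (c * complex_of_real x)"])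
  qed
  from this[of _ 1] show ?thesis by (simp add: smooth1_def)
qed

text \<open>The factors \<open>x\<^sup>-\<^sup>n\<close> make the family closed under differentiation.\<close>

definition flat :: "nat \<Rightarrow> real \<Rightarrow> real" where
  "flat n x = (if x > 0 then inverse x ^ n * exp (- inverse x) else 0)"

lemma flat_tendsto_0: "(flat n \<longlongrightarrow> 0) (at 0)"
proof -
  have "((\<lambda>x. inverse x ^ n / exp (inverse x)) \<longlongrightarrow> (0::real)) (at_right 0)"
    using filterlim_compose[OF tendsto_power_div_exp_0 filterlim_inverse_at_top_right] .
  then have "(flat n \<longlongrightarrow> 0) (at_right 0)"
    by (rule Lim_transform_eventually)
      (auto simp: flat_def eventually_at_filter exp_minus divide_inverse)
  moreover have "(flat n \<longlongrightarrow> 0) (at_left 0)"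
    by (rule Lim_transform_eventually[OF tendsto_const])
      (auto simp: flat_def eventually_at_filter)
  ultimately show ?thesis by (simp add: filterlim_split_at)
qed

lemma flat_deriv: "(flat n has_real_derivative flat (n + 2) x - of_nat n * flat (n + 1) x) (at x)"
proof -
  consider "x > 0" | "x < 0" | "x = 0" by linarith
  then show ?thesis
  proof cases
    case 1
    have p: "real n * inverse x ^ (n - 1) * inverse x ^ 2 = real n * inverse x ^ (n + 1)"
      by (cases n) (simp_all add: power2_eq_square)
    have "((\<lambda>x. inverse x ^ n * exp (- inverse x)) has_real_derivative
      - (real n * inverse x ^ (n - 1) * inverse x ^ 2) * exp (- inverse x)
      + inverse x ^ n * (exp (- inverse x) * inverse x ^ 2)) (at x)"
      using 1 by (auto intro!: derivative_eq_intros simp: power2_eq_square)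
    then have *: "((\<lambda>x. inverse x ^ n * exp (- inverse x)) has_real_derivative
      flat (n + 2) x - of_nat n * flat (n + 1) x) (at x)"
      unfolding p using 1 by (simp add: flat_def algebra_simps power2_eq_square)
    show ?thesis
      by (rule has_field_derivative_transform_within_open[OF *, of "{0<..}"]) (use 1 in \<open>auto simp: flat_def\<close>)
  next
    case 2
    have *: "((\<lambda>x. 0) has_real_derivative flat (n + 2) x - of_nat n * flat (n + 1) x) (at x)"
      using 2 by (auto simp: flat_def)
    show ?thesis
      by (rule has_field_derivative_transform_within_open[OF *, of "{..<0}"]) (use 2 in \<open>auto simp: flat_def\<close>)
  next
    case 3
    \<comment> \<open>The difference quotient of \<open>flat n\<close> at 0 is
      \<open>flat (n + 1)\<close> itself, so its limit at 0 is the derivative.\<close>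
    have "((\<lambda>h. flat (n + 1) h) \<longlongrightarrow> 0) (at 0)" by (rule flat_tendsto_0)
    moreover have "flat (n + 1) h = (flat n (0 + h) - flat n 0) / h" for h
      by (auto simp: flat_def divide_inverse)
    ultimately show ?thesis using 3 by (simp add: DERIV_def flat_def)
  qed
qed

lemma smooth1_flat: "smooth1 (\<lambda>x. of_real (flat 0 x))"
proof -
  have cont: "continuous_on UNIV (flat n)" for n
    using flat_deriv by (auto simp: continuous_on_eq_continuous_at intro: DERIV_isCont)
  have "Ck1 k (\<lambda>x. of_real (flat n x))" for k n
  proof (induction k arbitrary: n)
    case 0
    show ?case using cont by (auto intro!: continuous_intros)
  next
    case (Suc k)
    have "((\<lambda>x. of_real (flat n x) :: complex) has_vector_derivative
        of_real (flat (n + 2) x - of_nat n * flat (n + 1) x)) (at x)" for x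
      using flat_deriv[of n x] by (intro has_vector_derivative_of_real)
        (auto simp: has_real_derivative_iff_has_vector_derivative)
    moreover have "Ck1 k (\<lambda>x. of_real (flat (n + 2) x) + (- of_nat n) * (of_real (flat (n + 1) x)))"
      by (intro Ck1_add Ck1_mult Ck1_const Suc.IH)
    ultimately show ?case
      by (auto intro!: exI[of _ "\<lambda>x. of_real (flat (n + 2) x - of_nat n * flat (n + 1) x)"])
  qed
  then show ?thesis by (simp add: smooth1_def)
qed

text \<open>For a < x < b and n > 0 the factors are exp(-1/(n(x - a))) and exp(-1/(n(b - x))).
  Growing \<open>n\<close> steepens the edges towards the indicator of (a, b) while the support does
  not move.\<close>

definition bump :: "nat \<Rightarrow> real \<Rightarrow> real \<Rightarrow> real \<Rightarrow> complex" where
  "bump n a b x = of_real (flat 0 (n * x + - (n * a))) * of_real (flat 0 ((- n) * x + n * b))"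

lemma smooth1_bump: "smooth1 (bump n a b)"
  unfolding bump_def by (intro smooth1_mult smooth1_affine[OF smooth1_flat])

lemma flat0_bounds: "0 \<le> flat 0 x" "flat 0 x \<le> 1"
  by (auto simp: flat_def)

lemma norm_bump_le: "norm (bump n a b x) \<le> 1"
  using flat0_bounds by (auto simp: bump_def norm_mult intro!: mult_le_one)

lemma bump_eq_0: "x \<le> a \<or> b \<le> x \<Longrightarrow> bump n a b x = 0"
  by (auto simp: bump_def flat_def mult_less_cancel_left)

lemma bump_tendsto: "(\<lambda>n. bump n a b x) \<longlonglongrightarrow> indicator {a<..<b} x"
proof (cases "a < x \<and> x < b")
  case True
  have *: "(\<lambda>n. flat 0 (real n * c)) \<longlonglongrightarrow> 1" if "c > 0" for c
  proof -
    have "(\<lambda>n. exp (- (inverse c * inverse (real n)))) \<longlonglongrightarrow> exp (- (inverse c * 0))"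
      by (intro tendsto_intros lim_inverse_n)
    then show ?thesis
      using that by (rule_tac Lim_transform_eventually[where f = "\<lambda>n. exp (- (inverse c * inverse (real n)))"])
        (auto simp: flat_def intro: eventually_mono[OF eventually_gt_at_top[of 0]])
  qed
  have "(\<lambda>n. complex_of_real (flat 0 (real n * (x - a))) * of_real (flat 0 (real n * (b - x)))) \<longlonglongrightarrow> of_real 1 * of_real 1"
    using True by (intro tendsto_intros *) auto
  then show ?thesis using True by (simp add: bump_def algebra_simps)
next
  case False
  then have "bump n a b x = 0" for n by (intro bump_eq_0) auto
  then show ?thesis using False by simp
qed

text \<open>The margin 1/(n + 1) keeps the support compact inside (-1/2, 1/2), as test functions on
  the open strip demand. Steepness times margin stays bounded, which leaves room for pointwise
  convergence to 1.\<close>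

definition cutoff :: "nat \<Rightarrow> real \<Rightarrow> complex" where
  "cutoff n = bump n (-1/2 + 1 / real (Suc n)) (1/2 - 1 / real (Suc n))"

section \<open>Smooth functions of product form on Euclidean space\<close>

lemma Ck_on_add:
  assumes "Ck_on n UNIV f" "Ck_on n UNIV g"
  shows "Ck_on n UNIV (\<lambda>x. f x + g x)"
  using assms
proof (induction n arbitrary: f g)
  case 0 then show ?case by (auto intro: continuous_intros)
next
  case (Suc n)
  then have d: "f differentiable at x" "g differentiable at x" for x
    by (auto simp: differentiable_on_def)
  have "frechet_derivative (\<lambda>x. f x + g x) (at x) b =
      frechet_derivative f (at x) b + frechet_derivative g (at x) b" for x b
    unfolding frechet_derivative_at[OF has_derivative_add[OF d[unfolded frechet_derivative_works]], symmetric] ..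
  with Suc d show ?case by (auto simp: differentiable_on_def intro!: differentiable_add)
qed

lemma Ck_on_cmult:
  fixes f :: "'a::euclidean_space \<Rightarrow> complex"
  assumes "Ck_on n UNIV f"
  shows "Ck_on n UNIV (\<lambda>x. c * f x)"
  using assms
proof (induction n arbitrary: f)
  case 0 then show ?case by (auto intro: continuous_intros)
next
  case (Suc n)
  then have d: "f differentiable at x" for x
    by (auto simp: differentiable_on_def)
  have "((\<lambda>x. c * f x) has_derivative (\<lambda>b. c * frechet_derivative f (at x) b)) (at x)" for x
    using d[unfolded frechet_derivative_works] by (auto intro!: derivative_eq_intros)
  note * = this
  have "frechet_derivative (\<lambda>x. c * f x) (at x) b = c * frechet_derivative f (at x) b" for x b
    unfolding frechet_derivative_at[OF *, symmetric] ..
  moreover have "(\<lambda>x. c * f x) differentiable (at x)" for x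
    using * by (auto simp: differentiable_def)
  ultimately show ?case using Suc by (auto simp: differentiable_on_def)
qed

lemma tensor_deriv:
  fixes v1 v2 v3 :: "'a::euclidean_space"
  assumes "\<And>x. (f1 has_vector_derivative f1' x) (at x)" "\<And>x. (f2 has_vector_derivative f2' x) (at x)"
    "\<And>x. (f3 has_vector_derivative f3' x) (at x)"
  shows "((\<lambda>x. f1 (x \<bullet> v1) * f2 (x \<bullet> v2) * f3 (x \<bullet> v3)) has_derivative
      (\<lambda>b. complex_of_real (b \<bullet> v1) * (f1' (x \<bullet> v1) * f2 (x \<bullet> v2) * f3 (x \<bullet> v3))
        + of_real (b \<bullet> v2) * (f1 (x \<bullet> v1) * f2' (x \<bullet> v2) * f3 (x \<bullet> v3))
        + of_real (b \<bullet> v3) * (f1 (x \<bullet> v1) * f2 (x \<bullet> v2) * f3' (x \<bullet> v3)))) (at x)"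
proof -
  have *: "((\<lambda>x. f (x \<bullet> v)) has_derivative (\<lambda>b. of_real (b \<bullet> v) * f' (x \<bullet> v))) (at x)"
    if "\<And>x. (f has_vector_derivative f' x) (at x)" for f f' :: "real \<Rightarrow> complex" and v :: 'a
  proof -
    have "((\<lambda>x. x \<bullet> v) has_derivative (\<lambda>b. b \<bullet> v)) (at x)"
      by (intro derivative_eq_intros) auto
    from has_derivative_compose[OF this] that[of "x \<bullet> v", unfolded has_vector_derivative_def]
    show ?thesis by (simp add: scaleR_conv_of_real)
  qed
  show ?thesis
    by (rule has_derivative_eq_rhs[OF has_derivative_mult[OF has_derivative_mult[OF
            *[OF assms(1)] *[OF assms(2)]] *[OF assms(3)]]]) (rule ext, algebra)
qed

text \<open>A directional derivative of a triple product is a linear combination of triple products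
  with smooth factors again, so the induction generalises over the three factors.\<close>

lemma Ck_on_tensor:
  fixes v1 v2 v3 :: "'a::euclidean_space"
  assumes "smooth1 f1" "smooth1 f2" "smooth1 f3"
  shows "Ck_on n UNIV (\<lambda>x. f1 (x \<bullet> v1) * f2 (x \<bullet> v2) * f3 (x \<bullet> v3))"
  using assms
proof (induction n arbitrary: f1 f2 f3)
  case 0
  have *: "continuous_on UNIV (\<lambda>x. f (x \<bullet> v))" if "smooth1 f" for f and v :: 'a
    using smooth1_cont[OF that] by (auto intro!: continuous_on_compose2[of UNIV f] continuous_intros)
  show ?case using 0 by (auto intro!: continuous_intros *)
next
  case (Suc n)
  obtain f1' f2' f3' where s: "smooth1 f1'" "smooth1 f2'" "smooth1 f3'"
    and d: "\<And>x. (f1 has_vector_derivative f1' x) (at x)" "\<And>x. (f2 has_vector_derivative f2' x) (at x)"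
    "\<And>x. (f3 has_vector_derivative f3' x) (at x)"
    using Suc.prems smooth1_deriv by metis
  let ?f = "\<lambda>x. f1 (x \<bullet> v1) * f2 (x \<bullet> v2) * f3 (x \<bullet> v3)"
  note D = tensor_deriv[OF d, of v1 v2 v3]
  have "frechet_derivative ?f (at x) b = complex_of_real (b \<bullet> v1) * (f1' (x \<bullet> v1) * f2 (x \<bullet> v2) * f3 (x \<bullet> v3))
        + of_real (b \<bullet> v2) * (f1 (x \<bullet> v1) * f2' (x \<bullet> v2) * f3 (x \<bullet> v3))
        + of_real (b \<bullet> v3) * (f1 (x \<bullet> v1) * f2 (x \<bullet> v2) * f3' (x \<bullet> v3))" for x b
    unfolding frechet_derivative_at[OF D[of x], symmetric] ..
  moreover have "?f differentiable (at x)" for x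
    using D[of x] by (auto simp: differentiable_def)
  ultimately show ?case
    using Suc.prems s by (auto simp: differentiable_on_def intro!: Ck_on_add Ck_on_cmult Suc.IH)
qed

section \<open>Uniqueness of Fourier coefficients on the tube\<close>

definition unit_interval :: "real measure" where
  "unit_interval = density lborel (indicator {-1/2..1/2})"

definition unit_square :: "(real \<times> real) measure" where
  "unit_square = unit_interval \<Otimes>\<^sub>M unit_interval"

text \<open>The strip in the coordinates (x_1, s_2, s_3), without the area factor. It carries the
  Borel sigma algebra instead of its completion, so that its product structure is open to Fubini;
  replacing the half-open cell by a closed square changes a null set only.\<close>

definition tube :: "(real \<times> real \<times> real) measure" where
  "tube = lborel \<Otimes>\<^sub>M unit_square"

lemma sets_unit_interval [simp, measurable_cong]: "sets unit_interval = sets borel"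
  by (simp add: unit_interval_def)

lemma sets_unit_square [measurable_cong]: "sets unit_square = sets (borel \<Otimes>\<^sub>M borel)"
  unfolding unit_square_def by (intro sets_pair_measure_cong) auto

lemma sets_tube [measurable_cong]: "sets tube = sets (borel \<Otimes>\<^sub>M (borel \<Otimes>\<^sub>M borel))"
  unfolding tube_def by (intro sets_pair_measure_cong sets_unit_square) auto

lemma sets_tube_borel: "sets tube = sets borel"
  unfolding sets_tube borel_prod ..

lemma measurable_tube_continuous: "continuous_on UNIV f \<Longrightarrow> f \<in> borel_measurable tube"
  unfolding measurable_cong_sets[OF sets_tube_borel refl] by (rule borel_measurable_continuous_onI)

lemma measurable_square_continuous:
  fixes f :: "real \<times> real \<Rightarrow> 'b::topological_space"
  shows "continuous_on UNIV f \<Longrightarrow> f \<in> borel_measurable (borel \<Otimes>\<^sub>M borel)"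
  unfolding borel_prod by (rule borel_measurable_continuous_onI)

lemma space_tube [simp]: "space unit_interval = UNIV" "space unit_square = UNIV" "space tube = UNIV"
  by (simp_all add: unit_interval_def unit_square_def tube_def space_pair_measure)

lemma emeasure_unit_interval: "emeasure unit_interval UNIV = 1"
  by (simp add: unit_interval_def emeasure_density)

interpretation unit_interval: finite_measure unit_interval
  by standard (simp add: emeasure_unit_interval)

interpretation unit_square: finite_measure unit_square
  unfolding unit_square_def by (intro finite_measure_pair_measure unit_interval.finite_measure_axioms)

interpretation square: pair_sigma_finite unit_interval unit_interval ..

interpretation tube: pair_sigma_finite lborel unit_square ..

interpretation tube: sigma_finite_measure tube
  unfolding tube_def by (rule tube.sigma_finite_measure_axioms)

lemma emeasure_unit_square: "emeasure unit_square UNIV = 1"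
  using unit_interval.emeasure_pair_measure_Times[of UNIV unit_interval UNIV]
  by (simp add: unit_square_def emeasure_unit_interval)

lemma AE_unit_interval: "AE s in unit_interval. \<bar>s\<bar> < 1/2"
proof -
  have "AE s in lborel. s \<noteq> 1/2" "AE s in lborel. s \<noteq> (-1/2::real)" by (rule AE_lborel_singleton)+
  then have "AE s in lborel. s \<in> {-1/2..1/2::real} \<longrightarrow> \<bar>s\<bar> < 1/2" by eventually_elim auto
  then show ?thesis
    unfolding unit_interval_def by (subst AE_density) (auto simp: indicator_def)
qed

lemma AE_unit_square: "AE p in unit_square. \<bar>fst p\<bar> < 1/2 \<and> \<bar>snd p\<bar> < 1/2"
proof -
  have "AE s in unit_interval. AE t in unit_interval. \<bar>fst (s, t)\<bar> < 1/2 \<and> \<bar>snd (s, t)\<bar> < 1/2"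
    using AE_unit_interval by eventually_elim (use AE_unit_interval in \<open>eventually_elim, auto\<close>)
  then show ?thesis
    unfolding unit_square_def
  proof (intro square.AE_pair_measure)
    show "{p \<in> space (unit_interval \<Otimes>\<^sub>M unit_interval). \<bar>fst p\<bar> < 1/2 \<and> \<bar>snd p\<bar> < 1/2}
      \<in> sets (unit_interval \<Otimes>\<^sub>M unit_interval)" by measurable
  qed
qed

lemma AE_tube: "AE z in tube. \<bar>fst (snd z)\<bar> < 1/2 \<and> \<bar>snd (snd z)\<bar> < 1/2"
  unfolding tube_def
proof (intro tube.AE_pair_measure)
  show "AE x in lborel. AE p in unit_square. \<bar>fst (snd (x, p))\<bar> < 1/2 \<and> \<bar>snd (snd (x, p))\<bar> < 1/2"
    using AE_unit_square by auto
  show "{z \<in> space (lborel \<Otimes>\<^sub>M unit_square). \<bar>fst (snd z)\<bar> < 1/2 \<and> \<bar>snd (snd z)\<bar> < 1/2}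
    \<in> sets (lborel \<Otimes>\<^sub>M unit_square)" by measurable
qed

section \<open>Approximation by trigonometric polynomials\<close>

inductive trig_poly :: "(real \<times> real \<Rightarrow> complex) \<Rightarrow> bool" where
  monom: "trig_poly (\<lambda>p. c * exp (\<i> * of_real (2 * pi * (of_int m * fst p + of_int n * snd p))))"
| add: "trig_poly f \<Longrightarrow> trig_poly g \<Longrightarrow> trig_poly (\<lambda>p. f p + g p)"

lemma trig_poly_mult_monom:
  "trig_poly f \<Longrightarrow> trig_poly (\<lambda>p. f p * (c * exp (\<i> * of_real (2 * pi * (of_int m * fst p + of_int n * snd p)))))"
proof (induction rule: trig_poly.induct)
  case (monom d k l)
  have "(\<lambda>p. d * exp (\<i> * of_real (2 * pi * (of_int k * fst p + of_int l * snd p)))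
        * (c * exp (\<i> * of_real (2 * pi * (of_int m * fst p + of_int n * snd p)))))
      = (\<lambda>p. d * c * exp (\<i> * of_real (2 * pi * (of_int (k + m) * fst p + of_int (l + n) * snd p))))"
    by (intro ext) (simp add: exp_add[symmetric] algebra_simps)
  then show ?case by (metis trig_poly.monom)
next
  case (add f g)
  then show ?case by (simp add: distrib_right trig_poly.add)
qed

lemma trig_poly_mult: "trig_poly g \<Longrightarrow> trig_poly f \<Longrightarrow> trig_poly (\<lambda>p. f p * g p)"
proof (induction rule: trig_poly.induct)
  case (monom c m n)
  then show ?case by (rule trig_poly_mult_monom)
next
  case (add g h)
  then show ?case by (simp add: distrib_left trig_poly.add)
qed

lemma trig_poly_const: "trig_poly (\<lambda>p. c)"
  using trig_poly.monom[of c 0 0] by simp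

lemma trig_poly_circle:
  "trig_poly (\<lambda>p. of_real (Re (cis (2 * pi * fst p))))" "trig_poly (\<lambda>p. of_real (Im (cis (2 * pi * fst p))))"
  "trig_poly (\<lambda>p. of_real (Re (cis (2 * pi * snd p))))" "trig_poly (\<lambda>p. of_real (Im (cis (2 * pi * snd p))))"
proof -
  have re: "complex_of_real (Re (cis x)) = (1/2) * exp (\<i> * of_real x) + (1/2) * exp (\<i> * of_real (- x))"
    and im: "complex_of_real (Im (cis x)) = (-\<i>/2) * exp (\<i> * of_real x) + (\<i>/2) * exp (\<i> * of_real (- x))" for x
    by (auto simp: complex_eq_iff exp_eq_polar cis.ctr simp flip: cis_conv_exp)
  show "trig_poly (\<lambda>p. of_real (Re (cis (2 * pi * fst p))))" "trig_poly (\<lambda>p. of_real (Im (cis (2 * pi * fst p))))"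
    using trig_poly.add[OF trig_poly.monom[of "1/2" 1 0] trig_poly.monom[of "1/2" "-1" 0]]
      trig_poly.add[OF trig_poly.monom[of "-\<i>/2" 1 0] trig_poly.monom[of "\<i>/2" "-1" 0]]
    unfolding re im by simp_all
  show "trig_poly (\<lambda>p. of_real (Re (cis (2 * pi * snd p))))" "trig_poly (\<lambda>p. of_real (Im (cis (2 * pi * snd p))))"
    using trig_poly.add[OF trig_poly.monom[of "1/2" 0 1] trig_poly.monom[of "1/2" 0 "-1"]]
      trig_poly.add[OF trig_poly.monom[of "-\<i>/2" 0 1] trig_poly.monom[of "\<i>/2" 0 "-1"]]
    unfolding re im by simp_all
qed

text \<open>A linear functional of two complex numbers is a combination of their four real
  coordinates, and on the torus these are cosines and sines; sums and products stay
  trigonometric.\<close>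

lemma trig_poly_real_polynomial:
  fixes g :: "complex \<times> complex \<Rightarrow> real"
  assumes "real_polynomial_function g"
  shows "trig_poly (\<lambda>p. of_real (g (cis (2 * pi * fst p), cis (2 * pi * snd p))))"
  using assms
proof (induction rule: real_polynomial_function.induct)
  case (linear f)
  then interpret bounded_linear f .
  have "f (z, w) = Re z * f (1, 0) + Im z * f (\<i>, 0) + (Re w * f (0, 1) + Im w * f (0, \<i>))" for z w
  proof -
    have "(z, w) = (Re z *\<^sub>R (1, 0) + Im z *\<^sub>R (\<i>, 0)) + (Re w *\<^sub>R (0, 1) + Im w *\<^sub>R (0, \<i>))"
      by (auto simp: complex_eq_iff)
    then show ?thesis by (metis add scaleR real_scaleR_def)
  qed
  note lin = this
  have "(\<lambda>p. complex_of_real (f (cis (2 * pi * fst p), cis (2 * pi * snd p)))) = (\<lambda>p.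
      of_real (Re (cis (2 * pi * fst p))) * of_real (f (1, 0)) + of_real (Im (cis (2 * pi * fst p))) * of_real (f (\<i>, 0))
      + (of_real (Re (cis (2 * pi * snd p))) * of_real (f (0, 1)) + of_real (Im (cis (2 * pi * snd p))) * of_real (f (0, \<i>))))"
    by (rule ext, subst lin, simp only: of_real_add of_real_mult)
  then show ?case
    by (simp only:) (intro trig_poly.add trig_poly_mult trig_poly_const trig_poly_circle)
next
  case (const c)
  then show ?case by (simp add: trig_poly_const)
next
  case (add f g)
  then show ?case by (simp add: trig_poly.add)
next
  case (mult f g)
  then show ?case by (simp add: trig_poly_mult)
qed

lemma trig_poly_continuous: "trig_poly f \<Longrightarrow> continuous_on UNIV f"
  by (induction rule: trig_poly.induct) (auto intro!: continuous_intros)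

definition torus :: "real \<times> real \<Rightarrow> complex \<times> complex" where
  "torus p = (cis (2 * pi * fst p), cis (2 * pi * snd p))"

lemma measurable_torus [measurable]: "torus \<in> borel_measurable (borel \<Otimes>\<^sub>M borel)"
  unfolding torus_def by (intro measurable_square_continuous continuous_intros)

text \<open>Stone-Weierstrass on the product of two circles: a real polynomial in the four real
  coordinates is uniformly close to \<open>\<phi>\<close>, and on the torus it is a trigonometric
  polynomial, to which \<open>E\<close> is orthogonal. Uniform closeness is enough because
  \<open>E\<close> is integrable.\<close>

lemma integral_torus_zero:
  assumes E: "integrable tube E"
    and trig: "\<And>m n :: int. (\<integral>z. E z * exp (\<i> * of_real (2 * pi * (of_int m * fst (snd z) + of_int n * snd (snd z)))) \<partial>tube) = 0"
    and cont: "continuous_on UNIV \<phi>"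
  shows "(\<integral>z. E z * of_real (\<phi> (torus (snd z))) \<partial>tube) = 0"
proof -
  have [measurable]: "E \<in> borel_measurable tube" using E by auto
  have int: "integrable tube (\<lambda>z. E z * f z)" if [measurable]: "f \<in> borel_measurable tube" and le: "\<And>z. norm (f z) \<le> K" for f K
  proof (rule Bochner_Integration.integrable_bound[OF integrable_mult_right[OF integrable_norm[OF E], of K]])
    show "AE z in tube. norm (E z * f z) \<le> norm (K * norm (E z))"
      unfolding norm_mult real_norm_def
      unfolding abs_mult abs_norm_cancel mult.commute[of _ "norm (E _)"]
      by (intro AE_I2 mult_left_mono order_trans[OF le abs_ge_self]) auto
  qed measurable
  have tp: "(\<integral>z. E z * f (snd z) \<partial>tube) = 0 \<and> integrable tube (\<lambda>z. E z * f (snd z))" if "trig_poly f" for f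
    using that
  proof (induction rule: trig_poly.induct)
    case (monom c m n)
    have "(\<integral>z. E z * (c * exp (\<i> * of_real (2 * pi * (of_int m * fst (snd z) + of_int n * snd (snd z))))) \<partial>tube) = 0"
      using trig[of m n] by (simp add: mult.left_commute[of _ c])
    moreover have "integrable tube (\<lambda>z. E z * (c * exp (\<i> * of_real (2 * pi * (of_int m * fst (snd z) + of_int n * snd (snd z))))))"
      by (rule int[of _ "norm c"]) (auto simp: norm_mult)
    ultimately show ?case by simp
  next
    case (add f g)
    then show ?case by (simp add: distrib_left)
  qed
  have small: "norm (\<integral>z. E z * of_real (\<phi> (torus (snd z))) \<partial>tube) \<le> \<epsilon> * (\<integral>z. norm (E z) \<partial>tube)" if eps: "\<epsilon> > 0" for \<epsilon>
  proof -
    let ?T = "sphere 0 1 \<times> sphere 0 1 :: (complex \<times> complex) set"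
    have T: "compact ?T" by (intro compact_Times) auto
    obtain g where g: "real_polynomial_function g" "\<And>x. x \<in> ?T \<Longrightarrow> \<bar>\<phi> x - g x\<bar> < \<epsilon>"
      using Stone_Weierstrass_real_polynomial_function[of ?T \<phi> \<epsilon>,
          OF T continuous_on_subset[OF cont subset_UNIV] eps] by blast
    have T: "torus p \<in> ?T" for p by (simp add: torus_def)
    have [measurable]: "\<phi> \<in> borel_measurable borel" using cont by (rule borel_measurable_continuous_onI)
    note tg = trig_poly_real_polynomial[OF g(1), folded torus_def]
    have [measurable]: "(\<lambda>p. complex_of_real (g (torus p))) \<in> borel_measurable (borel \<Otimes>\<^sub>M borel)"
      using trig_poly_continuous[OF tg] by (rule measurable_square_continuous)
    have d: "norm (complex_of_real (\<phi> (torus p)) - of_real (g (torus p))) \<le> \<epsilon>" for p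
      using g(2)[OF T[of p]] by (simp flip: of_real_diff)
    have i: "integrable tube (\<lambda>z. E z * (of_real (\<phi> (torus (snd z))) - of_real (g (torus (snd z)))))"
      by (rule int[of _ \<epsilon>]) (use d in auto)
    have "(\<integral>z. E z * of_real (\<phi> (torus (snd z))) \<partial>tube)
        = (\<integral>z. E z * (of_real (\<phi> (torus (snd z))) - of_real (g (torus (snd z)))) + E z * of_real (g (torus (snd z))) \<partial>tube)"
      by (simp add: algebra_simps)
    also have "\<dots> = (\<integral>z. E z * (of_real (\<phi> (torus (snd z))) - of_real (g (torus (snd z)))) \<partial>tube)"
      using tp[OF tg] i by (subst Bochner_Integration.integral_add) auto
    also have "norm \<dots> \<le> (\<integral>z. norm (E z * (of_real (\<phi> (torus (snd z))) - of_real (g (torus (snd z))))) \<partial>tube)" by simp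
    also have "\<dots> \<le> (\<integral>z. \<epsilon> * norm (E z) \<partial>tube)"
    proof (intro integral_mono integrable_norm i integrable_mult_right E)
      show "norm (E z * (of_real (\<phi> (torus (snd z))) - of_real (g (torus (snd z))))) \<le> \<epsilon> * norm (E z)" for z
        unfolding norm_mult mult.commute[of \<epsilon>] by (intro mult_left_mono d) auto
    qed
    finally show ?thesis by simp
  qed
  let ?a = "norm (\<integral>z. E z * of_real (\<phi> (torus (snd z))) \<partial>tube)" and ?b = "\<integral>z. norm (E z) \<partial>tube"
  have b: "?b \<ge> 0" by simp
  have "?a \<le> 0"
  proof (rule field_le_epsilon)
    fix d :: real assume "d > 0"
    \<comment> \<open>Adding 1 guards against a vanishing integral of the norm.\<close>
    then have "?a \<le> d / (?b + 1) * ?b" using b by (intro small divide_pos_pos add_nonneg_pos) auto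
    also have "x / (y + 1) * y \<le> x" if "x > 0" "y \<ge> 0" for x y :: real using that by (simp add: field_simps)
    from this[OF \<open>d > 0\<close> b] have "d / (?b + 1) * ?b \<le> d" .
    finally show "?a \<le> 0 + d" by simp
  qed
  then show ?thesis by simp
qed

text \<open>The open interval \<open>(c, d)\<close> is cut out of \<open>(-1/2, 1/2)\<close> by an open arc of the circle centred at
  \<open>(c + d)/2\<close>.\<close>

lemma arc_iff:
  assumes "\<bar>s\<bar> < 1/2" "-1/2 \<le> c" "c < d" "d \<le> 1/2"
  shows "cos (pi * (d - c)) < cos (2 * pi * (s - (c + d) / 2)) \<longleftrightarrow> c < s \<and> s < d"
proof -
  define r where "r = \<bar>s - (c + d) / 2\<bar>"
  have cosr: "cos (2 * pi * (s - (c + d) / 2)) = cos (2 * pi * r)"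
  proof -
    have "2 * pi * r = \<bar>2 * pi * (s - (c + d) / 2)\<bar>" by (simp add: r_def abs_mult)
    then show ?thesis by (simp only: cos_abs_real)
  qed
  have iff: "cos (pi * (d - c)) < cos y \<longleftrightarrow> y < pi * (d - c)" if "0 \<le> y" "y \<le> pi" for y
    using assms that by (intro cos_mono_less_eq) auto
  show ?thesis
  proof (cases "r \<le> 1/2")
    case True
    have "cos (pi * (d - c)) < cos (2 * pi * r) \<longleftrightarrow> 2 * pi * r < pi * (d - c)"
      using True by (intro iff) (auto simp: r_def)
    also have "\<dots> \<longleftrightarrow> pi * (2 * r) < pi * (d - c)" by (simp add: mult.left_commute)
    also have "\<dots> \<longleftrightarrow> 2 * r < d - c" by (rule mult_less_cancel_left_pos) simp
    also have "\<dots> \<longleftrightarrow> c < s \<and> s < d" by (auto simp: r_def abs_if field_simps)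
    finally show ?thesis by (simp add: cosr)
  next
    \<comment> \<open>Here the angle 2 pi r exceeds pi. Periodicity replaces r by 1 - r, which is
      below 1/2, and both sides of the equivalence turn out false.\<close>
    case False
    have "-1/2 < s" "s < 1/2" using assms(1) by auto
    then have r1: "r < 1" unfolding r_def abs_less_iff using assms by (auto simp: field_simps)
    have "cos (2 * pi * r) = cos (2 * pi * (1 - r))"
      using cos_periodic[of "- (2 * pi * r)"] by (simp add: algebra_simps)
    moreover have "cos (pi * (d - c)) < cos (2 * pi * (1 - r)) \<longleftrightarrow> 2 * pi * (1 - r) < pi * (d - c)"
      using False r1 by (intro iff) (auto simp: field_simps)
    moreover have "2 * pi * (1 - r) < pi * (d - c) \<longleftrightarrow> pi * (2 * (1 - r)) < pi * (d - c)" by (simp add: mult.left_commute)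
    moreover have "\<dots> \<longleftrightarrow> 2 * (1 - r) < d - c" by (rule mult_less_cancel_left_pos) simp
    moreover have "\<not> 2 * (1 - r) < d - c" using assms by (auto simp: r_def abs_if field_simps)
    moreover have "\<not> (c < s \<and> s < d)"
    proof
      assume "c < s \<and> s < d"
      then have "r < (d - c) / 2" unfolding r_def abs_less_iff by (auto simp: field_simps)
      with False assms show False by simp
    qed
    ultimately show ?thesis using cosr by metis
  qed
qed

text \<open>Continuous in y, and increasing in \<open>n\<close> to the indicator of the positive
  reals; composed with a function that is positive exactly on an arc, it approximates the indicator
  of that arc.\<close>

definition ramp :: "nat \<Rightarrow> real \<Rightarrow> real" where "ramp n y = min 1 (real n * max 0 y)"

lemma ramp_tendsto: "(\<lambda>n. ramp n y) \<longlonglongrightarrow> indicator {0<..} y"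
proof (cases "y > 0")
  case True
  have "eventually (\<lambda>n. ramp n y = 1) sequentially"
    using eventually_ge_at_top[of "nat \<lceil>1 / y\<rceil>"]
  proof eventually_elim
    case (elim n)
    then have "1 / y \<le> real n" by linarith
    then have "1 \<le> real n * y" using True by (simp add: field_simps)
    then show ?case using True by (simp add: ramp_def)
  qed
  then show ?thesis using True by (simp add: tendsto_eventually)
qed (simp add: ramp_def)

lemma ramp_bounds: "0 \<le> ramp n y" "ramp n y \<le> 1" by (auto simp: ramp_def)

lemma integral_box_zero:
  assumes E: "integrable tube E"
    and trig: "\<And>m n :: int. (\<integral>z. E z * exp (\<i> * of_real (2 * pi * (of_int m * fst (snd z) + of_int n * snd (snd z)))) \<partial>tube) = 0"
    and "-1/2 \<le> c" "c < d" "d \<le> 1/2" "-1/2 \<le> c'" "c' < d'" "d' \<le> 1/2"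
  shows "(\<integral>z. E z * indicator ({c<..<d} \<times> {c'<..<d'}) (snd z) \<partial>tube) = 0"
proof -
  have [measurable]: "E \<in> borel_measurable tube" using E by auto
  \<comment> \<open>On the unit circle this is positive exactly on the open arc over (c, d): the
    first term is the cosine of the angle measured from the midpoint of the arc.\<close>
  define h where "h c d w = Re (w * cis (- (2 * pi * ((c + d) / 2)))) - cos (pi * (d - c))" for c d :: real and w
  have h_cont: "continuous_on UNIV (\<lambda>x. h c d (f x))" if "continuous_on UNIV f" for c d and f :: "complex \<times> complex \<Rightarrow> complex"
    unfolding h_def by (intro continuous_intros that)
  have h_pos: "h c d (cis (2 * pi * s)) > 0 \<longleftrightarrow> c < s \<and> s < d" if "\<bar>s\<bar> < 1/2" "-1/2 \<le> c" "c < d" "d \<le> 1/2" for c d s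
    using arc_iff[OF that] by (simp add: h_def cis_mult algebra_simps)
  define \<phi> where "\<phi> n x = ramp n (h c d (fst x)) * ramp n (h c' d' (snd x))" for n x
  have c\<phi>: "continuous_on UNIV (\<phi> n)" for n
    unfolding \<phi>_def ramp_def by (intro continuous_intros h_cont)
  have [measurable]: "\<phi> n \<in> borel_measurable borel" for n using c\<phi> by (rule borel_measurable_continuous_onI)
  have "(\<lambda>n. \<integral>z. E z * of_real (\<phi> n (torus (snd z))) \<partial>tube) \<longlonglongrightarrow> (\<integral>z. E z * indicator ({c<..<d} \<times> {c'<..<d'}) (snd z) \<partial>tube)"
  proof (rule integral_dominated_convergence)
    show "integrable tube (\<lambda>z. norm (E z))" using E by simp
    show "AE z in tube. norm (E z * of_real (\<phi> n (torus (snd z)))) \<le> norm (E z)" for n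
      using ramp_bounds by (intro AE_I2) (auto simp: norm_mult \<phi>_def abs_mult intro!: mult_left_le mult_le_one)
    show "AE z in tube. (\<lambda>n. E z * of_real (\<phi> n (torus (snd z)))) \<longlonglongrightarrow> E z * indicator ({c<..<d} \<times> {c'<..<d'}) (snd z)"
      using AE_tube
    proof eventually_elim
      case (elim z)
      have "(\<lambda>n. complex_of_real (\<phi> n (torus (snd z)))) \<longlonglongrightarrow> of_real
          (indicator {0<..} (h c d (fst (torus (snd z)))) * indicator {0<..} (h c' d' (snd (torus (snd z)))))"
        unfolding \<phi>_def by (intro tendsto_intros ramp_tendsto)
      moreover have "complex_of_real (indicator {0<..} (h c d (fst (torus (snd z)))) * indicator {0<..} (h c' d' (snd (torus (snd z)))))
          = indicator ({c<..<d} \<times> {c'<..<d'}) (snd z)"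
        using h_pos[of "fst (snd z)" c d] h_pos[of "snd (snd z)" c' d'] elim assms(3-)
        by (auto simp: torus_def indicator_def mem_Times_iff)
      ultimately show ?case by (intro tendsto_mult tendsto_const) simp
    qed
  qed measurable
  then show ?thesis
    using integral_torus_zero[OF E trig c\<phi>] by (simp add: LIMSEQ_const_iff)
qed

text \<open>Boxes are stable under intersection and generate the Borel sets, so the integral of
  \<open>E\<close> over every Borel set vanishes; the integral over the whole space handles
  complements. Real and imaginary part are then densities of the zero measure.\<close>

lemma AE_zero_of_boxes:
  fixes E :: "real \<times> real \<times> real \<Rightarrow> complex"
  assumes E: "integrable tube E"
    and box: "\<And>l u. (\<integral>z. indicator (box l u) z *\<^sub>R E z \<partial>tube) = 0"
    and total: "(\<integral>z. E z \<partial>tube) = 0"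
  shows "AE z in tube. E z = 0"
proof -
  have int: "set_integrable tube A E" if "A \<in> sets borel" for A
    unfolding set_integrable_def using E that by (intro integrable_mult_indicator) (auto simp: sets_tube_borel)
  have all: "(LINT z:A|tube. E z) = 0" if "A \<in> sets borel" for A
  proof -
    have "Int_stable (range (\<lambda>(a, b). box a b :: (real \<times> real \<times> real) set))"
      by (auto simp: Int_stable_def box_Int_box)
    moreover have "range (\<lambda>(a, b). box a b) \<subseteq> Pow (UNIV :: (real \<times> real \<times> real) set)" by simp
    moreover have "A \<in> sigma_sets UNIV (range (\<lambda>(a, b). box a b))" using that by (simp add: borel_eq_box)
    ultimately show ?thesis
    proof (induction rule: sigma_sets_induct_disjoint)
      case (basic A)
      then show ?case using box by (auto simp: set_lebesgue_integral_def)
    next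
      case empty
      show ?case by (simp add: set_lebesgue_integral_def)
    next
      case (compl A)
      have A: "A \<in> sets borel" using compl(1) by (simp add: borel_eq_box)
      have "(LINT z:A \<union> (UNIV - A)|tube. E z) = (LINT z:A|tube. E z) + (LINT z:UNIV - A|tube. E z)"
        using A by (intro set_integral_Un int) auto
      moreover have "A \<union> (UNIV - A) = UNIV" by auto
      ultimately show ?case using compl(2) total by (simp add: set_lebesgue_integral_def)
    next
      case (union A)
      have A: "A i \<in> sets borel" for i using union(2) by (auto simp: borel_eq_box)
      have "(LINT z:(\<Union>i. A i)|tube. E z) = (\<Sum>i. LINT z:A i|tube. E z)"
        using A union(1) int[of "\<Union>i. A i"]
        by (intro lebesgue_integral_countable_add) (auto simp: disjoint_family_on_def sets_tube_borel)
      then show ?case using union(3) by simp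
    qed
  qed
  have "AE z in tube. Re (E z) = 0"
  proof (rule density_unique_real)
    fix A assume A: "A \<in> sets tube"
    have "(LINT z:A|tube. Re (E z)) = Re (LINT z:A|tube. E z)"
      using int[of A] A[unfolded sets_tube_borel] unfolding set_lebesgue_integral_def set_integrable_def
      by (subst integral_Re[symmetric]) auto
    then show "(LINT z:A|tube. Re (E z)) = (LINT z:A|tube. 0)" using all[of A] A[unfolded sets_tube_borel] by (simp add: set_lebesgue_integral_def)
  qed (use E in auto)
  moreover have "AE z in tube. Im (E z) = 0"
  proof (rule density_unique_real)
    fix A assume A: "A \<in> sets tube"
    have "(LINT z:A|tube. Im (E z)) = Im (LINT z:A|tube. E z)"
      using int[of A] A[unfolded sets_tube_borel] unfolding set_lebesgue_integral_def set_integrable_def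
      by (subst integral_Im[symmetric]) auto
    then show "(LINT z:A|tube. Im (E z)) = (LINT z:A|tube. 0)" using all[of A] A[unfolded sets_tube_borel] by (simp add: set_lebesgue_integral_def)
  qed (use E in auto)
  ultimately show ?thesis by eventually_elim (simp add: complex_eq_iff)
qed

text \<open>The factor \<open>P\<close>, of modulus 1, strips off the phases
  \<open>\<theta>2\<close> and \<open>\<theta>3\<close> and leaves integer frequencies. As the bumps
  tend to the indicator of (a, b), \<open>D\<close> times \<open>P\<close> restricted to a slab is
  orthogonal to all trigonometric polynomials in the cell. Countably many slabs cover the tube, so
  local integrability suffices.\<close>

lemma mode_uniqueness:
  fixes D :: "real \<times> real \<times> real \<Rightarrow> complex"
  assumes [measurable]: "D \<in> borel_measurable tube"
    and loc: "\<And>a b. integrable tube (\<lambda>z. indicator {a<..<b} (fst z) *\<^sub>R D z)"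
    and zero: "\<And>a b k m n. (\<integral>z. D z * (bump k a b (fst z) * exp (- \<i> * of_real
      ((\<theta>2 + 2 * pi * of_int m) * fst (snd z) + (\<theta>3 + 2 * pi * of_int n) * snd (snd z)))) \<partial>tube) = 0"
  shows "AE z in tube. D z = 0"
proof -
  define P where "P z = exp (- \<i> * of_real (\<theta>2 * fst (snd z) + \<theta>3 * snd (snd z)))" for z :: "real \<times> real \<times> real"
  have [measurable]: "P \<in> borel_measurable tube"
    unfolding P_def by (auto intro!: measurable_tube_continuous continuous_intros)
  have [measurable]: "bump k a b \<in> borel_measurable borel" for k a b
    by (intro borel_measurable_continuous_onI smooth1_cont smooth1_bump)
  have nP: "norm (P z) = 1" for z by (simp add: P_def)
  define E where "E a b z = indicator {a<..<b} (fst z) *\<^sub>R (D z * P z)" for a b z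
  have [measurable]: "E a b \<in> borel_measurable tube" for a b unfolding E_def by measurable
  have E: "integrable tube (E a b)" for a b
    by (rule Bochner_Integration.integrable_bound[OF loc[of a b]]) (auto simp: E_def norm_mult nP)
  have trig: "(\<integral>z. E a b z * exp (\<i> * of_real (2 * pi * (of_int m * fst (snd z) + of_int n * snd (snd z)))) \<partial>tube) = 0" for a b m n
  proof -
    let ?x = "\<lambda>z. exp (\<i> * of_real (2 * pi * (of_int m * fst (snd z) + of_int n * snd (snd z)))) :: complex"
    have lim: "(\<lambda>k. \<integral>z. D z * P z * bump k a b (fst z) * ?x z \<partial>tube) \<longlonglongrightarrow> (\<integral>z. E a b z * ?x z \<partial>tube)"
    proof (rule integral_dominated_convergence)
      show "integrable tube (\<lambda>z. norm (E a b z))" using E by simp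
      show "AE z in tube. norm (D z * P z * bump k a b (fst z) * ?x z) \<le> norm (E a b z)" for k
        using norm_bump_le[of k a b] bump_eq_0[of _ a b k]
        by (intro AE_I2) (auto simp: E_def norm_mult nP indicator_def intro!: mult_left_le)
      show "AE z in tube. (\<lambda>k. D z * P z * bump k a b (fst z) * ?x z) \<longlonglongrightarrow> E a b z * ?x z"
      proof (intro AE_I2 tendsto_mult tendsto_const)
        fix z
        have "(\<lambda>k. D z * P z * bump k a b (fst z)) \<longlonglongrightarrow> D z * P z * indicator {a<..<b} (fst z)"
          by (intro tendsto_intros bump_tendsto)
        then show "(\<lambda>k. D z * P z * bump k a b (fst z)) \<longlonglongrightarrow> E a b z"
          by (cases "a < fst z \<and> fst z < b") (auto simp: E_def)
      qed
    qed measurable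
    have "D z * P z * bump k a b (fst z) * ?x z = D z * (bump k a b (fst z) * exp (- \<i> * of_real
      ((\<theta>2 + 2 * pi * of_int (- m)) * fst (snd z) + (\<theta>3 + 2 * pi * of_int (- n)) * snd (snd z))))" for z k
      by (simp add: P_def mult_exp_exp algebra_simps exp_add[symmetric])
    then have "(\<integral>z. D z * P z * bump k a b (fst z) * ?x z \<partial>tube) = 0" for k
      using zero[of k a b "-m" "-n"] by (simp only:)
    with lim show ?thesis by (simp only: LIMSEQ_const_iff)
  qed
  have AE_E: "AE z in tube. E a b z = 0" if ab: "a < b" for a b
  proof (rule AE_zero_of_boxes[OF E])
    have box: "(\<integral>z. E a b z * indicator ({c<..<d} \<times> {c'<..<d'}) (snd z) \<partial>tube) = 0"
      if "-1/2 \<le> c" "c < d" "d \<le> 1/2" "-1/2 \<le> c'" "c' < d'" "d' \<le> 1/2" for a b c d c' d'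
      by (rule integral_box_zero[OF E trig that])
    show "(\<integral>z. indicator (box l u) z *\<^sub>R E a b z \<partial>tube) = 0" for l u
    proof -
      obtain a1 c1 c1' where l: "l = (a1, c1, c1')" by (cases l) auto
      obtain b1 d1 d1' where u: "u = (b1, d1, d1')" by (cases u) auto
      have bx: "z \<in> box l u \<longleftrightarrow> fst z \<in> {a1<..<b1} \<and> fst (snd z) \<in> {c1<..<d1} \<and> snd (snd z) \<in> {c1'<..<d1'}" for z
        by (cases z) (auto simp: l u mem_box Basis_prod_def)
      \<comment> \<open>Outside the square the measure vanishes, so the box may be clipped to it; if
        the clipped box is empty, the integrand is zero almost everywhere.\<close>
      define c d c' d' where cd: "c = max c1 (-1/2)" "d = min d1 (1/2)" "c' = max c1' (-1/2)" "d' = min d1' (1/2)"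
      show ?thesis
      proof (cases "c < d \<and> c' < d'")
        case True
        have "(\<integral>z. indicator (box l u) z *\<^sub>R E a b z \<partial>tube)
            = (\<integral>z. E (max a a1) (min b b1) z * indicator ({c<..<d} \<times> {c'<..<d'}) (snd z) \<partial>tube)"
        proof (rule integral_cong_AE)
          show "AE z in tube. indicator (box l u) z *\<^sub>R E a b z
            = E (max a a1) (min b b1) z * indicator ({c<..<d} \<times> {c'<..<d'}) (snd z)"
            using AE_tube by eventually_elim (auto simp: E_def indicator_def bx cd mem_Times_iff)
        qed (auto intro!: borel_measurable_scaleR borel_measurable_indicator simp: sets_tube_borel)
        also have "\<dots> = 0" using True by (intro box) (auto simp: cd)
        finally show ?thesis .
      next
        case False
        have "AE z in tube. indicator (box l u) z *\<^sub>R E a b z = 0"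
          using AE_tube by eventually_elim (use False in \<open>auto simp: indicator_def bx cd\<close>)
        then show ?thesis by (simp add: integral_eq_zero_AE)
      qed
    qed
    show "(\<integral>z. E a b z \<partial>tube) = 0" using trig[of a b 0 0] by simp
  qed
  have "AE z in tube. \<forall>n::nat. E (- real (Suc n)) (real (Suc n)) z = 0"
    unfolding AE_all_countable by (intro allI AE_E) auto
  then show ?thesis
  proof eventually_elim
    case (elim z)
    obtain n :: nat where "\<bar>fst z\<bar> < real n" using reals_Archimedean2 by blast
    then have "fst z \<in> {- real (Suc n)<..<real (Suc n)}" by auto
    with elim[rule_format, of n] have "D z * P z = 0" by (simp add: E_def)
    then show ?case using nP[of z] by auto
  qed
qed

section \<open>Plane waves and the kernel of the evanescent modes\<close>

lemma integral_unit_interval: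
  fixes f :: "real \<Rightarrow> complex"
  assumes "f \<in> borel_measurable borel"
  shows "integral\<^sup>L unit_interval f = (\<integral>s. indicator {-1/2..1/2} s *\<^sub>R f s \<partial>lborel)"
proof -
  have "unit_interval = density lborel (\<lambda>s. ennreal (indicator {-1/2..1/2} s))"
    unfolding unit_interval_def by (simp add: ennreal_indicator)
  note eq = this
  show ?thesis using assms by (subst eq) (rule integral_density, auto)
qed

lemma measurable_cnj [measurable]: "cnj \<in> borel_measurable borel"
  by (intro borel_measurable_continuous_onI continuous_intros)

text \<open>An enumeration of Z^2, so that sums over the dual lattice become series over
  nat.\<close>

definition mode :: "nat \<Rightarrow> int \<times> int" where "mode = from_nat_into UNIV"

lemma bij_mode: "bij mode"
proof -
  have "infinite (UNIV :: (int \<times> int) set)" by (simp add: finite_prod infinite_UNIV_int)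
  then show ?thesis unfolding mode_def by (intro bij_betw_from_nat_into) auto
qed

text \<open>In the coordinates \<open>x\<^sub>l = s\<^sub>2a\<^sub>2 + s\<^sub>3a\<^sub>3\<close> and for \<open>\<theta>\<^sub>j = \<langle>k, a\<^sub>j\<rangle>\<close>, these are the plane waves
  \<open>exp(i\<langle>k + K, x\<^sub>l\<rangle>)\<close> with \<open>K \<in> \<L>\<^sup>\<bottom>\<close>.\<close>

definition chr :: "real \<Rightarrow> real \<Rightarrow> nat \<Rightarrow> real \<times> real \<Rightarrow> complex" where
  "chr \<theta>2 \<theta>3 k p = exp (\<i> * of_real ((\<theta>2 + 2 * pi * of_int (fst (mode k))) * fst p + (\<theta>3 + 2 * pi * of_int (snd (mode k))) * snd p))"

lemma norm_chr [simp]: "norm (chr a b k p) = 1"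
  by (simp add: chr_def)

lemma measurable_chr [measurable]: "chr a b k \<in> borel_measurable (borel \<Otimes>\<^sub>M borel)"
  unfolding chr_def by (intro measurable_square_continuous continuous_intros)

lemma chr_diff: "chr a b k (p - p') = chr a b k p * cnj (chr a b k p')"
  by (simp add: chr_def exp_cnj mult_exp_exp algebra_simps)

lemma integral_unit_interval_exp:
  "(\<integral>s. exp (\<i> * of_real (2 * pi * of_int m * s)) \<partial>unit_interval) = (if m = 0 then 1 else 0)"
proof (cases "m = 0")
  case True
  then show ?thesis using emeasure_unit_interval by (simp add: measure_def)
next
  case False
  define c where "c = \<i> * of_real (2 * pi * of_int m)"
  have c: "c \<noteq> 0" using False by (simp add: c_def)
  have "(\<integral>s. indicator {-1/2..1/2} s *\<^sub>R exp (c * of_real s) \<partial>lborel)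
    = exp (c * of_real (1/2)) / c - exp (c * of_real (-1/2)) / c"
  proof (rule integral_FTC_Icc)
    have d: "((\<lambda>z. exp (c * z) / c) has_field_derivative exp (c * z)) (at z)" for z
      using c by (auto intro!: derivative_eq_intros)
    show "((\<lambda>s. exp (c * of_real s) / c) has_vector_derivative exp (c * of_real s)) (at s within {-1/2..1/2})" for s :: real
      by (rule has_vector_derivative_real_field[OF d])
  qed (auto intro!: continuous_intros)
  moreover have "exp (c * of_real (1/2)) = exp (c * of_real (-1/2))"
  proof -
    have "exp (c * of_real (1/2)) = exp (c * of_real (-1/2)) * exp (\<i> * of_real (of_int m * (of_real pi * 2)))"
      unfolding mult_exp_exp by (rule arg_cong[of _ _ exp]) (simp add: c_def field_simps)
    also have "exp (\<i> * of_real (of_int m * (of_real pi * 2))) = 1"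
      using exp_integer_2pi[of "of_int m"] by (simp add: algebra_simps)
    finally show ?thesis by simp
  qed
  moreover have "(\<integral>s. exp (c * of_real s) \<partial>unit_interval) = (\<integral>s. indicator {-1/2..1/2} s *\<^sub>R exp (c * of_real s) \<partial>lborel)"
    by (intro integral_unit_interval borel_measurable_continuous_onI continuous_intros)
  ultimately show ?thesis using False by (simp add: c_def mult.assoc)
qed

lemma integrable_square_bounded:
  fixes f :: "real \<times> real \<Rightarrow> complex"
  assumes "f \<in> borel_measurable (borel \<Otimes>\<^sub>M borel)" "\<And>p. norm (f p) \<le> K"
  shows "integrable unit_square f"
  using assms by (intro unit_square.integrable_const_bound[of _ K]) auto

lemma chr_orthonormal:
  "(\<integral>p. chr a b j p * cnj (chr a b k p) \<partial>unit_square) = (if j = k then 1 else 0)"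
proof -
  define m n where "m = fst (mode j) - fst (mode k)" "n = snd (mode j) - snd (mode k)"
  let ?e = "\<lambda>(m::int) (s::real). exp (\<i> * of_real (2 * pi * of_int m * s)) :: complex"
  have "chr a b j p * cnj (chr a b k p) = ?e m (fst p) * ?e n (snd p)" for p
    by (simp add: chr_def exp_cnj mult_exp_exp m_n_def algebra_simps)
  then have "(\<integral>p. chr a b j p * cnj (chr a b k p) \<partial>unit_square) = (\<integral>p. ?e m (fst p) * ?e n (snd p) \<partial>unit_square)" by simp
  also have "\<dots> = (\<integral>s. \<integral>t. ?e m (fst (s, t)) * ?e n (snd (s, t)) \<partial>unit_interval \<partial>unit_interval)"
    unfolding unit_square_def
    by (rule square.integral_fst'[symmetric], fold unit_square_def, rule integrable_square_bounded[of _ 1])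
      (auto simp: norm_mult intro!: measurable_square_continuous continuous_intros)
  also have "\<dots> = (if m = 0 then 1 else 0) * (if n = 0 then 1 else 0)"
    by (simp only: fst_conv snd_conv integral_mult_right_zero integral_mult_left_zero integral_unit_interval_exp)
  also have "\<dots> = (if j = k then 1 else 0)"
    using bij_mode by (auto simp: m_n_def bij_def inj_def prod_eq_iff)
  finally show ?thesis .
qed

context
  fixes a :: "nat \<Rightarrow> complex" and \<theta>2 \<theta>3 :: real
  assumes a: "summable (\<lambda>k. norm (a k))"
begin

lemma chr_series_summable: "summable (\<lambda>k. norm (a k * chr \<theta>2 \<theta>3 k p))"
  using a by (simp add: norm_mult)

lemma chr_series_bound: "norm (\<Sum>k. a k * chr \<theta>2 \<theta>3 k p) \<le> (\<Sum>k. norm (a k))"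
  using summable_norm[OF chr_series_summable[of p]] by (simp add: norm_mult)

lemma chr_series_coeff: "(\<integral>p. (\<Sum>k. a k * chr \<theta>2 \<theta>3 k p) * cnj (chr \<theta>2 \<theta>3 j p) \<partial>unit_square) = a j"
proof -
  have "(\<Sum>k. a k * chr \<theta>2 \<theta>3 k p) * cnj (chr \<theta>2 \<theta>3 j p) = (\<Sum>k. a k * (chr \<theta>2 \<theta>3 k p * cnj (chr \<theta>2 \<theta>3 j p)))" for p
    using suminf_mult2[OF summable_norm_cancel[OF chr_series_summable[of p]], of "cnj (chr \<theta>2 \<theta>3 j p)"]
    by (simp add: mult.assoc)
  then have "(\<integral>p. (\<Sum>k. a k * chr \<theta>2 \<theta>3 k p) * cnj (chr \<theta>2 \<theta>3 j p) \<partial>unit_square)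
    = (\<integral>p. (\<Sum>k. a k * (chr \<theta>2 \<theta>3 k p * cnj (chr \<theta>2 \<theta>3 j p))) \<partial>unit_square)" by simp
  also have "\<dots> = (\<Sum>k. \<integral>p. a k * (chr \<theta>2 \<theta>3 k p * cnj (chr \<theta>2 \<theta>3 j p)) \<partial>unit_square)"
  proof (rule integral_suminf)
    show "integrable unit_square (\<lambda>p. a k * (chr \<theta>2 \<theta>3 k p * cnj (chr \<theta>2 \<theta>3 j p)))" for k
      by (rule integrable_square_bounded[of _ "norm (a k)"]) (auto simp: norm_mult)
    show "summable (\<lambda>k. \<integral>p. norm (a k * (chr \<theta>2 \<theta>3 k p * cnj (chr \<theta>2 \<theta>3 j p))) \<partial>unit_square)"
      using a emeasure_unit_square by (simp add: norm_mult measure_def)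
  qed (use a in \<open>simp add: norm_mult\<close>)
  also have "\<dots> = (\<Sum>k. if k = j then a j else 0)"
    by (intro arg_cong[of _ _ suminf] ext) (simp only: integral_mult_right_zero chr_orthonormal, simp)
  also have "\<dots> = a j" using sums_single[of j "\<lambda>k. a j"] by (simp add: sums_unique[symmetric])
  finally show ?thesis .
qed

lemma chr_series_square_summable: "summable (\<lambda>k. (norm (a k))\<^sup>2)"
proof -
  have "summable (\<lambda>k. (\<Sum>k. norm (a k)) * norm (a k))" using a by (rule summable_mult)
  then show ?thesis
    by (rule summable_comparison_test[rotated])
      (use sum_le_suminf[OF a, of "{_}"] in \<open>auto simp: power2_eq_square intro!: exI[of _ 0] mult_right_mono\<close>)
qed

text \<open>The series is paired with its own conjugate and integrated termwise; absolute
  summability bounds all integrands, and each term is a coefficient by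
  \<open>chr_series_coeff\<close>. This will turn the mean square of the kernel over a cross-section
  into a sum of squared mode amplitudes.\<close>

lemma chr_series_parseval:
  "(\<integral>p. (norm (\<Sum>k. a k * chr \<theta>2 \<theta>3 k p))\<^sup>2 \<partial>unit_square) = (\<Sum>k. (norm (a k))\<^sup>2)"
proof -
  let ?f = "\<lambda>p. \<Sum>k. a k * chr \<theta>2 \<theta>3 k p" and ?A = "\<Sum>k. norm (a k)"
  have "complex_of_real ((norm (?f p))\<^sup>2) = (\<Sum>k. cnj (a k) * (?f p * cnj (chr \<theta>2 \<theta>3 k p)))" for p
  proof -
    have "complex_of_real ((norm (?f p))\<^sup>2) = ?f p * cnj (?f p)" by (rule complex_norm_square)
    also have "cnj (?f p) = (\<Sum>k. cnj (a k * chr \<theta>2 \<theta>3 k p))"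
      using summable_norm_cancel[OF chr_series_summable] by (intro bounded_linear.suminf bounded_linear_cnj) auto
    also have "?f p * \<dots> = (\<Sum>k. ?f p * cnj (a k * chr \<theta>2 \<theta>3 k p))"
      using chr_series_summable[of p] by (intro suminf_mult[symmetric]) (auto simp: norm_mult intro: summable_norm_cancel)
    finally show ?thesis by (simp add: mult_ac)
  qed
  then have "complex_of_real (\<integral>p. (norm (?f p))\<^sup>2 \<partial>unit_square) = (\<integral>p. (\<Sum>k. cnj (a k) * (?f p * cnj (chr \<theta>2 \<theta>3 k p))) \<partial>unit_square)"
    by (simp flip: integral_complex_of_real)
  also have "\<dots> = (\<Sum>k. \<integral>p. cnj (a k) * (?f p * cnj (chr \<theta>2 \<theta>3 k p)) \<partial>unit_square)"
  proof (rule integral_suminf)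
    have le: "norm (cnj (a k) * (?f p * cnj (chr \<theta>2 \<theta>3 k p))) \<le> norm (a k) * ?A" for k p
      using chr_series_bound[of p] by (auto simp: norm_mult intro!: mult_left_mono)
    have [measurable]: "(\<lambda>p. ?f p) \<in> borel_measurable unit_square" by measurable
    show i: "integrable unit_square (\<lambda>p. cnj (a k) * (?f p * cnj (chr \<theta>2 \<theta>3 k p)))" for k
      by (rule integrable_square_bounded[OF _ le]) measurable
    have s: "summable (\<lambda>k. norm (a k) * ?A)" using a by (rule summable_mult2)
    show "AE p in unit_square. summable (\<lambda>k. norm (cnj (a k) * (?f p * cnj (chr \<theta>2 \<theta>3 k p))))"
      by (intro AE_I2 summable_comparison_test[OF _ s] exI[of _ 0]) (use le in auto)
    show "summable (\<lambda>k. \<integral>p. norm (cnj (a k) * (?f p * cnj (chr \<theta>2 \<theta>3 k p))) \<partial>unit_square)"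
    proof (rule summable_comparison_test[OF _ s], intro exI[of _ 0] allI impI)
      fix k
      have "(\<integral>p. norm (cnj (a k) * (?f p * cnj (chr \<theta>2 \<theta>3 k p))) \<partial>unit_square) \<le> (\<integral>p. norm (a k) * ?A \<partial>unit_square)"
        by (intro integral_mono integrable_norm i le) auto
      then show "norm (\<integral>p. norm (cnj (a k) * (?f p * cnj (chr \<theta>2 \<theta>3 k p))) \<partial>unit_square) \<le> norm (a k) * ?A"
        using emeasure_unit_square by (simp add: measure_def)
    qed
  qed
  also have "\<dots> = (\<Sum>k. cnj (a k) * a k)" by (simp only: integral_mult_right_zero chr_series_coeff)
  also have "\<dots> = (\<Sum>k. complex_of_real ((norm (a k))\<^sup>2))"
    by (simp only: complex_norm_square mult.commute)
  also have "\<dots> = complex_of_real (\<Sum>k. (norm (a k))\<^sup>2)"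
    by (rule suminf_of_real[symmetric, OF chr_series_square_summable])
  finally show ?thesis by (simp only: of_real_eq_iff)
qed

end

section \<open>The evanescent Green function and its L^1 bound\<close>

lemma nn_integral_exp_abs:
  assumes "\<kappa> > 0"
  shows "(\<integral>\<^sup>+x. ennreal (exp (- \<kappa> * \<bar>x - y\<bar>)) \<partial>lborel) = ennreal (2 / \<kappa>)"
proof -
  have half: "(\<integral>\<^sup>+x. ennreal (exp (- \<kappa> * x)) * indicator {0..} x \<partial>lborel) = ennreal (1 / \<kappa>)"
  proof -
    have "(\<integral>\<^sup>+x. ennreal (exp (- \<kappa> * x)) * indicator {0..} x \<partial>lborel) = ennreal (0 - (- exp (- \<kappa> * 0) / \<kappa>))"
    proof (rule nn_integral_FTC_atLeast)
      show "((\<lambda>x. - exp (- \<kappa> * x) / \<kappa>) has_real_derivative exp (- \<kappa> * x)) (at x)" for x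
        using assms by (auto intro!: derivative_eq_intros)
      have "((\<lambda>x. exp (- \<kappa> * x)) \<longlongrightarrow> 0) at_top"
        using assms by (intro filterlim_compose[OF exp_at_bot] filterlim_tendsto_neg_mult_at_bot[OF tendsto_const _ filterlim_ident]) auto
      then have "((\<lambda>x. - exp (- \<kappa> * x) / \<kappa>) \<longlongrightarrow> - 0 / \<kappa>) at_top" by (intro tendsto_intros) (use assms in auto)
      then show "((\<lambda>x. - exp (- \<kappa> * x) / \<kappa>) \<longlongrightarrow> 0) at_top" by simp
    qed auto
    then show ?thesis by simp
  qed
  have shift: "(\<integral>\<^sup>+x. f (x - y) \<partial>lborel) = (\<integral>\<^sup>+x. f x \<partial>lborel)" if "f \<in> borel_measurable borel" for f :: "real \<Rightarrow> ennreal"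
    using nn_integral_real_affine[of "\<lambda>x. f (x - y)" 1 y] that by simp
  have neg: "(\<integral>\<^sup>+x. f (- x) \<partial>lborel) = (\<integral>\<^sup>+x. f x \<partial>lborel)" if "f \<in> borel_measurable borel" for f :: "real \<Rightarrow> ennreal"
    using nn_integral_real_affine[of f "-1" 0] that by simp
  have "(\<integral>\<^sup>+x. ennreal (exp (- \<kappa> * \<bar>x - y\<bar>)) \<partial>lborel) = (\<integral>\<^sup>+x. ennreal (exp (- \<kappa> * \<bar>x\<bar>)) \<partial>lborel)"
    by (rule shift) simp
  also have "\<dots> = (\<integral>\<^sup>+x. ennreal (exp (- \<kappa> * x)) * indicator {0..} x + ennreal (exp (- \<kappa> * (- x))) * indicator {0..} (- x) \<partial>lborel)"
  proof (rule nn_integral_cong_AE)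
    show "AE x in lborel. ennreal (exp (- \<kappa> * \<bar>x\<bar>)) = ennreal (exp (- \<kappa> * x)) * indicator {0..} x + ennreal (exp (- \<kappa> * (- x))) * indicator {0..} (- x)"
      using AE_lborel_singleton[of 0] by eventually_elim (auto simp: indicator_def)
  qed
  also have "\<dots> = (\<integral>\<^sup>+x. ennreal (exp (- \<kappa> * x)) * indicator {0..} x \<partial>lborel) + (\<integral>\<^sup>+x. ennreal (exp (- \<kappa> * (- x))) * indicator {0..} (- x) \<partial>lborel)"
    by (rule nn_integral_add) auto
  also have "(\<integral>\<^sup>+x. ennreal (exp (- \<kappa> * (- x))) * indicator {0..} (- x) \<partial>lborel) = (\<integral>\<^sup>+x. ennreal (exp (- \<kappa> * x)) * indicator {0..} x \<partial>lborel)"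
    by (rule neg) simp
  finally show ?thesis
    unfolding half using assms by (simp flip: ennreal_plus)
qed

interpretation tube_pair: pair_sigma_finite tube tube ..

text \<open>\<open>\<kappa>\<close> are the decay rates and \<open>A\<close> is the set of
  evanescent modes. The cube is what the L^1 bound of the kernel produces, and 3 is the first
  integer exponent for which the sum over a two-dimensional lattice converges when the rates grow
  like the norm.\<close>

locale mode_kernel =
  fixes \<theta>2 \<theta>3 :: real and \<kappa> :: "nat \<Rightarrow> real" and A :: "nat set" and c0 Z :: real
  assumes c0: "c0 > 0" and \<kappa>_ge: "\<And>k. k \<in> A \<Longrightarrow> c0 \<le> \<kappa> k"
    and Z_summable: "summable (\<lambda>k. indicator A k / \<kappa> k ^ 3)" and Z: "(\<Sum>k. indicator A k / \<kappa> k ^ 3) \<le> Z"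
begin

text \<open>For k in \<open>A\<close>, the decaying Green function of -d^2/dr^2 +
  \<kappa>^2.\<close>

definition co :: "nat \<Rightarrow> real \<Rightarrow> real" where
  "co k r = indicator A k * exp (- \<kappa> k * \<bar>r\<bar>) / (2 * \<kappa> k)"

lemma \<kappa>_pos: "k \<in> A \<Longrightarrow> \<kappa> k > 0"
  using \<kappa>_ge[of k] c0 by simp

lemma co_nonneg: "0 \<le> co k r"
  using \<kappa>_pos[of k] by (auto simp: co_def indicator_def)

lemma measurable_co [measurable]: "co k \<in> borel_measurable borel"
  unfolding co_def by measurable

text \<open>From exp(-y) <= 2/y^2 with y = \<kappa> |r|: away from r = 0 the exponential buys the
  two powers of \<kappa> missing for the cubic sum.\<close>

lemma co_summable:
  assumes "r \<noteq> 0" shows "summable (\<lambda>k. co k r)"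
proof (rule summable_comparison_test[OF _ summable_mult[OF Z_summable, of "1 / r\<^sup>2"]], intro exI[of _ 0] allI impI)
  fix k
  show "norm (co k r) \<le> 1 / r\<^sup>2 * (indicator A k / \<kappa> k ^ 3)"
  proof (cases "k \<in> A")
    case True
    define y where "y = \<kappa> k * \<bar>r\<bar>"
    have y: "y > 0" using \<kappa>_pos[OF True] assms by (simp add: y_def)
    have "y\<^sup>2 / 2 \<le> exp y" using exp_lower_Taylor_quadratic[of y] y by (simp add: power2_eq_square)
    then have "exp (- y) \<le> 2 / y\<^sup>2" using y by (simp add: exp_minus field_simps)
    then have "exp (- y) / (2 * \<kappa> k) \<le> 2 / y\<^sup>2 / (2 * \<kappa> k)"
      using \<kappa>_pos[OF True] by (intro divide_right_mono) auto
    also have "\<dots> = 1 / r\<^sup>2 * (1 / \<kappa> k ^ 3)"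
      using \<kappa>_pos[OF True] assms by (simp add: y_def power2_eq_square power3_eq_cube)
    finally show ?thesis using True co_nonneg[of k r] by (simp add: co_def y_def)
  qed (simp add: co_def)
qed

text \<open>Away from r = 0 the series converges absolutely; the slice r = 0 is null, so the value
  of \<open>suminf\<close> there is immaterial.\<close>

definition S :: "real \<Rightarrow> real \<times> real \<Rightarrow> complex" where
  "S r p = (\<Sum>k. of_real (co k r) * chr \<theta>2 \<theta>3 k p)"

text \<open>As a function of p alone this is a character series with coefficients that are
  absolutely summable for r different from 0, so the bound, the coefficient formula and Parseval all
  apply to it.\<close>

lemma S_diff: "S r (p - p') = (\<Sum>k. (of_real (co k r) * cnj (chr \<theta>2 \<theta>3 k p')) * chr \<theta>2 \<theta>3 k p)"
  unfolding S_def chr_diff by (simp add: mult_ac)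

lemma a_summable: "r \<noteq> 0 \<Longrightarrow> summable (\<lambda>k. norm (of_real (co k r) * cnj (chr \<theta>2 \<theta>3 k p')))"
  using co_summable by (simp add: norm_mult co_nonneg)

lemma measurable_S [measurable]:
  "(\<lambda>(z, w). S (fst z - fst w) (snd z - snd w)) \<in> borel_measurable (tube \<Otimes>\<^sub>M tube)"
proof -
  have "(\<lambda>(z, w). S (fst z - fst w) (snd z - snd w)) = (\<lambda>(z, w). \<Sum>k. (of_real (co k (fst z - fst w)) * cnj (chr \<theta>2 \<theta>3 k (snd w))) * chr \<theta>2 \<theta>3 k (snd z))"
    by (auto simp: S_diff fun_eq_iff)
  then show ?thesis by (simp only:) measurable
qed

lemma measurable_S_section [measurable]:
  "(\<lambda>p. S r (p - p')) \<in> borel_measurable (borel \<Otimes>\<^sub>M borel)"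
  unfolding S_diff by measurable

text \<open>On a cross-section, |S| <= exp(c0 |r|) |S|^2 / 2 + exp(-c0 |r|) / 2, and Parseval
  evaluates the mean of |S|^2. As c0 <= \<kappa>, one of the two factors exp(-\<kappa> |r|) absorbs
  exp(c0 |r|). Integrating exp(-\<kappa> |r|) / (8 \<kappa>^2) over r gives 1 / (4 \<kappa>^3),
  hence Z/4 after summation; the second term contributes 1/c0.\<close>

lemma S_L1: "(\<integral>\<^sup>+z. norm (S (fst z - y) (snd z - p')) \<partial>tube) \<le> ennreal (Z / 4 + 1 / c0)"
proof -
  define g where "g k r = indicator A k * exp (- \<kappa> k * \<bar>r\<bar>) / (8 * (\<kappa> k)\<^sup>2)" for k r
  have g0: "0 \<le> g k r" for k r by (simp add: g_def)
  have gm [measurable]: "g k \<in> borel_measurable borel" for k unfolding g_def by measurable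
  have sq: "exp (c0 * \<bar>r\<bar>) * (co k r)\<^sup>2 / 2 \<le> g k r" for k r
  proof (cases "k \<in> A")
    case True
    have "exp (c0 * \<bar>r\<bar>) * (exp (- \<kappa> k * \<bar>r\<bar>))\<^sup>2 = exp (c0 * \<bar>r\<bar> - 2 * (\<kappa> k * \<bar>r\<bar>))"
      by (simp add: power2_eq_square exp_add[symmetric] exp_diff exp_minus field_simps mult_exp_exp)
    also have "\<dots> \<le> exp (- \<kappa> k * \<bar>r\<bar>)"
      using mult_right_mono[OF \<kappa>_ge[OF True], of "\<bar>r\<bar>"] by (simp add: mult.commute)
    finally have "exp (c0 * \<bar>r\<bar>) * (exp (- \<kappa> k * \<bar>r\<bar>))\<^sup>2 / (8 * (\<kappa> k)\<^sup>2) \<le> exp (- \<kappa> k * \<bar>r\<bar>) / (8 * (\<kappa> k)\<^sup>2)"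
      by (intro divide_right_mono) auto
    then show ?thesis using True by (simp add: g_def co_def power_divide power_mult_distrib)
  qed (simp add: co_def g_def)
  have inner: "(\<integral>\<^sup>+p. norm (S r (p - p')) \<partial>unit_square) \<le> (\<Sum>k. ennreal (g k r)) + ennreal (exp (- c0 * \<bar>r\<bar>) / 2)" if r: "r \<noteq> 0" for r
  proof -
    let ?s = "\<lambda>p. norm (S r (p - p'))" and ?e = "exp (c0 * \<bar>r\<bar>)"
    note as = a_summable[OF r, of p']
    have bd: "?s p \<le> (\<Sum>k. norm (of_real (co k r) * cnj (chr \<theta>2 \<theta>3 k p')))" for p
      unfolding S_diff by (rule chr_series_bound[OF as])
    have le: "?s p \<le> ?e / 2 * (?s p)\<^sup>2 + exp (- c0 * \<bar>r\<bar>) / 2" for p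
    proof -
      have "0 \<le> (?e * ?s p - 1)\<^sup>2" by simp
      then have "2 * ?e * ?s p \<le> ?e\<^sup>2 * (?s p)\<^sup>2 + 1" by (simp add: power2_eq_square algebra_simps)
      then have "2 * ?e * ?s p / (2 * ?e) \<le> (?e\<^sup>2 * (?s p)\<^sup>2 + 1) / (2 * ?e)" by (intro divide_right_mono) auto
      moreover have "2 * ?e * ?s p / (2 * ?e) = ?s p" by simp
      moreover have "(?e\<^sup>2 * (?s p)\<^sup>2 + 1) / (2 * ?e) = ?e / 2 * (?s p)\<^sup>2 + inverse ?e / 2"
        using exp_gt_zero[of "c0 * \<bar>r\<bar>"] by (simp add: field_simps power2_eq_square del: exp_gt_zero)
      moreover have "inverse ?e = exp (- c0 * \<bar>r\<bar>)" by (simp add: exp_minus)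
      ultimately show ?thesis by simp
    qed
    have m: "(\<lambda>p. ?s p) \<in> borel_measurable unit_square" by measurable
    have i1: "integrable unit_square ?s"
      by (rule unit_square.integrable_const_bound[OF AE_I2 m]) (use bd in simp)
    have i2: "integrable unit_square (\<lambda>p. (?s p)\<^sup>2)"
      by (rule unit_square.integrable_const_bound[of _ "(\<Sum>k. norm (of_real (co k r) * cnj (chr \<theta>2 \<theta>3 k p')))\<^sup>2"]) (use bd m in \<open>auto intro!: power_mono\<close>)
    have gs: "summable (\<lambda>k. g k r)"
    proof (rule summable_comparison_test[OF _ summable_mult[OF co_summable[OF r], of "1 / (4 * c0)"]], intro exI[of _ 0] allI impI)
      fix k
      show "norm (g k r) \<le> 1 / (4 * c0) * co k r"
      proof (cases "k \<in> A")
        case True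
        have "exp (- \<kappa> k * \<bar>r\<bar>) / (8 * (\<kappa> k)\<^sup>2) \<le> exp (- \<kappa> k * \<bar>r\<bar>) / (8 * (c0 * \<kappa> k))"
          using \<kappa>_ge[OF True] \<kappa>_pos[OF True] c0 by (intro divide_left_mono) (auto simp: power2_eq_square)
        then show ?thesis using True by (simp add: g_def co_def)
      qed (simp add: g_def co_def)
    qed
    have "(\<integral>p. ?s p \<partial>unit_square) \<le> (\<integral>p. ?e / 2 * (?s p)\<^sup>2 + exp (- c0 * \<bar>r\<bar>) / 2 \<partial>unit_square)"
      by (intro integral_mono i1 le Bochner_Integration.integrable_add integrable_mult_right i2) auto
    also have "\<dots> = ?e / 2 * (\<integral>p. (?s p)\<^sup>2 \<partial>unit_square) + exp (- c0 * \<bar>r\<bar>) / 2"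
      using i2 emeasure_unit_square by (subst Bochner_Integration.integral_add) (auto simp: measure_def)
    also have "(\<integral>p. (?s p)\<^sup>2 \<partial>unit_square) = (\<Sum>k. (co k r)\<^sup>2)"
      unfolding S_diff using chr_series_parseval[OF as] by (simp add: norm_mult power_mult_distrib)
    also have "?e / 2 * \<dots> = (\<Sum>k. ?e * (co k r)\<^sup>2 / 2)"
      using suminf_mult[OF chr_series_square_summable[OF as], of "?e / 2"] by (simp add: norm_mult power_mult_distrib)
    also have "\<dots> \<le> (\<Sum>k. g k r)"
    proof (rule suminf_le[OF sq])
      show "summable (\<lambda>k. ?e * (co k r)\<^sup>2 / 2)"
        using summable_mult[OF chr_series_square_summable[OF as], of "?e / 2"] by (simp add: norm_mult power_mult_distrib)
    qed (rule gs)
    finally have fin: "(\<integral>p. ?s p \<partial>unit_square) \<le> (\<Sum>k. g k r) + exp (- c0 * \<bar>r\<bar>) / 2" by simp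
    have "(\<integral>\<^sup>+p. norm (S r (p - p')) \<partial>unit_square) = ennreal (\<integral>p. ?s p \<partial>unit_square)"
      by (rule nn_integral_eq_integral[OF i1]) simp
    also have "\<dots> \<le> ennreal ((\<Sum>k. g k r) + exp (- c0 * \<bar>r\<bar>) / 2)" using fin by (rule ennreal_leI)
    also have "\<dots> = ennreal (\<Sum>k. g k r) + ennreal (exp (- c0 * \<bar>r\<bar>) / 2)"
      using suminf_nonneg[OF gs g0] by (intro ennreal_plus) auto
    also have "ennreal (\<Sum>k. g k r) = (\<Sum>k. ennreal (g k r))"
      by (rule suminf_ennreal2[symmetric, OF g0 gs])
    finally show ?thesis .
  qed
  have gk: "(\<integral>\<^sup>+x. ennreal (g k (x - y)) \<partial>lborel) = ennreal (indicator A k / \<kappa> k ^ 3 / 4)" for k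
  proof (cases "k \<in> A")
    case True
    have "(\<integral>\<^sup>+x. ennreal (g k (x - y)) \<partial>lborel) = (\<integral>\<^sup>+x. ennreal (1 / (8 * (\<kappa> k)\<^sup>2)) * ennreal (exp (- \<kappa> k * \<bar>x - y\<bar>)) \<partial>lborel)"
      using True by (intro nn_integral_cong, subst ennreal_mult[symmetric]) (auto simp: g_def)
    also have "\<dots> = ennreal (1 / (8 * (\<kappa> k)\<^sup>2)) * ennreal (2 / \<kappa> k)"
      unfolding nn_integral_exp_abs[OF \<kappa>_pos[OF True], of y, symmetric] by (rule nn_integral_cmult) auto
    also have "\<dots> = ennreal (indicator A k / \<kappa> k ^ 3 / 4)"
      using True \<kappa>_pos[OF True]
      by (subst ennreal_mult[symmetric]) (auto simp: power2_eq_square power3_eq_cube mult.assoc)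
    finally show ?thesis .
  qed (simp add: g_def)
  have "(\<integral>\<^sup>+z. norm (S (fst z - y) (snd z - p')) \<partial>tube) = (\<integral>\<^sup>+x. \<integral>\<^sup>+p. norm (S (fst (x, p) - y) (snd (x, p) - p')) \<partial>unit_square \<partial>lborel)"
    unfolding tube_def
  proof (rule unit_square.nn_integral_fst[symmetric], fold tube_def)
    have "(\<lambda>z. S (fst z - y) (snd z - p')) = (\<lambda>z. \<Sum>k. (of_real (co k (fst z - y)) * cnj (chr \<theta>2 \<theta>3 k p')) * chr \<theta>2 \<theta>3 k (snd z))"
      by (auto simp: S_diff)
    then have "(\<lambda>z. S (fst z - y) (snd z - p')) \<in> borel_measurable tube" by (simp only:) measurable
    then show "(\<lambda>z. ennreal (norm (S (fst z - y) (snd z - p')))) \<in> borel_measurable tube" by measurable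
  qed
  also have "\<dots> \<le> (\<integral>\<^sup>+x. (\<Sum>k. ennreal (g k (x - y))) + ennreal (exp (- c0 * \<bar>x - y\<bar>) / 2) \<partial>lborel)"
  proof (rule nn_integral_mono_AE)
    show "AE x in lborel. (\<integral>\<^sup>+p. norm (S (fst (x, p) - y) (snd (x, p) - p')) \<partial>unit_square)
      \<le> (\<Sum>k. ennreal (g k (x - y))) + ennreal (exp (- c0 * \<bar>x - y\<bar>) / 2)"
      using AE_lborel_singleton[of y] by eventually_elim (use inner in auto)
  qed
  also have "\<dots> = (\<Sum>k. \<integral>\<^sup>+x. ennreal (g k (x - y)) \<partial>lborel) + (\<integral>\<^sup>+x. ennreal (exp (- c0 * \<bar>x - y\<bar>) / 2) \<partial>lborel)"
    by (subst nn_integral_add) (auto simp: nn_integral_suminf)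
  also have "(\<integral>\<^sup>+x. ennreal (exp (- c0 * \<bar>x - y\<bar>) / 2) \<partial>lborel) = ennreal (1 / c0)"
  proof -
    have "(\<integral>\<^sup>+x. ennreal (exp (- c0 * \<bar>x - y\<bar>) / 2) \<partial>lborel) = (\<integral>\<^sup>+x. ennreal (1/2) * ennreal (exp (- c0 * \<bar>x - y\<bar>)) \<partial>lborel)"
      by (intro nn_integral_cong, subst ennreal_mult[symmetric]) auto
    also have "\<dots> = ennreal (1/2) * ennreal (2 / c0)"
      unfolding nn_integral_exp_abs[OF c0, of y, symmetric] by (rule nn_integral_cmult) auto
    also have "\<dots> = ennreal (1 / c0)" using c0 by (subst ennreal_mult[symmetric]) auto
    finally show ?thesis .
  qed
  also have "(\<Sum>k. \<integral>\<^sup>+x. ennreal (g k (x - y)) \<partial>lborel) = ennreal ((\<Sum>k. indicator A k / \<kappa> k ^ 3) / 4)"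
  proof -
    have "0 \<le> indicator A k / \<kappa> k ^ 3 / 4" for k using \<kappa>_pos[of k] by (auto simp: indicator_def)
    then have "(\<Sum>k. ennreal (indicator A k / \<kappa> k ^ 3 / 4)) = ennreal (\<Sum>k. indicator A k / \<kappa> k ^ 3 / 4)"
      by (intro suminf_ennreal2 summable_divide Z_summable)
    then show ?thesis by (simp only: gk suminf_divide[OF Z_summable])
  qed
  also have "\<dots> + ennreal (1 / c0) \<le> ennreal (Z / 4) + ennreal (1 / c0)"
    using Z by (intro add_right_mono ennreal_leI) simp
  also have "\<dots> = ennreal (Z / 4 + 1 / c0)"
  proof -
    have "0 \<le> (\<Sum>k. indicator A k / \<kappa> k ^ 3)"
      using \<kappa>_pos by (intro suminf_nonneg Z_summable) (auto simp: indicator_def less_imp_le)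
    then show ?thesis using Z c0 by (intro ennreal_plus[symmetric]) auto
  qed
  finally show ?thesis .
qed

definition bound :: real where "bound = Z / 4 + 1 / c0"

lemma bound_nonneg: "bound \<ge> 0"
proof -
  have "0 \<le> (\<Sum>k. indicator A k / \<kappa> k ^ 3)"
    using \<kappa>_pos by (intro suminf_nonneg Z_summable) (auto simp: indicator_def less_imp_le)
  then show ?thesis using Z c0 by (auto simp: bound_def)
qed

context
  fixes h :: "real \<times> real \<times> real \<Rightarrow> complex"
  assumes h: "integrable tube h"
begin

definition F :: "real \<times> real \<times> real \<Rightarrow> complex" where
  "F z = (\<integral>w. S (fst z - fst w) (snd z - snd w) * h w \<partial>tube)"

lemma measurable_h [measurable]: "h \<in> borel_measurable tube"
  using h by auto

lemma measurable_Sh [measurable]: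
  "(\<lambda>(z, w). S (fst z - fst w) (snd z - snd w) * h w) \<in> borel_measurable (tube \<Otimes>\<^sub>M tube)"
  using measurable_S by measurable

text \<open>Integrating first over \<open>z\<close> with \<open>w\<close> fixed reduces the double
  integral to \<open>S_L1\<close>; its finiteness licenses the later uses of Fubini.\<close>

lemma nn_Sh: "(\<integral>\<^sup>+zw. norm (case zw of (z, w) \<Rightarrow> S (fst z - fst w) (snd z - snd w) * h w) \<partial>(tube \<Otimes>\<^sub>M tube))
    \<le> ennreal (bound * (\<integral>w. norm (h w) \<partial>tube))"
proof -
  let ?k = "\<lambda>z w. S (fst z - fst w) (snd z - snd w) * h w"
  have "(\<integral>\<^sup>+zw. norm (case zw of (z, w) \<Rightarrow> ?k z w) \<partial>(tube \<Otimes>\<^sub>M tube))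
      = (\<integral>\<^sup>+w. \<integral>\<^sup>+z. norm (?k z w) \<partial>tube \<partial>tube)"
    using tube_pair.nn_integral_snd[OF measurable_compose[OF measurable_Sh, of "\<lambda>x. ennreal (norm x)"]] by simp
  also have "\<dots> \<le> (\<integral>\<^sup>+w. ennreal bound * norm (h w) \<partial>tube)"
  proof (rule nn_integral_mono)
    fix w
    have [measurable]: "(\<lambda>z. S (fst z - fst w) (snd z - snd w)) \<in> borel_measurable tube"
      using measurable_compose[OF measurable_Pair2'[of w tube tube] measurable_S] by simp
    have "(\<integral>\<^sup>+z. norm (?k z w) \<partial>tube) = (\<integral>\<^sup>+z. norm (S (fst z - fst w) (snd z - snd w)) * ennreal (norm (h w)) \<partial>tube)"
      by (simp add: norm_mult ennreal_mult)
    also have "\<dots> = (\<integral>\<^sup>+z. norm (S (fst z - fst w) (snd z - snd w)) \<partial>tube) * ennreal (norm (h w))"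
      by (rule nn_integral_multc) measurable
    also have "\<dots> \<le> ennreal bound * norm (h w)"
      unfolding bound_def by (intro mult_right_mono S_L1) auto
    finally show "(\<integral>\<^sup>+z. norm (?k z w) \<partial>tube) \<le> ennreal bound * norm (h w)" .
  qed
  also have "\<dots> = ennreal bound * (\<integral>\<^sup>+w. norm (h w) \<partial>tube)" by (rule nn_integral_cmult) measurable
  also have "(\<integral>\<^sup>+w. norm (h w) \<partial>tube) = ennreal (\<integral>w. norm (h w) \<partial>tube)"
    by (rule nn_integral_eq_integral) (use h in auto)
  finally show ?thesis using bound_nonneg by (simp add: ennreal_mult)
qed

lemma integrable_Sh: "integrable (tube \<Otimes>\<^sub>M tube) (\<lambda>(z, w). S (fst z - fst w) (snd z - snd w) * h w)"
  by (rule integrableI_bounded) (use nn_Sh in \<open>auto intro: le_less_trans\<close>)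

lemma AE_integrable_Sh: "AE z in tube. integrable tube (\<lambda>w. S (fst z - fst w) (snd z - snd w) * h w)"
  using  tube_pair.AE_integrable_fst'[OF integrable_Sh] by simp

lemma integrable_F: "integrable tube F"
  using  tube_pair.integrable_fst'[OF integrable_Sh] by (simp add: F_def[abs_def])

lemma integral_norm_F: "(\<integral>z. norm (F z) \<partial>tube) \<le> bound * (\<integral>w. norm (h w) \<partial>tube)"
proof -
  let ?k = "\<lambda>z w. S (fst z - fst w) (snd z - snd w) * h w"
  have "(\<integral>z. norm (F z) \<partial>tube) \<le> (\<integral>z. \<integral>w. norm (?k z w) \<partial>tube \<partial>tube)"
  proof (rule integral_mono[OF integrable_norm[OF integrable_F]])
    show "integrable tube (\<lambda>z. \<integral>w. norm (?k z w) \<partial>tube)"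
      using tube_pair.integrable_fst'[OF integrable_norm[OF integrable_Sh]] by simp
    show "norm (F z) \<le> (\<integral>w. norm (?k z w) \<partial>tube)" for z
      unfolding F_def by (rule integral_norm_bound)
  qed
  also have "\<dots> = (\<integral>zw. norm (case zw of (z, w) \<Rightarrow> ?k z w) \<partial>(tube \<Otimes>\<^sub>M tube))"
    using  tube_pair.integral_fst'[OF integrable_norm[OF integrable_Sh]] by simp
  also have "\<dots> = enn2real (\<integral>\<^sup>+zw. norm (case zw of (z, w) \<Rightarrow> ?k z w) \<partial>(tube \<Otimes>\<^sub>M tube))"
    by (rule integral_eq_nn_integral) auto
  also have "\<dots> \<le> bound * (\<integral>w. norm (h w) \<partial>tube)"
    using nn_Sh bound_nonneg by (intro enn2real_leI) auto
  finally show ?thesis .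
qed

text \<open>After Fubini the inner integral runs over \<open>z\<close> for fixed \<open>w\<close>.
  For almost every x_1 its cross-section part is a Fourier coefficient of an absolutely convergent
  character series, which picks out the single profile \<open>co j\<close>.\<close>

lemma F_mode:
  fixes \<eta> :: "real \<Rightarrow> complex"
  assumes [measurable]: "\<eta> \<in> borel_measurable borel" and \<eta>: "\<And>x. norm (\<eta> x) \<le> M"
  shows "(\<integral>z. F z * (\<eta> (fst z) * cnj (chr \<theta>2 \<theta>3 j (snd z))) \<partial>tube)
    = (\<integral>w. h w * cnj (chr \<theta>2 \<theta>3 j (snd w)) * (\<integral>x. of_real (co j (x - fst w)) * \<eta> x \<partial>lborel) \<partial>tube)"
proof -
  let ?k = "\<lambda>z w. S (fst z - fst w) (snd z - snd w) * h w"
  let ?e = "\<lambda>z. \<eta> (fst z) * cnj (chr \<theta>2 \<theta>3 j (snd z))"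
  have i: "integrable (tube \<Otimes>\<^sub>M tube) (\<lambda>(z, w). ?k z w * ?e z)"
  proof (rule Bochner_Integration.integrable_bound[OF integrable_mult_right[OF integrable_norm[OF integrable_Sh], of M]])
    show "AE p in tube \<Otimes>\<^sub>M tube. norm (case p of (z, w) \<Rightarrow> ?k z w * ?e z) \<le> norm (M * norm (case p of (z, w) \<Rightarrow> ?k z w))"
    proof (intro AE_I2)
      fix p
      show "norm (case p of (z, w) \<Rightarrow> ?k z w * ?e z) \<le> norm (M * norm (case p of (z, w) \<Rightarrow> ?k z w))"
      proof -
        obtain z w where p: "p = (z, w)" by (cases p)
        have "norm (?k z w) * norm (?e z) \<le> norm (?k z w) * \<bar>M\<bar>"
          using order_trans[OF \<eta>[of "fst z"] abs_ge_self] by (intro mult_left_mono) (auto simp: norm_mult)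
        then show ?thesis by (simp add: p norm_mult abs_mult mult_ac)
      qed
    qed
    have "(\<lambda>p. (case p of (z, w) \<Rightarrow> ?k z w) * ?e (fst p)) \<in> borel_measurable (tube \<Otimes>\<^sub>M tube)" by measurable
    then show "(\<lambda>(z, w). ?k z w * ?e z) \<in> borel_measurable (tube \<Otimes>\<^sub>M tube)" by (simp add: case_prod_beta')
  qed
  have "(\<integral>z. F z * ?e z \<partial>tube) = (\<integral>z. \<integral>w. ?k z w * ?e z \<partial>tube \<partial>tube)"
    unfolding F_def by simp
  also have "\<dots> = (\<integral>w. \<integral>z. ?k z w * ?e z \<partial>tube \<partial>tube)" by (rule  tube_pair.Fubini_integral[OF i, symmetric])
  also have "\<dots> = (\<integral>w. h w * cnj (chr \<theta>2 \<theta>3 j (snd w)) * (\<integral>x. of_real (co j (x - fst w)) * \<eta> x \<partial>lborel) \<partial>tube)"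
  proof (rule integral_cong_AE)
    show "AE w in tube. (\<integral>z. ?k z w * ?e z \<partial>tube) = h w * cnj (chr \<theta>2 \<theta>3 j (snd w)) * (\<integral>x. of_real (co j (x - fst w)) * \<eta> x \<partial>lborel)"
      using tube_pair.AE_integrable_fst'[OF  tube_pair.integrable_product_swap[OF i]]
    proof eventually_elim
      case (elim w)
      then have i': "integrable (lborel \<Otimes>\<^sub>M unit_square) (\<lambda>z. ?k z w * ?e z)" by (simp add: tube_def)
      have "(\<integral>z. ?k z w * ?e z \<partial>tube) = (\<integral>x. \<integral>p. ?k (x, p) w * ?e (x, p) \<partial>unit_square \<partial>lborel)"
        unfolding tube_def by (rule tube.integral_fst'[OF i', symmetric])
      also have "\<dots> = (\<integral>x. h w * cnj (chr \<theta>2 \<theta>3 j (snd w)) * (of_real (co j (x - fst w)) * \<eta> x) \<partial>lborel)"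
      proof (rule integral_cong_AE)
        show "AE x in lborel. (\<integral>p. ?k (x, p) w * ?e (x, p) \<partial>unit_square) = h w * cnj (chr \<theta>2 \<theta>3 j (snd w)) * (of_real (co j (x - fst w)) * \<eta> x)"
          using AE_lborel_singleton[of "fst w"]
        proof eventually_elim
          case (elim x)
          then have r: "x - fst w \<noteq> 0" by simp
          have "(\<integral>p. ?k (x, p) w * ?e (x, p) \<partial>unit_square)
            = (\<integral>p. h w * \<eta> x * (S (x - fst w) (p - snd w) * cnj (chr \<theta>2 \<theta>3 j p)) \<partial>unit_square)"
            by (simp add: mult_ac)
          also have "\<dots> = h w * \<eta> x * (of_real (co j (x - fst w)) * cnj (chr \<theta>2 \<theta>3 j (snd w)))"
            unfolding S_diff integral_mult_right_zero chr_series_coeff[OF a_summable[OF r]] ..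
          finally show ?case by (simp add: mult_ac)
        qed
        have "(\<lambda>x. \<integral>p. (case (x, p) of z \<Rightarrow> ?k z w * ?e z) \<partial>unit_square) \<in> borel_measurable lborel"
          using i' by (intro unit_square.borel_measurable_lebesgue_integral) auto
        then show "(\<lambda>x. \<integral>p. ?k (x, p) w * ?e (x, p) \<partial>unit_square) \<in> borel_measurable lborel" by simp
      qed measurable
      finally show ?case by simp
    qed
    show "(\<lambda>w. \<integral>z. ?k z w * ?e z \<partial>tube) \<in> borel_measurable tube"
      using tube_pair.integrable_fst'[OF  tube_pair.integrable_product_swap[OF i]] by (auto dest: borel_measurable_integrable)
  qed measurable
  finally show ?thesis .
qed

end

end

text \<open>The inverse cube of sqrt((1 + |m|)(1 + |n|)), the comparison function for the decay
  rates; the product form reduces summability to one dimension.\<close>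

definition lattice_weight :: "nat \<Rightarrow> real" where
  "lattice_weight k = (1 + \<bar>of_int (fst (mode k))\<bar>) powr (-3/2) * (1 + \<bar>of_int (snd (mode k))\<bar>) powr (-3/2)"

text \<open>The exponent 3/2 exceeds 1. The first \<open>n\<close> modes lie in some square of
  lattice points, over which the sum factorises, so the partial sums are bounded by the square of a
  one-dimensional sum.\<close>

lemma summable_lattice_weight: "summable lattice_weight"
proof -
  define g :: "int \<Rightarrow> real" where "g m = (1 + \<bar>of_int m\<bar>) powr (-3/2)" for m
  have g0: "0 \<le> g m" for m by (simp add: g_def)
  have sg: "summable (\<lambda>j. g (int j))"
  proof -
    have "summable (\<lambda>n. real n powr (-3/2))" by (simp add: summable_real_powr_iff)
    then have "summable (\<lambda>n. real (Suc n) powr (-3/2))" by (subst summable_Suc_iff)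
    then show ?thesis by (simp add: g_def add.commute)
  qed
  define B where "B = 2 * (\<Sum>j. g (int j))"
  have one: "sum g {- int M..int M} \<le> B" for M
  proof -
    have "{- int M..int M} \<subseteq> int ` {..M} \<union> (\<lambda>j. - int j) ` {..M}"
    proof
      fix x assume "x \<in> {- int M..int M}"
      then show "x \<in> int ` {..M} \<union> (\<lambda>j. - int j) ` {..M}"
        by (cases "x \<ge> 0") (auto intro: image_eqI[of _ _ "nat x"] image_eqI[of _ _ "nat (- x)"])
    qed
    then have "sum g {- int M..int M} \<le> sum g (int ` {..M} \<union> (\<lambda>j. - int j) ` {..M})"
      using g0 by (intro sum_mono2) auto
    also have "\<dots> \<le> sum g (int ` {..M}) + sum g ((\<lambda>j. - int j) ` {..M})"
      using sum.union_inter[of "int ` {..M}" "(\<lambda>j. - int j) ` {..M}" g]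
        sum_nonneg[of "int ` {..M} \<inter> (\<lambda>j. - int j) ` {..M}" g] g0 by simp
    also have "\<dots> = 2 * (\<Sum>j\<le>M. g (int j))"
      by (subst (1 2) sum.reindex) (auto simp: inj_on_def g_def)
    also have "\<dots> \<le> B" unfolding B_def using sum_le_suminf[OF sg, of "{..M}"] g0 by simp
    finally show ?thesis .
  qed
  have B0: "0 \<le> B" using one[of 0] g0[of 0] by simp
  show ?thesis
  proof (rule summableI_nonneg_bounded[of _ "B * B"])
    show "0 \<le> lattice_weight n" for n by (simp add: lattice_weight_def)
    show "sum lattice_weight {..<n} \<le> B * B" for n
    proof -
      have inj: "inj_on mode {..<n}" using bij_mode by (meson bij_is_inj inj_on_subset subset_UNIV)
      have eq: "sum lattice_weight {..<n} = (\<Sum>p\<in>mode ` {..<n}. g (fst p) * g (snd p))"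
        by (subst sum.reindex[OF inj]) (simp add: lattice_weight_def g_def o_def)
      obtain M :: nat where M: "mode ` {..<n} \<subseteq> {- int M..int M} \<times> {- int M..int M}"
      proof -
        let ?S = "(\<lambda>k. nat \<bar>fst (mode k)\<bar> + nat \<bar>snd (mode k)\<bar>) ` {..<n}"
        have mx: "nat \<bar>fst (mode k)\<bar> + nat \<bar>snd (mode k)\<bar> \<le> Max ?S" if "k < n" for k
          using that by (intro Max_ge) auto
        have bd: "\<bar>fst (mode k)\<bar> \<le> int (Max ?S) \<and> \<bar>snd (mode k)\<bar> \<le> int (Max ?S)" if "k < n" for k
          using mx[OF that] by linarith
        show ?thesis
        proof (rule that[of "Max ?S"], rule subsetI)
          fix p assume "p \<in> mode ` {..<n}"
          then obtain k where k: "k < n" "p = mode k" by blast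
          show "p \<in> {- int (Max ?S)..int (Max ?S)} \<times> {- int (Max ?S)..int (Max ?S)}"
            unfolding mem_Times_iff atLeastAtMost_iff k(2) using bd[OF k(1)] by linarith
        qed
      qed
      have "(\<Sum>p\<in>mode ` {..<n}. g (fst p) * g (snd p)) \<le> (\<Sum>p\<in>{- int M..int M} \<times> {- int M..int M}. g (fst p) * g (snd p))"
        using M g0 by (intro sum_mono2) auto
      also have "\<dots> = sum g {- int M..int M} * sum g {- int M..int M}"
        by (simp add: sum_product sum.cartesian_product case_prod_beta')
      also have "\<dots> \<le> B * B" using one[of M] g0 B0 by (intro mult_mono sum_nonneg) auto
      finally show ?thesis unfolding eq .
    qed
  qed
qed

text \<open>Cubing the lower bound on the decay rates gives \<open>lattice_weight\<close> divided by
  c^3, which dominates the series termwise.\<close>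

lemma mode_kernelI:
  assumes c: "c > 0"
    and le: "\<And>k. k \<in> A \<Longrightarrow> c * sqrt ((1 + \<bar>of_int (fst (mode k))\<bar>) * (1 + \<bar>of_int (snd (mode k))\<bar>)) \<le> \<kappa> k"
  shows "mode_kernel \<kappa> A c ((\<Sum>k. lattice_weight k) / c ^ 3)"
proof
  have le': "indicator A k / \<kappa> k ^ 3 \<le> lattice_weight k / c ^ 3" for k
  proof (cases "k \<in> A")
    case True
    define x y where "x = 1 + \<bar>real_of_int (fst (mode k))\<bar>" "y = 1 + \<bar>real_of_int (snd (mode k))\<bar>"
    have xy: "x \<ge> 1" "y \<ge> 1" by (auto simp: x_y_def)
    then have pos: "0 < c * sqrt (x * y)" using c by (simp add: zero_less_mult_iff)
    have "(c * sqrt (x * y)) ^ 3 \<le> \<kappa> k ^ 3"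
      using le[OF True] pos by (intro power_mono) (auto simp: x_y_def)
    moreover have p3: "0 < (c * sqrt (x * y)) ^ 3" using pos by (rule zero_less_power)
    ultimately have "1 / \<kappa> k ^ 3 \<le> 1 / (c * sqrt (x * y)) ^ 3"
      by (intro divide_left_mono mult_pos_pos) linarith+
    also have "\<dots> = lattice_weight k / c ^ 3"
    proof -
      have "(sqrt z) ^ 3 = z powr (3/2)" if "z > 0" for z :: real
        using that by (simp add: powr_half_sqrt[symmetric] powr_realpow[symmetric] powr_powr)
      then have "(sqrt (x * y)) ^ 3 = x powr (3/2) * y powr (3/2)" using xy by (simp add: powr_mult)
      then show ?thesis
        using xy by (simp add: lattice_weight_def power_mult_distrib powr_minus_divide flip: x_y_def)
    qed
    finally show ?thesis using True by simp
  qed (use c in \<open>simp add: lattice_weight_def\<close>)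
  show ge: "c \<le> \<kappa> k" if "k \<in> A" for k
  proof -
    have "1 * 1 \<le> (1 + \<bar>real_of_int (fst (mode k))\<bar>) * (1 + \<bar>real_of_int (snd (mode k))\<bar>)" by (intro mult_mono) auto
    then have "c * 1 \<le> c * sqrt ((1 + \<bar>of_int (fst (mode k))\<bar>) * (1 + \<bar>of_int (snd (mode k))\<bar>))"
      using c by (intro mult_left_mono) auto
    with le[OF that] show ?thesis by simp
  qed
  have s: "summable (\<lambda>k. lattice_weight k / c ^ 3)" by (intro summable_divide summable_lattice_weight)
  show sm: "summable (\<lambda>k. indicator A k / \<kappa> k ^ 3)"
  proof (rule summable_comparison_test[OF _ s], intro exI[of _ 0] allI impI)
    fix k
    have "0 \<le> indicator A k / \<kappa> k ^ 3" using ge[of k] c by (auto simp: indicator_def)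
    then show "norm (indicator A k / \<kappa> k ^ 3) \<le> lattice_weight k / c ^ 3" using le'[of k] by simp
  qed
  show "(\<Sum>k. indicator A k / \<kappa> k ^ 3) \<le> (\<Sum>k. lattice_weight k) / c ^ 3"
    using suminf_le[OF le' sm s] by (simp only: suminf_divide[OF summable_lattice_weight])
qed (rule c)

section \<open>Fundamental solutions in one variable\<close>

lemma window_integral:
  fixes f :: "real \<Rightarrow> complex"
  assumes [measurable]: "f \<in> borel_measurable borel" and "a \<le> b"
    and le: "\<And>t. norm (f t) \<le> K" and 0: "\<And>t. t \<notin> {a..b} \<Longrightarrow> f t = 0"
  shows "integrable lborel f" "norm (integral\<^sup>L lborel f) \<le> (b - a) * K"
proof -
  show i: "integrable lborel f"
    by (rule integrableI_bounded_set[where A = "{a..b}" and B = K]) (use \<open>a \<le> b\<close> in \<open>auto simp: le 0\<close>)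
  have j: "integrable lborel (\<lambda>t. K * indicator {a..b} t)" using \<open>a \<le> b\<close> by (auto intro!: integrable_real_indicator)
  have "norm (integral\<^sup>L lborel f) \<le> (\<integral>t. norm (f t) \<partial>lborel)" by simp
  also have "\<dots> \<le> (\<integral>t. K * indicator {a..b} t \<partial>lborel)"
    using i le 0 by (intro integral_mono j) (auto simp: indicator_def)
  finally show "norm (integral\<^sup>L lborel f) \<le> (b - a) * K" using \<open>a \<le> b\<close> by (simp add: mult.commute)
qed

lemma integrable_tensor:
  fixes f g :: "_ \<Rightarrow> real"
  assumes "sigma_finite_measure M1" "sigma_finite_measure M2" and f: "integrable M1 f" and g: "integrable M2 g"
  shows "integrable (M1 \<Otimes>\<^sub>M M2) (\<lambda>(x, y). f x * g y)"
proof -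
  interpret pair_sigma_finite M1 M2 using assms by (simp add: pair_sigma_finite_def)
  have [measurable]: "f \<in> borel_measurable M1" "g \<in> borel_measurable M2" using f g by auto
  show ?thesis
    using f g by (intro Fubini_integrable) (auto simp: abs_mult)
qed

text \<open>Green's identity: the integrand is the derivative of -P(t) e1(x - t) - P1(t) e(x - t),
  the reflected argument accounting for the signs.\<close>

lemma ibp_twice:
  fixes P P1 P2 :: "real \<Rightarrow> real" and e e1 e2 :: "real \<Rightarrow> complex"
  assumes "a \<le> b" and P: "\<And>t. (P has_real_derivative P1 t) (at t)" "\<And>t. (P1 has_real_derivative P2 t) (at t)"
    and "continuous_on UNIV P2"
    and e: "\<And>t. (e has_vector_derivative e1 t) (at t)" "\<And>t. (e1 has_vector_derivative e2 t) (at t)"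
    and "continuous_on UNIV e2"
  shows "has_bochner_integral lborel
      (\<lambda>t. indicator {a..b} t *\<^sub>R (of_real (P t) * e2 (x - t) - of_real (P2 t) * e (x - t)))
      ((- of_real (P b) * e1 (x - b) - of_real (P1 b) * e (x - b))
        - (- of_real (P a) * e1 (x - a) - of_real (P1 a) * e (x - a)))"
proof (rule has_bochner_integral_FTC_Icc[OF \<open>a \<le> b\<close>])
  fix t
  have refl: "((\<lambda>t. f (x - t)) has_vector_derivative - f' (x - t)) (at t)"
    if "\<And>t. (f has_vector_derivative f' t) (at t)" for f f' :: "real \<Rightarrow> complex"
  proof -
    have "((\<lambda>t. x - t) has_vector_derivative - 1) (at t)"
      by (auto intro!: derivative_eq_intros)
    from vector_diff_chain_at[OF this that] show ?thesis by (simp add: o_def)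
  qed
  have cr: "((\<lambda>t. complex_of_real (f t)) has_vector_derivative of_real (f' t)) (at t)"
    if "\<And>t. (f has_real_derivative f' t) (at t)" for f f' :: "real \<Rightarrow> real"
    using that[of t] by (intro has_vector_derivative_of_real)
      (simp add: has_real_derivative_iff_has_vector_derivative)
  have "((\<lambda>t. - of_real (P t) * e1 (x - t) - of_real (P1 t) * e (x - t)) has_vector_derivative
      of_real (P t) * e2 (x - t) - of_real (P2 t) * e (x - t)) (at t)"
    using has_vector_derivative_diff[OF
        has_vector_derivative_minus[OF has_vector_derivative_mult[OF cr[OF P(1)] refl[OF e(2)]]]
        has_vector_derivative_mult[OF cr[OF P(2)] refl[OF e(1)]]]
    by (simp add: algebra_simps)
  then show "((\<lambda>t. - of_real (P t) * e1 (x - t) - of_real (P1 t) * e (x - t)) has_vector_derivative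
      of_real (P t) * e2 (x - t) - of_real (P2 t) * e (x - t)) (at t within {a..b})"
    by (rule has_vector_derivative_at_within)
next
  have "continuous_on UNIV P" "continuous_on UNIV e"
    using P(1) e(1) by (auto simp: continuous_on_eq_continuous_at
      intro: DERIV_isCont has_vector_derivative_continuous)
  note c = this
  have k: "continuous_on {a..b} (\<lambda>t. f (x - t))" if "continuous_on UNIV f" for f :: "real \<Rightarrow> complex"
    by (rule continuous_on_compose2[OF that]) (auto intro!: continuous_intros)
  show "continuous_on {a..b} (\<lambda>t. complex_of_real (P t) * e2 (x - t) - of_real (P2 t) * e (x - t))"
    by (intro continuous_on_diff continuous_on_mult continuous_on_of_real k assms c
        continuous_on_subset[OF c(1)] continuous_on_subset[OF assms(4)] subset_UNIV)
qed

lemma integrable_tensor_bound: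
  fixes f :: "_ \<Rightarrow> _ \<Rightarrow> complex" and g h :: "_ \<Rightarrow> real"
  assumes "sigma_finite_measure M1" "sigma_finite_measure M2" and g: "integrable M1 g" and h: "integrable M2 h"
    and f: "case_prod f \<in> borel_measurable (M1 \<Otimes>\<^sub>M M2)" and le: "\<And>x y. norm (f x y) \<le> g x * h y"
  shows "integrable (M1 \<Otimes>\<^sub>M M2) (case_prod f)"
  by (rule Bochner_Integration.integrable_bound[OF integrable_tensor[OF assms(1-4)] f])
    (auto intro!: AE_I2 order_trans[OF le abs_ge_self] split: prod.splits)

text \<open>A polynomial cutoff on [-1, 1]. Its triple zeros make value and first derivative vanish
  at the ends, and at 0 it has value 1 and derivative 0, so it leaves the jump of a fundamental
  solution intact. \<open>rho1\<close> and \<open>rho2\<close> are its derivatives.\<close>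

definition rho :: "real \<Rightarrow> real" where "rho x = (1 - x\<^sup>2) ^ 3"
definition rho1 :: "real \<Rightarrow> real" where "rho1 x = - 6 * x * (1 - x\<^sup>2)\<^sup>2"
definition rho2 :: "real \<Rightarrow> real" where "rho2 x = 24 * x\<^sup>2 * (1 - x\<^sup>2) - 6 * (1 - x\<^sup>2)\<^sup>2"

lemma rho_deriv:
  assumes "R > 0"
  shows "((\<lambda>t. rho (t / R)) has_real_derivative rho1 (t / R) / R) (at t)"
    "((\<lambda>t. rho1 (t / R)) has_real_derivative rho2 (t / R) / R) (at t)"
proof -
  have 0: "((\<lambda>t. t / R) has_real_derivative 1 / R) (at t)" using assms by (auto intro!: derivative_eq_intros)
  have 1: "(rho has_real_derivative rho1 x) (at x)" for x
    unfolding rho_def rho1_def by (rule derivative_eq_intros refl)+ simp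
  have 2: "(rho1 has_real_derivative rho2 x) (at x)" for x
    unfolding rho1_def rho2_def by (rule derivative_eq_intros refl)+ (simp add: power2_eq_square algebra_simps)
  show "((\<lambda>t. rho (t / R)) has_real_derivative rho1 (t / R) / R) (at t)"
    "((\<lambda>t. rho1 (t / R)) has_real_derivative rho2 (t / R) / R) (at t)"
    using DERIV_chain2[OF 1 0] DERIV_chain2[OF 2 0] by simp_all
qed

lemma rho_bounds:
  assumes "\<bar>x\<bar> \<le> 1"
  shows "\<bar>rho x\<bar> \<le> 1" "\<bar>rho1 x\<bar> \<le> 6" "\<bar>rho2 x\<bar> \<le> 30"
proof -
  have x: "0 \<le> x\<^sup>2" "x\<^sup>2 \<le> 1" using assms by (auto simp: abs_square_le_1)
  have y: "0 \<le> 1 - x\<^sup>2" "1 - x\<^sup>2 \<le> 1" using x by auto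
  have y2: "0 \<le> (1 - x\<^sup>2)\<^sup>2" "(1 - x\<^sup>2)\<^sup>2 \<le> 1" using y by (auto intro: power_le_one)
  show "\<bar>rho x\<bar> \<le> 1" using y by (auto simp: rho_def power_abs intro: power_le_one)
  have "\<bar>x\<bar> * (1 - x\<^sup>2)\<^sup>2 \<le> 1 * 1" using assms y2 by (intro mult_mono) auto
  then show "\<bar>rho1 x\<bar> \<le> 6" using y2 by (simp add: rho1_def abs_mult)
  have "x\<^sup>2 * (1 - x\<^sup>2) \<le> 1 * 1" "0 \<le> x\<^sup>2 * (1 - x\<^sup>2)" using x y using mult_mono[of "x\<^sup>2" 1 "1 - x\<^sup>2" 1] by auto
  then have "\<bar>24 * (x\<^sup>2 * (1 - x\<^sup>2)) - 6 * (1 - x\<^sup>2)\<^sup>2\<bar> \<le> 30" using y2 by (intro abs_leI) linarith+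
  then show "\<bar>rho2 x\<bar> \<le> 30" by (simp add: rho2_def mult.assoc)
qed

text \<open>Gluing \<open>A\<close> on the left to \<open>B\<close> on the right of \<open>0\<close> gives a solution of \<open>-G'' + qG = \<delta>\<^sub>0\<close>.\<close>

locale fundamental_solution =
  fixes A A1 B B1 :: "real \<Rightarrow> real" and q C :: real
  assumes A: "\<And>t. (A has_real_derivative A1 t) (at t)" "\<And>t. (A1 has_real_derivative q * A t) (at t)"
    and B: "\<And>t. (B has_real_derivative B1 t) (at t)" "\<And>t. (B1 has_real_derivative q * B t) (at t)"
    and A_bound: "\<And>t. t \<le> 0 \<Longrightarrow> \<bar>A t\<bar> \<le> C * (1 + \<bar>t\<bar>)" "\<And>t. t \<le> 0 \<Longrightarrow> \<bar>A1 t\<bar> \<le> C"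
    and B_bound: "\<And>t. t \<ge> 0 \<Longrightarrow> \<bar>B t\<bar> \<le> C * (1 + \<bar>t\<bar>)" "\<And>t. t \<ge> 0 \<Longrightarrow> \<bar>B1 t\<bar> \<le> C"
    and jump: "A 0 = B 0" "A1 0 = B1 0 + 1"
begin

definition G :: "real \<Rightarrow> real" where "G t = (if t < 0 then A t else B t)"
definition G1 :: "real \<Rightarrow> real" where "G1 t = (if t < 0 then A1 t else B1 t)"

definition chi :: "real \<Rightarrow> real \<Rightarrow> real" where
  "chi R t = (if \<bar>t\<bar> \<le> R then G t * rho (t / R) else 0)"
text \<open>Up to sign, the commutator 2 G' rho' + G rho'' of the second derivative with the scaled
  cutoff: what remains besides the point mass when the operator acts on
  \<open>chi R\<close>.\<close>

definition err :: "real \<Rightarrow> real \<Rightarrow> real" where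
  "err R t = (if \<bar>t\<bar> \<le> R then 2 * G1 t * (rho1 (t / R) / R) + G t * (rho2 (t / R) / R\<^sup>2) else 0)"

lemma C_nonneg: "C \<ge> 0" using B_bound(2)[of 0] by auto

lemma cont: "continuous_on UNIV A" "continuous_on UNIV A1" "continuous_on UNIV B" "continuous_on UNIV B1"
  by (auto simp: continuous_on_eq_continuous_at intro: DERIV_isCont A B)

lemma measurable_G [measurable]: "G \<in> borel_measurable borel" "G1 \<in> borel_measurable borel"
  unfolding G_def G1_def using cont[THEN borel_measurable_continuous_onI] by measurable

lemma measurable_chi [measurable]: "chi R \<in> borel_measurable borel" "err R \<in> borel_measurable borel"
  unfolding chi_def err_def rho_def rho1_def rho2_def by measurable

lemma G_bound: "\<bar>G t\<bar> \<le> C * (1 + \<bar>t\<bar>)" "\<bar>G1 t\<bar> \<le> C"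
  using A_bound B_bound by (auto simp: G_def G1_def)

lemma chi_bound: "\<bar>chi R t\<bar> \<le> C * (1 + \<bar>t\<bar>)"
proof (cases "\<bar>t\<bar> \<le> R")
  case True
  then have "\<bar>rho (t / R)\<bar> \<le> 1" by (intro rho_bounds) (auto simp: field_simps abs_mult divide_le_eq_1)
  then have "\<bar>G t\<bar> * \<bar>rho (t / R)\<bar> \<le> C * (1 + \<bar>t\<bar>) * 1"
    using G_bound(1)[of t] by (intro mult_mono) auto
  then show ?thesis using True by (simp add: chi_def abs_mult)
qed (use C_nonneg in \<open>auto simp: chi_def\<close>)

text \<open>The two terms are at most 12 C / R and 60 C / R. In the second, |G| <= 2 C R on the
  window because R >= 1, which cancels one of the two powers of R in the denominator.\<close>

lemma err_bound:
  assumes "R \<ge> 1" shows "\<bar>err R t\<bar> \<le> 72 * C / R"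
proof (cases "\<bar>t\<bar> \<le> R")
  case True
  then have "\<bar>t / R\<bar> \<le> 1" using assms by (auto simp: field_simps)
  note b = rho_bounds[OF this]
  have 1: "\<bar>2 * G1 t * (rho1 (t / R) / R)\<bar> \<le> 2 * C * (6 / R)"
    unfolding abs_mult using assms b(2) G_bound(2)[of t] C_nonneg
    by (intro mult_mono) (auto simp: divide_right_mono)
  have "\<bar>G t\<bar> \<le> C * (2 * R)"
    by (rule order_trans[OF G_bound(1)], intro mult_left_mono) (use assms True C_nonneg in auto)
  then have 2: "\<bar>G t * (rho2 (t / R) / R\<^sup>2)\<bar> \<le> C * (2 * R) * (30 / R\<^sup>2)"
    unfolding abs_mult using assms b(3) C_nonneg
    by (intro mult_mono) (auto simp: divide_right_mono)
  have "C * (2 * R) * (30 / R\<^sup>2) = 60 * C / R" using assms by (simp add: power2_eq_square field_simps)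
  with 1 2 have "\<bar>2 * G1 t * (rho1 (t / R) / R) + G t * (rho2 (t / R) / R\<^sup>2)\<bar> \<le> 12 * C / R + 60 * C / R"
    by (intro order_trans[OF abs_triangle_ineq] add_mono) auto
  then show ?thesis using True by (simp add: err_def add_divide_distrib[symmetric] algebra_simps)
qed (use C_nonneg assms in \<open>auto simp: err_def\<close>)

context
  fixes e e1 e2 :: "real \<Rightarrow> complex" and L M :: real
  assumes e: "\<And>t. (e has_vector_derivative e1 t) (at t)" "\<And>t. (e1 has_vector_derivative e2 t) (at t)"
    and e2_cont: "continuous_on UNIV e2"
    and supp: "\<And>t. \<bar>t\<bar> > L \<Longrightarrow> e t = 0 \<and> e2 t = 0"
    and e_bound: "\<And>t. norm (e t) \<le> M" "\<And>t. norm (e2 t) \<le> M"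
    and L: "L \<ge> 0"
begin

lemma M_nonneg: "M \<ge> 0" using e_bound(1)[of 0] norm_ge_zero[of "e 0"] by linarith

lemma measurable_e [measurable]: "e \<in> borel_measurable borel" "e2 \<in> borel_measurable borel"
proof -
  have "continuous_on UNIV e"
    using e(1) by (auto simp: continuous_on_eq_continuous_at intro: has_vector_derivative_continuous)
  then show "e \<in> borel_measurable borel" "e2 \<in> borel_measurable borel"
    using e2_cont by (auto intro: borel_measurable_continuous_onI)
qed

text \<open>Integration by parts on [-R, 0] with \<open>A\<close> and on [0, R] with
  \<open>B\<close>. The truncation makes \<open>chi R\<close> compactly supported, so that weak
  equations can be integrated against it.\<close>

lemma conv_err:
  assumes "R \<ge> 1"
  shows "(\<integral>t. of_real (chi R t) * (of_real q * e (x - t) - e2 (x - t)) \<partial>lborel)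
    = e x - (\<integral>t. of_real (err R t) * e (x - t) \<partial>lborel)"
proof -
  have R: "R > 0" using assms by simp
  have half: "has_bochner_integral lborel
      (\<lambda>t. indicator {a..b} t *\<^sub>R (of_real (F t * rho (t / R)) * e2 (x - t)
        - of_real (q * F t * rho (t / R) + (2 * F1 t * (rho1 (t / R) / R) + F t * (rho2 (t / R) / R\<^sup>2))) * e (x - t)))
      ((- of_real (F b * rho (b / R)) * e1 (x - b)
         - of_real (F1 b * rho (b / R) + F b * (rho1 (b / R) / R)) * e (x - b))
        - (- of_real (F a * rho (a / R)) * e1 (x - a)
         - of_real (F1 a * rho (a / R) + F a * (rho1 (a / R) / R)) * e (x - a)))"
    if "a \<le> b" and F: "\<And>t. (F has_real_derivative F1 t) (at t)"
      "\<And>t. (F1 has_real_derivative q * F t) (at t)" for a b and F F1 :: "real \<Rightarrow> real"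
  proof (rule ibp_twice[OF \<open>a \<le> b\<close> _ _ _ e e2_cont])
    show "((\<lambda>t. F t * rho (t / R)) has_real_derivative F1 t * rho (t / R) + F t * (rho1 (t / R) / R)) (at t)" for t
      by (rule derivative_eq_intros F rho_deriv[OF R] refl)+ simp
    show "((\<lambda>t. F1 t * rho (t / R) + F t * (rho1 (t / R) / R)) has_real_derivative
       q * F t * rho (t / R) + (2 * F1 t * (rho1 (t / R) / R) + F t * (rho2 (t / R) / R\<^sup>2))) (at t)" for t
      by (rule derivative_eq_intros F rho_deriv[OF R] refl DERIV_cdivide)+ (use R in \<open>simp add: field_simps power2_eq_square\<close>)
    have "continuous_on UNIV F" "continuous_on UNIV F1"
      using F by (auto simp: continuous_on_eq_continuous_at intro: DERIV_isCont)
    then show "continuous_on UNIV (\<lambda>t. q * F t * rho (t / R) + (2 * F1 t * (rho1 (t / R) / R) + F t * (rho2 (t / R) / R\<^sup>2)))"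
      unfolding rho_def rho1_def rho2_def using R by (intro continuous_intros) auto
  qed
  have r0: "rho 0 = 1" "rho1 0 = 0" "rho 1 = 0" "rho1 1 = 0" "rho (-1) = 0" "rho1 (-1) = 0"
    by (auto simp: rho_def rho1_def)
  note h = has_bochner_integral_add[OF half[of "-R" 0, OF _ A] half[of 0 R, OF _ B]]
  let ?f = "\<lambda>t. of_real (chi R t) * (of_real q * e (x - t) - e2 (x - t))"
  let ?g = "\<lambda>t. of_real (err R t) * e (x - t)"
  define k where "k t = indicator {- R..0} t *\<^sub>R (of_real (A t * rho (t / R)) * e2 (x - t)
        - of_real (q * A t * rho (t / R) + (2 * A1 t * (rho1 (t / R) / R) + A t * (rho2 (t / R) / R\<^sup>2))) * e (x - t))
      + indicator {0..R} t *\<^sub>R (of_real (B t * rho (t / R)) * e2 (x - t)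
        - of_real (q * B t * rho (t / R) + (2 * B1 t * (rho1 (t / R) / R) + B t * (rho2 (t / R) / R\<^sup>2))) * e (x - t))" for t
  have "has_bochner_integral lborel k
      (((- of_real (A 0 * rho (0 / R)) * e1 (x - 0)
         - of_real (A1 0 * rho (0 / R) + A 0 * (rho1 (0 / R) / R)) * e (x - 0))
        - (- of_real (A (-R) * rho (-R / R)) * e1 (x - (-R))
         - of_real (A1 (-R) * rho (-R / R) + A (-R) * (rho1 (-R / R) / R)) * e (x - (-R))))
      + ((- of_real (B R * rho (R / R)) * e1 (x - R)
         - of_real (B1 R * rho (R / R) + B R * (rho1 (R / R) / R)) * e (x - R))
        - (- of_real (B 0 * rho (0 / R)) * e1 (x - 0)
         - of_real (B1 0 * rho (0 / R) + B 0 * (rho1 (0 / R) / R)) * e (x - 0))))"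
    unfolding k_def using R by (intro has_bochner_integral_add half A B) auto
  \<comment> \<open>At both ends of the window \<open>rho\<close> and \<open>rho1\<close> vanish; at
    0 the values of the two halves cancel and the jump of the first derivative leaves -e x.\<close>
  then have k: "has_bochner_integral lborel k (- e x)"
    using R r0 jump by (simp add: algebra_simps)
  have "has_bochner_integral lborel (\<lambda>t. - (?f t + ?g t)) (- e x)"
  proof (rule has_bochner_integral_cong_AE[THEN iffD1, OF _ _ _ k])
    show "AE t in lborel. k t = - (?f t + ?g t)"
      using AE_lborel_singleton[of 0]
    proof eventually_elim
      case (elim t)
      then show ?case using R
        by (cases "t < 0"; cases "\<bar>t\<bar> \<le> R")
          (auto simp: k_def chi_def err_def G_def G1_def indicator_def algebra_simps abs_if split: if_splits)
    qed
  qed (use borel_measurable_has_bochner_integral[OF k] in auto)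
  then have "has_bochner_integral lborel (\<lambda>t. ?f t + ?g t) (e x)"
    using has_bochner_integral_minus[of lborel "\<lambda>t. - (?f t + ?g t)" "- e x"] by (simp add: add.commute)
  moreover have "integrable lborel ?g"
  proof (rule window_integral(1)[where a = "-R" and b = R and K = "72 * C / R * M"])
    show "norm (?g t) \<le> 72 * C / R * M" for t
      unfolding norm_mult using err_bound[OF assms, of t] e_bound(1)[of "x - t"] C_nonneg R
      by (intro mult_mono) auto
    show "?g t = 0" if "t \<notin> {-R..R}" for t using that by (auto simp: err_def)
  qed (use R in auto)
  ultimately show ?thesis
    using has_bochner_integral_integral_eq[OF has_bochner_integral_diff[of lborel "\<lambda>t. ?f t + ?g t" "e x" ?g,
          OF _ has_bochner_integral_integrable]]
    by simp
qed

text \<open>Only the window |x - t| <= L contributes, on which 1 + |t| is at most (1 + L)(1 +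
  |x|).\<close>

lemma conv_bound:
  assumes [measurable]: "h \<in> borel_measurable borel" and h: "\<And>t. \<bar>h t\<bar> \<le> C * (1 + \<bar>t\<bar>)"
  shows "integrable lborel (\<lambda>t. of_real (h t) * e (x - t))"
    "norm (\<integral>t. of_real (h t) * e (x - t) \<partial>lborel) \<le> 2 * L * (C * (1 + L) * M) * (1 + \<bar>x\<bar>)"
proof -
  have *: "norm (of_real (h t) * e (x - t)) \<le> C * (1 + (\<bar>x\<bar> + L)) * M" for t
  proof (cases "\<bar>x - t\<bar> > L")
    case True
    then show ?thesis using supp[OF True] C_nonneg L M_nonneg by simp
  next
    case False
    then have "C * (1 + \<bar>t\<bar>) \<le> C * (1 + (\<bar>x\<bar> + L))" using C_nonneg by (intro mult_left_mono) auto
    then show ?thesis unfolding norm_mult using h[of t] e_bound(1)[of "x - t"] C_nonneg L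
      by (intro mult_mono) auto
  qed
  have z: "of_real (h t) * e (x - t) = 0" if "t \<notin> {x - L..x + L}" for t
  proof -
    have "\<bar>x - t\<bar> > L" using that by auto
    from supp[OF this] show ?thesis by simp
  qed
  show "integrable lborel (\<lambda>t. of_real (h t) * e (x - t))"
    by (rule window_integral(1)[OF _ _ * z]) (use L in auto)
  have "norm (\<integral>t. of_real (h t) * e (x - t) \<partial>lborel) \<le> (x + L - (x - L)) * (C * (1 + (\<bar>x\<bar> + L)) * M)"
    by (rule window_integral(2)[OF _ _ * z]) (use L in auto)
  also have "\<dots> \<le> 2 * L * (C * ((1 + L) * (1 + \<bar>x\<bar>)) * M)"
    using L C_nonneg M_nonneg
    by (auto intro!: mult_mono mult_left_mono mult_right_mono simp: algebra_simps)
  finally show "norm (\<integral>t. of_real (h t) * e (x - t) \<partial>lborel) \<le> 2 * L * (C * (1 + L) * M) * (1 + \<bar>x\<bar>)"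
    by (simp only: mult_ac)
qed

lemma conv_tendsto:
  "(\<lambda>n. \<integral>t. of_real (chi (real (Suc n)) t) * e (x - t) \<partial>lborel) \<longlonglongrightarrow> (\<integral>t. of_real (G t) * e (x - t) \<partial>lborel)"
proof (rule integral_dominated_convergence)
  show "integrable lborel (\<lambda>t. norm (of_real (C * (1 + \<bar>t\<bar>)) * e (x - t)))"
    by (intro integrable_norm conv_bound) (use C_nonneg in auto)
  show "AE t in lborel. norm (of_real (chi (real (Suc n)) t) * e (x - t))
      \<le> norm (of_real (C * (1 + \<bar>t\<bar>)) * e (x - t))" for n
    unfolding norm_mult using chi_bound C_nonneg
    by (intro AE_I2 mult_right_mono) (auto simp: abs_mult simp del: of_real_mult of_real_add)
  show "AE t in lborel. (\<lambda>n. of_real (chi (real (Suc n)) t) * e (x - t)) \<longlonglongrightarrow> of_real (G t) * e (x - t)"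
  proof (intro AE_I2 tendsto_intros)
    fix t
    have "(\<lambda>n. G t * rho (t * inverse (real (Suc n)))) \<longlonglongrightarrow> G t * (1 - (t * 0)\<^sup>2) ^ 3"
      unfolding rho_def by (intro tendsto_intros LIMSEQ_inverse_real_of_nat)
    moreover have "eventually (\<lambda>n. G t * rho (t * inverse (real (Suc n))) = chi (real (Suc n)) t) sequentially"
      using eventually_ge_at_top[of "nat \<lceil>\<bar>t\<bar>\<rceil>"]
      by eventually_elim (auto simp: chi_def divide_inverse nat_le_iff ceiling_le_iff)
    ultimately show "(\<lambda>n. chi (real (Suc n)) t) \<longlonglongrightarrow> G t"
      by (auto intro: Lim_transform_eventually)
  qed
qed measurable

text \<open>The weak equation for the translates of \<open>e\<close> is integrated against
  \<open>chi R\<close> and the integrals are exchanged. The left side becomes \<open>U\<close>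
  paired with e minus an error of size O(1/R) supported in |X| <= R + L. There the L^1 norm of
  \<open>U\<close> is only O(sqrt R), because \<open>U\<close> is square integrable and the volume
  grows linearly, so the error disappears; this is where homogeneous solutions are excluded. The
  right side converges by domination, the weight 1 + |X| absorbing the growth of
  \<open>G\<close>.\<close>

lemma representation:
  fixes N :: "'z measure" and X :: "'z \<Rightarrow> real" and U H :: "'z \<Rightarrow> complex"
  assumes sf: "sigma_finite_measure N"
    and [measurable]: "X \<in> borel_measurable N" "U \<in> borel_measurable N" "H \<in> borel_measurable N"
    and vol: "\<And>r. r \<ge> 0 \<Longrightarrow> emeasure N {z \<in> space N. \<bar>X z\<bar> \<le> r} \<le> ennreal (2 * r)"
    and U2: "integrable N (\<lambda>z. (cmod (U z))\<^sup>2)"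
    and Hint: "integrable N (\<lambda>z. (1 + \<bar>X z\<bar>) * cmod (H z))"
    and weak: "\<And>t. (\<integral>z. U z * (of_real q * e (X z - t) - e2 (X z - t)) \<partial>N) = (\<integral>z. H z * e (X z - t) \<partial>N)"
  shows "(\<integral>z. U z * e (X z) \<partial>N) = (\<integral>z. H z * (\<integral>t. of_real (G t) * e (X z - t) \<partial>lborel) \<partial>N)"
proof -
  interpret N: sigma_finite_measure N by fact
  interpret P: pair_sigma_finite N lborel ..
  define S where "S = (\<integral>z. (cmod (U z))\<^sup>2 \<partial>N)"
  have Sn: "S \<ge> 0" by (simp add: S_def)
  define I where "I r z = (indicator {z. \<bar>X z\<bar> \<le> r} z :: real)" for r z
  have [measurable]: "I r \<in> borel_measurable N" for r unfolding I_def by measurable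
  have I_int: "integrable N (I r)" "(\<integral>z. I r z \<partial>N) \<le> 2 * r" if "r \<ge> 0" for r
  proof -
    have eq: "emeasure N ({z. \<bar>X z\<bar> \<le> r} \<inter> space N) \<le> ennreal (2 * r)"
      using vol[OF that] by (simp add: Int_def conj_commute)
    have m: "{z. \<bar>X z\<bar> \<le> r} \<inter> space N \<in> sets N" by measurable
    have "integrable N (indicator ({z. \<bar>X z\<bar> \<le> r} \<inter> space N) :: _ \<Rightarrow> real)"
      using eq m by (intro integrable_real_indicator) (auto simp: le_less_trans)
    then show "integrable N (I r)"
      by (rule Bochner_Integration.integrable_cong[THEN iffD1, rotated 2]) (auto simp: I_def indicator_def)
    have "(\<integral>z. I r z \<partial>N) = measure N ({z. \<bar>X z\<bar> \<le> r} \<inter> space N)"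
      unfolding I_def by (subst Bochner_Integration.integral_indicator) (auto simp: m)
    also have "\<dots> \<le> 2 * r" using eq that by (simp add: measure_def enn2real_leI)
    finally show "(\<integral>z. I r z \<partial>N) \<le> 2 * r" .
  qed
  \<comment> \<open>A Cauchy-Schwarz estimate with a free parameter: t = 1 serves for mere
    integrability, while t = sqrt R with r = R + L balances both terms at order sqrt R.\<close>
  have U_loc: "integrable N (\<lambda>z. I r z * cmod (U z))"
    "(\<integral>z. I r z * cmod (U z) \<partial>N) \<le> (t * S + 2 * r / t) / 2" if "r \<ge> 0" "t > 0" for r t
  proof -
    have le: "I r z * cmod (U z) \<le> (t * (cmod (U z))\<^sup>2 + I r z / t) / 2" for z
    proof -
      have "0 \<le> (t * cmod (U z) - 1)\<^sup>2" by simp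
      then have "2 * cmod (U z) \<le> t * (cmod (U z))\<^sup>2 + 1 / t"
        using that by (simp add: field_simps power2_eq_square)
      then show ?thesis using that by (auto simp: I_def indicator_def)
    qed
    have i: "integrable N (\<lambda>z. (t * (cmod (U z))\<^sup>2 + I r z / t) / 2)"
      using U2 I_int that by auto
    show j: "integrable N (\<lambda>z. I r z * cmod (U z))"
      by (rule Bochner_Integration.integrable_bound[OF i])
        (use le that in \<open>auto simp: I_def indicator_def\<close>)
    have "(\<integral>z. I r z * cmod (U z) \<partial>N) \<le> (\<integral>z. (t * (cmod (U z))\<^sup>2 + I r z / t) / 2 \<partial>N)"
      by (intro integral_mono i j le)
    also have "\<dots> = (t * S + (\<integral>z. I r z \<partial>N) / t) / 2" using U2 I_int[OF \<open>r \<ge> 0\<close>] by (simp add: S_def)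
    also have "\<dots> \<le> (t * S + 2 * r / t) / 2" using I_int[OF \<open>r \<ge> 0\<close>] that by (auto intro!: divide_right_mono)
    finally show "(\<integral>z. I r z * cmod (U z) \<partial>N) \<le> (t * S + 2 * r / t) / 2" .
  qed
  have H1: "integrable N (\<lambda>z. cmod (H z))"
    by (rule Bochner_Integration.integrable_bound[OF Hint]) (auto simp: abs_mult mult_le_cancel_right1)
  define W where "W R z = (\<integral>t. of_real (err R t) * e (X z - t) \<partial>lborel)" for R z
  define V where "V R z = (\<integral>t. of_real (chi R t) * e (X z - t) \<partial>lborel)" for R z
  have [measurable]: "W R \<in> borel_measurable N" "V R \<in> borel_measurable N" for R
    unfolding W_def V_def by measurable
  have chi_zero: "\<bar>t\<bar> > R \<Longrightarrow> chi R t = 0" for R t by (simp add: chi_def)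
  have chi_le: "\<bar>chi R t\<bar> \<le> C * (1 + R)" if "R \<ge> 0" for R t
    using chi_bound[of R t] C_nonneg that chi_zero[of R t] mult_left_mono[of "1 + \<bar>t\<bar>" "1 + R" C]
    by (cases "\<bar>t\<bar> \<le> R") auto
  have key: "(\<integral>z. U z * (e (X z) - W R z) \<partial>N) = (\<integral>z. H z * V R z \<partial>N)" if R: "R \<ge> 1" for R
  proof -
    let ?k = "\<lambda>x t. of_real (chi R t) * (of_real q * e (x - t) - e2 (x - t))"
    have "integrable (N \<Otimes>\<^sub>M lborel) (\<lambda>(z, t). U z * ?k (X z) t)"
    proof (rule integrable_tensor_bound[OF sf lborel.sigma_finite_measure_axioms])
      show "integrable N (\<lambda>z. I (R + L) z * cmod (U z))" using R L by (intro U_loc[where t = 1]) auto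
      show "integrable lborel (\<lambda>t. indicator {-R..R} t * (C * (1 + R) * (\<bar>q\<bar> * M + M)))"
        using R by (auto intro!: integrable_real_indicator)
      show "norm (U z * ?k (X z) t) \<le>
        I (R + L) z * cmod (U z) * (indicator {-R..R} t * (C * (1 + R) * (\<bar>q\<bar> * M + M)))" for z t
      proof (cases "\<bar>t\<bar> \<le> R")
        case t: True
        show ?thesis
        proof (cases "\<bar>X z\<bar> \<le> R + L")
          case True
          have "cmod (complex_of_real q * e (X z - t) - e2 (X z - t)) \<le> \<bar>q\<bar> * M + M"
            by (rule order_trans[OF norm_triangle_ineq4], unfold norm_mult)
              (use e_bound in \<open>auto intro!: add_mono mult_left_mono\<close>)
          then have "\<bar>chi R t\<bar> * cmod (complex_of_real q * e (X z - t) - e2 (X z - t)) \<le> C * (1 + R) * (\<bar>q\<bar> * M + M)"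
            using chi_le[of R t] R C_nonneg by (intro mult_mono) auto
          then have "cmod (U z) * (\<bar>chi R t\<bar> * cmod (complex_of_real q * e (X z - t) - e2 (X z - t)))
            \<le> cmod (U z) * (C * (1 + R) * (\<bar>q\<bar> * M + M))" by (intro mult_left_mono) auto
          also have "\<dots> = I (R + L) z * cmod (U z) * (indicator {-R..R} t * (C * (1 + R) * (\<bar>q\<bar> * M + M)))"
            using True t by (auto simp: I_def indicator_def abs_le_iff)
          finally show ?thesis by (simp add: norm_mult)
        next
          case False
          with t have "\<bar>X z - t\<bar> > L" by linarith
          from supp[OF this] show ?thesis by (simp add: I_def False)
        qed
      qed (auto simp: chi_zero indicator_def)
    qed measurable
    note F1 = P.Fubini_integral[OF this]
    have "integrable (N \<Otimes>\<^sub>M lborel) (\<lambda>(z, t). H z * (of_real (chi R t) * e (X z - t)))"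
    proof (rule integrable_tensor_bound[OF sf lborel.sigma_finite_measure_axioms H1])
      show "integrable lborel (\<lambda>t. indicator {-R..R} t * (C * (1 + R) * M))"
        using R by (auto intro!: integrable_real_indicator)
      show "norm (H z * (of_real (chi R t) * e (X z - t))) \<le> cmod (H z) * (indicator {-R..R} t * (C * (1 + R) * M))" for z t
      proof -
        have "\<bar>chi R t\<bar> * cmod (e (X z - t)) \<le> indicator {-R..R} t * (C * (1 + R) * M)"
        proof (cases "\<bar>t\<bar> \<le> R")
          case True
          then have "indicator {-R..R} t = (1::real)" by (auto simp: indicator_def)
          then show ?thesis using chi_le[of R t] R C_nonneg e_bound(1)[of "X z - t"]
            by (simp, intro mult_mono) auto
        qed (auto simp: chi_zero indicator_def)
        then show ?thesis unfolding norm_mult by (intro mult_left_mono) auto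
      qed
    qed measurable
    note F2 = P.Fubini_integral[OF this]
    have "(\<integral>z. U z * (e (X z) - W R z) \<partial>N) = (\<integral>z. (\<integral>t. U z * ?k (X z) t \<partial>lborel) \<partial>N)"
      unfolding W_def using conv_err[OF R] by simp
    also have "\<dots> = (\<integral>t. (\<integral>z. U z * ?k (X z) t \<partial>N) \<partial>lborel)" using F1 by simp
    also have "\<dots> = (\<integral>t. of_real (chi R t) * (\<integral>z. U z * (of_real q * e (X z - t) - e2 (X z - t)) \<partial>N) \<partial>lborel)"
      by (simp only: mult.left_commute[of "U _"] integral_mult_right_zero)
    also have "\<dots> = (\<integral>t. (\<integral>z. H z * (of_real (chi R t) * e (X z - t)) \<partial>N) \<partial>lborel)"
      by (simp only: weak mult.left_commute[of "H _"] integral_mult_right_zero)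
    also have "\<dots> = (\<integral>z. H z * V R z \<partial>N)" unfolding V_def F2 by simp
    finally show ?thesis .
  qed
  let ?R = "\<lambda>n. real (Suc n)"
  have lim1: "(\<lambda>n. \<integral>z. H z * V (?R n) z \<partial>N) \<longlonglongrightarrow> (\<integral>z. H z * (\<integral>t. of_real (G t) * e (X z - t) \<partial>lborel) \<partial>N)"
  proof (rule integral_dominated_convergence)
    show "integrable N (\<lambda>z. 2 * L * (C * (1 + L) * M) * ((1 + \<bar>X z\<bar>) * cmod (H z)))"
      using Hint by simp
    show "AE z in N. norm (H z * V (?R n) z) \<le> 2 * L * (C * (1 + L) * M) * ((1 + \<bar>X z\<bar>) * cmod (H z))" for n
    proof (intro AE_I2)
      fix z
      have "cmod (H z) * norm (V (?R n) z) \<le> cmod (H z) * (2 * L * (C * (1 + L) * M) * (1 + \<bar>X z\<bar>))"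
        unfolding V_def by (intro mult_left_mono conv_bound chi_bound) auto
      then show "norm (H z * V (?R n) z) \<le> 2 * L * (C * (1 + L) * M) * ((1 + \<bar>X z\<bar>) * cmod (H z))"
        by (simp add: norm_mult mult_ac)
    qed
    show "AE z in N. (\<lambda>n. H z * V (?R n) z) \<longlonglongrightarrow> H z * (\<integral>t. of_real (G t) * e (X z - t) \<partial>lborel)"
      unfolding V_def by (intro AE_I2 tendsto_intros conv_tendsto)
  qed measurable
  have W_zero: "W R z = 0" if "\<bar>X z\<bar> > R + L" for R z
  proof -
    have "complex_of_real (err R t) * e (X z - t) = 0" for t
    proof (cases "\<bar>t\<bar> \<le> R")
      case True
      with that have "\<bar>X z - t\<bar> > L" by linarith
      from supp[OF this] show ?thesis by simp
    qed (simp add: err_def)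
    then show ?thesis unfolding W_def by (simp only: integral_zero)
  qed
  have W_le: "norm (W R z) \<le> 2 * L * (72 * C * M) / R * I (R + L) z" if R: "R \<ge> 1" for R z
  proof (cases "\<bar>X z\<bar> > R + L")
    case True then show ?thesis by (simp add: W_zero I_def)
  next
    case False
    have "norm (W R z) \<le> (X z + L - (X z - L)) * (72 * C / R * M)"
      unfolding W_def
    proof (rule window_integral(2)[where a = "X z - L" and b = "X z + L"])
      show "norm (of_real (err R t) * e (X z - t)) \<le> 72 * C / R * M" for t
        unfolding norm_mult using err_bound[OF R, of t] e_bound(1)[of "X z - t"] C_nonneg R
        by (intro mult_mono) auto
      show "of_real (err R t) * e (X z - t) = 0" if "t \<notin> {X z - L..X z + L}" for t
      proof -
        have "\<bar>X z - t\<bar> > L" using that by auto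
        from supp[OF this] show ?thesis by simp
      qed
    qed (use L in auto)
    then show ?thesis using False by (simp add: I_def)
  qed
  define K where "K = 2 * L * (72 * C * M)"
  have K: "K \<ge> 0" using L C_nonneg M_nonneg by (simp add: K_def)
  have UW: "integrable N (\<lambda>z. U z * W R z)"
    "norm (\<integral>z. U z * W R z \<partial>N) \<le> K * (S + 2 * (1 + L)) / sqrt R" if R: "R \<ge> 1" for R
  proof -
    have b: "norm (U z * W R z) \<le> K / R * (I (R + L) z * cmod (U z))" for z
      using mult_left_mono[OF W_le[OF R, of z], of "cmod (U z)"] by (simp add: norm_mult K_def mult_ac)
    have RL: "R + L \<ge> 0" "sqrt R > 0" using R L by auto
    note u = U_loc[OF RL]
    show i: "integrable N (\<lambda>z. U z * W R z)"
    proof (rule Bochner_Integration.integrable_bound[OF integrable_mult_right[OF u(1), of "K / R"]])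
      show "AE z in N. norm (U z * W R z) \<le> norm (K / R * (I (R + L) z * cmod (U z)))"
        unfolding real_norm_def by (intro AE_I2 order_trans[OF b abs_ge_self])
    qed measurable
    have "norm (\<integral>z. U z * W R z \<partial>N) \<le> (\<integral>z. norm (U z * W R z) \<partial>N)" by simp
    also have "\<dots> \<le> (\<integral>z. K / R * (I (R + L) z * cmod (U z)) \<partial>N)"
      by (intro integral_mono b integrable_norm i integrable_mult_right u)
    also have "\<dots> = K / R * (\<integral>z. (I (R + L) z * cmod (U z)) \<partial>N)" by simp
    also have "\<dots> \<le> K / R * ((sqrt R * S + 2 * (R + L) / sqrt R) / 2)"
      using u(2) K R by (intro mult_left_mono) auto
    also have "\<dots> \<le> K / R * (sqrt R * S + 2 * (R * (1 + L)) / sqrt R)"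
    proof (intro mult_left_mono)
      have "0 \<le> sqrt R * S" using R Sn by simp
      moreover have "2 * (R + L) / sqrt R \<le> 2 * (R * (1 + L)) / sqrt R"
        using R L mult_left_mono[of 1 R L] by (intro divide_right_mono) (auto simp: algebra_simps)
      moreover have "0 \<le> 2 * (R + L) / sqrt R" using R L by simp
      moreover have "(a + b) / 2 \<le> a + c" if "0 \<le> a" "b \<le> c" "0 \<le> b" for a b c :: real
        using that by simp
      ultimately show "(sqrt R * S + 2 * (R + L) / sqrt R) / 2 \<le> sqrt R * S + 2 * (R * (1 + L)) / sqrt R"
        by blast
    qed (use K R in auto)
    also have "\<dots> = K * (S + 2 * (1 + L)) / sqrt R"
    proof -
      have "1 / R = 1 / sqrt R * (1 / sqrt R)" using R by (simp add: real_sqrt_mult_self field_simps)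
      have "R = sqrt R * sqrt R" using R by simp
      then obtain r where r: "R = r * r" "sqrt R = r" by metis
      have "r > 0" using r R RL by auto
      then show ?thesis unfolding r by (simp add: field_simps)
    qed
    finally show "norm (\<integral>z. U z * W R z \<partial>N) \<le> K * (S + 2 * (1 + L)) / sqrt R" .
  qed
  have Ue: "integrable N (\<lambda>z. U z * e (X z))"
  proof (rule Bochner_Integration.integrable_bound[OF integrable_mult_right[OF U_loc(1)[OF L zero_less_one], of M]])
    show "AE z in N. norm (U z * e (X z)) \<le> norm (M * (I L z * cmod (U z)))"
    proof (intro AE_I2)
      fix z
      show "norm (U z * e (X z)) \<le> norm (M * (I L z * cmod (U z)))"
        using e_bound(1)[of "X z"] M_nonneg supp[of "X z"]
        by (cases "\<bar>X z\<bar> \<le> L") (auto simp: I_def norm_mult abs_mult mult.commute[of M] intro!: mult_left_mono)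
    qed
  qed measurable
  have "(\<lambda>n. K * (S + 2 * (1 + L)) * inverse (sqrt (?R n))) \<longlonglongrightarrow> K * (S + 2 * (1 + L)) * 0"
    by (intro tendsto_intros tendsto_inverse_0_at_top filterlim_compose[OF sqrt_at_top]
        filterlim_compose[OF filterlim_real_sequentially] filterlim_Suc)
  then have "(\<lambda>n. K * (S + 2 * (1 + L)) / sqrt (?R n)) \<longlonglongrightarrow> 0" by (simp add: divide_inverse)
  then have "(\<lambda>n. \<integral>z. U z * W (?R n) z \<partial>N) \<longlonglongrightarrow> 0"
    by (rule Lim_null_comparison[rotated]) (intro always_eventually allI UW(2), simp)
  then have lim2: "(\<lambda>n. (\<integral>z. U z * e (X z) \<partial>N) - (\<integral>z. U z * W (?R n) z \<partial>N)) \<longlonglongrightarrow> (\<integral>z. U z * e (X z) \<partial>N) - 0"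
    by (intro tendsto_intros)
  have "(\<integral>z. U z * e (X z) \<partial>N) - (\<integral>z. U z * W (?R n) z \<partial>N) = (\<integral>z. H z * V (?R n) z \<partial>N)" for n
    using key[of "?R n"] UW(1)[of "?R n"] Ue by (simp add: algebra_simps)
  with lim1 lim2 show ?thesis by (simp add: LIMSEQ_unique)
qed

end
end

section \<open>Solutions of the mode equations\<close>

text \<open>By uniqueness of derivatives \<open>e1\<close> and \<open>e2\<close> coincide with
  smooth ones, and a derivative vanishes wherever the function vanishes on an open set; continuity
  on a compact interval then gives the bounds.\<close>

lemma smooth1_compact_support:
  assumes "smooth1 e" and e: "\<And>t. (e has_vector_derivative e1 t) (at t)" "\<And>t. (e1 has_vector_derivative e2 t) (at t)"
    and L: "L \<ge> 0" "\<And>t. \<bar>t\<bar> > L \<Longrightarrow> e t = 0"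
  obtains M where "continuous_on UNIV e2" "\<And>t. \<bar>t\<bar> > L \<Longrightarrow> e2 t = 0" "\<And>t. norm (e t) \<le> M" "\<And>t. norm (e2 t) \<le> M"
proof -
  obtain f1 where f1: "smooth1 f1" "\<And>t. (e has_vector_derivative f1 t) (at t)" using smooth1_deriv[OF assms(1)] by blast
  obtain f2 where f2: "smooth1 f2" "\<And>t. (f1 has_vector_derivative f2 t) (at t)" using smooth1_deriv[OF f1(1)] by blast
  have "e1 = f1" using vector_derivative_unique_at[OF e(1) f1(2)] by blast
  then have "e2 = f2" using vector_derivative_unique_at[OF e(2)] f2(2) by blast
  then have c: "continuous_on UNIV e2" "continuous_on UNIV e" using f2 assms(1) smooth1_cont by auto
  have z: "f' t = 0" if f: "\<And>t. (f has_vector_derivative f' t) (at t)" and f0: "\<And>t. \<bar>t\<bar> > L \<Longrightarrow> f t = 0" and t: "\<bar>t\<bar> > L"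
    for f f' :: "real \<Rightarrow> complex" and t
  proof -
    have op: "open {t. \<bar>t\<bar> > L}" by (intro open_Collect_less continuous_intros)
    have "((\<lambda>t. 0) has_vector_derivative f' t) (at t)"
      by (rule has_vector_derivative_transform_within_open[OF f op]) (use t f0 in auto)
    then show ?thesis using vector_derivative_unique_at[OF _ has_vector_derivative_const] by blast
  qed
  have z1: "\<bar>t\<bar> > L \<Longrightarrow> e1 t = 0" for t using z[OF e(1) L(2)] .
  have z2: "\<bar>t\<bar> > L \<Longrightarrow> e2 t = 0" for t using z[OF e(2) z1] .
  have b: "\<exists>M. \<forall>t. norm (f t) \<le> M" if "continuous_on UNIV f" "\<And>t. \<bar>t\<bar> > L \<Longrightarrow> f t = 0" for f :: "real \<Rightarrow> complex"
  proof -
    have "compact (f ` {-L..L})" using that(1) by (intro compact_continuous_image) (auto intro: continuous_on_subset)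
    then obtain M where M: "\<And>x. x \<in> f ` {-L..L} \<Longrightarrow> norm x \<le> M" using compact_imp_bounded bounded_iff by metis
    have "norm (f t) \<le> max M 0" for t
    proof (cases "\<bar>t\<bar> > L")
      case False
      then have "t \<in> {-L..L}" by auto
      then show ?thesis using M[of "f t"] by (simp add: le_max_iff_disj)
    qed (simp add: that(2))
    then show ?thesis by blast
  qed
  obtain M M' where "\<forall>t. norm (e t) \<le> M" "\<forall>t. norm (e2 t) \<le> M'" using b[OF c(2) L(2)] b[OF c(1) z2] by auto
  then show ?thesis by (intro that[of "max M M'"] c z2) (auto simp: le_max_iff_disj)
qed

lemma tube_slab: "r \<ge> 0 \<Longrightarrow> emeasure tube {z \<in> space tube. \<bar>fst z\<bar> \<le> r} \<le> ennreal (2 * r)"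
proof -
  assume r: "r \<ge> 0"
  have "{z \<in> space tube. \<bar>fst z\<bar> \<le> r} = {-r..r} \<times> UNIV" by auto
  then have "emeasure tube {z \<in> space tube. \<bar>fst z\<bar> \<le> r} = emeasure lborel {-r..r} * emeasure unit_square UNIV"
    unfolding tube_def using sets.top[of unit_square] by (simp add: unit_square.emeasure_pair_measure_Times)
  then show ?thesis using r by (simp add: emeasure_unit_square)
qed

text \<open>The glued solution is exp(-\<kappa> |t|) / (2 \<kappa>); the constant is the larger of
  the bounds for its value and for its derivative.\<close>

lemma fundamental_solution_exp:
  assumes "\<kappa> > 0"
  shows "fundamental_solution (\<lambda>t. exp (\<kappa> * t) / (2 * \<kappa>)) (\<lambda>t. exp (\<kappa> * t) / 2)
    (\<lambda>t. exp (- \<kappa> * t) / (2 * \<kappa>)) (\<lambda>t. - exp (- \<kappa> * t) / 2) (\<kappa>\<^sup>2) (max (1 / (2 * \<kappa>)) (1/2))"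
proof
  fix t :: real
  show "((\<lambda>t. exp (\<kappa> * t) / (2 * \<kappa>)) has_real_derivative exp (\<kappa> * t) / 2) (at t)"
    "((\<lambda>t. exp (\<kappa> * t) / 2) has_real_derivative \<kappa>\<^sup>2 * (exp (\<kappa> * t) / (2 * \<kappa>))) (at t)"
    "((\<lambda>t. exp (- \<kappa> * t) / (2 * \<kappa>)) has_real_derivative - exp (- \<kappa> * t) / 2) (at t)"
    "((\<lambda>t. - exp (- \<kappa> * t) / 2) has_real_derivative \<kappa>\<^sup>2 * (exp (- \<kappa> * t) / (2 * \<kappa>))) (at t)"
    using assms by (auto intro!: derivative_eq_intros simp: power2_eq_square)
  have gen: "x / (2 * \<kappa>) \<le> max (1 / (2 * \<kappa>)) (1/2) * (1 + \<bar>t\<bar>)" if "x \<le> 1" "0 \<le> x" for x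
  proof -
    have "x / (2 * \<kappa>) * 1 \<le> max (1 / (2 * \<kappa>)) (1/2) * (1 + \<bar>t\<bar>)"
    proof (rule mult_mono)
      show "x / (2 * \<kappa>) \<le> max (1 / (2 * \<kappa>)) (1/2)" using assms that by (intro max.coboundedI1 divide_right_mono) auto
    qed (auto simp: le_max_iff_disj)
    then show ?thesis by simp
  qed
  show "\<bar>exp (\<kappa> * t) / (2 * \<kappa>)\<bar> \<le> max (1 / (2 * \<kappa>)) (1/2) * (1 + \<bar>t\<bar>)" if "t \<le> 0"
    using gen[of "exp (\<kappa> * t)"] assms that by (simp add: mult_le_0_iff)
  show "\<bar>exp (- \<kappa> * t) / (2 * \<kappa>)\<bar> \<le> max (1 / (2 * \<kappa>)) (1/2) * (1 + \<bar>t\<bar>)" if "t \<ge> 0"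
    using gen[of "exp (- \<kappa> * t)"] assms that by simp
  show "\<bar>exp (\<kappa> * t) / 2\<bar> \<le> max (1 / (2 * \<kappa>)) (1/2)" if "t \<le> 0"
    using assms that by (intro max.coboundedI2) (simp add: mult_le_0_iff)
  show "\<bar>- exp (- \<kappa> * t) / 2\<bar> \<le> max (1 / (2 * \<kappa>)) (1/2)" if "t \<ge> 0"
    using assms that by (intro max.coboundedI2) simp
qed auto

text \<open>The mode \<open>k0\<close> gets its own coefficient \<open>q0\<close> and an arbitrary
  fundamental solution for it, so that one decomposition serves the decaying solution as well as
  both one-sided ones. All other modes are evanescent.\<close>

locale tube_decomposition = mode_kernel \<theta>2 \<theta>3 \<kappa> A c0 Z + G0: fundamental_solution P P1 Q Q1 q0 C
  for \<theta>2 \<theta>3 \<kappa> A c0 Z P P1 Q Q1 q0 C +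
  fixes k0 :: nat and u h :: "real \<times> real \<times> real \<Rightarrow> complex"
  assumes A: "A = - {k0}"
    and u [measurable]: "u \<in> borel_measurable tube" and u2: "integrable tube (\<lambda>z. (cmod (u z))\<^sup>2)"
    and h [measurable]: "h \<in> borel_measurable tube" and h1: "integrable tube (\<lambda>z. (1 + \<bar>fst z\<bar>) * cmod (h z))"
    and weak: "\<And>\<eta> \<eta>1 \<eta>2 k. smooth1 \<eta> \<Longrightarrow> (\<And>t. (\<eta> has_vector_derivative \<eta>1 t) (at t)) \<Longrightarrow>
      (\<And>t. (\<eta>1 has_vector_derivative \<eta>2 t) (at t)) \<Longrightarrow> (\<exists>L. \<forall>t. \<bar>t\<bar> > L \<longrightarrow> \<eta> t = 0) \<Longrightarrow>
      (\<integral>z. u z * ((of_real (if k = k0 then q0 else (\<kappa> k)\<^sup>2) * \<eta> (fst z) - \<eta>2 (fst z)) * cnj (chr \<theta>2 \<theta>3 k (snd z))) \<partial>tube)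
      = (\<integral>z. h z * (\<eta> (fst z) * cnj (chr \<theta>2 \<theta>3 k (snd z))) \<partial>tube)"
begin

lemma h_integrable: "integrable tube h"
  by (rule Bochner_Integration.integrable_bound[OF h1]) (auto simp: abs_mult mult_le_cancel_right1)

text \<open>A one-sided \<open>G\<close> is not even, so the orientation \<open>fst w - x\<close>
  matters; it results from substituting in the convolution of \<open>representation\<close>.\<close>

definition v0 :: "real \<Rightarrow> complex" where
  "v0 x = (\<integral>w. of_real (G0.G (fst w - x)) * (cnj (chr \<theta>2 \<theta>3 k0 (snd w)) * h w) \<partial>tube)"

definition U0 :: "real \<times> real \<times> real \<Rightarrow> complex" where
  "U0 z = chr \<theta>2 \<theta>3 k0 (snd z) * v0 (fst z)"

text \<open>This is \<open>representation\<close> for \<open>u\<close> and \<open>h\<close>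
  multiplied by the conjugate character: the weak equation holds for all test functions, hence for
  all translates of \<open>\<eta>\<close>. A reflection of the variable turns the convolution into
  an integral of \<open>\<eta>\<close> against a kernel.\<close>

lemma mode_identity:
  assumes FS: "fundamental_solution B B1 D D1 (if k = k0 then q0 else (\<kappa> k)\<^sup>2) C'"
    and sm: "smooth1 \<eta>" and L: "L \<ge> 0" "\<And>t. \<bar>t\<bar> > L \<Longrightarrow> \<eta> t = 0"
  shows "(\<integral>z. u z * (\<eta> (fst z) * cnj (chr \<theta>2 \<theta>3 k (snd z))) \<partial>tube)
    = (\<integral>w. h w * cnj (chr \<theta>2 \<theta>3 k (snd w)) * (\<integral>x. of_real (fundamental_solution.G B D (fst w - x)) * \<eta> x \<partial>lborel) \<partial>tube)"
proof -
  obtain \<eta>1 where \<eta>1: "smooth1 \<eta>1" "\<And>t. (\<eta> has_vector_derivative \<eta>1 t) (at t)" using smooth1_deriv[OF sm] by blast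
  obtain \<eta>2 where \<eta>2: "\<And>t. (\<eta>1 has_vector_derivative \<eta>2 t) (at t)" using smooth1_deriv[OF \<eta>1(1)] by blast
  obtain M where M: "continuous_on UNIV \<eta>2" "\<And>t. \<bar>t\<bar> > L \<Longrightarrow> \<eta>2 t = 0" "\<And>t. norm (\<eta> t) \<le> M" "\<And>t. norm (\<eta>2 t) \<le> M"
    using smooth1_compact_support[OF sm \<eta>1(2) \<eta>2 L] by blast
  interpret FS: fundamental_solution B B1 D D1 "if k = k0 then q0 else (\<kappa> k)\<^sup>2" C' by fact
  let ?c = "\<lambda>z. cnj (chr \<theta>2 \<theta>3 k (snd z))"
  have sh: "(\<integral>t. of_real (FS.G t) * \<eta> (y - t) \<partial>lborel) = (\<integral>x. of_real (FS.G (y - x)) * \<eta> x \<partial>lborel)" for y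
    by (subst lborel_integral_real_affine[of "-1" _ y]) (simp_all add: algebra_simps)
  have "(\<integral>z. (u z * ?c z) * \<eta> (fst z) \<partial>tube) = (\<integral>z. (h z * ?c z) * (\<integral>t. of_real (FS.G t) * \<eta> (fst z - t) \<partial>lborel) \<partial>tube)"
  proof (rule FS.representation[OF \<eta>1(2) \<eta>2 M(1) _ M(3,4) L(1) tube.sigma_finite_measure_axioms])
    show "\<eta> t = 0 \<and> \<eta>2 t = 0" if "\<bar>t\<bar> > L" for t using L(2)[OF that] M(2)[OF that] by simp
    show "integrable tube (\<lambda>z. (cmod (u z * ?c z))\<^sup>2)" using u2 by (simp add: norm_mult)
    show "integrable tube (\<lambda>z. (1 + \<bar>fst z\<bar>) * cmod (h z * ?c z))" using h1 by (simp add: norm_mult)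
    show "(\<integral>z. (u z * ?c z) * (of_real (if k = k0 then q0 else (\<kappa> k)\<^sup>2) * \<eta> (fst z - t) - \<eta>2 (fst z - t)) \<partial>tube)
      = (\<integral>z. (h z * ?c z) * \<eta> (fst z - t) \<partial>tube)" for t
    proof -
      have sm': "smooth1 (\<lambda>x. \<eta> (x - t))" using smooth1_affine[OF sm, of 1 "-t"] by simp
      have d: "((\<lambda>x. f (x - t)) has_vector_derivative f' (s - t)) (at s)" if "\<And>t. (f has_vector_derivative f' t) (at t)"
        for f f' :: "real \<Rightarrow> complex" and s
      proof -
        have "((\<lambda>x. x - t) has_vector_derivative 1) (at s)" by (auto intro!: derivative_eq_intros)
        from vector_diff_chain_at[OF this that] show ?thesis by (simp add: o_def)
      qed
      have "\<exists>L. \<forall>s. \<bar>s\<bar> > L \<longrightarrow> \<eta> (s - t) = 0" using L(2) by (intro exI[of _ "L + \<bar>t\<bar>"]) auto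
      from weak[OF sm' d[OF \<eta>1(2)] d[OF \<eta>2] this, of k] show ?thesis by (simp only: mult_ac)
    qed
  qed (use tube_slab in auto)
  then show ?thesis unfolding sh by (simp only: mult_ac)
qed

text \<open>Submultiplicativity of 1 + |x| splits the linear growth: the factor in y is absorbed by
  the weight on \<open>h\<close>, the factor in x is bounded on compact sets.\<close>

lemma G0_factor: "\<bar>G0.G (y - x)\<bar> \<le> C * ((1 + \<bar>x\<bar>) * (1 + \<bar>y\<bar>))"
proof -
  have "1 + \<bar>y - x\<bar> \<le> 1 + \<bar>x\<bar> + \<bar>y\<bar> + \<bar>x\<bar> * \<bar>y\<bar>"
    using abs_triangle_ineq4[of y x] mult_nonneg_nonneg[of "\<bar>x\<bar>" "\<bar>y\<bar>"] by linarith
  also have "\<dots> = (1 + \<bar>x\<bar>) * (1 + \<bar>y\<bar>)" by (simp add: algebra_simps)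
  finally have "1 + \<bar>y - x\<bar> \<le> (1 + \<bar>x\<bar>) * (1 + \<bar>y\<bar>)" .
  then have "C * (1 + \<bar>y - x\<bar>) \<le> C * ((1 + \<bar>x\<bar>) * (1 + \<bar>y\<bar>))" using G0.C_nonneg by (rule mult_left_mono)
  then show ?thesis using G0.G_bound(1)[of "y - x"] by linarith
qed

lemma measurable_v0 [measurable]: "v0 \<in> borel_measurable borel"
proof -
  have "(\<lambda>x. \<integral>w. (case (x, w) of (x, w) \<Rightarrow> of_real (G0.G (fst w - x)) * (cnj (chr \<theta>2 \<theta>3 k0 (snd w)) * h w)) \<partial>tube) \<in> borel_measurable lborel"
    by (rule tube.borel_measurable_lebesgue_integral) measurable
  then show ?thesis by (simp add: v0_def[abs_def])
qed

lemma v0_integrand_le: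
  "norm (of_real (G0.G (fst w - x)) * (cnj (chr \<theta>2 \<theta>3 k0 (snd w)) * h w)) \<le> C * (1 + \<bar>x\<bar>) * ((1 + \<bar>fst w\<bar>) * cmod (h w))"
  using mult_right_mono[OF G0_factor[of "fst w" x], of "cmod (h w)"] by (simp add: norm_mult mult.assoc)

lemma v0_integrable: "integrable tube (\<lambda>w. of_real (G0.G (fst w - x)) * (cnj (chr \<theta>2 \<theta>3 k0 (snd w)) * h w))"
proof -
  have i: "integrable tube (\<lambda>w. C * (1 + \<bar>x\<bar>) * ((1 + \<bar>fst w\<bar>) * cmod (h w)))" using h1 by (rule integrable_mult_right)
  show ?thesis
    by (rule Bochner_Integration.integrable_bound[OF i]) (use v0_integrand_le in \<open>auto intro!: AE_I2 order_trans[OF v0_integrand_le abs_ge_self]\<close>)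
qed

lemma v0_bound: "norm (v0 x) \<le> C * (1 + \<bar>x\<bar>) * (\<integral>w. (1 + \<bar>fst w\<bar>) * cmod (h w) \<partial>tube)"
proof -
  have i: "integrable tube (\<lambda>w. C * (1 + \<bar>x\<bar>) * ((1 + \<bar>fst w\<bar>) * cmod (h w)))" using h1 by (rule integrable_mult_right)
  have "norm (v0 x) \<le> (\<integral>w. norm (of_real (G0.G (fst w - x)) * (cnj (chr \<theta>2 \<theta>3 k0 (snd w)) * h w)) \<partial>tube)"
    unfolding v0_def by (rule integral_norm_bound)
  also have "\<dots> \<le> (\<integral>w. C * (1 + \<bar>x\<bar>) * ((1 + \<bar>fst w\<bar>) * cmod (h w)) \<partial>tube)"
    by (intro integral_mono integrable_norm v0_integrable i v0_integrand_le)
  finally show ?thesis by simp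
qed

lemma measurable_U0 [measurable]: "U0 \<in> borel_measurable tube"
  unfolding U0_def by measurable

lemma integrable_slab:
  fixes f :: "real \<times> real \<times> real \<Rightarrow> complex"
  assumes [measurable]: "f \<in> borel_measurable tube" and "\<And>z. fst z \<notin> {a..b} \<Longrightarrow> f z = 0" and "\<And>z. norm (f z) \<le> K"
  shows "integrable tube f"
proof -
  define r where "r = max \<bar>a\<bar> \<bar>b\<bar>"
  show ?thesis
  proof (rule integrableI_bounded_set[where A = "{z \<in> space tube. \<bar>fst z\<bar> \<le> r}" and B = K])
    show "emeasure tube {z \<in> space tube. \<bar>fst z\<bar> \<le> r} < \<infinity>"
      using le_less_trans[OF tube_slab[of r] ennreal_less_top] by (simp add: r_def)
    show "AE z in tube. z \<notin> {z \<in> space tube. \<bar>fst z\<bar> \<le> r} \<longrightarrow> f z = 0"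
    proof (intro AE_I2 impI assms(2))
      fix z assume "z \<notin> {z \<in> space tube. \<bar>fst z\<bar> \<le> r}"
      then have "\<bar>a\<bar> < \<bar>fst z\<bar>" "\<bar>b\<bar> < \<bar>fst z\<bar>" by (auto simp: r_def)
      then show "fst z \<notin> {a..b}" by auto
    qed
    show "{z \<in> space tube. \<bar>fst z\<bar> \<le> r} \<in> sets tube" by measurable
  qed (use assms in auto)
qed

text \<open>Orthonormality removes every mode but \<open>k0\<close>; Fubini then moves the test
  function onto the kernel, which gives the form occurring in \<open>mode_identity\<close>.\<close>

lemma U0_mode:
  assumes [measurable]: "\<eta> \<in> borel_measurable borel" and L: "L \<ge> 0" "\<And>t. \<bar>t\<bar> > L \<Longrightarrow> \<eta> t = 0" and M: "\<And>t. norm (\<eta> t) \<le> M"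
  shows "integrable tube (\<lambda>z. U0 z * (\<eta> (fst z) * cnj (chr \<theta>2 \<theta>3 k (snd z))))"
    "(\<integral>z. U0 z * (\<eta> (fst z) * cnj (chr \<theta>2 \<theta>3 k (snd z))) \<partial>tube)
    = (if k = k0 then \<integral>w. h w * cnj (chr \<theta>2 \<theta>3 k (snd w)) * (\<integral>x. of_real (G0.G (fst w - x)) * \<eta> x \<partial>lborel) \<partial>tube else 0)"
proof -
  define B where "B = (\<integral>w. (1 + \<bar>fst w\<bar>) * cmod (h w) \<partial>tube)"
  have B: "B \<ge> 0" by (simp add: B_def)
  have M0: "M \<ge> 0" using M[of 0] norm_ge_zero order_trans by blast
  have vb: "norm (v0 x * \<eta> x) \<le> C * (1 + L) * B * M" for x
  proof (cases "\<bar>x\<bar> > L")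
    case True then show ?thesis using L M0 B G0.C_nonneg by simp
  next
    case False
    have "norm (v0 x) \<le> C * (1 + \<bar>x\<bar>) * B" using v0_bound[of x] by (simp add: B_def)
    also have "\<dots> \<le> C * (1 + L) * B" using False B G0.C_nonneg by (intro mult_right_mono mult_left_mono) auto
    finally show ?thesis unfolding norm_mult using M[of x] B G0.C_nonneg L by (intro mult_mono) auto
  qed
  have z: "\<eta> x = 0" if "x \<notin> {-L..L}" for x using that by (intro L(2)) auto
  show i: "integrable tube (\<lambda>z. U0 z * (\<eta> (fst z) * cnj (chr \<theta>2 \<theta>3 k (snd z))))"
  proof (rule integrable_slab[where a = "-L" and b = L and K = "C * (1 + L) * B * M"])
    show "norm (U0 z * (\<eta> (fst z) * cnj (chr \<theta>2 \<theta>3 k (snd z)))) \<le> C * (1 + L) * B * M" for z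
      using vb[of "fst z"] by (simp add: U0_def norm_mult)
  qed (auto simp: z)
  then have i': "integrable (lborel \<Otimes>\<^sub>M unit_square) (\<lambda>z. U0 z * (\<eta> (fst z) * cnj (chr \<theta>2 \<theta>3 k (snd z))))"
    by (simp add: tube_def)
  have "(\<integral>z. U0 z * (\<eta> (fst z) * cnj (chr \<theta>2 \<theta>3 k (snd z))) \<partial>tube)
    = (\<integral>x. \<integral>p. U0 (x, p) * (\<eta> (fst (x, p)) * cnj (chr \<theta>2 \<theta>3 k (snd (x, p)))) \<partial>unit_square \<partial>lborel)"
    unfolding tube_def by (rule tube.integral_fst'[OF i', symmetric])
  also have "\<dots> = (\<integral>x. \<integral>p. v0 x * \<eta> x * (chr \<theta>2 \<theta>3 k0 p * cnj (chr \<theta>2 \<theta>3 k p)) \<partial>unit_square \<partial>lborel)"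
    by (simp add: U0_def mult_ac)
  also have "\<dots> = (\<integral>x. v0 x * \<eta> x * (if k0 = k then 1 else 0) \<partial>lborel)"
    by (simp only: integral_mult_right_zero chr_orthonormal)
  also have "\<dots> = (if k = k0 then \<integral>x. v0 x * \<eta> x \<partial>lborel else 0)" by auto
  also have "(\<integral>x. v0 x * \<eta> x \<partial>lborel) = (\<integral>w. h w * cnj (chr \<theta>2 \<theta>3 k0 (snd w)) * (\<integral>x. of_real (G0.G (fst w - x)) * \<eta> x \<partial>lborel) \<partial>tube)"
  proof -
    let ?k = "\<lambda>w x. of_real (G0.G (fst w - x)) * (cnj (chr \<theta>2 \<theta>3 k0 (snd w)) * h w) * \<eta> x"
    interpret TL: pair_sigma_finite tube lborel ..
    have i: "integrable (tube \<Otimes>\<^sub>M lborel) (\<lambda>(w, x). ?k w x)"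
    proof (rule integrable_tensor_bound[OF tube.sigma_finite_measure_axioms lborel.sigma_finite_measure_axioms h1])
      show "integrable lborel (\<lambda>x. indicator {-L..L} x * (C * (1 + L) * M))"
        using L by (auto intro!: integrable_real_indicator)
      show "norm (?k w x) \<le> (1 + \<bar>fst w\<bar>) * cmod (h w) * (indicator {-L..L} x * (C * (1 + L) * M))" for w x
      proof (cases "x \<in> {-L..L}")
        case True
        have "C * ((1 + \<bar>x\<bar>) * (1 + \<bar>fst w\<bar>)) \<le> C * ((1 + L) * (1 + \<bar>fst w\<bar>))"
          using True G0.C_nonneg by (intro mult_left_mono mult_right_mono) auto
        then have "\<bar>G0.G (fst w - x)\<bar> \<le> C * ((1 + L) * (1 + \<bar>fst w\<bar>))"
          using G0_factor[of "fst w" x] by linarith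
        then have "\<bar>G0.G (fst w - x)\<bar> * cmod (h w) * norm (\<eta> x) \<le> C * ((1 + L) * (1 + \<bar>fst w\<bar>)) * cmod (h w) * M"
          using M[of x] L G0.C_nonneg by (intro mult_mono) auto
        then show ?thesis using True by (simp add: norm_mult mult_ac)
      qed (simp add: z)
    qed measurable
    have "(\<integral>x. v0 x * \<eta> x \<partial>lborel) = (\<integral>x. \<integral>w. ?k w x \<partial>tube \<partial>lborel)" unfolding v0_def by simp
    also have "\<dots> = (\<integral>w. \<integral>x. ?k w x \<partial>lborel \<partial>tube)" by (rule TL.Fubini_integral[OF i])
    also have "\<dots> = (\<integral>w. \<integral>x. (h w * cnj (chr \<theta>2 \<theta>3 k0 (snd w))) * (of_real (G0.G (fst w - x)) * \<eta> x) \<partial>lborel \<partial>tube)"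
      by (simp only: mult_ac)
    finally show ?thesis by (simp only: integral_mult_right_zero)
  qed
  finally show "(\<integral>z. U0 z * (\<eta> (fst z) * cnj (chr \<theta>2 \<theta>3 k (snd z))) \<partial>tube)
    = (if k = k0 then \<integral>w. h w * cnj (chr \<theta>2 \<theta>3 k (snd w)) * (\<integral>x. of_real (G0.G (fst w - x)) * \<eta> x \<partial>lborel) \<partial>tube else 0)"
    by (simp cong: if_cong)
qed

text \<open>Pairings with a bump times a conjugate character agree on both sides: mode
  \<open>k0\<close> comes from \<open>U0\<close> and every other mode from \<open>F h\<close>. Then
  \<open>mode_uniqueness\<close> applies to the difference.\<close>

theorem decomposition: "AE z in tube. u z = U0 z + F h z"
proof -
  have [measurable]: "F h \<in> borel_measurable tube" using integrable_F[OF h_integrable] by auto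
  have "AE z in tube. u z - (U0 z + F h z) = 0"
  proof (rule mode_uniqueness[of _ \<theta>2 \<theta>3])
    \<comment> \<open>\<open>u\<close> is only square integrable; its product with a function f of
      modulus at most 1 supported in a slab is bounded by |u|^2 + |f|.\<close>
    have ui: "integrable tube (\<lambda>z. u z * f z)" if [measurable]: "f \<in> borel_measurable tube" and f: "\<And>z. norm (f z) \<le> 1"
      "\<And>z. fst z \<notin> {a..b} \<Longrightarrow> f z = 0" for f :: "real \<times> real \<times> real \<Rightarrow> complex" and a b
    proof (rule Bochner_Integration.integrable_bound)
      have "integrable tube (\<lambda>z. of_real (norm (f z)) :: complex)"
        by (rule integrable_slab[of _ a b 1]) (use f in auto)
      then have "integrable tube (\<lambda>z. norm (f z))" by (simp add: complex_of_real_integrable_eq)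
      then show "integrable tube (\<lambda>z. (cmod (u z))\<^sup>2 + norm (f z))" using u2 by simp
      show "AE z in tube. norm (u z * f z) \<le> norm ((cmod (u z))\<^sup>2 + norm (f z))"
      proof (intro AE_I2)
        fix z
        have "0 \<le> (cmod (u z) - norm (f z))\<^sup>2" by simp
        moreover have "(norm (f z))\<^sup>2 \<le> norm (f z)" using f(1)[of z] by (simp add: power2_eq_square mult_left_le)
        moreover have "0 \<le> cmod (u z) * norm (f z)" by simp
        ultimately have "cmod (u z) * norm (f z) \<le> (cmod (u z))\<^sup>2 + norm (f z)"
          unfolding power2_diff by linarith
        then show "norm (u z * f z) \<le> norm ((cmod (u z))\<^sup>2 + norm (f z))" by (simp add: norm_mult)
      qed
    qed measurable
    fix a b :: real
    show "(\<lambda>z. u z - (U0 z + F h z)) \<in> borel_measurable tube" by measurable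
    have "integrable tube (\<lambda>z. u z * indicator {a<..<b} (fst z))"
      by (rule ui[of _ a b]) (auto simp: indicator_def)
    moreover have "integrable tube (\<lambda>z. U0 z * indicator {a<..<b} (fst z))"
    proof (rule integrable_slab[of _ a b "C * (1 + max \<bar>a\<bar> \<bar>b\<bar>) * (\<integral>w. (1 + \<bar>fst w\<bar>) * cmod (h w) \<partial>tube)"])
      show "norm (U0 z * indicator {a<..<b} (fst z)) \<le> C * (1 + max \<bar>a\<bar> \<bar>b\<bar>) * (\<integral>w. (1 + \<bar>fst w\<bar>) * cmod (h w) \<partial>tube)" for z
      proof (cases "fst z \<in> {a<..<b}")
        case True
        have "C * (1 + \<bar>fst z\<bar>) * (\<integral>w. (1 + \<bar>fst w\<bar>) * cmod (h w) \<partial>tube) \<le> C * (1 + max \<bar>a\<bar> \<bar>b\<bar>) * (\<integral>w. (1 + \<bar>fst w\<bar>) * cmod (h w) \<partial>tube)"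
          using True G0.C_nonneg by (intro mult_right_mono mult_left_mono) auto
        then show ?thesis using True v0_bound[of "fst z"] by (simp add: U0_def norm_mult)
      qed (use G0.C_nonneg in \<open>auto intro!: mult_nonneg_nonneg\<close>)
    qed (auto simp: indicator_def)
    moreover have "integrable tube (\<lambda>z. indicator {a<..<b} (fst z) *\<^sub>R F h z)"
      by (rule Bochner_Integration.integrable_bound[OF integrable_F[OF h_integrable]]) (auto simp: indicator_def)
    ultimately have "integrable tube (\<lambda>z. u z * indicator {a<..<b} (fst z)
        - (U0 z * indicator {a<..<b} (fst z) + indicator {a<..<b} (fst z) *\<^sub>R F h z))"
      by (intro Bochner_Integration.integrable_diff Bochner_Integration.integrable_add)
    moreover have "u z * indicator {a<..<b} (fst z) - (U0 z * indicator {a<..<b} (fst z) + indicator {a<..<b} (fst z) *\<^sub>R F h z)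
        = indicator {a<..<b} (fst z) *\<^sub>R (u z - (U0 z + F h z))" for z
      by (simp add: indicator_def)
    ultimately show "integrable tube (\<lambda>z. indicator {a<..<b} (fst z) *\<^sub>R (u z - (U0 z + F h z)))"
      by (simp only:)
    fix n :: nat and i j :: int
    let ?\<eta> = "bump n a b"
    define L where "L = max \<bar>a\<bar> \<bar>b\<bar>"
    have L: "L \<ge> 0" "\<bar>t\<bar> > L \<Longrightarrow> ?\<eta> t = 0" for t
      by (simp add: L_def) (rule bump_eq_0, auto simp: L_def)
    obtain k where k: "mode k = (i, j)" using bij_mode by (metis bij_pointE)
    have m [measurable]: "?\<eta> \<in> borel_measurable borel" by (intro borel_measurable_continuous_onI smooth1_cont smooth1_bump)
    let ?c = "\<lambda>z. ?\<eta> (fst z) * cnj (chr \<theta>2 \<theta>3 k (snd z))"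
    have c: "?\<eta> (fst z) * exp (- \<i> * of_real ((\<theta>2 + 2 * pi * of_int i) * fst (snd z) + (\<theta>3 + 2 * pi * of_int j) * snd (snd z))) = ?c z" for z
      by (simp add: chr_def k exp_cnj)
    have nc: "norm (?c z) \<le> 1" for z using norm_bump_le by (simp add: norm_mult)
    have iu: "integrable tube (\<lambda>z. u z * ?c z)"
      by (rule ui[of _ a b]) (use nc in \<open>auto simp: bump_eq_0\<close>)
    note U = U0_mode[OF m L norm_bump_le, where k = k]
    have iF: "integrable tube (\<lambda>z. F h z * ?c z)"
      by (rule Bochner_Integration.integrable_bound[OF integrable_F[OF h_integrable]])
        (use norm_bump_le in \<open>auto simp: norm_mult intro!: mult_left_le\<close>)
    note Fm = F_mode[OF h_integrable m norm_bump_le, where j = k]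
    have "(\<integral>z. u z * ?c z \<partial>tube) = (\<integral>z. U0 z * ?c z \<partial>tube) + (\<integral>z. F h z * ?c z \<partial>tube)"
    proof (cases "k = k0")
      case True
      have "(\<integral>z. u z * ?c z \<partial>tube) = (\<integral>w. h w * cnj (chr \<theta>2 \<theta>3 k (snd w)) * (\<integral>x. of_real (G0.G (fst w - x)) * ?\<eta> x \<partial>lborel) \<partial>tube)"
        by (rule mode_identity[where ?B1.0 = P1 and ?D1.0 = Q1 and C' = C, OF _ smooth1_bump L])
          (simp_all add: True G0.fundamental_solution_axioms)
      \<comment> \<open>\<open>k0\<close> lies outside \<open>A\<close>, so \<open>F h\<close> has
        no component in this mode.\<close>
      moreover have "co k r = 0" for r using True A unfolding co_def by simp
      ultimately show ?thesis using U(2) Fm True by simp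
    next
      case False
      then have kA: "k \<in> A" using A by simp
      note FS = fundamental_solution_exp[OF \<kappa>_pos[OF kA]]
      \<comment> \<open>The decaying fundamental solution is even, so here the orientation of the
        argument is immaterial.\<close>
      have G: "fundamental_solution.G (\<lambda>t. exp (\<kappa> k * t) / (2 * \<kappa> k)) (\<lambda>t. exp (- \<kappa> k * t) / (2 * \<kappa> k)) (y - x) = co k (x - y)" for x y
        using kA unfolding fundamental_solution.G_def[OF FS] by (auto simp: co_def abs_if right_diff_distrib)
      have "(\<integral>z. u z * ?c z \<partial>tube) = (\<integral>w. h w * cnj (chr \<theta>2 \<theta>3 k (snd w)) * (\<integral>x. of_real (co k (x - fst w)) * ?\<eta> x \<partial>lborel) \<partial>tube)"
      proof -
        have FS': "fundamental_solution (\<lambda>t. exp (\<kappa> k * t) / (2 * \<kappa> k)) (\<lambda>t. exp (\<kappa> k * t) / 2)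
            (\<lambda>t. exp (- \<kappa> k * t) / (2 * \<kappa> k)) (\<lambda>t. - exp (- \<kappa> k * t) / 2)
            (if k = k0 then q0 else (\<kappa> k)\<^sup>2) (max (1 / (2 * \<kappa> k)) (1/2))"
          unfolding if_not_P[OF False] by (rule FS)
        show ?thesis by (rule mode_identity[OF FS' smooth1_bump L, unfolded G])
      qed
      then show ?thesis using U(2) Fm False by simp
    qed
    then have "(\<integral>z. (u z - (U0 z + F h z)) * ?c z \<partial>tube) = 0"
      using iu U(1) iF by (simp add: left_diff_distrib distrib_right)
    then show "(\<integral>z. (u z - (U0 z + F h z)) * (?\<eta> (fst z) * exp (- \<i> * of_real ((\<theta>2 + 2 * pi * of_int i) * fst (snd z) + (\<theta>3 + 2 * pi * of_int j) * snd (snd z)))) \<partial>tube) = 0"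
      unfolding c .
  qed
  then show ?thesis by eventually_elim simp
qed

end

section \<open>Lattice coordinates on the strip\<close>

lemma tube_density:
  "tube = density lborel (indicator (UNIV \<times> {-1/2..1/2} \<times> {-1/2..1/2}))"
proof -
  let ?I = "{-1/2..1/2} :: real set"
  have "sigma_finite_measure (density lborel (indicator ?I :: real \<Rightarrow> ennreal))"
    using unit_interval.sigma_finite_measure_axioms by (simp add: unit_interval_def)
  moreover have "(\<lambda>(x, y). indicator ?I x * indicator ?I y :: ennreal) = indicator (?I \<times> ?I)"
    by (auto simp: fun_eq_iff indicator_def)
  ultimately have sq: "unit_square = density lborel (indicator (?I \<times> ?I))"
    unfolding unit_square_def unit_interval_def
    by (subst pair_measure_density) (auto simp: lborel_prod lborel.sigma_finite_measure_axioms)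
  have "(\<lambda>(x, y). 1 * indicator (?I \<times> ?I) y :: ennreal) = indicator (UNIV \<times> ?I \<times> ?I)"
    by (auto simp: fun_eq_iff indicator_def)
  note ind = this
  have "tube = density lborel (\<lambda>_. 1) \<Otimes>\<^sub>M density lborel (indicator (?I \<times> ?I))"
    unfolding tube_def sq by (simp add: density_1)
  also have "\<dots> = density lborel (indicator (UNIV \<times> ?I \<times> ?I))"
    unfolding ind[symmetric] using unit_square.sigma_finite_measure_axioms
    by (subst pair_measure_density) (auto simp: lborel_prod lborel.sigma_finite_measure_axioms sq
        intro!: borel_measurable_indicator borel_closed closed_Times)
  finally show ?thesis .
qed

lemma emeasure_lborel_Times:
  fixes A :: "'a::euclidean_space set" and B :: "'b::euclidean_space set"
  assumes "A \<in> sets borel" "B \<in> sets borel"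
  shows "emeasure lborel (A \<times> B) = emeasure lborel A * emeasure lborel B"
  using lborel.emeasure_pair_measure_Times[of A lborel B] assms by (simp add: lborel_prod)

locale rect_lattice =
  fixes a2 a3 :: "real^2"
  assumes nz: "a2 \<noteq> 0" "a3 \<noteq> 0" and orth: "a2 \<bullet> a3 = 0"
begin

text \<open>The coefficient of the orthogonal projection onto \<open>a\<close>; for an orthogonal
  pair of vectors these are the lattice coordinates.\<close>

definition sc :: "real^2 \<Rightarrow> real^2 \<Rightarrow> real" where "sc a x = (x \<bullet> a) / (a \<bullet> a)"

text \<open>By orthogonality this is the area of the cell, hence the Jacobian of
  \<open>Phi\<close>.\<close>

definition D :: real where "D = norm a2 * norm a3"

definition Phi :: "real \<times> real \<times> real \<Rightarrow> real \<times> (real^2)" where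
  "Phi z = (fst z, fst (snd z) *\<^sub>R a2 + snd (snd z) *\<^sub>R a3)"

definition Psi :: "real \<times> (real^2) \<Rightarrow> real \<times> real \<times> real" where
  "Psi y = (fst y, sc a2 (snd y), sc a3 (snd y))"

lemma D_pos: "D > 0" using nz by (simp add: D_def)

lemma orth': "a3 \<bullet> a2 = 0" using orth by (simp add: inner_commute)

lemma sc_lin: "sc a2 (s *\<^sub>R a2 + t *\<^sub>R a3) = s" "sc a3 (s *\<^sub>R a2 + t *\<^sub>R a3) = t"
  using nz by (auto simp: sc_def inner_add_left orth orth')

text \<open>By Lagrange's identity the determinant of the two vectors is nonzero, so the remainder,
  being orthogonal to both, vanishes by Cramer's rule.\<close>

lemma decomp: "sc a2 x *\<^sub>R a2 + sc a3 x *\<^sub>R a3 = x"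
proof -
  define d where "d = a2$1 * a3$2 - a2$2 * a3$1"
  have "d\<^sup>2 = (a2 \<bullet> a2) * (a3 \<bullet> a3) - (a2 \<bullet> a3)\<^sup>2"
    by (simp add: d_def inner_vec_def sum_2 power2_eq_square algebra_simps)
  then have "d \<noteq> 0" using nz orth by auto
  define y where "y = x - (sc a2 x *\<^sub>R a2 + sc a3 x *\<^sub>R a3)"
  have "y \<bullet> a2 = 0" "y \<bullet> a3 = 0"
    using nz by (auto simp: y_def sc_def inner_diff_left inner_add_left orth orth')
  then have e: "y$1 * a2$1 + y$2 * a2$2 = 0" "y$1 * a3$1 + y$2 * a3$2 = 0" by (simp_all add: inner_vec_def sum_2)
  have "d * y$1 = a3$2 * (y$1 * a2$1 + y$2 * a2$2) - a2$2 * (y$1 * a3$1 + y$2 * a3$2)"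
    "d * y$2 = a2$1 * (y$1 * a3$1 + y$2 * a3$2) - a3$1 * (y$1 * a2$1 + y$2 * a2$2)"
    by (simp_all add: d_def algebra_simps)
  then have "y$1 = 0" "y$2 = 0" using e \<open>d \<noteq> 0\<close> by auto
  then have "y = 0" by (simp add: vec_eq_iff forall_2)
  then show ?thesis by (simp add: y_def)
qed

lemma Psi_Phi [simp]: "Psi (Phi z) = z" by (simp add: Psi_def Phi_def sc_lin)

lemma Phi_Psi [simp]: "Phi (Psi y) = y" by (simp add: Psi_def Phi_def decomp)

lemma continuous_Phi: "continuous_on UNIV Phi" unfolding Phi_def by (intro continuous_intros)

lemma continuous_Psi: "continuous_on UNIV Psi" unfolding Psi_def sc_def by (intro continuous_intros) (use nz in auto)

lemma measurable_Phi_Psi [measurable]: "Phi \<in> borel_measurable borel" "Psi \<in> borel_measurable borel"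
  by (intro borel_measurable_continuous_onI continuous_Phi continuous_Psi)+

lemma cell_iff: "x \<in> cell a2 a3 \<longleftrightarrow> -1/2 < sc a2 x \<and> sc a2 x \<le> 1/2 \<and> -1/2 < sc a3 x \<and> sc a3 x \<le> 1/2"
proof
  assume "x \<in> cell a2 a3"
  then show "-1/2 < sc a2 x \<and> sc a2 x \<le> 1/2 \<and> -1/2 < sc a3 x \<and> sc a3 x \<le> 1/2"
    by (auto simp: cell_def sc_lin)
next
  assume "-1/2 < sc a2 x \<and> sc a2 x \<le> 1/2 \<and> -1/2 < sc a3 x \<and> sc a3 x \<le> 1/2"
  then show "x \<in> cell a2 a3" unfolding cell_def using decomp[of x] by (intro CollectI exI[of _ "sc a2 x"] exI[of _ "sc a3 x"]) auto
qed

lemma interior_cell: "interior (cell a2 a3) = {x. \<bar>sc a2 x\<bar> < 1/2 \<and> \<bar>sc a3 x\<bar> < 1/2}"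
proof (rule interior_unique)
  show "open {x. \<bar>sc a2 x\<bar> < 1/2 \<and> \<bar>sc a3 x\<bar> < 1/2}"
    unfolding sc_def by (intro open_Collect_conj open_Collect_less continuous_intros) (use nz in auto)
  show "{x. \<bar>sc a2 x\<bar> < 1/2 \<and> \<bar>sc a3 x\<bar> < 1/2} \<subseteq> cell a2 a3" by (auto simp: cell_iff)
  fix T assume T: "T \<subseteq> cell a2 a3" "open T"
  show "T \<subseteq> {x. \<bar>sc a2 x\<bar> < 1/2 \<and> \<bar>sc a3 x\<bar> < 1/2}"
  proof
    fix x assume x: "x \<in> T"
    \<comment> \<open>The cell is half-open: small steps along \<open>a2\<close> and
      \<open>a3\<close> stay in the open set \<open>T\<close> and turn the weak upper bounds into
      strict ones, while the lower bounds are strict already.\<close>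
    have ev: "eventually (\<lambda>e. x + e *\<^sub>R a \<in> T) (at_right 0)" for a
    proof -
      have "((\<lambda>e. x + e *\<^sub>R a) \<longlongrightarrow> x + 0 *\<^sub>R a) (at_right 0)" by (intro tendsto_intros)
      then show ?thesis using T(2) x by (auto simp: tendsto_def)
    qed
    have s: "sc b (x + e *\<^sub>R a) = sc b x + e * sc b a" for a b e by (simp add: sc_def inner_add_left add_divide_distrib)
    have one: "sc a2 a2 = 1" "sc a3 a3 = 1" using nz by (auto simp: sc_def)
    have "eventually (\<lambda>e. x + e *\<^sub>R a2 \<in> T \<and> x + e *\<^sub>R a3 \<in> T \<and> e > 0) (at_right 0)"
      using ev[of a2] ev[of a3] eventually_at_right_less[of "0::real"] by eventually_elim auto
    then obtain e where e: "e > 0" "x + e *\<^sub>R a2 \<in> cell a2 a3" "x + e *\<^sub>R a3 \<in> cell a2 a3"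
      using T(1) eventually_happens'[OF trivial_limit_at_right_real] by blast
    then have "sc a2 x + e \<le> 1/2" "sc a3 x + e \<le> 1/2" by (auto simp: cell_iff s one)
    then show "x \<in> {x. \<bar>sc a2 x\<bar> < 1/2 \<and> \<bar>sc a3 x\<bar> < 1/2}" using e(1) subsetD[OF T(1) x] by (auto simp: cell_iff)
  qed
qed

lemma interior_strip: "interior (strip a2 a3) = {y. \<bar>sc a2 (snd y)\<bar> < 1/2 \<and> \<bar>sc a3 (snd y)\<bar> < 1/2}"
  by (auto simp: strip_def interior_Times interior_cell)

lemma strip_iff: "y \<in> strip a2 a3 \<longleftrightarrow> -1/2 < sc a2 (snd y) \<and> sc a2 (snd y) \<le> 1/2 \<and> -1/2 < sc a3 (snd y) \<and> sc a3 (snd y) \<le> 1/2"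
  by (cases y) (simp add: strip_def cell_iff)

text \<open>Links the measure on pairs of coordinates with the measure on the vector type, to which
  the determinant formula for linear images is applied.\<close>

lemma lborel_vec2: "(lborel :: (real^2) measure) = distr lborel borel (\<lambda>p. \<chi> i. if i = 1 then fst p else snd p)" (is "_ = distr _ _ ?E")
proof (rule lborel_eqI)
  have m [measurable]: "?E \<in> borel_measurable borel"
  proof (intro borel_measurable_continuous_onI)
    have c: "continuous_on UNIV (\<lambda>p::real \<times> real. if i = (1::2) then fst p else snd p)" for i
      by (cases "i = 1") (auto intro!: continuous_intros)
    show "continuous_on UNIV ?E" by (rule continuous_on_vec_lambda, rule c)
  qed
  fix l u :: "real^2" assume le: "\<And>b. b \<in> Basis \<Longrightarrow> l \<bullet> b \<le> u \<bullet> b"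
  have l12: "l $ i \<le> u $ i" for i using le[of "axis i 1"] by (simp add: axis_in_Basis_iff inner_axis)
  have "?E -` box l u = {l$1<..<u$1} \<times> {l$2<..<u$2}"
    by (auto simp: mem_box_cart forall_2)
  then have "emeasure (distr lborel borel ?E) (box l u) = emeasure lborel ({l$1<..<u$1} \<times> {l$2<..<u$2})"
    by (subst emeasure_distr) auto
  also have "\<dots> = emeasure lborel {l$1<..<u$1} * emeasure lborel {l$2<..<u$2}"
    by (rule emeasure_lborel_Times) auto
  also have "\<dots> = ennreal ((u$1 - l$1) * (u$2 - l$2))" using l12 by (simp add: ennreal_mult)
  also have "(u$1 - l$1) * (u$2 - l$2) = (\<Prod>b\<in>Basis. (u - l) \<bullet> b)"
  proof -
    have "(Basis :: (real^2) set) = range (\<lambda>i. axis i 1)" by (auto simp: Basis_vec_def)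
    moreover have "inj (\<lambda>i::2. axis i (1::real))" by (auto simp: inj_def axis_eq_axis)
    ultimately have "(\<Prod>b\<in>Basis. (u - l) \<bullet> b) = (\<Prod>i\<in>UNIV. (u - l) \<bullet> axis i 1)"
      using prod.reindex[of "\<lambda>i::2. axis i (1::real)" UNIV "\<lambda>b. (u - l) \<bullet> b"] by (simp add: o_def)
    then show ?thesis by (simp add: inner_axis UNIV_2)
  qed
  finally show "emeasure (distr lborel borel ?E) (box l u) = ennreal (\<Prod>b\<in>Basis. (u - l) \<bullet> b)" .
qed simp

text \<open>The coordinate map \<open>B\<close> is linear, and its determinant has modulus 1/D, once
  more by Lagrange's identity.\<close>

lemma emeasure_cell_map:
  assumes "bounded T" "T \<in> sets borel"
  shows "ennreal D * emeasure lborel ((\<lambda>p. fst p *\<^sub>R a2 + snd p *\<^sub>R a3) -` T) = emeasure lborel T"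
proof -
  define B :: "real^2 \<Rightarrow> real^2" where "B y = (\<chi> i. if i = 1 then sc a2 y else sc a3 y)" for y
  have lin: "linear B"
    by (rule linearI) (simp_all add: B_def sc_def vec_eq_iff inner_add_left add_divide_distrib)
  have det: "\<bar>det (matrix B)\<bar> = 1 / D"
  proof -
    define d where "d = a2$1 * a3$2 - a2$2 * a3$1"
    have "d\<^sup>2 = (a2 \<bullet> a2) * (a3 \<bullet> a3) - (a2 \<bullet> a3)\<^sup>2"
      by (simp add: d_def inner_vec_def sum_2 power2_eq_square algebra_simps)
    then have "d\<^sup>2 = D\<^sup>2" using orth by (simp add: D_def power_mult_distrib dot_square_norm)
    then have dD: "\<bar>d\<bar> = D" using D_pos by (metis abs_of_pos power2_eq_iff abs_minus_cancel)
    have "det (matrix B) = d / ((a2 \<bullet> a2) * (a3 \<bullet> a3))"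
      unfolding det_2 by (simp add: matrix_def B_def sc_def d_def inner_axis inner_axis' diff_divide_distrib)
    moreover have "(a2 \<bullet> a2) * (a3 \<bullet> a3) = D * D" by (simp add: D_def dot_square_norm power2_eq_square)
    ultimately show ?thesis using dD D_pos by (simp add: abs_divide)
  qed
  let ?E = "\<lambda>p. (\<chi> i. if i = 1 then fst p else snd p) :: real^2"
  have BT: "B ` T = {w. w$1 *\<^sub>R a2 + w$2 *\<^sub>R a3 \<in> T}"
  proof (intro set_eqI iffI)
    fix w assume "w \<in> B ` T"
    then show "w \<in> {w. w$1 *\<^sub>R a2 + w$2 *\<^sub>R a3 \<in> T}" by (auto simp: B_def decomp)
  next
    fix w :: "real^2" assume w: "w \<in> {w. w$1 *\<^sub>R a2 + w$2 *\<^sub>R a3 \<in> T}"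
    have "w = B (w$1 *\<^sub>R a2 + w$2 *\<^sub>R a3)" by (simp add: B_def sc_lin vec_eq_iff forall_2)
    with w show "w \<in> B ` T" by blast
  qed
  have em: "emeasure lborel S = ennreal (measure lebesgue S)" if "S \<in> lmeasurable" "S \<in> sets borel" for S :: "(real^2) set"
  proof -
    have "emeasure lborel S = emeasure lebesgue S" using that by simp
    also have "\<dots> = ennreal (measure lebesgue S)" using that by (intro emeasure_eq_measure2)
    finally show ?thesis .
  qed
  have T: "T \<in> lmeasurable" using assms by (intro bounded_set_imp_lmeasurable) auto
  have meas: "{w :: real^2. w$1 *\<^sub>R a2 + w$2 *\<^sub>R a3 \<in> T} \<in> sets borel"
  proof -
    have "(\<lambda>w :: real^2. w$1 *\<^sub>R a2 + w$2 *\<^sub>R a3) \<in> borel_measurable borel"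
      by (intro borel_measurable_continuous_onI continuous_intros)
    from measurable_sets[OF this assms(2)] show ?thesis by (simp add: vimage_def)
  qed
  have E [measurable]: "?E \<in> borel_measurable borel"
  proof (intro borel_measurable_continuous_onI)
    have c: "continuous_on UNIV (\<lambda>p::real \<times> real. if i = (1::2) then fst p else snd p)" for i
      by (cases "i = 1") (auto intro!: continuous_intros)
    show "continuous_on UNIV ?E" by (rule continuous_on_vec_lambda, rule c)
  qed
  have "emeasure lborel {w :: real^2. w$1 *\<^sub>R a2 + w$2 *\<^sub>R a3 \<in> T} = emeasure lborel ((\<lambda>p. fst p *\<^sub>R a2 + snd p *\<^sub>R a3) -` T)"
    using meas by (subst lborel_vec2, subst emeasure_distr) (auto simp: vimage_def)
  then have e1: "emeasure lborel ((\<lambda>p. fst p *\<^sub>R a2 + snd p *\<^sub>R a3) -` T) = emeasure lborel {w :: real^2. w$1 *\<^sub>R a2 + w$2 *\<^sub>R a3 \<in> T}" by simp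
  have e2: "emeasure lborel {w :: real^2. w$1 *\<^sub>R a2 + w$2 *\<^sub>R a3 \<in> T} = ennreal (measure lebesgue T / D)"
  proof -
    have "B ` T \<in> lmeasurable" "measure lebesgue (B ` T) = measure lebesgue T / D"
      using measurable_linear_image[OF lin T] measure_linear_image[OF lin T] det by auto
    then show ?thesis unfolding BT[symmetric] using em meas[folded BT] by simp
  qed
  have e3: "emeasure lborel T = ennreal (measure lebesgue T)"
    using T assms(2) by (rule em)
  show ?thesis unfolding e1 e2 e3 using D_pos by (subst ennreal_mult[symmetric]) auto
qed

text \<open>It suffices to compare on boxes, where the first coordinate splits off and
  \<open>emeasure_cell_map\<close> treats the plane.\<close>

lemma lborel_Phi: "lborel = density (distr lborel borel Phi) (\<lambda>_. ennreal D)"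
proof (rule lborel_eqI)
  fix l u :: "real \<times> (real^2)" assume le: "\<And>b. b \<in> Basis \<Longrightarrow> l \<bullet> b \<le> u \<bullet> b"
  obtain l1 l2 u1 u2 where lu: "l = (l1, l2)" "u = (u1, u2)" by (cases l; cases u) auto
  let ?p = "\<lambda>p. fst p *\<^sub>R a2 + snd p *\<^sub>R a3"
  have b: "box l u = {l1<..<u1} \<times> box l2 u2"
    by (auto simp: lu mem_box Basis_prod_def)
  have bs: "?p -` box l2 u2 \<in> sets borel"
  proof -
    have "?p \<in> borel_measurable borel" by (intro borel_measurable_continuous_onI continuous_intros)
    from measurable_sets[OF this, of "box l2 u2"] show ?thesis by simp
  qed
  have "Phi -` box l u = {l1<..<u1} \<times> (?p -` box l2 u2)"
    by (auto simp: b Phi_def)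
  then have "emeasure (density (distr lborel borel Phi) (\<lambda>_. ennreal D)) (box l u)
      = ennreal D * emeasure lborel ({l1<..<u1} \<times> (?p -` box l2 u2))"
    by (simp add: emeasure_density_const emeasure_distr)
  also have "\<dots> = ennreal D * (emeasure lborel {l1<..<u1} * emeasure lborel (?p -` box l2 u2))"
    using bs by (simp add: emeasure_lborel_Times)
  also have "\<dots> = emeasure lborel {l1<..<u1} * emeasure lborel (box l2 u2)"
    unfolding mult.left_commute[of "ennreal D"] by (subst emeasure_cell_map) auto
  also have "\<dots> = emeasure lborel (box l u)"
    unfolding b by (rule emeasure_lborel_Times[symmetric]) auto
  also have "\<dots> = (\<Prod>b\<in>Basis. (u - l) \<bullet> b)" using le by (simp add: emeasure_lborel_box)
  finally show "emeasure (density (distr lborel borel Phi) (\<lambda>_. ennreal D)) (box l u) = (\<Prod>b\<in>Basis. (u - l) \<bullet> b)" .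
qed simp

lemma strip_borel [measurable]: "strip a2 a3 \<in> sets borel"
proof -
  have "strip a2 a3 = Psi -` (UNIV \<times> {-1/2<..1/2} \<times> {-1/2<..1/2}) \<inter> space borel"
    by (auto simp: strip_iff Psi_def)
  moreover have "UNIV \<times> {-1/2<..1/2} \<times> {-1/2<..1/2} \<in> sets (borel :: (real \<times> real \<times> real) measure)"
    by (intro borel_Times) auto
  ultimately show ?thesis using measurable_sets[OF measurable_Phi_Psi(2)] by metis
qed

lemma AE_hilb_lborel: "(AE y in hilb a2 a3. P y) \<longleftrightarrow> (AE y in lborel. y \<in> strip a2 a3 \<longrightarrow> P y)"
  using strip_borel by (subst AE_restrict_space_iff) (auto simp: AE_completion_iff)

lemma AE_tube_lborel: "(AE z in tube. P z) \<longleftrightarrow> (AE z in lborel. z \<in> UNIV \<times> {-1/2..1/2} \<times> {-1/2..1/2} \<longrightarrow> P z)"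
  unfolding tube_density
  by (subst AE_density) (auto simp: indicator_def intro!: borel_measurable_indicator borel_closed closed_Times)

text \<open>Under \<open>Phi\<close> the half-open strip and the closed tube differ by a null set
  only. Conversely, the preimage of a Borel null set under \<open>Psi\<close> is null by
  \<open>lborel_Phi\<close>.\<close>

lemma AE_hilb_iff: "(AE y in hilb a2 a3. P y) \<longleftrightarrow> (AE z in tube. P (Phi z))"
proof
  assume "AE y in hilb a2 a3. P y"
  then have "AE y in density (distr lborel borel Phi) (\<lambda>_. ennreal D). y \<in> strip a2 a3 \<longrightarrow> P y"
    unfolding lborel_Phi[symmetric] AE_hilb_lborel[symmetric] .
  then have "AE y in distr lborel borel Phi. y \<in> strip a2 a3 \<longrightarrow> P y"
    using D_pos by (subst (asm) AE_density) auto
  then have "AE z in lborel. Phi z \<in> strip a2 a3 \<longrightarrow> P (Phi z)" by (intro AE_distrD[of Phi _ borel]) auto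
  then have "AE z in tube. Phi z \<in> strip a2 a3 \<longrightarrow> P (Phi z)" by (auto simp: AE_tube_lborel)
  then show "AE z in tube. P (Phi z)"
    using AE_tube by eventually_elim (auto simp: strip_iff Phi_def sc_lin)
next
  assume "AE z in tube. P (Phi z)"
  then have "AE z in lborel. z \<in> UNIV \<times> {-1/2..1/2} \<times> {-1/2..1/2} \<longrightarrow> P (Phi z)" by (simp only: AE_tube_lborel)
  then obtain N where N: "{z. \<not> (z \<in> UNIV \<times> {-1/2..1/2} \<times> {-1/2..1/2} \<longrightarrow> P (Phi z))} \<subseteq> N" "N \<in> null_sets lborel"
    unfolding eventually_ae_filter by auto
  have m: "Psi -` N \<in> sets borel" using measurable_sets[OF measurable_Phi_Psi(2), of N] N(2) by auto
  have "emeasure lborel (Psi -` N) = ennreal D * emeasure lborel (Phi -` (Psi -` N))"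
    using m by (subst lborel_Phi) (simp add: emeasure_density_const emeasure_distr)
  also have "Phi -` (Psi -` N) = N" by (auto simp: vimage_def)
  finally have "Psi -` N \<in> null_sets lborel" using m null_setsD1[OF N(2)] by (intro null_setsI) simp_all
  then have "AE y in lborel. y \<notin> Psi -` N" by (rule AE_not_in)
  then have "AE y in lborel. y \<in> strip a2 a3 \<longrightarrow> P y"
  proof eventually_elim
    case (elim y)
    show ?case
    proof
      assume "y \<in> strip a2 a3"
      then have Q: "Psi y \<in> UNIV \<times> {-1/2..1/2} \<times> {-1/2..1/2}" by (auto simp: strip_iff Psi_def)
      have "Psi y \<notin> N" using elim by simp
      from contra_subsetD[OF N(1) this] Q have "P (Phi (Psi y))" by (simp only: mem_Collect_eq not_not simp_thms)
      then show "P y" by simp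
    qed
  qed
  then show "AE y in hilb a2 a3. P y" by (simp add: AE_hilb_lborel)
qed

text \<open>The measure on the strip is a restriction of completed Lebesgue measure, the one on the
  tube is Borel. Functions are therefore transferred through a Borel representative
  \<open>g\<close>, with Jacobian \<open>D\<close>.\<close>

lemma hilb_integral:
  fixes f :: "real \<times> (real^2) \<Rightarrow> 'b::euclidean_space"
  assumes g: "g \<in> borel_measurable tube" and eq: "AE z in tube. f (Phi z) = g z"
  shows "f \<in> borel_measurable (hilb a2 a3)" "integrable (hilb a2 a3) f \<longleftrightarrow> integrable tube g"
    "integral\<^sup>L (hilb a2 a3) f = D *\<^sub>R integral\<^sup>L tube g"
proof -
  have g' [measurable]: "g \<in> borel_measurable borel" using g unfolding measurable_cong_sets[OF sets_tube_borel refl] .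
  define f' where "f' y = g (Psi y)" for y
  have f' [measurable]: "f' \<in> borel_measurable borel" unfolding f'_def by measurable
  have st: "strip a2 a3 \<in> sets lebesgue" using strip_borel by auto
  have ae: "AE y in hilb a2 a3. f y = f' y" unfolding AE_hilb_iff f'_def using eq by simp
  then have ae': "AE y in lebesgue. indicator (strip a2 a3) y *\<^sub>R f' y = indicator (strip a2 a3) y *\<^sub>R f y"
    unfolding AE_hilb_lborel AE_completion_iff by eventually_elim (auto simp: indicator_def)
  have "(\<lambda>y. indicator (strip a2 a3) y *\<^sub>R f' y) \<in> borel_measurable lborel" by measurable
  then have "(\<lambda>y. indicator (strip a2 a3) y *\<^sub>R f' y) \<in> borel_measurable lebesgue" by (rule measurable_completion)
  from borel_measurable_AE[OF this ae'] show fm: "f \<in> borel_measurable (hilb a2 a3)"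
    using st by (subst borel_measurable_restrict_space_iff) auto
  have f'm: "f' \<in> borel_measurable (hilb a2 a3)"
    using measurable_restrict_space1[OF measurable_completion[of f' lborel borel]] by simp
  let ?I = "UNIV \<times> {-1/2..1/2} \<times> {-1/2..1/2} :: (real \<times> real \<times> real) set"
  have I: "?I \<in> sets borel" by (intro borel_closed closed_Times) auto
  have tube: "tube = density lborel (\<lambda>z. ennreal (indicator ?I z))" unfolding tube_density by (simp add: ennreal_indicator)
  let ?k = "\<lambda>y. indicator (strip a2 a3) y *\<^sub>R f' y"
  have aeI: "AE z in lborel. indicator (strip a2 a3) (Phi z) *\<^sub>R f' (Phi z) = indicator ?I z *\<^sub>R g z"
  proof -
    have "AE z in tube. Phi z \<in> strip a2 a3" using AE_tube by eventually_elim (auto simp: strip_iff Phi_def sc_lin)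
    then have "AE z in lborel. z \<in> ?I \<longrightarrow> Phi z \<in> strip a2 a3" by (simp only: AE_tube_lborel)
    then show ?thesis
    proof eventually_elim
      case (elim z)
      have "f' (Phi z) = g z" by (simp add: f'_def)
      moreover have "Phi z \<in> strip a2 a3 \<Longrightarrow> z \<in> ?I" by (auto simp: strip_iff Phi_def sc_lin mem_Times_iff)
      ultimately show ?case using elim by (auto simp: indicator_def)
    qed
  qed
  have mPhi: "(\<lambda>z. ?k (Phi z)) \<in> borel_measurable lborel" by measurable
  have mg: "(\<lambda>z. indicator ?I z *\<^sub>R g z) \<in> borel_measurable lborel" using I by measurable
  have k: "?k \<in> borel_measurable (distr lborel borel Phi)" "?k \<in> borel_measurable lborel" by measurable
  have i1: "integrable lborel ?k \<longleftrightarrow> integrable tube g"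
  proof -
    have "integrable lborel ?k \<longleftrightarrow> integrable (distr lborel borel Phi) (\<lambda>y. D *\<^sub>R ?k y)"
      by (subst lborel_Phi, subst integrable_density) (use k D_pos in auto)
    also have "\<dots> \<longleftrightarrow> integrable lborel (\<lambda>z. D *\<^sub>R ?k (Phi z))" by (rule integrable_distr_eq) measurable
    also have "\<dots> \<longleftrightarrow> integrable lborel (\<lambda>z. ?k (Phi z))"
    proof
      assume "integrable lborel (\<lambda>z. D *\<^sub>R ?k (Phi z))"
      then have "integrable lborel (\<lambda>z. (1 / D) *\<^sub>R D *\<^sub>R ?k (Phi z))" by (rule integrable_scaleR_right)
      then show "integrable lborel (\<lambda>z. ?k (Phi z))" using D_pos by simp
    qed (rule integrable_scaleR_right)
    also have "\<dots> \<longleftrightarrow> integrable lborel (\<lambda>z. indicator ?I z *\<^sub>R g z)" by (rule integrable_cong_AE[OF mPhi mg aeI])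
    also have "\<dots> \<longleftrightarrow> integrable tube g" unfolding tube using I g by (subst integrable_density) (auto simp: tube)
    finally show ?thesis .
  qed
  have i2: "integral\<^sup>L lborel ?k = D *\<^sub>R integral\<^sup>L tube g"
  proof -
    have "integral\<^sup>L lborel ?k = (\<integral>y. D *\<^sub>R ?k y \<partial>distr lborel borel Phi)"
      by (subst lborel_Phi, subst integral_density) (use k D_pos in auto)
    also have "\<dots> = (\<integral>z. D *\<^sub>R ?k (Phi z) \<partial>lborel)" by (rule integral_distr) measurable
    also have "\<dots> = D *\<^sub>R (\<integral>z. ?k (Phi z) \<partial>lborel)" by (rule integral_scaleR_right)
    also have "(\<integral>z. ?k (Phi z) \<partial>lborel) = (\<integral>z. indicator ?I z *\<^sub>R g z \<partial>lborel)" by (rule integral_cong_AE[OF mPhi mg aeI])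
    also have "\<dots> = integral\<^sup>L tube g" unfolding tube using I g' by (subst integral_density) auto
    finally show ?thesis .
  qed
  have "integrable (hilb a2 a3) f \<longleftrightarrow> integrable (hilb a2 a3) f'" by (rule integrable_cong_AE[OF fm f'm ae])
  also have "\<dots> \<longleftrightarrow> integrable lebesgue ?k" using st by (subst integrable_restrict_space) (auto simp: mult.commute)
  also have "\<dots> \<longleftrightarrow> integrable lborel ?k" by (rule integrable_completion[OF k(2)])
  finally show "integrable (hilb a2 a3) f \<longleftrightarrow> integrable tube g" using i1 by simp
  have "integral\<^sup>L (hilb a2 a3) f = integral\<^sup>L (hilb a2 a3) f'" by (rule integral_cong_AE[OF fm f'm ae])
  also have "\<dots> = integral\<^sup>L lebesgue ?k" using st by (subst integral_restrict_space) auto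
  also have "\<dots> = integral\<^sup>L lborel ?k" by (rule integral_completion[OF k(2)])
  finally show "integral\<^sup>L (hilb a2 a3) f = D *\<^sub>R integral\<^sup>L tube g" using i2 by simp
qed

text \<open>Coordinatewise, a real function measurable for the completion agrees almost everywhere
  with a Borel one.\<close>

lemma borel_representative:
  fixes f :: "real \<times> (real^2) \<Rightarrow> 'b::euclidean_space"
  assumes "f \<in> borel_measurable (hilb a2 a3)"
  obtains g where "g \<in> borel_measurable tube" "AE z in tube. f (Phi z) = g z"
proof -
  have st: "strip a2 a3 \<in> sets lebesgue" using strip_borel by auto
  let ?F = "\<lambda>y. indicator (strip a2 a3) y *\<^sub>R f y"
  have F: "?F \<in> borel_measurable (completion lborel)"
    using assms st by (subst (asm) borel_measurable_restrict_space_iff) auto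
  have "\<exists>g\<in>borel_measurable lborel. AE y in lborel. ?F y \<bullet> b = g y" for b
  proof (rule completion_ex_borel_measurable_real)
    show "(\<lambda>y. ?F y \<bullet> b) \<in> borel_measurable (completion lborel)"
      by (rule borel_measurable_inner[OF F]) simp
  qed
  then have "\<forall>b. \<exists>g. g \<in> borel_measurable lborel \<and> (AE y in lborel. ?F y \<bullet> b = g y)" by blast
  from choice[OF this] obtain G where G: "\<And>b. G b \<in> borel_measurable lborel"
    "\<And>b. AE y in lborel. ?F y \<bullet> b = G b y" by blast
  define g where "g y = (\<Sum>b\<in>Basis. G b y *\<^sub>R b)" for y :: "real \<times> (real^2)"
  have [measurable]: "g \<in> borel_measurable borel" unfolding g_def using G(1) by measurable
  have "AE y in lborel. \<forall>b\<in>Basis. ?F y \<bullet> b = G b y" using G(2) by (intro AE_finite_allI) auto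
  then have "AE y in lborel. y \<in> strip a2 a3 \<longrightarrow> f y = g y"
  proof eventually_elim
    case (elim y)
    have "?F y = (\<Sum>b\<in>Basis. (?F y \<bullet> b) *\<^sub>R b)" by (rule euclidean_representation[symmetric])
    also have "\<dots> = g y" unfolding g_def using elim by (intro sum.cong) auto
    finally show ?case by (auto simp: indicator_def)
  qed
  then have "AE z in tube. f (Phi z) = g (Phi z)" using AE_hilb_iff by (simp add: AE_hilb_lborel)
  moreover have "(\<lambda>z. g (Phi z)) \<in> borel_measurable tube"
    unfolding measurable_cong_sets[OF sets_tube_borel refl] by measurable
  ultimately show ?thesis using that by blast
qed

end

section \<open>Weak derivatives\<close>

lemma L2_mult_integrable:
  assumes "f \<in> L2 M" "g \<in> L2 M"
  shows "integrable M (\<lambda>x. f x * g x)"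
proof (rule Bochner_Integration.integrable_bound)
  show "integrable M (\<lambda>x. (cmod (f x))\<^sup>2 + (cmod (g x))\<^sup>2)" using assms by (simp add: L2_def)
  show "AE x in M. norm (f x * g x) \<le> norm ((cmod (f x))\<^sup>2 + (cmod (g x))\<^sup>2)"
  proof (intro AE_I2)
    fix x
    have "0 \<le> (cmod (f x) - cmod (g x))\<^sup>2" by simp
    moreover have "0 \<le> cmod (f x) * cmod (g x)" by simp
    ultimately have "cmod (f x) * cmod (g x) \<le> (cmod (f x))\<^sup>2 + (cmod (g x))\<^sup>2" unfolding power2_diff by linarith
    then show "norm (f x * g x) \<le> norm ((cmod (f x))\<^sup>2 + (cmod (g x))\<^sup>2)" by (simp add: norm_mult)
  qed
qed (use assms in \<open>auto simp: L2_def\<close>)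

lemma L2_add: "f \<in> L2 M \<Longrightarrow> g \<in> L2 M \<Longrightarrow> (\<lambda>x. f x + g x) \<in> L2 M"
proof -
  assume f: "f \<in> L2 M" and g: "g \<in> L2 M"
  have "integrable M (\<lambda>x. (cmod (f x + g x))\<^sup>2)"
  proof (rule Bochner_Integration.integrable_bound)
    show "integrable M (\<lambda>x. 2 * (cmod (f x))\<^sup>2 + 2 * (cmod (g x))\<^sup>2)" using f g by (simp add: L2_def)
    show "AE x in M. norm ((cmod (f x + g x))\<^sup>2) \<le> norm (2 * (cmod (f x))\<^sup>2 + 2 * (cmod (g x))\<^sup>2)"
    proof (intro AE_I2)
      fix x
      have "(cmod (f x + g x))\<^sup>2 \<le> (cmod (f x) + cmod (g x))\<^sup>2" by (intro power_mono norm_triangle_ineq) auto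
      also have "\<dots> \<le> 2 * (cmod (f x))\<^sup>2 + 2 * (cmod (g x))\<^sup>2"
        using zero_le_power2[of "cmod (f x) - cmod (g x)"] unfolding power2_diff power2_sum by linarith
      finally show "norm ((cmod (f x + g x))\<^sup>2) \<le> norm (2 * (cmod (f x))\<^sup>2 + 2 * (cmod (g x))\<^sup>2)" by simp
    qed
  qed (use f g in \<open>auto simp: L2_def\<close>)
  then show ?thesis using f g by (auto simp: L2_def)
qed

lemma L2_cmult: "f \<in> L2 M \<Longrightarrow> (\<lambda>x. c * f x) \<in> L2 M"
  by (auto simp: L2_def norm_mult power_mult_distrib)

lemma L2_zero: "(\<lambda>x. 0) \<in> L2 M" by (simp add: L2_def)

lemma L2_sum: "finite B \<Longrightarrow> (\<And>b. b \<in> B \<Longrightarrow> f b \<in> L2 M) \<Longrightarrow> (\<lambda>x. \<Sum>b\<in>B. f b x) \<in> L2 M"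
  by (induction B rule: finite_induct) (auto intro: L2_add L2_zero)

lemma L2_diff: "f \<in> L2 M \<Longrightarrow> g \<in> L2 M \<Longrightarrow> (\<lambda>x. f x - g x) \<in> L2 M"
  using L2_add[of f M "\<lambda>x. -1 * g x"] L2_cmult[of g M "-1"] by simp

lemma L2_pairing_tendsto:
  assumes U: "\<And>n. U n \<in> L2 M" and u: "u \<in> L2 M" and \<phi>: "\<phi> \<in> L2 M"
    and lim: "(\<lambda>n. L2norm M (\<lambda>x. U n x - u x)) \<longlonglongrightarrow> 0"
  shows "(\<lambda>n. \<integral>x. U n x * \<phi> x \<partial>M) \<longlonglongrightarrow> (\<integral>x. u x * \<phi> x \<partial>M)"
proof -
  define A where "A n = (\<integral>x. (cmod (U n x - u x))\<^sup>2 \<partial>M)" for n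
  define B where "B = (\<integral>x. (cmod (\<phi> x))\<^sup>2 \<partial>M)"
  have A0: "A n \<ge> 0" "B \<ge> 0" for n by (auto simp: A_def B_def)
  have "(\<lambda>n. (L2norm M (\<lambda>x. U n x - u x))\<^sup>2) \<longlonglongrightarrow> 0\<^sup>2" by (intro tendsto_intros lim)
  moreover have "(L2norm M (\<lambda>x. U n x - u x))\<^sup>2 = A n" for n
    using A0(1)[of n] by (simp add: L2norm_def A_def)
  ultimately have Al: "A \<longlonglongrightarrow> 0" by simp
  have d: "(\<lambda>x. U n x - u x) \<in> L2 M" for n by (intro L2_diff U u)
  have est: "norm ((\<integral>x. U n x * \<phi> x \<partial>M) - (\<integral>x. u x * \<phi> x \<partial>M)) \<le> t * A n + B / t" if t: "t > 0" for n t
  proof -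
    have "(\<integral>x. U n x * \<phi> x \<partial>M) - (\<integral>x. u x * \<phi> x \<partial>M) = (\<integral>x. (U n x - u x) * \<phi> x \<partial>M)"
      using L2_mult_integrable[OF U \<phi>] L2_mult_integrable[OF u \<phi>] by (simp add: left_diff_distrib)
    also have "norm \<dots> \<le> (\<integral>x. norm ((U n x - u x) * \<phi> x) \<partial>M)" by simp
    also have "\<dots> \<le> (\<integral>x. t * (cmod (U n x - u x))\<^sup>2 + (cmod (\<phi> x))\<^sup>2 / t \<partial>M)"
    proof (rule integral_mono)
      show "integrable M (\<lambda>x. norm ((U n x - u x) * \<phi> x))" by (intro integrable_norm L2_mult_integrable d \<phi>)
      show "integrable M (\<lambda>x. t * (cmod (U n x - u x))\<^sup>2 + (cmod (\<phi> x))\<^sup>2 / t)" using d[of n] \<phi> by (simp add: L2_def)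
      fix x
      define a b where "a = cmod (U n x - u x)" "b = cmod (\<phi> x)"
      have "0 \<le> (t * a - b)\<^sup>2" by simp
      then have "2 * (t * a) * b \<le> t\<^sup>2 * a\<^sup>2 + b\<^sup>2" unfolding power2_diff by (simp add: power_mult_distrib)
      moreover have "0 \<le> t * a * b" using t by (simp add: a_b_def)
      ultimately have "t * a * b \<le> t\<^sup>2 * a\<^sup>2 + b\<^sup>2" by linarith
      then have "t * a * b / t \<le> (t\<^sup>2 * a\<^sup>2 + b\<^sup>2) / t" using t by (intro divide_right_mono) auto
      also have "\<dots> = t * a\<^sup>2 + b\<^sup>2 / t" using t by (simp add: add_divide_distrib power2_eq_square)
      finally show "norm ((U n x - u x) * \<phi> x) \<le> t * (cmod (U n x - u x))\<^sup>2 + (cmod (\<phi> x))\<^sup>2 / t"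
        using t by (simp add: a_b_def norm_mult)
    qed
    also have "\<dots> = t * A n + B / t" using d[of n] \<phi> by (simp add: L2_def A_def B_def)
    finally show ?thesis .
  qed
  show ?thesis
  proof (rule LIMSEQ_I)
    fix r :: real assume r: "r > 0"
    \<comment> \<open>This weight makes B / t less than r / 2; thereafter \<open>n\<close> is taken
      so large that t times A n is less than r / 2 as well.\<close>
    define t where "t = 2 * (B + 1) / r"
    have t: "t > 0" using r A0 by (simp add: t_def add_nonneg_pos)
    have "B / t < r / 2" using r A0(2) by (simp add: t_def field_simps)
    moreover have "\<exists>N. \<forall>n\<ge>N. norm (A n - 0) < r / (2 * t)" using Al r t by (intro LIMSEQ_D) auto
    then obtain N where N: "\<And>n. n \<ge> N \<Longrightarrow> A n < r / (2 * t)" using A0 by auto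
    have "t * A n < r / 2" if "n \<ge> N" for n
      using mult_strict_left_mono[OF N[OF that] t] t by simp
    ultimately show "\<exists>N. \<forall>n\<ge>N. norm ((\<integral>x. U n x * \<phi> x \<partial>M) - (\<integral>x. u x * \<phi> x \<partial>M)) < r"
      using est[OF t] by (intro exI[of _ N]) (smt (verit) field_sum_of_halves)
  qed
qed

lemma L2_bounded_support:
  fixes f :: "'a::euclidean_space \<Rightarrow> complex"
  assumes f: "f \<in> borel_measurable (lebesgue_on S)" and S: "S \<in> sets lebesgue" and T: "T \<in> lmeasurable"
    and sup: "\<And>x. x \<in> S \<Longrightarrow> x \<notin> T \<Longrightarrow> f x = 0" and le: "\<And>x. x \<in> S \<Longrightarrow> norm (f x) \<le> K"
  shows "f \<in> L2 (lebesgue_on S)"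
proof -
  have "integrable (lebesgue_on S) (\<lambda>x. (cmod (f x))\<^sup>2)"
  proof (rule integrableI_bounded_set[where A = "S \<inter> T" and B = "K\<^sup>2"])
    show "S \<inter> T \<in> sets (lebesgue_on S)" using S T by (auto simp: sets_restrict_space)
    have "emeasure (lebesgue_on S) (S \<inter> T) = emeasure lebesgue (S \<inter> T)"
      using S by (subst emeasure_restrict_space) auto
    also have "\<dots> \<le> emeasure lebesgue T" using T by (intro emeasure_mono) auto
    also have "\<dots> < \<infinity>" using T by (auto simp: fmeasurable_def)
    finally show "emeasure (lebesgue_on S) (S \<inter> T) < \<infinity>" .
    show "AE x in lebesgue_on S. x \<in> S \<inter> T \<longrightarrow> norm ((cmod (f x))\<^sup>2) \<le> K\<^sup>2"
      using le by (auto intro!: AE_I2 power_mono)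
    show "AE x in lebesgue_on S. x \<notin> S \<inter> T \<longrightarrow> (cmod (f x))\<^sup>2 = 0"
      using sup by (auto intro!: AE_I2)
  qed (use f in measurable)
  then show ?thesis using f by (simp add: L2_def)
qed

lemma continuous_lebesgue_on:
  fixes f :: "'a::euclidean_space \<Rightarrow> 'b::euclidean_space"
  assumes "continuous_on UNIV f" shows "f \<in> borel_measurable (lebesgue_on S)"
  using assms by (intro measurable_restrict_space1 measurable_completion) (simp add: borel_measurable_continuous_onI)

lemma L2_compact_support:
  fixes f :: "'a::euclidean_space \<Rightarrow> complex"
  assumes "continuous_on UNIV f" "S \<in> sets lebesgue" "compact K" "\<And>x. x \<notin> K \<Longrightarrow> f x = 0"
  shows "f \<in> L2 (lebesgue_on S)"
proof -
  have "compact (f ` K)" using assms by (intro compact_continuous_image) (auto intro: continuous_on_subset)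
  then obtain B where B: "\<And>x. x \<in> f ` K \<Longrightarrow> norm x \<le> B" using compact_imp_bounded bounded_iff by metis
  have "norm (f x) \<le> max B 0" for x
  proof (cases "x \<in> K")
    case True then show ?thesis using B[of "f x"] by (simp add: le_max_iff_disj)
  qed (simp add: assms(4))
  then show ?thesis
    using assms by (intro L2_bounded_support[where T = K and K = "max B 0"] continuous_lebesgue_on) (auto intro: lmeasurable_compact)
qed

lemma Ck_on_imp_continuous: "Ck_on n UNIV f \<Longrightarrow> continuous_on UNIV f"
  by (cases n) (auto intro: differentiable_imp_continuous_on)

lemma test_fun_differentiable: "test_fun \<Omega> \<phi> \<Longrightarrow> \<phi> differentiable (at x)"
proof -
  assume "test_fun \<Omega> \<phi>"
  then have "Ck_on (Suc 0) UNIV \<phi>" unfolding test_fun_def by blast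
  then show ?thesis by (simp add: differentiable_on_def)
qed

lemma test_fun_deriv:
  assumes "test_fun \<Omega> \<phi>" "b \<in> Basis" shows "test_fun \<Omega> (\<lambda>x. frechet_derivative \<phi> (at x) b)"
proof -
  obtain K where K: "compact K" "K \<subseteq> \<Omega>" "\<And>x. x \<notin> K \<Longrightarrow> \<phi> x = 0" using assms by (auto simp: test_fun_def)
  have "Ck_on n UNIV (\<lambda>x. frechet_derivative \<phi> (at x) b)" for n
  proof -
    have "Ck_on (Suc n) UNIV \<phi>" using assms(1) unfolding test_fun_def by blast
    then show ?thesis using assms(2) by simp
  qed
  moreover have "frechet_derivative \<phi> (at x) b = 0" if "x \<notin> K" for x
  proof -
    have "(\<phi> has_derivative (\<lambda>_. 0)) (at x)"
      by (rule has_derivative_transform_within_open[of "\<lambda>_. 0" _ _ _ "- K"])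
        (use K that in \<open>auto intro: compact_imp_closed\<close>)
    then show ?thesis using frechet_derivative_at by metis
  qed
  ultimately show ?thesis unfolding test_fun_def using K by blast
qed

lemma test_fun_L2: "test_fun \<Omega> \<phi> \<Longrightarrow> S \<in> sets lebesgue \<Longrightarrow> \<phi> \<in> L2 (lebesgue_on S)"
  unfolding test_fun_def by (auto intro: L2_compact_support Ck_on_imp_continuous)

lemma test_fun_deriv_sum:
  assumes "test_fun \<Omega> \<phi>"
  shows "frechet_derivative \<phi> (at x) v = (\<Sum>b\<in>Basis. of_real (v \<bullet> b) * frechet_derivative \<phi> (at x) b)"
proof -
  have lin: "linear (frechet_derivative \<phi> (at x))"
    using test_fun_differentiable[OF assms] by (rule linear_frechet_derivative)
  have "frechet_derivative \<phi> (at x) v = frechet_derivative \<phi> (at x) (\<Sum>b\<in>Basis. (v \<bullet> b) *\<^sub>R b)"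
    by (simp add: euclidean_representation)
  also have "\<dots> = (\<Sum>b\<in>Basis. (v \<bullet> b) *\<^sub>R frechet_derivative \<phi> (at x) b)"
    using lin by (simp add: linear_sum linear_cmul o_def)
  finally show ?thesis by (simp add: scaleR_conv_of_real)
qed

lemma integral_lincomb:
  assumes "\<And>b. b \<in> B \<Longrightarrow> integrable M (\<lambda>x. w b x * \<phi> x :: complex)"
  shows "(\<integral>x. (\<Sum>b\<in>B. c b * w b x) * \<phi> x \<partial>M) = (\<Sum>b\<in>B. c b * (\<integral>x. w b x * \<phi> x \<partial>M))"
proof -
  have "(\<integral>x. (\<Sum>b\<in>B. c b * w b x) * \<phi> x \<partial>M) = (\<integral>x. (\<Sum>b\<in>B. c b * (w b x * \<phi> x)) \<partial>M)"
    by (simp add: sum_distrib_right mult.assoc)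
  also have "\<dots> = (\<Sum>b\<in>B. \<integral>x. c b * (w b x * \<phi> x) \<partial>M)"
    using assms by (intro Bochner_Integration.integral_sum integrable_mult_right)
  finally show ?thesis by simp
qed

text \<open>Sobolev spaces provide weak derivatives along basis vectors only, whereas the boundary
  conditions differentiate along lattice vectors; linearity of the derivative of a test function
  bridges this.\<close>

lemma has_weak_deriv_direction:
  assumes "open \<Omega>" and u: "u \<in> L2 (lebesgue_on \<Omega>)" and w: "\<And>b. b \<in> Basis \<Longrightarrow> has_weak_deriv \<Omega> b u (w b)"
  shows "has_weak_deriv \<Omega> v u (\<lambda>x. \<Sum>b\<in>Basis. of_real (v \<bullet> b) * w b x)"
  unfolding has_weak_deriv_def
proof (intro conjI allI impI)
  have wL: "w b \<in> L2 (lebesgue_on \<Omega>)" if "b \<in> Basis" for b using w[OF that] by (simp add: has_weak_deriv_def)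
  then show "(\<lambda>x. \<Sum>b\<in>Basis. of_real (v \<bullet> b) * w b x) \<in> L2 (lebesgue_on \<Omega>)"
    by (intro L2_sum L2_cmult) auto
  fix \<phi> assume \<phi>: "test_fun \<Omega> \<phi>"
  have S: "\<Omega> \<in> sets lebesgue" using assms(1) by auto
  have "(\<integral>x. u x * frechet_derivative \<phi> (at x) v \<partial>lebesgue_on \<Omega>)
    = (\<integral>x. (\<Sum>b\<in>Basis. of_real (v \<bullet> b) * frechet_derivative \<phi> (at x) b) * u x \<partial>lebesgue_on \<Omega>)"
    unfolding test_fun_deriv_sum[OF \<phi>, of _ v] by (simp add: mult.commute)
  also have "\<dots> = (\<Sum>b\<in>Basis. of_real (v \<bullet> b) * (\<integral>x. frechet_derivative \<phi> (at x) b * u x \<partial>lebesgue_on \<Omega>))"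
    using test_fun_L2[OF test_fun_deriv[OF \<phi>] S] u by (intro integral_lincomb L2_mult_integrable)
  also have "\<dots> = (\<Sum>b\<in>Basis. of_real (v \<bullet> b) * - (\<integral>x. w b x * \<phi> x \<partial>lebesgue_on \<Omega>))"
    using w \<phi> by (intro sum.cong refl) (auto simp: has_weak_deriv_def mult.commute)
  also have "\<dots> = - (\<Sum>b\<in>Basis. of_real (v \<bullet> b) * (\<integral>x. w b x * \<phi> x \<partial>lebesgue_on \<Omega>))"
    by (simp add: sum_negf)
  also have "(\<Sum>b\<in>Basis. of_real (v \<bullet> b) * (\<integral>x. w b x * \<phi> x \<partial>lebesgue_on \<Omega>))
    = (\<integral>x. (\<Sum>b\<in>Basis. of_real (v \<bullet> b) * w b x) * \<phi> x \<partial>lebesgue_on \<Omega>)"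
    using test_fun_L2[OF \<phi> S] wL by (intro integral_lincomb[symmetric] L2_mult_integrable)
  finally show "(\<integral>x. u x * frechet_derivative \<phi> (at x) v \<partial>lebesgue_on \<Omega>)
    = - (\<integral>x. (\<Sum>b\<in>Basis. of_real (v \<bullet> b) * w b x) * \<phi> x \<partial>lebesgue_on \<Omega>)" .
qed

lemma has_weak_derivD:
  "has_weak_deriv \<Omega> v u w \<Longrightarrow> test_fun \<Omega> \<phi> \<Longrightarrow>
    (\<integral>x. u x * frechet_derivative \<phi> (at x) v \<partial>lebesgue_on \<Omega>) = - (\<integral>x. w x * \<phi> x \<partial>lebesgue_on \<Omega>)"
  by (auto simp: has_weak_deriv_def)

lemma weak_deriv_works: "has_weak_deriv \<Omega> v u w \<Longrightarrow> has_weak_deriv \<Omega> v u (weak_deriv \<Omega> v u)"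
  unfolding weak_deriv_def by (rule someI[of "has_weak_deriv \<Omega> v u"])

lemma sobolev1_weak_deriv: "sobolev (Suc m) \<Omega> u \<Longrightarrow> b \<in> Basis \<Longrightarrow> has_weak_deriv \<Omega> b u (weak_deriv \<Omega> b u)"
  by (auto intro: weak_deriv_works)

lemma sobolev_L2: "sobolev m \<Omega> u \<Longrightarrow> u \<in> L2 (lebesgue_on \<Omega>)"
  by (cases m) auto

text \<open>The derivative of a test function is a test function, so the choice of the first weak
  derivative does not matter for the existence of the second one.\<close>

lemma sobolev2_weak_deriv:
  assumes "sobolev (Suc (Suc m)) \<Omega> u" "b \<in> Basis"
  shows "has_weak_deriv \<Omega> b (weak_deriv \<Omega> b u) (weak_deriv \<Omega> b (weak_deriv \<Omega> b u))"
proof -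
  obtain w where w: "has_weak_deriv \<Omega> b u w" "sobolev (Suc m) \<Omega> w" using assms by auto
  then obtain w' where w': "has_weak_deriv \<Omega> b w w'" using assms(2) by auto
  note wd = sobolev1_weak_deriv[OF assms]
  have "has_weak_deriv \<Omega> b (weak_deriv \<Omega> b u) w'"
    unfolding has_weak_deriv_def
  proof (intro conjI allI impI)
    show "w' \<in> L2 (lebesgue_on \<Omega>)" using w' by (simp add: has_weak_deriv_def)
    fix \<phi> assume \<phi>: "test_fun \<Omega> \<phi>"
    have "(\<integral>x. weak_deriv \<Omega> b u x * frechet_derivative \<phi> (at x) b \<partial>lebesgue_on \<Omega>)
      = (\<integral>x. w x * frechet_derivative \<phi> (at x) b \<partial>lebesgue_on \<Omega>)"
      using has_weak_derivD[OF wd test_fun_deriv[OF \<phi> assms(2)]]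
        has_weak_derivD[OF w(1) test_fun_deriv[OF \<phi> assms(2)]] by simp
    then show "(\<integral>x. weak_deriv \<Omega> b u x * frechet_derivative \<phi> (at x) b \<partial>lebesgue_on \<Omega>)
      = - (\<integral>x. w' x * \<phi> x \<partial>lebesgue_on \<Omega>)"
      using has_weak_derivD[OF w' \<phi>] by simp
  qed
  then show ?thesis by (rule weak_deriv_works)
qed

section \<open>Tensor products of test functions\<close>

lemma cutoff_tendsto: "\<bar>s\<bar> < 1/2 \<Longrightarrow> (\<lambda>n. cutoff n s) \<longlonglongrightarrow> 1"
proof -
  assume s: "\<bar>s\<bar> < 1/2"
  have fl: "(flat 0 \<longlongrightarrow> 1) at_top"
  proof -
    have "((\<lambda>x::real. exp (- inverse x)) \<longlongrightarrow> exp (- 0)) at_top"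
      by (intro tendsto_intros tendsto_inverse_0_at_top filterlim_ident)
    moreover have "eventually (\<lambda>x::real. exp (- inverse x) = flat 0 x) at_top"
      using eventually_gt_at_top[of "0::real"] by eventually_elim (simp add: flat_def)
    ultimately show ?thesis by (simp add: Lim_transform_eventually)
  qed
  \<comment> \<open>The margin costs n / (n + 1) <= 1 in the argument, which n c outgrows.\<close>
  have *: "(\<lambda>n. flat 0 (real n * c - real n / real (Suc n))) \<longlonglongrightarrow> 1" if c: "c > 0" for c
  proof (rule filterlim_compose[OF fl])
    have "filterlim (\<lambda>n. - 1 + c * real n) at_top sequentially"
      by (rule filterlim_tendsto_add_at_top[OF tendsto_const]) (rule filterlim_tendsto_pos_mult_at_top[OF tendsto_const c filterlim_real_sequentially])
    then show "filterlim (\<lambda>n. real n * c - real n / real (Suc n)) at_top sequentially"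
      by (rule filterlim_at_top_mono) (auto intro!: always_eventually simp: mult.commute)
  qed
  have "(\<lambda>n. complex_of_real (flat 0 (real n * (s + 1/2) - real n / real (Suc n))) *
      of_real (flat 0 (real n * (1/2 - s) - real n / real (Suc n)))) \<longlonglongrightarrow> of_real 1 * of_real 1"
    using s by (intro tendsto_intros *) auto
  moreover have "cutoff n s = complex_of_real (flat 0 (real n * (s + 1/2) - real n / real (Suc n))) *
      of_real (flat 0 (real n * (1/2 - s) - real n / real (Suc n)))" for n
    unfolding cutoff_def bump_def by (simp add: algebra_simps diff_divide_distrib)
  ultimately show "(\<lambda>n. cutoff n s) \<longlonglongrightarrow> 1" by simp
qed

lemma smooth1_cutoff: "smooth1 (cutoff n)" unfolding cutoff_def by (rule smooth1_bump)

lemma norm_cutoff_le: "norm (cutoff n s) \<le> 1" unfolding cutoff_def by (rule norm_bump_le)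

lemma cutoff_eq_0: "\<bar>s\<bar> > 1/2 - 1 / real (Suc n) \<Longrightarrow> cutoff n s = 0"
  unfolding cutoff_def by (rule bump_eq_0) auto

context rect_lattice
begin

definition \<Omega> :: "(real \<times> (real^2)) set" where "\<Omega> = interior (strip a2 a3)"

text \<open>\<open>V1\<close>, \<open>V2\<close>, \<open>V3\<close> form the basis dual to (1, 0),
  (0, a2), (0, a3): inner products with them are the lattice coordinates, which brings
  \<open>tp\<close> into the form of \<open>tensor_deriv\<close>.\<close>

definition V1 :: "real \<times> (real^2)" where "V1 = (1, 0)"
definition V2 :: "real \<times> (real^2)" where "V2 = (0, a2 /\<^sub>R (a2 \<bullet> a2))"
definition V3 :: "real \<times> (real^2)" where "V3 = (0, a3 /\<^sub>R (a3 \<bullet> a3))"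

definition tp :: "(real \<Rightarrow> complex) \<Rightarrow> (real \<Rightarrow> complex) \<Rightarrow> (real \<Rightarrow> complex) \<Rightarrow> real \<times> (real^2) \<Rightarrow> complex" where
  "tp f1 f2 f3 y = f1 (fst y) * f2 (sc a2 (snd y)) * f3 (sc a3 (snd y))"

lemma V_inner: "y \<bullet> V1 = fst y" "y \<bullet> V2 = sc a2 (snd y)" "y \<bullet> V3 = sc a3 (snd y)"
  by (cases y; simp add: V1_def V2_def V3_def sc_def divide_inverse)+

lemma V_V: "V1 \<bullet> V1 = 1" "V1 \<bullet> V2 = 0" "V1 \<bullet> V3 = 0" "(0, a2) \<bullet> V1 = 0" "(0, a2) \<bullet> V2 = 1" "(0, a2) \<bullet> V3 = 0"
  "(0, a3) \<bullet> V1 = 0" "(0, a3) \<bullet> V2 = 0" "(0, a3) \<bullet> V3 = 1"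
  using nz by (auto simp: V1_def V2_def V3_def orth orth')

lemma tp_inner: "tp f1 f2 f3 = (\<lambda>y. f1 (y \<bullet> V1) * f2 (y \<bullet> V2) * f3 (y \<bullet> V3))"
  by (auto simp: tp_def V_inner)

lemma tp_deriv:
  assumes "\<And>x. (f1 has_vector_derivative f1' x) (at x)" "\<And>x. (f2 has_vector_derivative f2' x) (at x)"
    "\<And>x. (f3 has_vector_derivative f3' x) (at x)"
  shows "frechet_derivative (tp f1 f2 f3) (at y) b = of_real (b \<bullet> V1) * tp f1' f2 f3 y
    + of_real (b \<bullet> V2) * tp f1 f2' f3 y + of_real (b \<bullet> V3) * tp f1 f2 f3' y"
  unfolding tp_inner frechet_derivative_at[OF tensor_deriv[OF assms], symmetric] ..

lemma tp_continuous:
  assumes "continuous_on UNIV f1" "continuous_on UNIV f2" "continuous_on UNIV f3"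
  shows "continuous_on UNIV (tp f1 f2 f3)"
proof -
  have "continuous_on UNIV (\<lambda>y. f (y \<bullet> v))" if "continuous_on UNIV f" for f :: "real \<Rightarrow> complex" and v :: "real \<times> (real^2)"
    using that by (auto intro!: continuous_on_compose2[of UNIV f] continuous_intros)
  then show ?thesis unfolding tp_inner using assms by (intro continuous_intros) auto
qed

lemma open_\<Omega>: "open \<Omega>" by (simp add: \<Omega>_def)

lemma \<Omega>_sets: "\<Omega> \<in> sets lebesgue" using open_\<Omega> by auto

lemma \<Omega>_iff: "y \<in> \<Omega> \<longleftrightarrow> \<bar>sc a2 (snd y)\<bar> < 1/2 \<and> \<bar>sc a3 (snd y)\<bar> < 1/2"
  by (simp add: \<Omega>_def interior_strip)

lemma tp_test_fun:
  assumes "smooth1 f1" "smooth1 f2" "smooth1 f3" and f1: "\<And>x. \<bar>x\<bar> > R \<Longrightarrow> f1 x = 0"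
    and f2: "\<And>x. \<bar>x\<bar> > r \<Longrightarrow> f2 x = 0" and f3: "\<And>x. \<bar>x\<bar> > r \<Longrightarrow> f3 x = 0" and r: "r < 1/2"
  shows "test_fun \<Omega> (tp f1 f2 f3)"
  unfolding test_fun_def
proof (intro conjI allI exI[of _ "Phi ` ({-R..R} \<times> {-r..r} \<times> {-r..r})"] impI)
  show "Ck_on n UNIV (tp f1 f2 f3)" for n unfolding tp_inner by (intro Ck_on_tensor assms)
  show "compact (Phi ` ({-R..R} \<times> {-r..r} \<times> {-r..r}))"
    by (intro compact_continuous_image continuous_on_subset[OF continuous_Phi] compact_Times) auto
  show "Phi ` ({-R..R} \<times> {-r..r} \<times> {-r..r}) \<subseteq> \<Omega>" using r by (auto simp: \<Omega>_iff Phi_def sc_lin)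
  fix y assume y: "y \<notin> Phi ` ({-R..R} \<times> {-r..r} \<times> {-r..r})"
  have "Psi y \<notin> {-R..R} \<times> {-r..r} \<times> {-r..r}"
  proof
    assume "Psi y \<in> {-R..R} \<times> {-r..r} \<times> {-r..r}"
    from image_eqI[OF _ this, of y Phi] y show False by simp
  qed
  then have "\<bar>fst y\<bar> > R \<or> \<bar>sc a2 (snd y)\<bar> > r \<or> \<bar>sc a3 (snd y)\<bar> > r"
    by (auto simp: Psi_def)
  then show "tp f1 f2 f3 y = 0" using f1 f2 f3 by (auto simp: tp_def)
qed

lemma slab_lmeasurable: "{y \<in> \<Omega>. \<bar>fst y\<bar> \<le> R} \<in> lmeasurable"
proof (rule bounded_set_imp_lmeasurable)
  have "{y \<in> \<Omega>. \<bar>fst y\<bar> \<le> R} \<subseteq> Phi ` ({-R..R} \<times> {-1/2..1/2} \<times> {-1/2..1/2})"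
  proof
    fix y assume "y \<in> {y \<in> \<Omega>. \<bar>fst y\<bar> \<le> R}"
    then have "Psi y \<in> {-R..R} \<times> {-1/2..1/2} \<times> {-1/2..1/2}" by (auto simp: \<Omega>_iff Psi_def)
    from image_eqI[OF _ this, of y Phi] show "y \<in> Phi ` ({-R..R} \<times> {-1/2..1/2} \<times> {-1/2..1/2})" by simp
  qed
  moreover have "compact (Phi ` ({-R..R} \<times> {-1/2..1/2} \<times> {-1/2..1/2}))"
    by (intro compact_continuous_image continuous_on_subset[OF continuous_Phi] compact_Times) auto
  ultimately show "bounded {y \<in> \<Omega>. \<bar>fst y\<bar> \<le> R}" using bounded_subset compact_imp_bounded by blast
  have "closed {y :: real \<times> (real^2). \<bar>fst y\<bar> \<le> R}" by (intro closed_Collect_le continuous_intros)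
  then have "\<Omega> \<inter> {y. \<bar>fst y\<bar> \<le> R} \<in> sets lebesgue" using \<Omega>_sets by auto
  then show "{y \<in> \<Omega>. \<bar>fst y\<bar> \<le> R} \<in> sets lebesgue" by (simp add: Collect_conj_eq)
qed

lemma tp_L2:
  assumes c: "continuous_on UNIV f1" "continuous_on UNIV f2" "continuous_on UNIV f3" and f1: "\<And>x. \<bar>x\<bar> > R \<Longrightarrow> f1 x = 0"
  shows "tp f1 f2 f3 \<in> L2 (lebesgue_on \<Omega>)"
proof -
  have b: "\<exists>B\<ge>0. \<forall>x\<in>{-r..r}. norm (f x) \<le> B" if "continuous_on UNIV f" for f :: "real \<Rightarrow> complex" and r
  proof -
    have "compact (f ` {-r..r})" using that by (intro compact_continuous_image) (auto intro: continuous_on_subset)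
    then obtain B where "\<And>x. x \<in> f ` {-r..r} \<Longrightarrow> norm x \<le> B" using compact_imp_bounded bounded_iff by metis
    then show ?thesis by (intro exI[of _ "max B 0"]) (auto simp: le_max_iff_disj)
  qed
  obtain B1 where B1: "B1 \<ge> 0" "\<forall>x\<in>{-R..R}. norm (f1 x) \<le> B1" using b[OF c(1)] by blast
  obtain B2 where B2: "B2 \<ge> 0" "\<forall>x\<in>{-1/2..1/2}. norm (f2 x) \<le> B2" using b[OF c(2), of "1/2"] by auto
  obtain B3 where B3: "B3 \<ge> 0" "\<forall>x\<in>{-1/2..1/2}. norm (f3 x) \<le> B3" using b[OF c(3), of "1/2"] by auto
  show ?thesis
  proof (rule L2_bounded_support[OF continuous_lebesgue_on[OF tp_continuous[OF c]] \<Omega>_sets slab_lmeasurable[of R]])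
    show "tp f1 f2 f3 y = 0" if "y \<in> \<Omega>" "y \<notin> {y \<in> \<Omega>. \<bar>fst y\<bar> \<le> R}" for y
      using that f1 by (auto simp: tp_def)
    show "norm (tp f1 f2 f3 y) \<le> B1 * B2 * B3" if "y \<in> \<Omega>" for y
    proof -
      have "norm (f1 (fst y)) \<le> B1"
      proof (cases "\<bar>fst y\<bar> > R")
        case False
        then have "fst y \<in> {-R..R}" by auto
        then show ?thesis using B1(2) by blast
      qed (simp add: f1 B1(1))
      moreover have "sc a2 (snd y) \<in> {-1/2..1/2}" "sc a3 (snd y) \<in> {-1/2..1/2}"
        using that by (auto simp: \<Omega>_iff)
      then have "norm (f2 (sc a2 (snd y))) \<le> B2" "norm (f3 (sc a3 (snd y))) \<le> B3"
        using B2(2) B3(2) by blast+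
      ultimately show ?thesis unfolding tp_def norm_mult using B1(1) B2(1) B3(1) by (intro mult_mono mult_nonneg_nonneg) auto
    qed
  qed
qed

text \<open>Plane waves do not vanish at the faces, so their products are no test functions on
  \<open>\<Omega>\<close>. The cutoffs repair this and disappear in the limit: they tend to 1 at
  every point of \<open>\<Omega>\<close>, dominated by the product without cutoffs.\<close>

lemma cutoff_limit:
  assumes g: "g \<in> L2 (lebesgue_on \<Omega>)" and c: "continuous_on UNIV f1" "continuous_on UNIV f2" "continuous_on UNIV f3"
    and f1: "\<And>x. \<bar>x\<bar> > R \<Longrightarrow> f1 x = 0"
  shows "(\<lambda>n. \<integral>y. g y * tp f1 (\<lambda>s. f2 s * cutoff n s) (\<lambda>s. f3 s * cutoff n s) y \<partial>lebesgue_on \<Omega>)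
    \<longlonglongrightarrow> (\<integral>y. g y * tp f1 f2 f3 y \<partial>lebesgue_on \<Omega>)"
proof (rule integral_dominated_convergence)
  have tpL: "tp f1 f2 f3 \<in> L2 (lebesgue_on \<Omega>)" by (rule tp_L2[OF c f1])
  show "integrable (lebesgue_on \<Omega>) (\<lambda>y. norm (g y * tp f1 f2 f3 y))"
    by (intro integrable_norm L2_mult_integrable g tpL)
  show "(\<lambda>y. g y * tp f1 f2 f3 y) \<in> borel_measurable (lebesgue_on \<Omega>)"
    using L2_mult_integrable[OF g tpL] by auto
  have cc: "continuous_on UNIV (cutoff n)" for n by (rule smooth1_cont[OF smooth1_cutoff])
  have "tp f1 (\<lambda>s. f2 s * cutoff n s) (\<lambda>s. f3 s * cutoff n s) \<in> L2 (lebesgue_on \<Omega>)" for n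
    by (rule tp_L2[OF c(1) _ _ f1]) (intro continuous_intros c cc)+
  from L2_mult_integrable[OF g this]
  show "(\<lambda>y. g y * tp f1 (\<lambda>s. f2 s * cutoff n s) (\<lambda>s. f3 s * cutoff n s) y) \<in> borel_measurable (lebesgue_on \<Omega>)" for n
    by auto
  have eq: "tp f1 (\<lambda>s. f2 s * cutoff n s) (\<lambda>s. f3 s * cutoff n s) y
    = tp f1 f2 f3 y * (cutoff n (sc a2 (snd y)) * cutoff n (sc a3 (snd y)))" for n and y :: "real \<times> (real^2)"
    by (simp add: tp_def mult_ac)
  show "AE y in lebesgue_on \<Omega>. norm (g y * tp f1 (\<lambda>s. f2 s * cutoff n s) (\<lambda>s. f3 s * cutoff n s) y) \<le> norm (g y * tp f1 f2 f3 y)" for n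
  proof (intro AE_I2)
    fix y :: "real \<times> (real^2)"
    have "norm (cutoff n (sc a2 (snd y)) * cutoff n (sc a3 (snd y))) \<le> 1"
      unfolding norm_mult by (intro mult_le_one norm_cutoff_le) auto
    then have "norm (g y * tp f1 f2 f3 y) * norm (cutoff n (sc a2 (snd y)) * cutoff n (sc a3 (snd y))) \<le> norm (g y * tp f1 f2 f3 y)"
      by (intro mult_left_le) auto
    then show "norm (g y * tp f1 (\<lambda>s. f2 s * cutoff n s) (\<lambda>s. f3 s * cutoff n s) y) \<le> norm (g y * tp f1 f2 f3 y)"
      unfolding eq by (simp add: norm_mult mult.assoc)
  qed
  show "AE y in lebesgue_on \<Omega>. (\<lambda>n. g y * tp f1 (\<lambda>s. f2 s * cutoff n s) (\<lambda>s. f3 s * cutoff n s) y) \<longlonglongrightarrow> g y * tp f1 f2 f3 y"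
  proof (intro AE_I2)
    fix y assume "y \<in> space (lebesgue_on \<Omega>)"
    then have y: "\<bar>sc a2 (snd y)\<bar> < 1/2" "\<bar>sc a3 (snd y)\<bar> < 1/2" by (auto simp: \<Omega>_iff)
    have "(\<lambda>n. g y * (tp f1 f2 f3 y * (cutoff n (sc a2 (snd y)) * cutoff n (sc a3 (snd y))))) \<longlonglongrightarrow> g y * (tp f1 f2 f3 y * (1 * 1))"
      by (intro tendsto_intros cutoff_tendsto y)
    then show "(\<lambda>n. g y * tp f1 (\<lambda>s. f2 s * cutoff n s) (\<lambda>s. f3 s * cutoff n s) y) \<longlonglongrightarrow> g y * tp f1 f2 f3 y"
      unfolding eq by simp
  qed
qed

text \<open>\<open>weak_deriv\<close> is an arbitrary choice. Two weak derivatives agree on test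
  functions, and \<open>cutoff_limit\<close> extends this to products that do not vanish at the
  faces.\<close>

lemma weak_deriv_pairing_unique:
  assumes w: "has_weak_deriv \<Omega> v u w" "has_weak_deriv \<Omega> v u w'" and s: "smooth1 f1" "smooth1 f2" "smooth1 f3"
    and f1: "\<And>x. \<bar>x\<bar> > R \<Longrightarrow> f1 x = 0"
  shows "(\<integral>y. w y * tp f1 f2 f3 y \<partial>lebesgue_on \<Omega>) = (\<integral>y. w' y * tp f1 f2 f3 y \<partial>lebesgue_on \<Omega>)"
proof -
  have L: "w \<in> L2 (lebesgue_on \<Omega>)" "w' \<in> L2 (lebesgue_on \<Omega>)" using w by (auto simp: has_weak_deriv_def)
  note c = s[THEN smooth1_cont]
  have t: "test_fun \<Omega> (tp f1 (\<lambda>s. f2 s * cutoff n s) (\<lambda>s. f3 s * cutoff n s))" for n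
    by (rule tp_test_fun[where R = R and r = "1/2 - 1 / real (Suc n)"]) (use s f1 in \<open>auto intro!: smooth1_mult smooth1_cutoff simp: cutoff_eq_0\<close>)
  have "(\<integral>y. w y * tp f1 (\<lambda>s. f2 s * cutoff n s) (\<lambda>s. f3 s * cutoff n s) y \<partial>lebesgue_on \<Omega>)
    = (\<integral>y. w' y * tp f1 (\<lambda>s. f2 s * cutoff n s) (\<lambda>s. f3 s * cutoff n s) y \<partial>lebesgue_on \<Omega>)" for n
    using has_weak_derivD[OF w(1) t[of n]] has_weak_derivD[OF w(2) t[of n]] by simp
  note eq = this
  show ?thesis by (rule LIMSEQ_unique[OF cutoff_limit[OF L(1) c f1, unfolded eq] cutoff_limit[OF L(2) c f1]])
qed

text \<open>A representative of the derivative along \<open>v\<close> assembled from the chosen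
  basis derivatives, which are the ones that \<open>has_trace\<close> approximates in L^2.\<close>

definition lin_deriv :: "real \<times> (real^2) \<Rightarrow> (real \<times> (real^2) \<Rightarrow> complex) \<Rightarrow> real \<times> (real^2) \<Rightarrow> complex" where
  "lin_deriv v u y = (\<Sum>b\<in>Basis. of_real (v \<bullet> b) * weak_deriv \<Omega> b u y)"

lemma lin_deriv: "sobolev (Suc m) \<Omega> u \<Longrightarrow> has_weak_deriv \<Omega> v u (lin_deriv v u)"
  unfolding lin_deriv_def
  by (intro has_weak_deriv_direction open_\<Omega> sobolev1_weak_deriv) (auto dest: sobolev_L2)

text \<open>By orthogonality the Laplacian is the second x_1-derivative plus the second derivatives
  along a2 and a3, divided by |a2|^2 and |a3|^2. In x_1 both derivatives move to the test function.
  In the lattice directions one of them is moved there and back, so that a derivative of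
  \<open>v2\<close> or \<open>v3\<close> appears, to which the boundary conditions apply.\<close>

lemma laplacian_pairing_compact:
  fixes u
  defines "v2 \<equiv> weak_deriv \<Omega> (0, a2) u" and "v3 \<equiv> weak_deriv \<Omega> (0, a3) u"
  assumes u: "sobolev 2 \<Omega> u" and v: "sobolev 1 \<Omega> v2" "sobolev 1 \<Omega> v3"
    and s: "smooth1 f1" "smooth1 f2" "smooth1 f3" and f1: "\<And>x. \<bar>x\<bar> > R \<Longrightarrow> f1 x = 0"
    and f2: "\<And>x. \<bar>x\<bar> > r \<Longrightarrow> f2 x = 0" and f3: "\<And>x. \<bar>x\<bar> > r \<Longrightarrow> f3 x = 0" and r: "r < 1/2" "R \<ge> 0" "r \<ge> 0"
    and d1: "\<And>x. (f1 has_vector_derivative f1' x) (at x)" "\<And>x. (f1' has_vector_derivative f1'' x) (at x)"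
  shows "(\<integral>y. weak_laplacian \<Omega> u y * tp f1 f2 f3 y \<partial>lebesgue_on \<Omega>)
    = (\<integral>y. u y * tp f1'' f2 f3 y \<partial>lebesgue_on \<Omega>)
      + (\<integral>y. lin_deriv (0, a2) v2 y * tp f1 f2 f3 y \<partial>lebesgue_on \<Omega>) / of_real (a2 \<bullet> a2)
      + (\<integral>y. lin_deriv (0, a3) v3 y * tp f1 f2 f3 y \<partial>lebesgue_on \<Omega>) / of_real (a3 \<bullet> a3)"
proof -
  have supp: "\<And>x. \<bar>x\<bar> > L \<Longrightarrow> f' x = 0" if f: "\<And>x. (f has_vector_derivative f' x) (at x)" "\<And>x. \<bar>x\<bar> > L \<Longrightarrow> f x = 0"
    for f f' :: "real \<Rightarrow> complex" and L
  proof -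
    fix x :: real assume x: "\<bar>x\<bar> > L"
    have op: "open {t. \<bar>t\<bar> > L}" by (intro open_Collect_less continuous_intros)
    have "((\<lambda>t. 0) has_vector_derivative f' x) (at x)"
      by (rule has_vector_derivative_transform_within_open[OF f(1) op]) (use x f(2) in auto)
    then show "f' x = 0" using vector_derivative_unique_at[OF _ has_vector_derivative_const] by blast
  qed
  have un: "f' = g'" if "\<And>x. (f has_vector_derivative f' x) (at x)" "\<And>x. (f has_vector_derivative g' x) (at x)"
    for f f' g' :: "real \<Rightarrow> complex"
    using that vector_derivative_unique_at by (intro ext) blast
  have s1: "smooth1 f1'" using smooth1_deriv[OF s(1)] un[OF d1(1)] by metis
  obtain f2' where f2': "smooth1 f2'" "\<And>x. (f2 has_vector_derivative f2' x) (at x)" using smooth1_deriv[OF s(2)] by blast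
  obtain f3' where f3': "smooth1 f3'" "\<And>x. (f3 has_vector_derivative f3' x) (at x)" using smooth1_deriv[OF s(3)] by blast
  note z1 = supp[OF d1(1) f1] and z2 = supp[OF f2'(2) f2] and z3 = supp[OF f3'(2) f3]
  let ?M = "lebesgue_on \<Omega>"
  have t: "test_fun \<Omega> (tp f1 f2 f3)" by (rule tp_test_fun[OF s f1 f2 f3 r(1)])
  have t1: "test_fun \<Omega> (tp f1' f2 f3)" by (rule tp_test_fun[OF s1 s(2,3) z1 f2 f3 r(1)])
  have t2: "test_fun \<Omega> (tp f1 f2' f3)" by (rule tp_test_fun[OF s(1) f2'(1) s(3) f1 z2 f3 r(1)])
  have t3: "test_fun \<Omega> (tp f1 f2 f3')" by (rule tp_test_fun[OF s(1,2) f3'(1) f1 f2 z3 r(1)])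
  note tL = test_fun_L2[OF _ \<Omega>_sets]
  have u2: "sobolev (Suc (Suc 0)) \<Omega> u" "sobolev (Suc 0) \<Omega> v2" "sobolev (Suc 0) \<Omega> v3" using u v by (simp_all add: numeral_2_eq_2)
  let ?w = "\<lambda>b. weak_deriv \<Omega> b u"
  have w: "has_weak_deriv \<Omega> b u (?w b)" "has_weak_deriv \<Omega> b (?w b) (weak_deriv \<Omega> b (?w b))" if "b \<in> Basis" for b
    using sobolev1_weak_deriv[OF u2(1) that] sobolev2_weak_deriv[OF u2(1) that] .
  have wL: "?w b \<in> L2 ?M" "weak_deriv \<Omega> b (?w b) \<in> L2 ?M" if "b \<in> Basis" for b
    using w[OF that] by (auto simp: has_weak_deriv_def)
  have "(\<integral>y. weak_laplacian \<Omega> u y * tp f1 f2 f3 y \<partial>?M)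
    = (\<integral>y. (\<Sum>b\<in>Basis. 1 * weak_deriv \<Omega> b (?w b) y) * tp f1 f2 f3 y \<partial>?M)" by (simp add: weak_laplacian_def)
  also have "\<dots> = (\<Sum>b\<in>Basis. 1 * (\<integral>y. weak_deriv \<Omega> b (?w b) y * tp f1 f2 f3 y \<partial>?M))"
    by (intro integral_lincomb L2_mult_integrable wL tL[OF t])
  also have "\<dots> = (\<Sum>b\<in>Basis. - (\<integral>y. ?w b y * frechet_derivative (tp f1 f2 f3) (at y) b \<partial>?M))"
    using has_weak_derivD[OF w(2) t] by (intro sum.cong) auto
  also have "\<dots> = (\<Sum>b\<in>Basis. - (of_real (b \<bullet> V1) * (\<integral>y. ?w b y * tp f1' f2 f3 y \<partial>?M)
      + of_real (b \<bullet> V2) * (\<integral>y. ?w b y * tp f1 f2' f3 y \<partial>?M) + of_real (b \<bullet> V3) * (\<integral>y. ?w b y * tp f1 f2 f3' y \<partial>?M)))"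
  proof (intro sum.cong refl arg_cong[of _ _ uminus])
    fix b :: "real \<times> (real^2)" assume b: "b \<in> Basis"
    have i: "integrable ?M (\<lambda>y. ?w b y * tp f1' f2 f3 y)" "integrable ?M (\<lambda>y. ?w b y * tp f1 f2' f3 y)" "integrable ?M (\<lambda>y. ?w b y * tp f1 f2 f3' y)"
      by (intro L2_mult_integrable wL[OF b] tL[OF t1] tL[OF t2] tL[OF t3])+
    have "(\<integral>y. ?w b y * frechet_derivative (tp f1 f2 f3) (at y) b \<partial>?M)
      = (\<integral>y. of_real (b \<bullet> V1) * (?w b y * tp f1' f2 f3 y) + of_real (b \<bullet> V2) * (?w b y * tp f1 f2' f3 y)
          + of_real (b \<bullet> V3) * (?w b y * tp f1 f2 f3' y) \<partial>?M)"
      unfolding tp_deriv[OF d1(1) f2'(2) f3'(2)] by (simp add: algebra_simps)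
    also have "\<dots> = of_real (b \<bullet> V1) * (\<integral>y. ?w b y * tp f1' f2 f3 y \<partial>?M)
      + of_real (b \<bullet> V2) * (\<integral>y. ?w b y * tp f1 f2' f3 y \<partial>?M) + of_real (b \<bullet> V3) * (\<integral>y. ?w b y * tp f1 f2 f3' y \<partial>?M)"
      using i by simp
    finally show "(\<integral>y. ?w b y * frechet_derivative (tp f1 f2 f3) (at y) b \<partial>?M)
      = of_real (b \<bullet> V1) * (\<integral>y. ?w b y * tp f1' f2 f3 y \<partial>?M)
      + of_real (b \<bullet> V2) * (\<integral>y. ?w b y * tp f1 f2' f3 y \<partial>?M) + of_real (b \<bullet> V3) * (\<integral>y. ?w b y * tp f1 f2 f3' y \<partial>?M)" .
  qed
  also have "\<dots> = - (\<Sum>b\<in>Basis. of_real (V1 \<bullet> b) * (\<integral>y. ?w b y * tp f1' f2 f3 y \<partial>?M))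
    - (\<Sum>b\<in>Basis. of_real (V2 \<bullet> b) * (\<integral>y. ?w b y * tp f1 f2' f3 y \<partial>?M))
    - (\<Sum>b\<in>Basis. of_real (V3 \<bullet> b) * (\<integral>y. ?w b y * tp f1 f2 f3' y \<partial>?M))"
    unfolding inner_commute[of V1] inner_commute[of V2] inner_commute[of V3] sum_negf sum.distrib by simp
  also have "(\<Sum>b\<in>Basis. of_real (V1 \<bullet> b) * (\<integral>y. ?w b y * tp f1' f2 f3 y \<partial>?M)) = (\<integral>y. lin_deriv V1 u y * tp f1' f2 f3 y \<partial>?M)"
    unfolding lin_deriv_def by (intro integral_lincomb[symmetric] L2_mult_integrable wL tL[OF t1])
  also have "\<dots> = - (\<integral>y. u y * tp f1'' f2 f3 y \<partial>?M)"
    using has_weak_derivD[OF lin_deriv[OF u2(1), of V1] t1] by (simp add: tp_deriv[OF d1(2) f2'(2) f3'(2)] V_V)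
  also have "(\<Sum>b\<in>Basis. of_real (V2 \<bullet> b) * (\<integral>y. ?w b y * tp f1 f2' f3 y \<partial>?M)) = - (\<integral>y. lin_deriv (0, a2) v2 y * tp f1 f2 f3 y \<partial>?M) / of_real (a2 \<bullet> a2)"
  proof -
    have e: "V2 \<bullet> b = ((0, a2) \<bullet> b) / (a2 \<bullet> a2)" for b by (cases b) (simp add: V2_def divide_inverse)
    have "(\<Sum>b\<in>Basis. of_real (V2 \<bullet> b) * (\<integral>y. ?w b y * tp f1 f2' f3 y \<partial>?M)) = (\<Sum>b\<in>Basis. of_real ((0, a2) \<bullet> b) * (\<integral>y. ?w b y * tp f1 f2' f3 y \<partial>?M)) / of_real (a2 \<bullet> a2)"
      unfolding e by (simp add: sum_divide_distrib)
    also have "(\<Sum>b\<in>Basis. of_real ((0, a2) \<bullet> b) * (\<integral>y. ?w b y * tp f1 f2' f3 y \<partial>?M)) = (\<integral>y. lin_deriv (0, a2) u y * tp f1 f2' f3 y \<partial>?M)"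
      unfolding lin_deriv_def by (intro integral_lincomb[symmetric] L2_mult_integrable wL tL[OF t2])
    also have "\<dots> = (\<integral>y. v2 y * tp f1 f2' f3 y \<partial>?M)"
      using has_weak_derivD[OF lin_deriv[OF u2(1), of "(0, a2)"] t2] has_weak_derivD[OF weak_deriv_works[OF lin_deriv[OF u2(1), of "(0, a2)"]] t2]
      by (simp add: v2_def)
    also have "\<dots> = - (\<integral>y. lin_deriv (0, a2) v2 y * tp f1 f2 f3 y \<partial>?M)"
      using has_weak_derivD[OF lin_deriv[OF u2(2), of "(0, a2)"] t] by (simp add: tp_deriv[OF d1(1) f2'(2) f3'(2)] V_V)
    finally show ?thesis .
  qed
  also have "(\<Sum>b\<in>Basis. of_real (V3 \<bullet> b) * (\<integral>y. ?w b y * tp f1 f2 f3' y \<partial>?M)) = - (\<integral>y. lin_deriv (0, a3) v3 y * tp f1 f2 f3 y \<partial>?M) / of_real (a3 \<bullet> a3)"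
  proof -
    have e: "V3 \<bullet> b = ((0, a3) \<bullet> b) / (a3 \<bullet> a3)" for b by (cases b) (simp add: V3_def divide_inverse)
    have "(\<Sum>b\<in>Basis. of_real (V3 \<bullet> b) * (\<integral>y. ?w b y * tp f1 f2 f3' y \<partial>?M)) = (\<Sum>b\<in>Basis. of_real ((0, a3) \<bullet> b) * (\<integral>y. ?w b y * tp f1 f2 f3' y \<partial>?M)) / of_real (a3 \<bullet> a3)"
      unfolding e by (simp add: sum_divide_distrib)
    also have "(\<Sum>b\<in>Basis. of_real ((0, a3) \<bullet> b) * (\<integral>y. ?w b y * tp f1 f2 f3' y \<partial>?M)) = (\<integral>y. lin_deriv (0, a3) u y * tp f1 f2 f3' y \<partial>?M)"
      unfolding lin_deriv_def by (intro integral_lincomb[symmetric] L2_mult_integrable wL tL[OF t3])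
    also have "\<dots> = (\<integral>y. v3 y * tp f1 f2 f3' y \<partial>?M)"
      using has_weak_derivD[OF lin_deriv[OF u2(1), of "(0, a3)"] t3] has_weak_derivD[OF weak_deriv_works[OF lin_deriv[OF u2(1), of "(0, a3)"]] t3]
      by (simp add: v3_def)
    also have "\<dots> = - (\<integral>y. lin_deriv (0, a3) v3 y * tp f1 f2 f3 y \<partial>?M)"
      using has_weak_derivD[OF lin_deriv[OF u2(3), of "(0, a3)"] t] by (simp add: tp_deriv[OF d1(1) f2'(2) f3'(2)] V_V)
    finally show ?thesis .
  qed
  finally show ?thesis by simp
qed

end

section \<open>Quasi-periodicity\<close>

lemma test_fun_continuous: "test_fun \<Omega> \<phi> \<Longrightarrow> continuous_on UNIV \<phi>"
proof -
  assume "test_fun \<Omega> \<phi>"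
  then have "Ck_on 0 UNIV \<phi>" unfolding test_fun_def by blast
  then show ?thesis by simp
qed

context rect_lattice
begin

text \<open>The strip exceeds its interior by parts of its faces, and these are null in lattice
  coordinates.\<close>

lemma integral_\<Omega>: "(\<integral>y. f y \<partial>lebesgue_on \<Omega>) = (\<integral>y. f y \<partial>hilb a2 a3)" if "f \<in> borel_measurable (hilb a2 a3)"
  for f :: "real \<times> (real^2) \<Rightarrow> 'b::euclidean_space"
proof -
  have st: "strip a2 a3 \<in> sets lebesgue" using strip_borel by auto
  have sub: "\<Omega> \<subseteq> strip a2 a3" unfolding \<Omega>_def by (rule interior_subset)
  have "AE y in hilb a2 a3. y \<in> \<Omega>"
    unfolding AE_hilb_iff using AE_tube by eventually_elim (simp add: \<Omega>_iff Phi_def sc_lin)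
  then have ae: "AE y in lebesgue. y \<in> strip a2 a3 \<longrightarrow> y \<in> \<Omega>" by (simp add: AE_hilb_lborel AE_completion_iff)
  have m: "(\<lambda>y. indicator (strip a2 a3) y *\<^sub>R f y) \<in> borel_measurable lebesgue"
    using that st by (subst (asm) borel_measurable_restrict_space_iff) auto
  have "(\<lambda>y. indicator \<Omega> y *\<^sub>R (indicator (strip a2 a3) y *\<^sub>R f y)) \<in> borel_measurable lebesgue"
    by (rule borel_measurable_scaleR[OF borel_measurable_indicator[OF \<Omega>_sets] m])
  then have m': "(\<lambda>y. indicator \<Omega> y *\<^sub>R f y) \<in> borel_measurable lebesgue"
    by (rule measurable_cong[THEN iffD1, rotated]) (use sub in \<open>auto simp: indicator_def\<close>)
  have "(\<integral>y. f y \<partial>lebesgue_on \<Omega>) = (\<integral>y. indicator \<Omega> y *\<^sub>R f y \<partial>lebesgue)"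
    using \<Omega>_sets by (subst integral_restrict_space) auto
  also have "\<dots> = (\<integral>y. indicator (strip a2 a3) y *\<^sub>R f y \<partial>lebesgue)"
  proof (rule integral_cong_AE[OF m' m])
    show "AE y in lebesgue. indicator \<Omega> y *\<^sub>R f y = indicator (strip a2 a3) y *\<^sub>R f y"
      using ae by eventually_elim (use sub in \<open>auto simp: indicator_def\<close>)
  qed
  also have "\<dots> = (\<integral>y. f y \<partial>hilb a2 a3)"
    using st by (subst integral_restrict_space) auto
  finally show ?thesis .
qed

lemma integral_\<Omega>_continuous:
  fixes f :: "real \<times> (real^2) \<Rightarrow> complex"
  assumes "continuous_on UNIV f"
  shows "(\<integral>y. f y \<partial>lebesgue_on \<Omega>) = D *\<^sub>R (\<integral>z. f (Phi z) \<partial>tube)"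
proof -
  have "(\<lambda>z. f (Phi z)) \<in> borel_measurable tube"
    by (intro measurable_tube_continuous continuous_on_compose2[OF assms continuous_Phi]) auto
  from hilb_integral[OF this, of f] show ?thesis by (simp add: integral_\<Omega>)
qed

definition face :: "real \<Rightarrow> real \<times> real \<Rightarrow> real \<times> (real^2)" where
  "face r p = (fst p, r *\<^sub>R a2 + snd p *\<^sub>R a3)"

definition face_measure :: "(real \<times> real) measure" where
  "face_measure = lebesgue_on (UNIV \<times> {-1/2..1/2})"

lemma integral_face:
  fixes f :: "real \<times> real \<Rightarrow> complex"
  assumes f: "continuous_on UNIV f" and supp: "\<And>p. \<bar>fst p\<bar> > R \<Longrightarrow> f p = 0"
  shows "(\<integral>p. f p \<partial>face_measure) = (\<integral>x. \<integral>t. f (x, t) \<partial>unit_interval \<partial>lborel)"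
proof -
  let ?I = "UNIV \<times> {-1/2..1/2} :: (real \<times> real) set"
  have I: "?I \<in> sets borel" by (intro borel_closed closed_Times) auto
  have fm: "f \<in> borel_measurable borel" using f by (rule borel_measurable_continuous_onI)
  have m: "(\<lambda>p. indicator ?I p *\<^sub>R f p) \<in> borel_measurable lborel" using I fm by (simp add: borel_measurable_indicator)
  have "(\<integral>p. f p \<partial>face_measure) = (\<integral>p. indicator ?I p *\<^sub>R f p \<partial>lebesgue)"
    unfolding face_measure_def using I by (subst integral_restrict_space) auto
  also have "\<dots> = (\<integral>p. indicator ?I p *\<^sub>R f p \<partial>lborel)" by (rule integral_completion[OF m])
  also have "\<dots> = (\<integral>p. indicator ?I p *\<^sub>R f p \<partial>(lborel \<Otimes>\<^sub>M lborel))" by (simp add: lborel_prod)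
  also have "\<dots> = (\<integral>x. \<integral>t. indicator ?I (x, t) *\<^sub>R f (x, t) \<partial>lborel \<partial>lborel)"
  proof (rule lborel_pair.integral_fst'[symmetric])
    have "integrable lborel (\<lambda>p. indicator ({-R..R} \<times> {-1/2..1/2}) p *\<^sub>R f p)"
      by (intro borel_integrable_compact compact_Times continuous_on_subset[OF f]) auto
    moreover have "indicator ({-R..R} \<times> {-1/2..1/2}) p *\<^sub>R f p = indicator ?I p *\<^sub>R f p" for p
    proof (cases "\<bar>fst p\<bar> > R")
      case True then show ?thesis by (simp add: supp)
    next
      case False
      then have "fst p \<in> {-R..R}" by auto
      then show ?thesis by (auto simp: indicator_def mem_Times_iff)
    qed
    ultimately show "integrable (lborel \<Otimes>\<^sub>M lborel) (\<lambda>p. indicator ?I p *\<^sub>R f p)"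
      unfolding lborel_prod by (simp only:)
  qed
  also have "\<dots> = (\<integral>x. \<integral>t. f (x, t) \<partial>unit_interval \<partial>lborel)"
  proof (rule Bochner_Integration.integral_cong[OF refl])
    fix x :: real
    have "(\<lambda>t. f (x, t)) \<in> borel_measurable borel"
      by (intro borel_measurable_continuous_onI continuous_on_compose2[OF f] continuous_intros) auto
    from integral_unit_interval[OF this]
    show "(\<integral>t. indicator ?I (x, t) *\<^sub>R f (x, t) \<partial>lborel) = (\<integral>t. f (x, t) \<partial>unit_interval)"
      by (simp add: indicator_def)
  qed
  finally show ?thesis .
qed

text \<open>In lattice coordinates, Fubini and the fundamental theorem along \<open>a2\<close>:
  since f vanishes at the opposite face, only the face at r contributes, with the outward sign 2
  r.\<close>

lemma classical_trace:
  assumes U: "test_fun UNIV U" and r: "r = 1/2 \<or> r = -1/2"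
    and c: "continuous_on UNIV f1" "continuous_on UNIV f3" and f1: "\<And>x. \<bar>x\<bar> > R \<Longrightarrow> f1 x = 0"
    and f: "\<And>x. (f has_vector_derivative f' x) (at x)" and cf': "continuous_on UNIV f'" and f0: "f (- r) = 0"
  shows "(\<integral>y. frechet_derivative U (at y) (0, a2) * tp f1 f f3 y \<partial>lebesgue_on \<Omega>) + (\<integral>y. U y * tp f1 f' f3 y \<partial>lebesgue_on \<Omega>)
    = of_real (2 * r * D) * f r * (\<integral>p. U (face r p) * (f1 (fst p) * f3 (snd p)) \<partial>face_measure)"
proof -
  have cU: "continuous_on UNIV U" by (rule test_fun_continuous[OF U])
  have dU: "U differentiable (at y)" for y by (rule test_fun_differentiable[OF U])
  have cd: "continuous_on UNIV (\<lambda>y. frechet_derivative U (at y) (0, a2))"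
  proof -
    have "continuous_on UNIV (\<lambda>y. frechet_derivative U (at y) b)" if "b \<in> Basis" for b
      by (rule test_fun_continuous[OF test_fun_deriv[OF U that]])
    then show ?thesis
      by (subst test_fun_deriv_sum[OF U]) (intro continuous_on_sum continuous_on_mult continuous_on_const)
  qed
  have cf: "continuous_on UNIV f" using f by (auto simp: continuous_on_eq_continuous_at intro: has_vector_derivative_continuous)
  define k where "k y = frechet_derivative U (at y) (0, a2) * f (sc a2 (snd y)) + U y * f' (sc a2 (snd y))" for y
  have csc: "continuous_on UNIV (\<lambda>y :: real \<times> (real^2). g (sc a (snd y)))" if "continuous_on UNIV g" "a \<noteq> 0" for g :: "real \<Rightarrow> complex" and a
    unfolding sc_def by (rule continuous_on_compose2[OF that(1)]) (use that(2) in \<open>auto intro!: continuous_intros\<close>)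
  have ck: "continuous_on UNIV k" unfolding k_def by (intro continuous_intros cd cU csc cf cf' nz)
  have cc: "continuous_on UNIV (\<lambda>y. k y * (f1 (fst y) * f3 (sc a3 (snd y))))"
    by (intro continuous_intros ck csc c nz continuous_on_compose2[OF c(1)]) auto
  have i: "integrable (lebesgue_on \<Omega>) (\<lambda>y. frechet_derivative U (at y) (0, a2) * tp f1 f f3 y)"
    "integrable (lebesgue_on \<Omega>) (\<lambda>y. U y * tp f1 f' f3 y)"
  proof -
    have "(\<lambda>y. frechet_derivative U (at y) (0, a2)) \<in> L2 (lebesgue_on \<Omega>)"
      by (subst test_fun_deriv_sum[OF U]) (intro L2_sum L2_cmult test_fun_L2[OF test_fun_deriv[OF U] \<Omega>_sets] finite_Basis)
    then show "integrable (lebesgue_on \<Omega>) (\<lambda>y. frechet_derivative U (at y) (0, a2) * tp f1 f f3 y)"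
      by (rule L2_mult_integrable) (rule tp_L2[OF c(1) cf c(2) f1])
    show "integrable (lebesgue_on \<Omega>) (\<lambda>y. U y * tp f1 f' f3 y)"
      by (rule L2_mult_integrable[OF test_fun_L2[OF U \<Omega>_sets]]) (rule tp_L2[OF c(1) cf' c(2) f1])
  qed
  have "(\<integral>y. frechet_derivative U (at y) (0, a2) * tp f1 f f3 y \<partial>lebesgue_on \<Omega>) + (\<integral>y. U y * tp f1 f' f3 y \<partial>lebesgue_on \<Omega>)
    = (\<integral>y. k y * (f1 (fst y) * f3 (sc a3 (snd y))) \<partial>lebesgue_on \<Omega>)"
    unfolding Bochner_Integration.integral_add[OF i, symmetric] by (simp add: tp_def k_def algebra_simps)
  also have "\<dots> = D *\<^sub>R (\<integral>z. k (Phi z) * (f1 (fst (Phi z)) * f3 (sc a3 (snd (Phi z)))) \<partial>tube)"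
    by (rule integral_\<Omega>_continuous[OF cc])
  also have "(\<integral>z. k (Phi z) * (f1 (fst (Phi z)) * f3 (sc a3 (snd (Phi z)))) \<partial>tube)
    = (\<integral>z. k (Phi z) * (f1 (fst z) * f3 (snd (snd z))) \<partial>tube)" by (simp add: Phi_def sc_lin)
  also have "\<dots> = (\<integral>x. \<integral>p. k (Phi (x, p)) * (f1 x * f3 (snd p)) \<partial>unit_square \<partial>lborel)"
  proof -
    let ?K = "{-R..R} \<times> {-1/2..1/2} \<times> {-1/2..1/2} :: (real \<times> real \<times> real) set"
    let ?g = "\<lambda>z. k (Phi z) * (f1 (fst z) * f3 (snd (snd z)))"
    have cg: "continuous_on UNIV ?g"
      by (intro continuous_intros continuous_on_compose2[OF ck continuous_Phi] continuous_on_compose2[OF c(1)] continuous_on_compose2[OF c(2)]) auto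
    have K: "compact ?K" by (intro compact_Times) auto
    then have "compact (?g ` ?K)" by (intro compact_continuous_image continuous_on_subset[OF cg]) auto
    from compact_imp_bounded[OF this] obtain B where B: "\<And>x. x \<in> ?g ` ?K \<Longrightarrow> norm x \<le> B"
      unfolding bounded_iff by blast
    have "integrable tube ?g"
    proof (rule integrableI_bounded_set[where A = "{z \<in> space tube. \<bar>fst z\<bar> \<le> max R 0}" and B = "max B 0"])
      show "{z \<in> space tube. \<bar>fst z\<bar> \<le> max R 0} \<in> sets tube" by measurable
      show "?g \<in> borel_measurable tube" by (rule measurable_tube_continuous[OF cg])
      show "emeasure tube {z \<in> space tube. \<bar>fst z\<bar> \<le> max R 0} < \<infinity>"
        using le_less_trans[OF tube_slab[of "max R 0"] ennreal_less_top] by simp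
      show "AE z in tube. z \<notin> {z \<in> space tube. \<bar>fst z\<bar> \<le> max R 0} \<longrightarrow> ?g z = 0"
        using f1 by (intro AE_I2) auto
      show "AE z in tube. z \<in> {z \<in> space tube. \<bar>fst z\<bar> \<le> max R 0} \<longrightarrow> norm (?g z) \<le> max B 0"
        using AE_tube
      proof eventually_elim
        case (elim z)
        show ?case
        proof (cases "\<bar>fst z\<bar> > R")
          case True then show ?thesis using f1 by simp
        next
          case False
          then have "z \<in> ?K" using elim by (auto simp: mem_Times_iff)
          from B[OF imageI[OF this]] have "norm (?g z) \<le> B" .
          then show ?thesis by (simp add: le_max_iff_disj)
        qed
      qed
    qed
    then have i: "integrable (lborel \<Otimes>\<^sub>M unit_square) ?g" by (simp add: tube_def)
    show ?thesis unfolding tube_def using tube.integral_fst'[OF i] by simp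
  qed
  also have "\<dots> = (\<integral>x. \<integral>t. of_real (2 * r) * f r * (U (face r (x, t)) * (f1 x * f3 t)) \<partial>unit_interval \<partial>lborel)"
  proof (rule Bochner_Integration.integral_cong[OF refl])
    fix x :: real
    let ?g = "\<lambda>p. k (Phi (x, p)) * (f1 x * f3 (snd p))"
    have cg: "continuous_on UNIV ?g"
      by (intro continuous_intros continuous_on_compose2[OF ck] continuous_on_compose2[OF continuous_Phi] continuous_on_compose2[OF c(2)]) auto
    have "compact (?g ` ({-1/2..1/2} \<times> {-1/2..1/2}))"
      by (intro compact_continuous_image continuous_on_subset[OF cg] compact_Times) auto
    from compact_imp_bounded[OF this] obtain B where B: "\<And>x. x \<in> ?g ` ({-1/2..1/2} \<times> {-1/2..1/2}) \<Longrightarrow> norm x \<le> B"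
      unfolding bounded_iff by blast
    have "integrable unit_square ?g"
    proof (rule unit_square.integrable_const_bound[where B = B])
      show "AE p in unit_square. norm (?g p) \<le> B"
        using AE_unit_square
      proof eventually_elim
        case (elim p)
        then have "p \<in> {-1/2..1/2} \<times> {-1/2..1/2}" by (auto simp: mem_Times_iff)
        from B[OF imageI[OF this]] show ?case .
      qed
      show "?g \<in> borel_measurable unit_square"
        using measurable_square_continuous[OF cg] by (simp cong: measurable_cong_sets add: sets_unit_square)
    qed
    then have i: "integrable (unit_interval \<Otimes>\<^sub>M unit_interval) (case_prod (\<lambda>s t. ?g (s, t)))" by (simp add: unit_square_def case_prod_beta')
    have "(\<integral>p. ?g p \<partial>unit_square) = (\<integral>t. \<integral>s. ?g (s, t) \<partial>unit_interval \<partial>unit_interval)"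
      unfolding unit_square_def using square.integral_snd[OF i] by (simp add: case_prod_beta')
    also have "\<dots> = (\<integral>t. of_real (2 * r) * f r * (U (face r (x, t)) * (f1 x * f3 t)) \<partial>unit_interval)"
    proof (rule Bochner_Integration.integral_cong[OF refl])
      fix t :: real
      let ?G = "\<lambda>s. U (x, s *\<^sub>R a2 + t *\<^sub>R a3) * f s"
      have ks: "continuous_on UNIV (\<lambda>s. k (Phi (x, s, t)))"
        by (intro continuous_on_compose2[OF ck] continuous_on_compose2[OF continuous_Phi] continuous_intros) auto
      have "(\<integral>s. k (Phi (x, s, t)) \<partial>unit_interval) = (\<integral>s. indicator {-1/2..1/2} s *\<^sub>R k (Phi (x, s, t)) \<partial>lborel)"
        by (rule integral_unit_interval) (rule borel_measurable_continuous_onI[OF ks])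
      also have "\<dots> = ?G (1/2) - ?G (-1/2)"
      proof (rule integral_FTC_Icc)
        fix s :: real
        have "((\<lambda>s. (x, s *\<^sub>R a2 + t *\<^sub>R a3)) has_derivative (\<lambda>h. (0, h *\<^sub>R a2))) (at s)"
          by (auto intro!: derivative_eq_intros)
        from has_derivative_compose[OF this dU[unfolded frechet_derivative_works]]
        have "((\<lambda>s. U (x, s *\<^sub>R a2 + t *\<^sub>R a3)) has_derivative (\<lambda>h. frechet_derivative U (at (x, s *\<^sub>R a2 + t *\<^sub>R a3)) (0, h *\<^sub>R a2))) (at s)" .
        moreover have "frechet_derivative U (at y) (0, h *\<^sub>R a2) = h *\<^sub>R frechet_derivative U (at y) (0, a2)" for y h
          using linear_cmul[OF linear_frechet_derivative[OF dU], of y h "(0, a2)"] by simp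
        ultimately have "((\<lambda>s. U (x, s *\<^sub>R a2 + t *\<^sub>R a3)) has_vector_derivative frechet_derivative U (at (x, s *\<^sub>R a2 + t *\<^sub>R a3)) (0, a2)) (at s)"
          by (simp add: has_vector_derivative_def)
        from has_vector_derivative_mult[OF this f]
        have "(?G has_vector_derivative k (Phi (x, s, t))) (at s)"
          by (simp add: k_def Phi_def sc_lin add.commute)
        then show "(?G has_vector_derivative k (Phi (x, s, t))) (at s within {-1/2..1/2})" by (rule has_vector_derivative_at_within)
      qed (use ks in \<open>auto intro: continuous_on_subset\<close>)
      also have "\<dots> = of_real (2 * r) * f r * U (face r (x, t))"
        using r
      proof
        assume r: "r = 1/2"
        show ?thesis using f0[unfolded r] unfolding r by (simp add: face_def)
      next
        assume r: "r = -1/2"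
        show ?thesis using f0[unfolded r] unfolding r by (simp add: face_def)
      qed
      finally have e: "(\<integral>s. k (Phi (x, s, t)) \<partial>unit_interval) = of_real (2 * r) * f r * U (face r (x, t))" .
      have "(\<integral>s. ?g (s, t) \<partial>unit_interval) = (\<integral>s. k (Phi (x, s, t)) \<partial>unit_interval) * (f1 x * f3 t)" by simp
      then show "(\<integral>s. ?g (s, t) \<partial>unit_interval) = of_real (2 * r) * f r * (U (face r (x, t)) * (f1 x * f3 t))"
        unfolding e by (simp add: mult.assoc)
    qed
    finally show "(\<integral>p. ?g p \<partial>unit_square) = (\<integral>t. of_real (2 * r) * f r * (U (face r (x, t)) * (f1 x * f3 t)) \<partial>unit_interval)" .
  qed
  also have "\<dots> = of_real (2 * r) * f r * (\<integral>x. \<integral>t. U (face r (x, t)) * (f1 x * f3 t) \<partial>unit_interval \<partial>lborel)"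
    by (simp only: integral_mult_right_zero)
  also have "(\<integral>x. \<integral>t. U (face r (x, t)) * (f1 x * f3 t) \<partial>unit_interval \<partial>lborel) = (\<integral>p. U (face r p) * (f1 (fst p) * f3 (snd p)) \<partial>face_measure)"
  proof -
    have "continuous_on UNIV (\<lambda>p. U (face r p) * (f1 (fst p) * f3 (snd p)))"
      unfolding face_def by (intro continuous_intros continuous_on_compose2[OF cU] continuous_on_compose2[OF c(1)] continuous_on_compose2[OF c(2)]) auto
    from integral_face[OF this, of R] f1 show ?thesis by simp
  qed
  finally show ?thesis by (simp add: scaleR_conv_of_real mult_ac)
qed

text \<open>Each of the three terms is an L^2 pairing with a fixed function, hence continuous along
  the approximating sequence from the definition of the trace.\<close>

lemma trace_pairing:
  assumes tr: "has_trace \<Omega> face_measure (face r) v \<tau>" and r: "r = 1/2 \<or> r = -1/2"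
    and c: "continuous_on UNIV f1" "continuous_on UNIV f3" and f1: "\<And>x. \<bar>x\<bar> > R \<Longrightarrow> f1 x = 0"
    and f: "\<And>x. (f has_vector_derivative f' x) (at x)" and cf': "continuous_on UNIV f'" and f0: "f (- r) = 0"
  shows "(\<integral>y. lin_deriv (0, a2) v y * tp f1 f f3 y \<partial>lebesgue_on \<Omega>) + (\<integral>y. v y * tp f1 f' f3 y \<partial>lebesgue_on \<Omega>)
    = of_real (2 * r * D) * f r * (\<integral>p. \<tau> p * (f1 (fst p) * f3 (snd p)) \<partial>face_measure)"
proof -
  let ?M = "lebesgue_on \<Omega>"
  obtain U where U: "\<And>n. test_fun UNIV (U n)" and l0: "(\<lambda>n. L2norm ?M (\<lambda>x. U n x - v x)) \<longlonglongrightarrow> 0"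
    and l1: "\<And>b. b \<in> Basis \<Longrightarrow> (\<lambda>n. L2norm ?M (\<lambda>x. frechet_derivative (U n) (at x) b - weak_deriv \<Omega> b v x)) \<longlonglongrightarrow> 0"
    and lt: "(\<lambda>n. L2norm face_measure (\<lambda>p. U n (face r p) - \<tau> p)) \<longlonglongrightarrow> 0"
    and v: "sobolev 1 \<Omega> v" and \<tau>: "\<tau> \<in> L2 face_measure"
    using tr unfolding has_trace_def by blast
  have v1: "sobolev (Suc 0) \<Omega> v" using v by simp
  have cf: "continuous_on UNIV f" using f by (auto simp: continuous_on_eq_continuous_at intro: has_vector_derivative_continuous)
  have L: "tp f1 f f3 \<in> L2 ?M" "tp f1 f' f3 \<in> L2 ?M"
    by (rule tp_L2[OF c(1) cf c(2) f1], assumption, rule tp_L2[OF c(1) cf' c(2) f1], assumption)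
  have vL: "v \<in> L2 ?M" using v by (rule sobolev_L2)
  have wL: "weak_deriv \<Omega> b v \<in> L2 ?M" if "b \<in> Basis" for b
    using sobolev1_weak_deriv[OF v1 that] by (simp add: has_weak_deriv_def)
  have dL: "(\<lambda>x. frechet_derivative (U n) (at x) b) \<in> L2 ?M" if "b \<in> Basis" for b n
    by (rule test_fun_L2[OF test_fun_deriv[OF U that] \<Omega>_sets])
  have A: "(\<lambda>n. \<integral>y. frechet_derivative (U n) (at y) (0, a2) * tp f1 f f3 y \<partial>?M) \<longlonglongrightarrow> (\<integral>y. lin_deriv (0, a2) v y * tp f1 f f3 y \<partial>?M)"
  proof -
    have "(\<lambda>n. \<Sum>b\<in>Basis. of_real ((0, a2) \<bullet> b) * (\<integral>y. frechet_derivative (U n) (at y) b * tp f1 f f3 y \<partial>?M))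
      \<longlonglongrightarrow> (\<Sum>b\<in>Basis. of_real ((0, a2) \<bullet> b) * (\<integral>y. weak_deriv \<Omega> b v y * tp f1 f f3 y \<partial>?M))"
      by (intro tendsto_sum tendsto_mult tendsto_const L2_pairing_tendsto dL wL L l1)
    moreover have "(\<integral>y. frechet_derivative (U n) (at y) (0, a2) * tp f1 f f3 y \<partial>?M)
      = (\<Sum>b\<in>Basis. of_real ((0, a2) \<bullet> b) * (\<integral>y. frechet_derivative (U n) (at y) b * tp f1 f f3 y \<partial>?M))" for n
      by (subst test_fun_deriv_sum[OF U, of n _ "(0, a2)"]) (intro integral_lincomb L2_mult_integrable dL L)
    moreover have "(\<integral>y. lin_deriv (0, a2) v y * tp f1 f f3 y \<partial>?M)
      = (\<Sum>b\<in>Basis. of_real ((0, a2) \<bullet> b) * (\<integral>y. weak_deriv \<Omega> b v y * tp f1 f f3 y \<partial>?M))"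
      unfolding lin_deriv_def by (intro integral_lincomb L2_mult_integrable wL L)
    ultimately show ?thesis by (simp only:)
  qed
  have B: "(\<lambda>n. \<integral>y. U n y * tp f1 f' f3 y \<partial>?M) \<longlonglongrightarrow> (\<integral>y. v y * tp f1 f' f3 y \<partial>?M)"
    by (intro L2_pairing_tendsto test_fun_L2[OF U \<Omega>_sets] vL L l0)
  let ?I = "UNIV \<times> {-1/2..1/2} :: (real \<times> real) set"
  have "?I \<in> sets borel" by (intro borel_closed closed_Times) auto
  then have I: "?I \<in> sets lebesgue" by simp
  have Lf: "(\<lambda>p. f1 (fst p) * f3 (snd p)) \<in> L2 face_measure"
  proof -
    have b: "\<exists>B\<ge>0. \<forall>x\<in>{-s..s}. norm (g x) \<le> B" if "continuous_on UNIV g" for g :: "real \<Rightarrow> complex" and s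
    proof -
      have "compact (g ` {-s..s})" using that by (intro compact_continuous_image) (auto intro: continuous_on_subset)
      from compact_imp_bounded[OF this] obtain B where "\<And>x. x \<in> g ` {-s..s} \<Longrightarrow> norm x \<le> B"
        unfolding bounded_iff by blast
      then show ?thesis by (intro exI[of _ "max B 0"]) (auto simp: le_max_iff_disj)
    qed
    obtain B1 where B1: "B1 \<ge> 0" "\<forall>x\<in>{-R..R}. norm (f1 x) \<le> B1" using b[OF c(1)] by blast
    obtain B3 where B3: "B3 \<ge> 0" "\<forall>x\<in>{-1/2..1/2}. norm (f3 x) \<le> B3" using b[OF c(2), of "1/2"] by auto
    show ?thesis unfolding face_measure_def
    proof (rule L2_bounded_support[OF continuous_lebesgue_on I, where T = "{-R..R} \<times> {-1/2..1/2} :: (real \<times> real) set" and K = "B1 * B3"])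
      show "continuous_on UNIV (\<lambda>p. f1 (fst p) * f3 (snd p))"
        by (intro continuous_intros continuous_on_compose2[OF c(1)] continuous_on_compose2[OF c(2)]) auto
      show "({-R..R} \<times> {-1/2..1/2} :: (real \<times> real) set) \<in> lmeasurable" by (intro lmeasurable_compact compact_Times) auto
      show "f1 (fst p) * f3 (snd p) = 0" if "p \<in> ?I" "p \<notin> {-R..R} \<times> {-1/2..1/2}" for p
      proof -
        have "\<bar>fst p\<bar> > R" using that by (auto simp: mem_Times_iff)
        then show ?thesis by (simp add: f1)
      qed
      show "norm (f1 (fst p) * f3 (snd p)) \<le> B1 * B3" if "p \<in> ?I" for p
      proof -
        have "norm (f3 (snd p)) \<le> B3" using B3(2) that by auto
        moreover have "norm (f1 (fst p)) \<le> B1"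
        proof (cases "\<bar>fst p\<bar> > R")
          case False
          then have "fst p \<in> {-R..R}" by auto
          then show ?thesis using B1(2) by blast
        qed (simp add: f1 B1(1))
        ultimately show ?thesis unfolding norm_mult using B1(1) by (intro mult_mono) auto
      qed
    qed
  qed
  have UL: "(\<lambda>p. U n (face r p)) \<in> L2 face_measure" for n
  proof -
    obtain K where K: "compact K" "\<And>x. x \<notin> K \<Longrightarrow> U n x = 0" using U[of n] unfolding test_fun_def by blast
    have cU: "continuous_on UNIV (U n)" by (rule test_fun_continuous[OF U])
    have cP: "continuous_on UNIV (\<lambda>y :: real \<times> (real^2). (fst y, sc a3 (snd y)))"
      unfolding sc_def using nz by (intro continuous_intros) auto
    show ?thesis unfolding face_measure_def
    proof (rule L2_compact_support[OF _ I])
      show "continuous_on UNIV (\<lambda>p. U n (face r p))"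
        unfolding face_def by (intro continuous_on_compose2[OF cU] continuous_intros) auto
      show "compact ((\<lambda>y. (fst y, sc a3 (snd y))) ` K)"
        by (intro compact_continuous_image K continuous_on_subset[OF cP]) auto
      fix p assume p: "p \<notin> (\<lambda>y. (fst y, sc a3 (snd y))) ` K"
      have "face r p \<notin> K"
      proof
        assume "face r p \<in> K"
        then have "(fst (face r p), sc a3 (snd (face r p))) \<in> (\<lambda>y. (fst y, sc a3 (snd y))) ` K" by (rule imageI)
        with p show False by (simp add: face_def sc_lin)
      qed
      then show "U n (face r p) = 0" by (rule K(2))
    qed
  qed
  have T: "(\<lambda>n. \<integral>p. U n (face r p) * (f1 (fst p) * f3 (snd p)) \<partial>face_measure) \<longlonglongrightarrow> (\<integral>p. \<tau> p * (f1 (fst p) * f3 (snd p)) \<partial>face_measure)"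
    by (intro L2_pairing_tendsto UL \<tau> Lf lt)
  have "(\<lambda>n. of_real (2 * r * D) * f r * (\<integral>p. U n (face r p) * (f1 (fst p) * f3 (snd p)) \<partial>face_measure))
    \<longlonglongrightarrow> (\<integral>y. lin_deriv (0, a2) v y * tp f1 f f3 y \<partial>?M) + (\<integral>y. v y * tp f1 f' f3 y \<partial>?M)"
  proof -
    have "(\<integral>y. frechet_derivative (U n) (at y) (0, a2) * tp f1 f f3 y \<partial>?M) + (\<integral>y. U n y * tp f1 f' f3 y \<partial>?M)
      = of_real (2 * r * D) * f r * (\<integral>p. U n (face r p) * (f1 (fst p) * f3 (snd p)) \<partial>face_measure)" for n
      by (rule classical_trace[OF U r c f1 f cf' f0])
    then show ?thesis using tendsto_add[OF A B] by (simp only:)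
  qed
  moreover have "(\<lambda>n. of_real (2 * r * D) * f r * (\<integral>p. U n (face r p) * (f1 (fst p) * f3 (snd p)) \<partial>face_measure))
    \<longlonglongrightarrow> of_real (2 * r * D) * f r * (\<integral>p. \<tau> p * (f1 (fst p) * f3 (snd p)) \<partial>face_measure)"
    by (intro tendsto_intros T)
  ultimately show ?thesis by (rule LIMSEQ_unique)
qed

text \<open>The two traces come with different approximating sequences; the partition of unity
  \<open>(s + 1/2) + (1/2 - s)\<close> separates the two faces.\<close>

lemma quasi_periodic_pairing:
  assumes qp: "quasi_periodic a2 a3 k v" and \<omega>: "exp (\<i> * of_real \<omega>) = exp (\<i> * of_real (k \<bullet> a2))"
    and c: "continuous_on UNIV f1" "continuous_on UNIV f3" and f1: "\<And>x. \<bar>x\<bar> > R \<Longrightarrow> f1 x = 0"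
  shows "(\<integral>y. lin_deriv (0, a2) v y * tp f1 (\<lambda>s. exp (- \<i> * of_real \<omega> * of_real s)) f3 y \<partial>lebesgue_on \<Omega>)
    = \<i> * of_real \<omega> * (\<integral>y. v y * tp f1 (\<lambda>s. exp (- \<i> * of_real \<omega> * of_real s)) f3 y \<partial>lebesgue_on \<Omega>)"
proof -
  let ?M = "lebesgue_on \<Omega>"
  define e where "e s = exp (- \<i> * of_real \<omega> * of_real s)" for s :: real
  have face: "(\<lambda>(x1, s). (x1, r *\<^sub>R a2 + s *\<^sub>R a3)) = face r" for r
    by (auto simp: face_def fun_eq_iff)
  obtain \<tau>0 \<tau>1 where t0: "has_trace \<Omega> face_measure (face (-1/2)) v \<tau>0" and t1: "has_trace \<Omega> face_measure (face (1/2)) v \<tau>1"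
    and eq: "AE p in face_measure. \<tau>1 p = exp (\<i> * of_real (k \<bullet> a2)) * \<tau>0 p"
    using qp unfolding quasi_periodic_def Let_def face \<Omega>_def[symmetric] face_measure_def[symmetric] by blast
  have de: "(e has_vector_derivative (- \<i> * of_real \<omega>) * e x) (at x)" for x
  proof -
    have d: "((\<lambda>z. exp (- \<i> * of_real \<omega> * z)) has_field_derivative (- \<i> * of_real \<omega>) * exp (- \<i> * of_real \<omega> * z)) (at z)" for z
      by (auto intro!: derivative_eq_intros)
    show ?thesis unfolding e_def by (rule has_vector_derivative_real_field[OF d])
  qed
  have ce: "continuous_on UNIV e" unfolding e_def by (intro continuous_intros)
  let ?e1 = "\<lambda>s. e s * of_real (s + 1/2)" and ?e0 = "\<lambda>s. e s * of_real (1/2 - s)"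
  let ?d1 = "\<lambda>s. e s * 1 + (- \<i> * of_real \<omega>) * e s * of_real (s + 1/2)"
  let ?d0 = "\<lambda>s. e s * (- 1) + (- \<i> * of_real \<omega>) * e s * of_real (1/2 - s)"
  have d1: "(?e1 has_vector_derivative ?d1 s) (at s)" for s
  proof (rule has_vector_derivative_mult[OF de])
    have "((\<lambda>s. s + 1/2) has_real_derivative 1) (at s)" by (auto intro!: derivative_eq_intros)
    from has_vector_derivative_of_real[OF this] show "((\<lambda>s. complex_of_real (s + 1/2)) has_vector_derivative 1) (at s)"
      by (simp only: of_real_1)
  qed
  have d0: "(?e0 has_vector_derivative ?d0 s) (at s)" for s
  proof (rule has_vector_derivative_mult[OF de])
    have "((\<lambda>s. 1/2 - s) has_real_derivative - 1) (at s)" by (auto intro!: derivative_eq_intros)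
    from has_vector_derivative_of_real[OF this] show "((\<lambda>s. complex_of_real (1/2 - s)) has_vector_derivative - 1) (at s)"
      by (simp only: of_real_1 of_real_minus)
  qed
  have c1: "continuous_on UNIV ?d1" "continuous_on UNIV ?d0" by (intro continuous_intros ce)+
  have ce': "continuous_on UNIV ?e1" "continuous_on UNIV ?e0" by (intro continuous_intros ce)+
  have v1: "sobolev (Suc 0) \<Omega> v" using t0 by (simp add: has_trace_def)
  have vL: "v \<in> L2 ?M" using v1 by (rule sobolev_L2)
  have wL: "lin_deriv (0, a2) v \<in> L2 ?M" using lin_deriv[OF v1] by (simp add: has_weak_deriv_def)
  note tL = tp_L2[OF c(1) _ c(2) f1]
  have p1: "(\<integral>y. lin_deriv (0, a2) v y * tp f1 ?e1 f3 y \<partial>?M) + (\<integral>y. v y * tp f1 ?d1 f3 y \<partial>?M)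
    = of_real (2 * (1/2) * D) * ?e1 (1/2) * (\<integral>p. \<tau>1 p * (f1 (fst p) * f3 (snd p)) \<partial>face_measure)"
    by (rule trace_pairing[OF t1 _ c f1 d1 c1(1)]) auto
  have p0: "(\<integral>y. lin_deriv (0, a2) v y * tp f1 ?e0 f3 y \<partial>?M) + (\<integral>y. v y * tp f1 ?d0 f3 y \<partial>?M)
    = of_real (2 * (-1/2) * D) * ?e0 (-1/2) * (\<integral>p. \<tau>0 p * (f1 (fst p) * f3 (snd p)) \<partial>face_measure)"
    by (rule trace_pairing[OF t0 _ c f1 d0 c1(2)]) auto
  have tt: "(\<integral>p. \<tau>1 p * (f1 (fst p) * f3 (snd p)) \<partial>face_measure) = exp (\<i> * of_real \<omega>) * (\<integral>p. \<tau>0 p * (f1 (fst p) * f3 (snd p)) \<partial>face_measure)"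
  proof -
    have cm: "(\<lambda>p. f1 (fst p) * f3 (snd p)) \<in> borel_measurable face_measure"
      unfolding face_measure_def
      by (intro continuous_lebesgue_on continuous_intros continuous_on_compose2[OF c(1)] continuous_on_compose2[OF c(2)]) auto
    have m: "\<tau>0 \<in> borel_measurable face_measure" "\<tau>1 \<in> borel_measurable face_measure"
      using t0 t1 by (auto simp: has_trace_def L2_def)
    have "(\<integral>p. \<tau>1 p * (f1 (fst p) * f3 (snd p)) \<partial>face_measure) = (\<integral>p. exp (\<i> * of_real \<omega>) * (\<tau>0 p * (f1 (fst p) * f3 (snd p))) \<partial>face_measure)"
    proof (rule integral_cong_AE)
      show "AE p in face_measure. \<tau>1 p * (f1 (fst p) * f3 (snd p)) = exp (\<i> * of_real \<omega>) * (\<tau>0 p * (f1 (fst p) * f3 (snd p)))"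
        using eq by eventually_elim (simp add: \<omega>)
    qed (use m cm in \<open>auto intro!: borel_measurable_times\<close>)
    then show ?thesis by simp
  qed
  \<comment> \<open>This cancels the two face contributions, which enter with the factors e(1/2)
    exp(i \<omega>) and -e(-1/2).\<close>
  have ee: "e (1/2) * exp (\<i> * of_real \<omega>) = e (-1/2)"
    unfolding e_def mult_exp_exp by (rule arg_cong[of _ _ exp]) (simp add: field_simps)
  have s1: "(\<integral>y. lin_deriv (0, a2) v y * tp f1 ?e1 f3 y \<partial>?M) + (\<integral>y. lin_deriv (0, a2) v y * tp f1 ?e0 f3 y \<partial>?M)
    = (\<integral>y. lin_deriv (0, a2) v y * tp f1 e f3 y \<partial>?M)"
  proof -
    have "(\<integral>y. lin_deriv (0, a2) v y * tp f1 ?e1 f3 y \<partial>?M) + (\<integral>y. lin_deriv (0, a2) v y * tp f1 ?e0 f3 y \<partial>?M)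
      = (\<integral>y. lin_deriv (0, a2) v y * tp f1 ?e1 f3 y + lin_deriv (0, a2) v y * tp f1 ?e0 f3 y \<partial>?M)"
      by (intro Bochner_Integration.integral_add[symmetric] L2_mult_integrable wL tL ce')
    also have "\<dots> = (\<integral>y. lin_deriv (0, a2) v y * tp f1 e f3 y \<partial>?M)"
      by (rule Bochner_Integration.integral_cong[OF refl]) (simp add: tp_def algebra_simps)
    finally show ?thesis .
  qed
  have s2: "(\<integral>y. v y * tp f1 ?d1 f3 y \<partial>?M) + (\<integral>y. v y * tp f1 ?d0 f3 y \<partial>?M)
    = - (\<i> * of_real \<omega>) * (\<integral>y. v y * tp f1 e f3 y \<partial>?M)"
  proof -
    have "(\<integral>y. v y * tp f1 ?d1 f3 y \<partial>?M) + (\<integral>y. v y * tp f1 ?d0 f3 y \<partial>?M) = (\<integral>y. v y * tp f1 ?d1 f3 y + v y * tp f1 ?d0 f3 y \<partial>?M)"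
      by (intro Bochner_Integration.integral_add[symmetric] L2_mult_integrable vL tL c1)
    also have "\<dots> = (\<integral>y. - (\<i> * of_real \<omega>) * (v y * tp f1 e f3 y) \<partial>?M)"
      by (intro Bochner_Integration.integral_cong refl) (simp add: tp_def algebra_simps)
    finally show ?thesis by (simp only: integral_mult_right_zero)
  qed
  have "(\<integral>y. lin_deriv (0, a2) v y * tp f1 e f3 y \<partial>?M) - (\<i> * of_real \<omega>) * (\<integral>y. v y * tp f1 e f3 y \<partial>?M)
    = of_real D * (e (1/2) * exp (\<i> * of_real \<omega>) - e (-1/2)) * (\<integral>p. \<tau>0 p * (f1 (fst p) * f3 (snd p)) \<partial>face_measure)"
  proof -
    let ?T = "\<integral>p. \<tau>0 p * (f1 (fst p) * f3 (snd p)) \<partial>face_measure"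
    have k1: "of_real (2 * (1/2) * D) * ?e1 (1/2) * t = of_real D * e (1/2) * t" for t by simp
    have k0: "of_real (2 * (-1/2) * D) * ?e0 (-1/2) * t = - (of_real D * e (-1/2) * t)" for t by simp
    have "I - w * J = d * (e1 * x - e0) * t"
      if "i1 + j1 = d * e1 * (x * t)" "i0 + j0 = - (d * e0 * t)" "i1 + i0 = I" "j1 + j0 = - w * J"
      for I J w d e1 e0 x t i1 j1 i0 j0 :: complex
    proof -
      have "I - w * J = (i1 + j1) + (i0 + j0)" using that(3,4) by (simp add: algebra_simps flip: that(3))
      then show ?thesis unfolding that(1,2) by (simp add: algebra_simps)
    qed
    from this[OF p1[unfolded k1 tt] p0[unfolded k0] s1 s2] show ?thesis .
  qed
  then show ?thesis unfolding ee by (simp add: e_def[abs_def])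
qed

end

section \<open>The mode equations of a guided state\<close>

lemma i_square_collect: "\<i> * of_real a * (\<i> * of_real a * x) = - of_real (a\<^sup>2) * x"
proof -
  have "\<i> * of_real a * (\<i> * of_real a * x) = (\<i> * \<i>) * (of_real a * of_real a * x)" by (simp only: mult_ac)
  then show ?thesis by (simp add: power2_eq_square)
qed

context rect_lattice
begin

text \<open>The situation is symmetric in \<open>a2\<close> and \<open>a3\<close>, so the results
  for the faces across \<open>a2\<close> are reused for \<open>a3\<close> after exchanging two
  factors of \<open>tp\<close>.\<close>

lemma swapped: "rect_lattice a3 a2" using nz orth' by unfold_locales auto

lemma strip_swap: "strip a3 a2 = strip a2 a3"
  unfolding strip_def cell_def by (auto; metis add.commute)

lemma \<Omega>_swap: "rect_lattice.\<Omega> a3 a2 = \<Omega>"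
  unfolding rect_lattice.\<Omega>_def[OF swapped] \<Omega>_def strip_swap ..

lemma tp_swap: "rect_lattice.tp a3 a2 f1 f3 f2 = tp f1 f2 f3"
  unfolding rect_lattice.tp_def[OF swapped, abs_def] tp_def[abs_def] by (simp add: mult_ac)

lemma lin_deriv_swap: "rect_lattice.lin_deriv a3 a2 = lin_deriv"
  unfolding rect_lattice.lin_deriv_def[OF swapped, abs_def] lin_deriv_def[abs_def] \<Omega>_swap ..

lemma quasi_periodic_pairing_swap:
  assumes "quasi_periodic a3 a2 k v" "exp (\<i> * of_real \<omega>) = exp (\<i> * of_real (k \<bullet> a3))"
    "continuous_on UNIV f1" "continuous_on UNIV f2" "\<And>x. \<bar>x\<bar> > R \<Longrightarrow> f1 x = 0"
  shows "(\<integral>y. lin_deriv (0, a3) v y * tp f1 f2 (\<lambda>s. exp (- \<i> * of_real \<omega> * of_real s)) y \<partial>lebesgue_on \<Omega>)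
    = \<i> * of_real \<omega> * (\<integral>y. v y * tp f1 f2 (\<lambda>s. exp (- \<i> * of_real \<omega> * of_real s)) y \<partial>lebesgue_on \<Omega>)"
  using rect_lattice.quasi_periodic_pairing[OF swapped assms]
  unfolding \<Omega>_swap tp_swap lin_deriv_swap .

lemma quasi_periodic_sobolev: "quasi_periodic a2 a3 k v \<Longrightarrow> sobolev 1 \<Omega> v" "quasi_periodic a3 a2 k v \<Longrightarrow> sobolev 1 \<Omega> v"
  unfolding quasi_periodic_def Let_def has_trace_def strip_swap \<Omega>_def by auto

lemma sobolev2_laplacian_L2: "sobolev 2 \<Omega> u \<Longrightarrow> weak_laplacian \<Omega> u \<in> L2 (lebesgue_on \<Omega>)"
  unfolding weak_laplacian_def numeral_2_eq_2
  by (intro L2_sum finite_Basis) (drule sobolev2_weak_deriv, assumption, simp add: has_weak_deriv_def)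

text \<open>The cutoffs of \<open>laplacian_pairing_compact\<close> are removed first. Then
  quasi-periodicity is used twice in each lattice direction, for the derivative and for
  \<open>u\<close> itself, each time producing a factor i \<omega>; in between, the chosen weak
  derivative is exchanged for \<open>lin_deriv\<close>.\<close>

lemma laplacian_pairing:
  assumes u: "u \<in> dom_H a2 a3 k"
    and \<omega>2: "exp (\<i> * of_real \<omega>2) = exp (\<i> * of_real (k \<bullet> a2))" and \<omega>3: "exp (\<i> * of_real \<omega>3) = exp (\<i> * of_real (k \<bullet> a3))"
    and s: "smooth1 \<eta>" and \<eta>: "\<And>x. \<bar>x\<bar> > R \<Longrightarrow> \<eta> x = 0" and R: "R \<ge> 0"
    and d: "\<And>x. (\<eta> has_vector_derivative \<eta>1 x) (at x)" "\<And>x. (\<eta>1 has_vector_derivative \<eta>2 x) (at x)"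
  defines "e2 \<equiv> \<lambda>s. exp (- \<i> * of_real \<omega>2 * of_real s)" and "e3 \<equiv> \<lambda>s. exp (- \<i> * of_real \<omega>3 * of_real s)"
  shows "(\<integral>y. weak_laplacian \<Omega> u y * tp \<eta> e2 e3 y \<partial>lebesgue_on \<Omega>)
    = (\<integral>y. u y * tp \<eta>2 e2 e3 y \<partial>lebesgue_on \<Omega>)
      - of_real (\<omega>2\<^sup>2 / (a2 \<bullet> a2) + \<omega>3\<^sup>2 / (a3 \<bullet> a3)) * (\<integral>y. u y * tp \<eta> e2 e3 y \<partial>lebesgue_on \<Omega>)"
proof -
  let ?M = "lebesgue_on \<Omega>"
  define v2 v3 where "v2 = weak_deriv \<Omega> (0, a2) u" and "v3 = weak_deriv \<Omega> (0, a3) u"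
  have u2: "sobolev 2 \<Omega> u" and q: "quasi_periodic a2 a3 k u" "quasi_periodic a2 a3 k v2" "quasi_periodic a3 a2 k u" "quasi_periodic a3 a2 k v3"
    using u by (auto simp: dom_H_def \<Omega>_def v2_def v3_def)
  have v: "sobolev 1 \<Omega> v2" "sobolev 1 \<Omega> v3" using quasi_periodic_sobolev q by blast+
  have u1: "sobolev (Suc (Suc 0)) \<Omega> u" using u2 by (simp add: numeral_2_eq_2)
  have v1: "sobolev (Suc 0) \<Omega> v2" "sobolev (Suc 0) \<Omega> v3" using v by simp_all
  have uL: "u \<in> L2 ?M" using u2 by (rule sobolev_L2)
  have wL: "lin_deriv (0, a2) v2 \<in> L2 ?M" "lin_deriv (0, a3) v3 \<in> L2 ?M"
    using lin_deriv[OF v1(1)] lin_deriv[OF v1(2)] by (auto simp: has_weak_deriv_def)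
  note lapL = sobolev2_laplacian_L2[OF u2]
  obtain \<eta>2' where "smooth1 \<eta>2'" "\<And>x. (\<eta>1 has_vector_derivative \<eta>2' x) (at x)"
  proof -
    obtain f1 where f1: "smooth1 f1" "\<And>x. (\<eta> has_vector_derivative f1 x) (at x)" using smooth1_deriv[OF s] by blast
    have "\<eta>1 = f1" using vector_derivative_unique_at[OF d(1) f1(2)] by blast
    then show ?thesis using smooth1_deriv[OF f1(1)] that by blast
  qed
  moreover have "\<eta>2' = \<eta>2" if "\<And>x. (\<eta>1 has_vector_derivative \<eta>2' x) (at x)" for \<eta>2'
    using vector_derivative_unique_at[OF that d(2)] by blast
  ultimately have s2: "smooth1 \<eta>2" by blast
  obtain M where M: "\<And>t. \<bar>t\<bar> > R \<Longrightarrow> \<eta>2 t = 0"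
    using smooth1_compact_support[OF s d R \<eta>] by blast
  have se: "smooth1 e2" "smooth1 e3" unfolding e2_def e3_def by (rule smooth1_exp)+
  note c = smooth1_cont[OF s] smooth1_cont[OF s2] smooth1_cont[OF se(1)] smooth1_cont[OF se(2)]
  let ?c = "\<lambda>n. tp \<eta> (\<lambda>s. e2 s * cutoff n s) (\<lambda>s. e3 s * cutoff n s)"
  let ?c2 = "\<lambda>n. tp \<eta>2 (\<lambda>s. e2 s * cutoff n s) (\<lambda>s. e3 s * cutoff n s)"
  have eq: "(\<integral>y. weak_laplacian \<Omega> u y * ?c n y \<partial>?M)
    = (\<integral>y. u y * ?c2 n y \<partial>?M) + (\<integral>y. lin_deriv (0, a2) v2 y * ?c n y \<partial>?M) / of_real (a2 \<bullet> a2)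
      + (\<integral>y. lin_deriv (0, a3) v3 y * ?c n y \<partial>?M) / of_real (a3 \<bullet> a3)" for n
    unfolding v2_def v3_def
  \<comment> \<open>For n = 0 the radius 1/2 - 1/(n + 1) is negative, hence the maximum with
    0.\<close>
  proof (rule laplacian_pairing_compact[where R = R and r = "max 0 (1/2 - 1 / real (Suc n))"])
    show "smooth1 (\<lambda>s. e2 s * cutoff n s)" "smooth1 (\<lambda>s. e3 s * cutoff n s)"
      by (intro smooth1_mult se smooth1_cutoff)+
    show "sobolev 1 \<Omega> (weak_deriv \<Omega> (0, a2) u)" "sobolev 1 \<Omega> (weak_deriv \<Omega> (0, a3) u)"
      using v by (simp_all add: v2_def v3_def)
    show "\<And>x. max 0 (1/2 - 1 / real (Suc n)) < \<bar>x\<bar> \<Longrightarrow> e2 x * cutoff n x = 0"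
      "\<And>x. max 0 (1/2 - 1 / real (Suc n)) < \<bar>x\<bar> \<Longrightarrow> e3 x * cutoff n x = 0"
      using cutoff_eq_0[of n] by auto
    show "max 0 (1/2 - 1 / real (Suc n)) < 1/2" by (simp add: max_def)
  qed (use u2 s \<eta> R d in auto)
  have "(\<lambda>n. \<integral>y. weak_laplacian \<Omega> u y * ?c n y \<partial>?M) \<longlonglongrightarrow> (\<integral>y. u y * tp \<eta>2 e2 e3 y \<partial>?M)
    + (\<integral>y. lin_deriv (0, a2) v2 y * tp \<eta> e2 e3 y \<partial>?M) / of_real (a2 \<bullet> a2)
    + (\<integral>y. lin_deriv (0, a3) v3 y * tp \<eta> e2 e3 y \<partial>?M) / of_real (a3 \<bullet> a3)"
    unfolding eq using nz
    by (intro tendsto_intros cutoff_limit[OF uL c(2,3,4) M] cutoff_limit[OF wL(1) c(1,3,4) \<eta>] cutoff_limit[OF wL(2) c(1,3,4) \<eta>]) auto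
  from LIMSEQ_unique[OF cutoff_limit[OF lapL c(1,3,4) \<eta>] this]
  have main: "(\<integral>y. weak_laplacian \<Omega> u y * tp \<eta> e2 e3 y \<partial>?M) = (\<integral>y. u y * tp \<eta>2 e2 e3 y \<partial>?M)
    + (\<integral>y. lin_deriv (0, a2) v2 y * tp \<eta> e2 e3 y \<partial>?M) / of_real (a2 \<bullet> a2)
    + (\<integral>y. lin_deriv (0, a3) v3 y * tp \<eta> e2 e3 y \<partial>?M) / of_real (a3 \<bullet> a3)" .
  let ?I = "\<integral>y. u y * tp \<eta> e2 e3 y \<partial>?M"
  have "(\<integral>y. lin_deriv (0, a2) v2 y * tp \<eta> e2 e3 y \<partial>?M) = \<i> * of_real \<omega>2 * (\<integral>y. v2 y * tp \<eta> e2 e3 y \<partial>?M)"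
    unfolding e2_def by (rule quasi_periodic_pairing[OF q(2) \<omega>2 c(1,4) \<eta>])
  also have "(\<integral>y. v2 y * tp \<eta> e2 e3 y \<partial>?M) = (\<integral>y. lin_deriv (0, a2) u y * tp \<eta> e2 e3 y \<partial>?M)"
    unfolding v2_def by (rule weak_deriv_pairing_unique[OF weak_deriv_works[OF lin_deriv[OF u1]] lin_deriv[OF u1] s se \<eta>])
  also have "\<dots> = \<i> * of_real \<omega>2 * ?I"
    unfolding e2_def by (rule quasi_periodic_pairing[OF q(1) \<omega>2 c(1,4) \<eta>])
  finally have w2: "(\<integral>y. lin_deriv (0, a2) v2 y * tp \<eta> e2 e3 y \<partial>?M) = - of_real (\<omega>2\<^sup>2) * ?I"
    by (simp only: i_square_collect)
  have "(\<integral>y. lin_deriv (0, a3) v3 y * tp \<eta> e2 e3 y \<partial>?M) = \<i> * of_real \<omega>3 * (\<integral>y. v3 y * tp \<eta> e2 e3 y \<partial>?M)"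
    unfolding e3_def by (rule quasi_periodic_pairing_swap[OF q(4) \<omega>3 c(1,3) \<eta>])
  also have "(\<integral>y. v3 y * tp \<eta> e2 e3 y \<partial>?M) = (\<integral>y. lin_deriv (0, a3) u y * tp \<eta> e2 e3 y \<partial>?M)"
    unfolding v3_def by (rule weak_deriv_pairing_unique[OF weak_deriv_works[OF lin_deriv[OF u1]] lin_deriv[OF u1] s se \<eta>])
  also have "\<dots> = \<i> * of_real \<omega>3 * ?I"
    unfolding e3_def by (rule quasi_periodic_pairing_swap[OF q(3) \<omega>3 c(1,3) \<eta>])
  finally have w3: "(\<integral>y. lin_deriv (0, a3) v3 y * tp \<eta> e2 e3 y \<partial>?M) = - of_real (\<omega>3\<^sup>2) * ?I"
    by (simp only: i_square_collect)
  show ?thesis unfolding main w2 w3 by (simp add: algebra_simps)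
qed

text \<open>This is |k + K|^2 for the lattice vector K with index \<open>j\<close>, see
  \<open>freq_eq\<close>, in the form in which it comes out of the pairing with characters.\<close>

definition freq :: "real^2 \<Rightarrow> nat \<Rightarrow> real" where
  "freq k j = (k \<bullet> a2 + 2 * pi * of_int (fst (mode j)))\<^sup>2 / (a2 \<bullet> a2) + (k \<bullet> a3 + 2 * pi * of_int (snd (mode j)))\<^sup>2 / (a3 \<bullet> a3)"

text \<open>The eigenvalue equation is paired with \<open>\<eta>\<close> times the conjugate
  character, whose frequencies differ from those of \<open>k\<close> by multiples of 2 pi as
  \<open>laplacian_pairing\<close> demands. The Jacobian \<open>D\<close> cancels after the transfer
  to the tube.\<close>

lemma mode_equation:
  assumes gs: "guided_state a2 a3 W g E k u" and W: "W \<in> borel_measurable (hilb a2 a3)"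
    and u': "u' \<in> borel_measurable tube" "AE z in tube. u (Phi z) = u' z"
    and W': "W' \<in> borel_measurable tube" "AE z in tube. W (Phi z) = W' z"
    and s: "smooth1 \<eta>" and \<eta>: "\<exists>L. \<forall>x. \<bar>x\<bar> > L \<longrightarrow> \<eta> x = 0"
    and d: "\<And>x. (\<eta> has_vector_derivative \<eta>1 x) (at x)" "\<And>x. (\<eta>1 has_vector_derivative \<eta>2 x) (at x)"
  shows "(\<integral>z. u' z * ((of_real (freq k j - E) * \<eta> (fst z) - \<eta>2 (fst z)) * cnj (chr (k \<bullet> a2) (k \<bullet> a3) j (snd z))) \<partial>tube)
    = (\<integral>z. of_real (g * (W' z)\<^sup>2) * u' z * (\<eta> (fst z) * cnj (chr (k \<bullet> a2) (k \<bullet> a3) j (snd z))) \<partial>tube)"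
proof -
  obtain L where L: "\<And>x. \<bar>x\<bar> > L \<Longrightarrow> \<eta> x = 0" using \<eta> by blast
  define R where "R = max L 0"
  have R: "R \<ge> 0" "\<And>x. \<bar>x\<bar> > R \<Longrightarrow> \<eta> x = 0" using L by (auto simp: R_def)
  define \<omega>2 \<omega>3 where "\<omega>2 = k \<bullet> a2 + 2 * pi * of_int (fst (mode j))" and "\<omega>3 = k \<bullet> a3 + 2 * pi * of_int (snd (mode j))"
  have per: "exp (\<i> * of_real (x + 2 * pi * of_int m)) = exp (\<i> * of_real x)" for x m
  proof -
    have "exp (\<i> * of_real (x + 2 * pi * of_int m)) = exp (\<i> * of_real x) * exp (\<i> * of_real (of_int m * (of_real pi * 2)))"
      by (simp add: mult_exp_exp algebra_simps)
    then show ?thesis using exp_integer_2pi[of "of_int m"] by (simp add: algebra_simps)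
  qed
  define e2 e3 where "e2 = (\<lambda>s. exp (- \<i> * of_real \<omega>2 * complex_of_real s))" and "e3 = (\<lambda>s. exp (- \<i> * of_real \<omega>3 * complex_of_real s))"
  let ?M = "lebesgue_on \<Omega>" and ?\<phi> = "tp \<eta> e2 e3" and ?\<phi>2 = "tp \<eta>2 e2 e3"
  have uD: "u \<in> dom_H a2 a3 k" and H: "AE y in hilb a2 a3. H_op a2 a3 W g u y = of_real E * u y"
    using gs by (auto simp: guided_state_def)
  note lp = laplacian_pairing[OF uD _ _ s R(2) R(1) d, of \<omega>2 \<omega>3, folded e2_def e3_def, unfolded \<omega>2_def \<omega>3_def, OF per per, folded \<omega>2_def \<omega>3_def]
  have u2: "sobolev 2 \<Omega> u" and uh: "u \<in> L2 (hilb a2 a3)" using uD by (auto simp: dom_H_def \<Omega>_def)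
  have uL: "u \<in> L2 ?M" using u2 by (rule sobolev_L2)
  obtain f1 where f1: "smooth1 f1" "\<And>x. (\<eta> has_vector_derivative f1 x) (at x)" using smooth1_deriv[OF s] by blast
  have f1e: "\<eta>1 = f1" using vector_derivative_unique_at[OF d(1) f1(2)] by blast
  obtain f2 where f2: "smooth1 f2" "\<And>x. (\<eta>1 has_vector_derivative f2 x) (at x)" using smooth1_deriv[OF f1(1)] f1e by blast
  have s2: "smooth1 \<eta>2" using vector_derivative_unique_at[OF d(2) f2(2)] f2(1) by (metis ext)
  obtain M where M: "\<And>t. \<bar>t\<bar> > R \<Longrightarrow> \<eta>2 t = 0"
    using smooth1_compact_support[OF s d R] by blast
  have se: "continuous_on UNIV e2" "continuous_on UNIV e3" unfolding e2_def e3_def by (intro continuous_intros)+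
  have \<phi>L: "?\<phi> \<in> L2 ?M" by (rule tp_L2[OF smooth1_cont[OF s] se R(2)])
  have \<phi>2L: "?\<phi>2 \<in> L2 ?M" by (rule tp_L2[OF smooth1_cont[OF s2] se M])
  have um: "u \<in> borel_measurable (hilb a2 a3)" using uh by (simp add: L2_def)
  have sub: "\<Omega> \<subseteq> strip a2 a3" unfolding \<Omega>_def by (rule interior_subset)
  have restr: "f \<in> borel_measurable ?M" if "f \<in> borel_measurable (hilb a2 a3)" for f :: "real \<times> (real^2) \<Rightarrow> complex"
    using measurable_restrict_mono[OF that sub] .
  let ?h = "\<lambda>y. of_real (g * (W y)\<^sup>2) * u y"
  have hm: "?h \<in> borel_measurable (hilb a2 a3)" using W um by measurable
  have st: "strip a2 a3 \<in> sets lebesgue" using strip_borel by auto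
  have "AE y in ?M. weak_laplacian \<Omega> u y = - (?h y + of_real E * u y)"
  proof -
    have "AE y in lebesgue. y \<in> strip a2 a3 \<longrightarrow> H_op a2 a3 W g u y = of_real E * u y"
      using H st by (subst (asm) AE_restrict_space_iff) auto
    then have "AE y in lebesgue. y \<in> \<Omega> \<longrightarrow> weak_laplacian \<Omega> u y = - (?h y + of_real E * u y)"
    proof eventually_elim
      case (elim y)
      show ?case
      proof
        assume "y \<in> \<Omega>"
        then have "- weak_laplacian \<Omega> u y - ?h y = of_real E * u y" using elim sub by (auto simp: H_op_def \<Omega>_def)
        then show "weak_laplacian \<Omega> u y = - (?h y + of_real E * u y)" by algebra
      qed
    qed
    then show ?thesis using \<Omega>_sets by (subst AE_restrict_space_iff) auto
  qed
  note lapAE = this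
  have lapL: "weak_laplacian \<Omega> u \<in> L2 ?M" by (rule sobolev2_laplacian_L2[OF u2])
  have \<phi>m: "?\<phi> \<in> borel_measurable ?M" using \<phi>L by (simp add: L2_def)
  have i1: "integrable ?M (\<lambda>y. weak_laplacian \<Omega> u y * ?\<phi> y)" "integrable ?M (\<lambda>y. u y * ?\<phi> y)" "integrable ?M (\<lambda>y. u y * ?\<phi>2 y)"
    by (intro L2_mult_integrable lapL uL \<phi>L \<phi>2L)+
  \<comment> \<open>Integrability of the potential term is read off from the equation, whose other
    terms are products of L^2 functions.\<close>
  have ih: "integrable ?M (\<lambda>y. ?h y * ?\<phi> y)"
  proof (rule integrable_cong_AE_imp[of _ "\<lambda>y. - (weak_laplacian \<Omega> u y * ?\<phi> y + of_real E * (u y * ?\<phi> y))"])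
    show "integrable ?M (\<lambda>y. - (weak_laplacian \<Omega> u y * ?\<phi> y + of_real E * (u y * ?\<phi> y)))" using i1 by simp
    show "(\<lambda>y. ?h y * ?\<phi> y) \<in> borel_measurable ?M" using restr[OF hm] \<phi>m by (rule borel_measurable_times)
    show "AE y in ?M. - (weak_laplacian \<Omega> u y * ?\<phi> y + of_real E * (u y * ?\<phi> y)) = ?h y * ?\<phi> y"
      using lapAE by eventually_elim algebra
  qed
  have "(\<integral>y. weak_laplacian \<Omega> u y * ?\<phi> y \<partial>?M) = (\<integral>y. - (?h y * ?\<phi> y + of_real E * (u y * ?\<phi> y)) \<partial>?M)"
  proof (rule integral_cong_AE)
    show "AE y in ?M. weak_laplacian \<Omega> u y * ?\<phi> y = - (?h y * ?\<phi> y + of_real E * (u y * ?\<phi> y))"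
      using lapAE by eventually_elim algebra
  qed (use i1 ih in auto)
  also have "\<dots> = - (\<integral>y. ?h y * ?\<phi> y \<partial>?M) - of_real E * (\<integral>y. u y * ?\<phi> y \<partial>?M)"
    using i1 ih by simp
  finally have lap: "(\<integral>y. weak_laplacian \<Omega> u y * ?\<phi> y \<partial>?M) = - (\<integral>y. ?h y * ?\<phi> y \<partial>?M) - of_real E * (\<integral>y. u y * ?\<phi> y \<partial>?M)" .
  have "\<omega>2\<^sup>2 / (a2 \<bullet> a2) + \<omega>3\<^sup>2 / (a3 \<bullet> a3) = freq k j" by (simp only: freq_def \<omega>2_def \<omega>3_def)
  note lap2 = lp[unfolded this]
  have "a = of_real (f - E) * b - c" if "l = - a - of_real E * b" "l = c - of_real f * b" for a b c l :: complex and f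
    using that unfolding of_real_diff by algebra
  from this[OF lap lap2] have "(\<integral>y. ?h y * ?\<phi> y \<partial>?M) = of_real (freq k j - E) * (\<integral>y. u y * ?\<phi> y \<partial>?M) - (\<integral>y. u y * ?\<phi>2 y \<partial>?M)" .
  moreover
  let ?c = "\<lambda>z. cnj (chr (k \<bullet> a2) (k \<bullet> a3) j (snd z))"
  have tpP: "tp f e2 e3 (Phi z) = f (fst z) * ?c z" for f z
    by (simp add: tp_def Phi_def sc_lin e2_def e3_def chr_def exp_cnj mult_exp_exp \<omega>2_def \<omega>3_def algebra_simps)
  have mc: "(\<lambda>z. f (fst z) * ?c z) \<in> borel_measurable tube" if "continuous_on UNIV f" for f
    using borel_measurable_continuous_onI[OF that] by measurable
  have conv: "integrable tube (\<lambda>z. G z * (f (fst z) * ?c z))" "(\<integral>y. F y * tp f e2 e3 y \<partial>?M) = D *\<^sub>R (\<integral>z. G z * (f (fst z) * ?c z) \<partial>tube)"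
    if F: "F \<in> borel_measurable (hilb a2 a3)" and G: "G \<in> borel_measurable tube" "AE z in tube. F (Phi z) = G z"
      and f: "continuous_on UNIV f" and i: "integrable ?M (\<lambda>y. F y * tp f e2 e3 y)" for F G f
  proof -
    have m: "(\<lambda>z. G z * (f (fst z) * ?c z)) \<in> borel_measurable tube" using G(1) mc[OF f] by (rule borel_measurable_times)
    have ae: "AE z in tube. F (Phi z) * tp f e2 e3 (Phi z) = G z * (f (fst z) * ?c z)"
      using G(2) by eventually_elim (simp add: tpP)
    note hi = hilb_integral[OF m ae]
    show "(\<integral>y. F y * tp f e2 e3 y \<partial>?M) = D *\<^sub>R (\<integral>z. G z * (f (fst z) * ?c z) \<partial>tube)"
      using integral_\<Omega>[OF hi(1)] hi(3) by simp
    have "integrable (hilb a2 a3) (\<lambda>y. F y * tp f e2 e3 y)"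
    proof -
      have "(\<integral>\<^sup>+y. ennreal (norm (F y * tp f e2 e3 y)) \<partial>hilb a2 a3) = (\<integral>\<^sup>+y. ennreal (norm (F y * tp f e2 e3 y)) \<partial>?M)"
      proof -
        have ae: "AE y in lebesgue. y \<in> strip a2 a3 \<longrightarrow> y \<in> \<Omega>"
        proof -
          have "AE y in hilb a2 a3. y \<in> \<Omega>"
            unfolding AE_hilb_iff using AE_tube by eventually_elim (simp add: \<Omega>_iff Phi_def sc_lin)
          then show ?thesis by (simp add: AE_hilb_lborel AE_completion_iff)
        qed
        show ?thesis
          apply (subst nn_integral_restrict_space, use st in simp)
          apply (subst nn_integral_restrict_space, use \<Omega>_sets in simp)
          by (rule nn_integral_cong_AE, rule AE_mp[OF ae]) (use sub in \<open>auto simp: indicator_def intro!: AE_I2\<close>)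
      qed
      also have "\<dots> < \<infinity>" using i by (simp add: integrable_iff_bounded)
      finally show ?thesis using hi(1) by (simp add: integrable_iff_bounded)
    qed
    then show "integrable tube (\<lambda>z. G z * (f (fst z) * ?c z))" using hi(2) by simp
  qed
  have hG: "(\<lambda>z. of_real (g * (W' z)\<^sup>2) * u' z) \<in> borel_measurable tube" "AE z in tube. ?h (Phi z) = of_real (g * (W' z)\<^sup>2) * u' z"
    using u'(1) W'(1) apply measurable using u'(2) W'(2) by (eventually_elim, simp)
  note c1 = conv[OF hm hG smooth1_cont[OF s] ih] and c2 = conv[OF um u' smooth1_cont[OF s] i1(2)] and c3 = conv[OF um u' smooth1_cont[OF s2] i1(3)]
  ultimately have "D *\<^sub>R (\<integral>z. of_real (g * (W' z)\<^sup>2) * u' z * (\<eta> (fst z) * ?c z) \<partial>tube)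
    = D *\<^sub>R (of_real (freq k j - E) * (\<integral>z. u' z * (\<eta> (fst z) * ?c z) \<partial>tube) - (\<integral>z. u' z * (\<eta>2 (fst z) * ?c z) \<partial>tube))"
    unfolding c1(2) c2(2) c3(2) by (simp add: scaleR_right_diff_distrib)
  then have "(\<integral>z. of_real (g * (W' z)\<^sup>2) * u' z * (\<eta> (fst z) * ?c z) \<partial>tube)
    = of_real (freq k j - E) * (\<integral>z. u' z * (\<eta> (fst z) * ?c z) \<partial>tube) - (\<integral>z. u' z * (\<eta>2 (fst z) * ?c z) \<partial>tube)"
    using D_pos by simp
  also have "\<dots> = (\<integral>z. of_real (freq k j - E) * (u' z * (\<eta> (fst z) * ?c z)) - u' z * (\<eta>2 (fst z) * ?c z) \<partial>tube)"
    using c2(1) c3(1) by simp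
  also have "\<dots> = (\<integral>z. u' z * ((of_real (freq k j - E) * \<eta> (fst z) - \<eta>2 (fst z)) * ?c z) \<partial>tube)"
    by (simp add: algebra_simps)
  finally show ?thesis by simp
qed

end

section \<open>Spectral gap and decay of the potential\<close>

lemma integrable_one_plus_square: "integrable lborel (\<lambda>x::real. 1 / (1 + x\<^sup>2))"
proof -
  let ?f = "\<lambda>x::real. 1 / (1 + x\<^sup>2)"
  have pos: "0 < 1 + x\<^sup>2" for x :: real by (rule add_pos_nonneg) auto
  have i: "integrable lborel (\<lambda>x. ?f x * indicator {0..} x)"
  proof (rule integrableI_nonneg)
    have "(\<integral>\<^sup>+x. ennreal (?f x * indicator {0..} x) \<partial>lborel) = (\<integral>\<^sup>+x. ennreal (?f x) * indicator {0..} x \<partial>lborel)"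
      by (intro nn_integral_cong) (auto simp: indicator_def)
    also have "\<dots> = ennreal (pi / 2 - arctan 0)"
      by (rule nn_integral_FTC_atLeast[OF _ _ _ tendsto_arctan_at_top])
        (use pos in \<open>auto intro!: derivative_eq_intros simp: inverse_eq_divide less_imp_le\<close>)
    also have "\<dots> < \<infinity>" by simp
    finally show "(\<integral>\<^sup>+x. ennreal (?f x * indicator {0..} x) \<partial>lborel) < \<infinity>" .
  qed (use pos in \<open>auto intro!: AE_I2 simp: less_imp_le\<close>)
  have "integrable lborel (\<lambda>x. ?f (0 + (-1) * x) * indicator {0..} (0 + (-1) * x))"
    by (rule lborel_integrable_real_affine[OF i]) simp
  from Bochner_Integration.integrable_add[OF i this] show ?thesis
    by (rule Bochner_Integration.integrable_bound) (use pos in \<open>auto intro!: AE_I2 simp: indicator_def less_imp_le abs_of_pos\<close>)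
qed

text \<open>With y = 1 + |x_1|, the decay gives y W^2 <= C^2 y^(-2 - eta), which is bounded and
  integrable along the tube. These are the two quantities in the weak coupling estimate.\<close>

lemma potential_bounds:
  assumes [measurable]: "W \<in> borel_measurable tube" and \<eta>: "\<eta> > 0"
    and le: "AE z in tube. \<bar>W z\<bar> \<le> C * (1 + \<bar>fst z\<bar>) powr (- (3 + \<eta>) / 2)"
  shows "AE z in tube. (1 + \<bar>fst z\<bar>) * (W z)\<^sup>2 \<le> C\<^sup>2"
    and "integrable tube (\<lambda>z. (1 + \<bar>fst z\<bar>) * (W z)\<^sup>2)"
proof -
  have le': "AE z in tube. (1 + \<bar>fst z\<bar>) * (W z)\<^sup>2 \<le> C\<^sup>2 / (1 + (fst z)\<^sup>2)"
    using le
  proof eventually_elim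
    case (elim z)
    define y where "y = 1 + \<bar>fst z\<bar>"
    have y: "y \<ge> 1" by (simp add: y_def)
    have "(W z)\<^sup>2 = \<bar>W z\<bar>\<^sup>2" by simp
    also have "\<dots> \<le> (C * y powr (- (3 + \<eta>) / 2))\<^sup>2" using elim by (intro power_mono) (auto simp: y_def)
    also have "\<dots> = C\<^sup>2 * y powr (- (3 + \<eta>))"
      by (simp add: power_mult_distrib power2_eq_square flip: powr_add)
    also have "\<dots> \<le> C\<^sup>2 * y powr (- 3)" using y \<eta> by (intro mult_left_mono powr_mono) auto
    finally have "(1 + \<bar>fst z\<bar>) * (W z)\<^sup>2 \<le> y * (C\<^sup>2 * y powr (-3))"
      using y unfolding y_def[symmetric] by (intro mult_left_mono) auto
    also have "y * (C\<^sup>2 * y powr (-3)) = C\<^sup>2 / y\<^sup>2"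
      using y by (simp add: powr_minus divide_simps power2_eq_square power3_eq_cube)
    also have "\<dots> \<le> C\<^sup>2 / (1 + (fst z)\<^sup>2)"
    proof (intro divide_left_mono)
      show "1 + (fst z)\<^sup>2 \<le> y\<^sup>2" by (simp add: y_def power2_eq_square algebra_simps)
    qed (use y in \<open>auto intro!: mult_pos_pos add_pos_nonneg\<close>)
    finally show ?case .
  qed
  then show "AE z in tube. (1 + \<bar>fst z\<bar>) * (W z)\<^sup>2 \<le> C\<^sup>2"
  proof eventually_elim
    case (elim z)
    have "C\<^sup>2 / (1 + (fst z)\<^sup>2) \<le> C\<^sup>2 / 1" by (intro divide_left_mono) (auto intro!: add_pos_nonneg)
    with elim show ?case by simp
  qed
  have "integrable tube (\<lambda>(x, p). 1 / (1 + x\<^sup>2) * (1::real))"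
    unfolding tube_def
    by (rule integrable_tensor[OF _ _ integrable_one_plus_square]) (unfold_locales, simp)
  then have "integrable tube (\<lambda>z. C\<^sup>2 * (1 / (1 + (fst z)\<^sup>2)))" by (intro integrable_mult_right) (simp add: case_prod_unfold)
  then show "integrable tube (\<lambda>z. (1 + \<bar>fst z\<bar>) * (W z)\<^sup>2)"
    by (rule Bochner_Integration.integrable_bound) (use le' in \<open>auto elim!: eventually_mono simp: abs_mult abs_of_nonneg\<close>)
qed

text \<open>|S t| <= |t| holds for every l >= 0, including l = 0, where the sine degenerates to t.
  The uniformity in l is what keeps the coupling threshold independent of the
  quasi-momentum.\<close>

lemma fundamental_solution_sin:
  assumes "l \<ge> 0"
  defines "S \<equiv> \<lambda>t. if l = 0 then t else sin (l * t) / l"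
  shows "fundamental_solution (\<lambda>_. 0) (\<lambda>_. 0) (\<lambda>t. - S t) (\<lambda>t. - cos (l * t)) (- l\<^sup>2) 1"
    and "fundamental_solution S (\<lambda>t. cos (l * t)) (\<lambda>_. 0) (\<lambda>_. 0) (- l\<^sup>2) 1"
    and "\<bar>S t\<bar> \<le> \<bar>t\<bar>"
proof -
  have le: "\<bar>S t\<bar> \<le> \<bar>t\<bar>" for t
    using abs_sin_x_le_abs_x[of "l * t"] assms(1) by (auto simp: S_def abs_mult field_simps)
  then show "\<bar>S t\<bar> \<le> \<bar>t\<bar>" .
  have le': "\<bar>S t\<bar> \<le> 1 + \<bar>t\<bar>" for t using le[of t] by linarith
  have d: "(S has_real_derivative cos (l * t)) (at t)" for t
    using assms(1) by (cases "l = 0") (auto simp: S_def intro!: derivative_eq_intros)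
  have d2: "((\<lambda>t. cos (l * t)) has_real_derivative - l\<^sup>2 * S t) (at t)" for t
    using assms(1) by (cases "l = 0") (auto simp: S_def power2_eq_square intro!: derivative_eq_intros)
  have S0: "S 0 = 0" by (simp add: S_def)
  show "fundamental_solution (\<lambda>_. 0) (\<lambda>_. 0) (\<lambda>t. - S t) (\<lambda>t. - cos (l * t)) (- l\<^sup>2) 1"
    "fundamental_solution S (\<lambda>t. cos (l * t)) (\<lambda>_. 0) (\<lambda>_. 0) (- l\<^sup>2) 1"
    by unfold_locales (use le' d2 in \<open>auto simp: S0 intro!: DERIV_minus[THEN DERIV_cong] d order_trans[OF le']\<close>)
qed

context rect_lattice
begin

lemma norm_dual_vec: "a \<noteq> 0 \<Longrightarrow> (norm (dual_vec a))\<^sup>2 = 4 * pi\<^sup>2 / (a \<bullet> a)"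
  by (simp add: dual_vec_def power_mult_distrib power_divide power2_norm_eq_inner[symmetric] power2_eq_square)

lemma inner_self_decomp: "x \<bullet> x = (x \<bullet> a2)\<^sup>2 / (a2 \<bullet> a2) + (x \<bullet> a3)\<^sup>2 / (a3 \<bullet> a3)"
proof -
  have "x \<bullet> x = x \<bullet> (sc a2 x *\<^sub>R a2 + sc a3 x *\<^sub>R a3)" by (simp only: decomp)
  also have "\<dots> = sc a2 x * (x \<bullet> a2) + sc a3 x * (x \<bullet> a3)" by (simp only: inner_add_right inner_scaleR_right)
  finally show ?thesis by (simp add: sc_def power2_eq_square)
qed

lemma dual_inner:
  "(s *\<^sub>R dual_vec a2 + t *\<^sub>R dual_vec a3) \<bullet> a2 = 2 * pi * s"
  "(s *\<^sub>R dual_vec a2 + t *\<^sub>R dual_vec a3) \<bullet> a3 = 2 * pi * t"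
  using nz orth orth' by (simp_all add: dual_vec_def inner_add_left power2_norm_eq_inner)

lemma freq_eq:
  "freq k j = (norm (k + of_int (fst (mode j)) *\<^sub>R dual_vec a2 + of_int (snd (mode j)) *\<^sub>R dual_vec a3))\<^sup>2"
  unfolding power2_norm_eq_inner
  by (subst inner_self_decomp) (simp add: freq_def inner_add_left[of k] add.assoc dual_inner)

text \<open>As |s| <= 1/2, (s + m)^2 >= m^2 / 4, and likewise for t and n. Since m^2 + n^2 >= 1,
  subtracting \<open>E\<close> removes at most the fraction 1 / (1 + \<delta>) of \<beta> (m^2 +
  n^2) / 4. The rest is compared through (1 + |m|)(1 + |n|) <= 9/2 (m^2 + n^2); 4 times 9/2 is the
  constant 18.\<close>

lemma mode_gap_arith:
  fixes m n :: int and s t :: real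
  assumes s: "\<bar>s\<bar> \<le> 1/2" "\<bar>t\<bar> \<le> 1/2" and mn: "(m, n) \<noteq> (0, 0)"
    and \<beta>: "0 < \<beta>" "\<beta> \<le> B2" "\<beta> \<le> B3" and \<delta>: "\<delta> > 0" and E: "E < 1 / (4 * (1 + \<delta>)) * \<beta>"
  shows "\<beta> * \<delta> / (18 * (1 + \<delta>)) * ((1 + \<bar>of_int m\<bar>) * (1 + \<bar>of_int n\<bar>)) \<le> (s + of_int m)\<^sup>2 * B2 + (t + of_int n)\<^sup>2 * B3 - E"
proof -
  define x y where "x = \<bar>real_of_int m\<bar>" and "y = \<bar>real_of_int n\<bar>"
  have quarter: "(real_of_int m)\<^sup>2 / 4 \<le> (s + of_int m)\<^sup>2" if "\<bar>s\<bar> \<le> 1/2" for m s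
  proof -
    have "\<bar>real_of_int m\<bar> / 2 \<le> \<bar>s + of_int m\<bar>"
    proof (cases "m = 0")
      case False
      then have "1 \<le> \<bar>real_of_int m\<bar>" by linarith
      then show ?thesis using that by linarith
    qed simp
    then have "(\<bar>real_of_int m\<bar> / 2)\<^sup>2 \<le> \<bar>s + of_int m\<bar>\<^sup>2" by (intro power_mono) auto
    then show ?thesis by (simp add: power_divide)
  qed
  have xy: "x + y \<ge> 1" "x \<ge> 0" "y \<ge> 0" "x\<^sup>2 + y\<^sup>2 \<ge> 1"
  proof -
    show "x + y \<ge> 1" using mn by (auto simp: x_def y_def)
    have "1 \<le> x\<^sup>2" if "m \<noteq> 0" using that one_le_power[of x 2] by (simp add: x_def)
    moreover have "1 \<le> y\<^sup>2" if "n \<noteq> 0" using that one_le_power[of y 2] by (simp add: y_def)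
    ultimately show "x\<^sup>2 + y\<^sup>2 \<ge> 1" using mn by (cases "m = 0") (auto intro: add_increasing add_increasing2)
  qed (auto simp: x_def y_def)
  have "(1 + x) * (1 + y) \<le> 9 / 2 * (x\<^sup>2 + y\<^sup>2)"
  proof -
    have "4 * ((1 + x) * (1 + y)) \<le> (2 + x + y)\<^sup>2"
      using zero_le_power2[of "x - y"] by (simp add: power2_eq_square algebra_simps)
    also have "\<dots> \<le> (3 * (x + y))\<^sup>2" using xy by (intro power_mono) auto
    also have "\<dots> \<le> 18 * (x\<^sup>2 + y\<^sup>2)"
      using zero_le_power2[of "x - y"] by (simp add: power2_eq_square algebra_simps)
    finally show ?thesis by simp
  qed
  then have "\<beta> * \<delta> / (18 * (1 + \<delta>)) * ((1 + x) * (1 + y)) \<le> \<beta> * \<delta> / (18 * (1 + \<delta>)) * (9 / 2 * (x\<^sup>2 + y\<^sup>2))"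
    using \<beta> \<delta> by (intro mult_left_mono) auto
  also have "\<dots> = \<beta> / 4 * (x\<^sup>2 + y\<^sup>2) - 1 / (4 * (1 + \<delta>)) * \<beta> * (x\<^sup>2 + y\<^sup>2)"
    using \<delta> by (simp add: divide_simps) (simp add: algebra_simps)?
  also have "\<dots> \<le> \<beta> / 4 * (x\<^sup>2 + y\<^sup>2) - E"
  proof -
    have "1 / (4 * (1 + \<delta>)) * \<beta> * 1 \<le> 1 / (4 * (1 + \<delta>)) * \<beta> * (x\<^sup>2 + y\<^sup>2)"
      using xy \<beta> \<delta> by (intro mult_left_mono) auto
    then show ?thesis using E by linarith
  qed
  also have "\<beta> / 4 * (x\<^sup>2 + y\<^sup>2) = x\<^sup>2 / 4 * \<beta> + y\<^sup>2 / 4 * \<beta>" by (simp add: algebra_simps)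
  also have "\<dots> \<le> (s + of_int m)\<^sup>2 * B2 + (t + of_int n)\<^sup>2 * B3"
    using quarter[OF s(1), of m] quarter[OF s(2), of n] \<beta> by (intro add_mono mult_mono) (auto simp: x_def y_def)
  finally show ?thesis by (simp add: x_def y_def)
qed

text \<open>The constant of \<open>mode_gap_arith\<close>. It does not involve \<open>k\<close>, so
  the decay rates of all evanescent modes, and with them the L^1 bound of the kernel, are controlled
  uniformly in the quasi-momentum.\<close>

definition gap :: "real \<Rightarrow> real" where
  "gap \<delta> = min ((norm (dual_vec a2))\<^sup>2) ((norm (dual_vec a3))\<^sup>2) * \<delta> / (18 * (1 + \<delta>))"

lemma gap_pos: "\<delta> > 0 \<Longrightarrow> gap \<delta> > 0"
  using nz by (auto simp: gap_def dual_vec_def min_def intro!: mult_pos_pos divide_pos_pos)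

lemma freq_gap:
  assumes k: "k \<in> brillouin a2 a3" and \<delta>: "\<delta> > 0" and E: "E < E_thr a2 a3 \<delta>" and j: "mode j \<noteq> (0, 0)"
  shows "gap \<delta> * ((1 + \<bar>of_int (fst (mode j))\<bar>) * (1 + \<bar>of_int (snd (mode j))\<bar>)) \<le> freq k j - E"
proof -
  obtain s t where st: "k = s *\<^sub>R dual_vec a2 + t *\<^sub>R dual_vec a3" "\<bar>s\<bar> \<le> 1/2" "\<bar>t\<bar> \<le> 1/2"
    using k unfolding brillouin_def cell_def by (auto simp: abs_le_iff)
  let ?B = "\<lambda>a. (norm (dual_vec a))\<^sup>2"
  have pos: "0 < ?B a2" "0 < ?B a3" using nz by (auto simp: dual_vec_def)
  have eq: "(2 * pi * s + 2 * pi * x)\<^sup>2 / (a \<bullet> a) = (s + x)\<^sup>2 * ?B a" if "a \<noteq> 0" for s x a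
  proof -
    have "(2 * pi * s + 2 * pi * x)\<^sup>2 = 4 * pi\<^sup>2 * (s + x)\<^sup>2" by (simp add: power2_eq_square algebra_simps)
    then show ?thesis by (simp add: norm_dual_vec[OF that])
  qed
  have "freq k j = (s + of_int (fst (mode j)))\<^sup>2 * ?B a2 + (t + of_int (snd (mode j)))\<^sup>2 * ?B a3"
    unfolding freq_def st(1) dual_inner eq[OF nz(1)] eq[OF nz(2)] ..
  then show ?thesis unfolding gap_def
    using mode_gap_arith[OF st(2,3) _ _ _ _ \<delta>, of "fst (mode j)" "snd (mode j)" "min (?B a2) (?B a3)" "?B a2" "?B a3" E] j pos E
    by (simp add: E_thr_def)
qed

text \<open>The dual vectors span a rectangular lattice again, so \<open>emeasure_cell_map\<close>
  applies to them; the constant beta of the kernel thereby becomes 1 / (2 D).\<close>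

lemma measure_brillouin: "measure lebesgue (brillouin a2 a3) = 4 * pi\<^sup>2 / D"
proof -
  have nz': "dual_vec a2 \<noteq> 0" "dual_vec a3 \<noteq> 0" using nz by (auto simp: dual_vec_def)
  interpret d: rect_lattice "dual_vec a2" "dual_vec a3"
    using nz' orth by unfold_locales (auto simp: dual_vec_def)
  let ?T = "brillouin a2 a3"
  have b: "bounded ?T"
  proof (rule boundedI)
    fix x assume "x \<in> ?T"
    then obtain s t where st: "x = s *\<^sub>R dual_vec a2 + t *\<^sub>R dual_vec a3" "\<bar>s\<bar> \<le> 1" "\<bar>t\<bar> \<le> 1"
      unfolding brillouin_def cell_def by (auto simp: abs_le_iff)
    have "norm x \<le> \<bar>s\<bar> * norm (dual_vec a2) + \<bar>t\<bar> * norm (dual_vec a3)"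
      unfolding st(1) using norm_triangle_ineq by (metis norm_scaleR)
    also have "\<dots> \<le> 1 * norm (dual_vec a2) + 1 * norm (dual_vec a3)"
      using st by (intro add_mono mult_right_mono) auto
    finally show "norm x \<le> 1 * norm (dual_vec a2) + 1 * norm (dual_vec a3)" .
  qed
  have pre: "(\<lambda>p. fst p *\<^sub>R dual_vec a2 + snd p *\<^sub>R dual_vec a3) -` ?T = {-1/2<..1/2::real} \<times> {-1/2<..1/2::real}"
    by (auto simp: brillouin_def d.cell_iff d.sc_lin)
  have m: "?T \<in> sets borel"
  proof -
    have c: "continuous_on UNIV (d.sc (dual_vec a2))" "continuous_on UNIV (d.sc (dual_vec a3))"
      unfolding d.sc_def using nz' by (auto intro!: continuous_intros)
    have [measurable]: "d.sc (dual_vec a2) \<in> borel_measurable borel" "d.sc (dual_vec a3) \<in> borel_measurable borel"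
      using c by (auto intro: borel_measurable_continuous_onI)
    have "?T = {x \<in> space borel. -1/2 < d.sc (dual_vec a2) x \<and> d.sc (dual_vec a2) x \<le> 1/2 \<and> -1/2 < d.sc (dual_vec a3) x \<and> d.sc (dual_vec a3) x \<le> 1/2}"
      by (auto simp: brillouin_def d.cell_iff)
    also have "\<dots> \<in> sets borel" by measurable
    finally show ?thesis .
  qed
  have "emeasure lborel ?T = ennreal d.D * emeasure lborel ({-1/2<..1/2::real} \<times> {-1/2<..1/2::real})"
    using d.emeasure_cell_map[OF b m] unfolding pre by simp
  also have "\<dots> = ennreal d.D" by (simp add: emeasure_lborel_Times)
  finally have "measure lebesgue ?T = d.D" using m d.D_pos by (simp add: measure_def)
  also have "d.D = 4 * pi\<^sup>2 / D"
    using nz unfolding d.D_def D_def by (simp add: dual_vec_def power2_eq_square)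
  finally show ?thesis .
qed

end

section \<open>Guided states at weak coupling\<close>

locale guided_mode = rect_lattice a2 a3 for a2 a3 +
  fixes W :: "real \<times> (real^2) \<Rightarrow> real" and g E \<delta> K :: real and k :: "real^2" and u :: "real \<times> (real^2) \<Rightarrow> complex"
    and W' :: "real \<times> real \<times> real \<Rightarrow> real" and u' :: "real \<times> real \<times> real \<Rightarrow> complex" and k0 :: nat
  assumes guided: "guided_state a2 a3 W g E k u" and W_meas: "W \<in> borel_measurable (hilb a2 a3)"
    and W' [measurable]: "W' \<in> borel_measurable tube" and W_eq: "AE z in tube. W (Phi z) = W' z"
    and u' [measurable]: "u' \<in> borel_measurable tube" and u_eq: "AE z in tube. u (Phi z) = u' z"
    and k0: "mode k0 = (0, 0)" and \<delta>: "\<delta> > 0" and E: "E < E_thr a2 a3 \<delta>" and g: "g > 0"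
    and W_bound: "AE z in tube. (1 + \<bar>fst z\<bar>) * (W' z)\<^sup>2 \<le> K"
    and W_int: "integrable tube (\<lambda>z. (1 + \<bar>fst z\<bar>) * (W' z)\<^sup>2)"
begin

text \<open>For j different from \<open>k0\<close> the argument of the root is positive. At
  \<open>k0\<close> this is a decay rate only if |k|^2 > E; otherwise that value does not enter the
  kernel, whose index set omits \<open>k0\<close>.\<close>

definition \<kappa> :: "nat \<Rightarrow> real" where "\<kappa> j = sqrt (freq k j - E)"
definition h :: "real \<times> real \<times> real \<Rightarrow> complex" where "h z = of_real (g * (W' z)\<^sup>2) * u' z"

lemma k_brillouin: "k \<in> brillouin a2 a3"
  using guided by (simp add: guided_state_def)

lemma freq_k0: "freq k k0 = (norm k)\<^sup>2"
  by (simp add: freq_eq k0)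

lemma mode_nonzero: "j \<noteq> k0 \<Longrightarrow> mode j \<noteq> (0, 0)"
  using bij_mode k0 by (metis bij_pointE)

lemma gap_le:
  "j \<noteq> k0 \<Longrightarrow> gap \<delta> * ((1 + \<bar>of_int (fst (mode j))\<bar>) * (1 + \<bar>of_int (snd (mode j))\<bar>)) \<le> freq k j - E"
  using freq_gap[OF k_brillouin \<delta> E mode_nonzero] .

lemma freq_gt: assumes "j \<noteq> k0" shows "freq k j > E"
proof -
  have "0 < gap \<delta> * ((1 + \<bar>of_int (fst (mode j))\<bar>) * (1 + \<bar>of_int (snd (mode j))\<bar>))"
    using gap_pos[OF \<delta>] by (intro mult_pos_pos add_pos_nonneg) auto
  then show ?thesis using gap_le[OF assms] by linarith
qed

lemma kernel: "mode_kernel \<kappa> (- {k0}) (sqrt (gap \<delta>)) ((\<Sum>j. lattice_weight j) / sqrt (gap \<delta>) ^ 3)"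
proof (rule mode_kernelI)
  fix j assume "j \<in> - {k0}"
  then show "sqrt (gap \<delta>) * sqrt ((1 + \<bar>of_int (fst (mode j))\<bar>) * (1 + \<bar>of_int (snd (mode j))\<bar>)) \<le> \<kappa> j"
    using gap_le[of j] by (simp add: \<kappa>_def flip: real_sqrt_mult)
qed (use gap_pos[OF \<delta>] in simp)

sublocale mk: mode_kernel "k \<bullet> a2" "k \<bullet> a3" \<kappa> "- {k0}" "sqrt (gap \<delta>)" "(\<Sum>j. lattice_weight j) / sqrt (gap \<delta>) ^ 3"
  by (rule kernel)

lemma u'_square_integrable: "integrable tube (\<lambda>z. (cmod (u' z))\<^sup>2)"
proof -
  have "integrable (hilb a2 a3) (\<lambda>y. (cmod (u y))\<^sup>2)" using guided by (simp add: guided_state_def dom_H_def L2_def)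
  moreover have "AE z in tube. (cmod (u (Phi z)))\<^sup>2 = (cmod (u' z))\<^sup>2" using u_eq by eventually_elim simp
  ultimately show ?thesis using hilb_integral(2)[of "\<lambda>z. (cmod (u' z))\<^sup>2" "\<lambda>y. (cmod (u y))\<^sup>2"] by simp
qed

lemma measurable_h [measurable]: "h \<in> borel_measurable tube"
  unfolding h_def[abs_def] by measurable

text \<open>With V = (1 + |x_1|) W'^2, the product V |u'| is at most V^2 + |u'|^2, and V <= K
  reduces V^2 to the integrable K V.\<close>

lemma h_weighted: "integrable tube (\<lambda>z. (1 + \<bar>fst z\<bar>) * cmod (h z))"
proof -
  let ?V = "\<lambda>z. (1 + \<bar>fst z\<bar>) * (W' z)\<^sup>2"
  have "integrable tube (\<lambda>z. g * (K * ?V z + (cmod (u' z))\<^sup>2))" using W_int u'_square_integrable by auto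
  then show ?thesis
  proof (rule Bochner_Integration.integrable_bound)
    show "AE z in tube. norm ((1 + \<bar>fst z\<bar>) * cmod (h z)) \<le> norm (g * (K * ?V z + (cmod (u' z))\<^sup>2))"
      using W_bound
    proof eventually_elim
      case (elim z)
      have V0: "0 \<le> ?V z" by simp
      have "0 \<le> (?V z - cmod (u' z))\<^sup>2 + (?V z)\<^sup>2 + (cmod (u' z))\<^sup>2" by simp
      then have "?V z * cmod (u' z) \<le> ?V z * ?V z + (cmod (u' z))\<^sup>2" by (simp add: power2_diff power2_eq_square algebra_simps)
      also have "\<dots> \<le> K * ?V z + (cmod (u' z))\<^sup>2" using mult_right_mono[OF elim V0] by simp
      finally have "g * (?V z * cmod (u' z)) \<le> g * (K * ?V z + (cmod (u' z))\<^sup>2)" using g by simp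
      moreover have "norm ((1 + \<bar>fst z\<bar>) * cmod (h z)) = g * (?V z * cmod (u' z))"
        using g by (simp add: h_def norm_mult abs_mult norm_power)
      ultimately show ?case unfolding real_norm_def by (metis abs_ge_self order_trans)
    qed
  qed measurable
qed

lemma decomposition_exists:
  assumes "fundamental_solution P P1 Q Q1 ((norm k)\<^sup>2 - E) C"
  shows "tube_decomposition (k \<bullet> a2) (k \<bullet> a3) \<kappa> (- {k0}) (sqrt (gap \<delta>)) ((\<Sum>j. lattice_weight j) / sqrt (gap \<delta>) ^ 3) P P1 Q Q1 ((norm k)\<^sup>2 - E) C k0 u' h"
proof -
  interpret G0: fundamental_solution P P1 Q Q1 "(norm k)\<^sup>2 - E" C by fact
  have "(if j = k0 then (norm k)\<^sup>2 - E else (\<kappa> j)\<^sup>2) = freq k j - E" for j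
    using freq_gt[of j] by (auto simp: \<kappa>_def freq_k0)
  note eq = this
  show ?thesis
  proof unfold_locales
    fix \<eta> \<eta>1 \<eta>2 j
    assume "smooth1 \<eta>" "\<And>t. (\<eta> has_vector_derivative \<eta>1 t) (at t)" "\<And>t. (\<eta>1 has_vector_derivative \<eta>2 t) (at t)"
      "\<exists>L. \<forall>t. \<bar>t\<bar> > L \<longrightarrow> \<eta> t = 0"
    then show "(\<integral>z. u' z * ((of_real (if j = k0 then (norm k)\<^sup>2 - E else (\<kappa> j)\<^sup>2) * \<eta> (fst z) - \<eta>2 (fst z)) * cnj (chr (k \<bullet> a2) (k \<bullet> a3) j (snd z))) \<partial>tube)
      = (\<integral>z. h z * (\<eta> (fst z) * cnj (chr (k \<bullet> a2) (k \<bullet> a3) j (snd z))) \<partial>tube)"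
      unfolding eq h_def by (intro mode_equation[OF guided W_meas u' u_eq W' W_eq])
  qed (simp_all add: h_weighted u'_square_integrable)
qed

text \<open>Both parts of the decomposition are integrals against \<open>h\<close>, so a vanishing
  \<open>h\<close> would make the guided state vanish.\<close>

lemma h_nonzero:
  assumes "fundamental_solution P P1 Q Q1 ((norm k)\<^sup>2 - E) C"
  shows "\<not> (AE z in tube. h z = 0)"
proof
  assume h0: "AE z in tube. h z = 0"
  interpret td: tube_decomposition "k \<bullet> a2" "k \<bullet> a3" \<kappa> "- {k0}" "sqrt (gap \<delta>)" "(\<Sum>j. lattice_weight j) / sqrt (gap \<delta>) ^ 3" P P1 Q Q1 "(norm k)\<^sup>2 - E" C k0 u' h
    using assms by (rule decomposition_exists)
  have "td.v0 x = 0" for x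
    unfolding td.v0_def by (rule integral_eq_zero_AE) (use h0 in \<open>auto elim: eventually_mono\<close>)
  moreover have "mk.F h z = 0" for z
    unfolding mk.F_def[OF td.h_integrable] by (rule integral_eq_zero_AE) (use h0 in \<open>auto elim: eventually_mono\<close>)
  ultimately have "AE z in tube. u' z = 0" using td.decomposition by (simp add: td.U0_def)
  then have "AE z in tube. u (Phi z) = 0" using u_eq by eventually_elim simp
  then show False using guided by (simp add: guided_state_def AE_hilb_iff)
qed

text \<open>When \<open>|k|\<^sup>2 \<le> E\<close>, the mode \<open>k0\<close> does not decay exponentially, and one uses for \<open>x\<^sub>1 \<ge> 0\<close> the
  fundamental solution vanishing to the left and for \<open>x\<^sub>1 \<le> 0\<close> the one vanishing to the right.\<close>

lemma small_coupling:
  assumes le: "(norm k)\<^sup>2 \<le> E"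
  shows "1 \<le> g * ((\<integral>z. (1 + \<bar>fst z\<bar>) * (W' z)\<^sup>2 \<partial>tube) + K * mk.bound)"
proof (rule ccontr)
  assume small: "\<not> ?thesis"
  define M where "M = (\<integral>w. (1 + \<bar>fst w\<bar>) * cmod (h w) \<partial>tube)"
  define l where "l = sqrt (E - (norm k)\<^sup>2)"
  have l: "l \<ge> 0" and q: "- l\<^sup>2 = (norm k)\<^sup>2 - E" using le by (auto simp: l_def)
  note fs = fundamental_solution_sin[OF l, unfolded q]
  define S where "S = (\<lambda>t. if l = 0 then t else sin (l * t) / l)"
  interpret r: tube_decomposition "k \<bullet> a2" "k \<bullet> a3" \<kappa> "- {k0}" "sqrt (gap \<delta>)" "(\<Sum>j. lattice_weight j) / sqrt (gap \<delta>) ^ 3"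
      "\<lambda>_. 0" "\<lambda>_. 0" "\<lambda>t. - S t" "\<lambda>t. - cos (l * t)" "(norm k)\<^sup>2 - E" 1 k0 u' h
    unfolding S_def by (rule decomposition_exists[OF fs(1)])
  interpret s: tube_decomposition "k \<bullet> a2" "k \<bullet> a3" \<kappa> "- {k0}" "sqrt (gap \<delta>)" "(\<Sum>j. lattice_weight j) / sqrt (gap \<delta>) ^ 3"
      S "\<lambda>t. cos (l * t)" "\<lambda>_. 0" "\<lambda>_. 0" "(norm k)\<^sup>2 - E" 1 k0 u' h
    unfolding S_def by (rule decomposition_exists[OF fs(2)])
  have S_le: "\<bar>S t\<bar> \<le> \<bar>t\<bar>" for t using fs(3)[of t] by (simp add: S_def)
  have v: "norm (\<integral>w. of_real (G w) * (cnj (chr (k \<bullet> a2) (k \<bullet> a3) k0 (snd w)) * h w) \<partial>tube) \<le> M"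
    if "\<And>w. \<bar>G w\<bar> \<le> \<bar>fst w\<bar>" for G
  proof -
    have "norm (of_real (G w) * (cnj (chr (k \<bullet> a2) (k \<bullet> a3) k0 (snd w)) * h w)) \<le> (1 + \<bar>fst w\<bar>) * cmod (h w)" for w
      using mult_right_mono[of "\<bar>G w\<bar>" "1 + \<bar>fst w\<bar>" "cmod (h w)"] that[of w] by (simp add: norm_mult)
    then show ?thesis unfolding M_def
      using h_weighted integral_norm_bound_integral by (intro order_trans[OF integral_norm_bound] integral_mono') auto
  qed
  \<comment> \<open>The kernel lives on fst w >= fst z >= 0, where |fst w - fst z| <= |fst w|: the
    growth of the solution is charged to the source point alone. \<open>U_s\<close> is the mirror
    image.\<close>
  have U_r: "norm (r.U0 z) \<le> M" if "fst z \<ge> 0" for z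
  proof -
    have "\<bar>r.G0.G (fst w - fst z)\<bar> \<le> \<bar>fst w\<bar>" for w :: "real \<times> real \<times> real"
      using S_le[of "fst w - fst z"] that by (auto simp: r.G0.G_def)
    from v[OF this] show ?thesis by (simp add: r.U0_def r.v0_def norm_mult)
  qed
  have U_s: "norm (s.U0 z) \<le> M" if "fst z \<le> 0" for z
  proof -
    have "\<bar>s.G0.G (fst w - fst z)\<bar> \<le> \<bar>fst w\<bar>" for w :: "real \<times> real \<times> real"
      using S_le[of "fst w - fst z"] that by (auto simp: s.G0.G_def)
    from v[OF this] show ?thesis by (simp add: s.U0_def s.v0_def norm_mult)
  qed
  have u'_le: "AE z in tube. cmod (u' z) \<le> M + cmod (mk.F h z)"
    using r.decomposition s.decomposition
  proof eventually_elim
    case (elim z)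
    show ?case
    proof (cases "fst z \<ge> 0")
      case True
      with U_r[OF True] elim(1) show ?thesis using norm_triangle_ineq[of "r.U0 z" "mk.F h z"] by simp
    next
      case False
      with U_s[of z] elim(2) show ?thesis using norm_triangle_ineq[of "s.U0 z" "mk.F h z"] by simp
    qed
  qed
  let ?V = "\<lambda>z. (1 + \<bar>fst z\<bar>) * (W' z)\<^sup>2"
  note h1 = r.h_integrable and F1 = mk.integrable_F[OF r.h_integrable]
  have M0: "M \<ge> 0" by (simp add: M_def)
  have hh: "(\<integral>w. norm (h w) \<partial>tube) \<le> M" unfolding M_def
    by (intro integral_mono h_weighted integrable_norm h1) (simp add: mult_le_cancel_right1)
  \<comment> \<open>\<open>K\<close> bounds a nonnegative function almost everywhere; the tube is
    not null, as otherwise \<open>h\<close> would vanish.\<close>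
  have K0: "K \<ge> 0"
  proof -
    have "AE z in tube. 0 \<le> K" using W_bound by eventually_elim (auto intro: order_trans[rotated])
    moreover have "\<not> (AE z in tube. False)"
    proof
      assume "AE z in tube. False"
      then have "AE z in tube. h z = 0" by eventually_elim simp
      with h_nonzero[OF fs(1)] show False by contradiction
    qed
    ultimately show ?thesis by (cases "0 \<le> K") auto
  qed
  \<comment> \<open>The bound |u'| <= M + |F h| is multiplied by g V: the first term keeps the
    integral of V, the second uses V <= K and the L^1 bound of \<open>F\<close>. The outcome M <= c
    M with c < 1 forces M = 0.\<close>
  have "M \<le> (\<integral>z. g * M * ?V z + g * K * norm (mk.F h z) \<partial>tube)"
  proof (subst M_def, rule integral_mono_AE[OF h_weighted])
    show "integrable tube (\<lambda>z. g * M * ?V z + g * K * norm (mk.F h z))" using W_int F1 by auto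
    show "AE z in tube. (1 + \<bar>fst z\<bar>) * cmod (h z) \<le> g * M * ?V z + g * K * norm (mk.F h z)"
      using u'_le W_bound
    proof eventually_elim
      case (elim z)
      have "(1 + \<bar>fst z\<bar>) * cmod (h z) = g * (?V z * cmod (u' z))" using g by (simp add: h_def norm_mult norm_power abs_mult)
      also have "\<dots> \<le> g * (?V z * (M + cmod (mk.F h z)))" using elim(1) g by (intro mult_left_mono) auto
      also have "\<dots> \<le> g * (M * ?V z + K * cmod (mk.F h z))"
        using mult_right_mono[OF elim(2), of "cmod (mk.F h z)"] g by (intro mult_left_mono) (auto simp: algebra_simps)
      finally show ?case by (simp add: algebra_simps)
    qed
  qed
  also have "\<dots> = g * M * (\<integral>z. ?V z \<partial>tube) + g * K * (\<integral>z. norm (mk.F h z) \<partial>tube)" using W_int F1 by simp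
  also have "\<dots> \<le> g * M * (\<integral>z. ?V z \<partial>tube) + g * K * (mk.bound * M)"
    using order_trans[OF mk.integral_norm_F[OF h1] mult_left_mono[OF hh mk.bound_nonneg]] K0 g by (intro add_left_mono mult_left_mono) auto
  also have "\<dots> = g * ((\<integral>z. ?V z \<partial>tube) + K * mk.bound) * M" by (simp add: algebra_simps)
  finally have "M \<le> g * ((\<integral>z. ?V z \<partial>tube) + K * mk.bound) * M" .
  moreover have "r * M < M" if "M > 0" "r < 1" for r using mult_strict_right_mono[OF that(2,1)] by simp
  ultimately have "M \<le> 0" using small by (meson not_le)
  with M0 have "(\<integral>w. (1 + \<bar>fst w\<bar>) * cmod (h w) \<partial>tube) = 0" unfolding M_def by (rule antisym[rotated])
  then have "AE z in tube. (1 + \<bar>fst z\<bar>) * cmod (h z) = 0"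
    by (subst (asm) integral_nonneg_eq_0_iff_AE[OF h_weighted]) auto
  then have "AE z in tube. h z = 0" by eventually_elim (smt (verit) mult_eq_0_iff norm_eq_zero abs_ge_zero)
  with h_nonzero[OF fs(1)] show False by contradiction
qed

section \<open>The case |k|^2 > E: an eigenfunction of the integral operator\<close>

lemma dual_lattice_bij:
  "bij_betw (\<lambda>j. of_int (fst (mode j)) *\<^sub>R dual_vec a2 + of_int (snd (mode j)) *\<^sub>R dual_vec a3) UNIV (dual_lattice a2 a3)"
  (is "bij_betw ?L _ _")
proof (rule bij_betw_imageI)
  have "mode i = mode j" if "?L i = ?L j" for i j
    using arg_cong[OF that, of "\<lambda>x. x \<bullet> a2"] arg_cong[OF that, of "\<lambda>x. x \<bullet> a3"]
    by (simp add: dual_inner prod_eq_iff)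
  then show "inj ?L" using bij_mode by (auto intro!: injI dest: bij_is_inj injD)
  show "range ?L = dual_lattice a2 a3"
  proof
    show "dual_lattice a2 a3 \<subseteq> range ?L"
    proof
      fix x assume "x \<in> dual_lattice a2 a3"
      then obtain m n where x: "x = of_int m *\<^sub>R dual_vec a2 + of_int n *\<^sub>R dual_vec a3" by (auto simp: dual_lattice_def)
      obtain j where "mode j = (m, n)" using bij_mode by (metis bij_pointE)
      then show "x \<in> range ?L" unfolding x by (intro range_eqI[of _ _ j]) simp
    qed
  qed (auto simp: dual_lattice_def)
qed

lemma inner_dual_Phi:
  "(k + (of_int (fst (mode j)) *\<^sub>R dual_vec a2 + of_int (snd (mode j)) *\<^sub>R dual_vec a3)) \<bullet> (snd (Phi z) - snd (Phi w))
    = (k \<bullet> a2 + 2 * pi * of_int (fst (mode j))) * fst (snd z - snd w) + (k \<bullet> a3 + 2 * pi * of_int (snd (mode j))) * snd (snd z - snd w)"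
proof -
  have "snd (Phi z) - snd (Phi w) = fst (snd z - snd w) *\<^sub>R a2 + snd (snd z - snd w) *\<^sub>R a3"
    by (simp add: Phi_def algebra_simps)
  then show ?thesis
    by (simp only: inner_add_right inner_scaleR_right inner_add_left[of k] dual_inner) (simp add: mult.commute)
qed

context
  assumes gt: "(norm k)\<^sup>2 > E"
begin

lemma freq_gt': "freq k j > E"
  using gt freq_gt[of j] by (cases "j = k0") (auto simp: freq_k0)

lemma \<kappa>_positive: "\<kappa> j > 0"
  using freq_gt'[of j] by (simp add: \<kappa>_def)

lemma fundamental_solution_k0:
  "fundamental_solution (\<lambda>t. exp (\<kappa> k0 * t) / (2 * \<kappa> k0)) (\<lambda>t. exp (\<kappa> k0 * t) / 2)
    (\<lambda>t. exp (- \<kappa> k0 * t) / (2 * \<kappa> k0)) (\<lambda>t. - exp (- \<kappa> k0 * t) / 2) ((norm k)\<^sup>2 - E) (max (1 / (2 * \<kappa> k0)) (1/2))"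
  using fundamental_solution_exp[OF \<kappa>_positive[of k0]] gt by (simp add: \<kappa>_def freq_k0)

text \<open>On negative reals the square root is i \<kappa>, so each lattice term is -2 i times a
  Green function times a character, and i beta (-2 i) = 2 beta = 1 / D. Absolute convergence for
  distinct first coordinates identifies the unordered lattice sum with the series.\<close>

lemma Gamma_kernel_series:
  assumes ne: "fst z \<noteq> fst w"
  shows "Gamma_kernel a2 a3 W k E (Phi z) (Phi w) = of_real (W (Phi z) * W (Phi w) / D) *
    (of_real (exp (- \<kappa> k0 * \<bar>fst z - fst w\<bar>) / (2 * \<kappa> k0)) * chr (k \<bullet> a2) (k \<bullet> a3) k0 (snd z - snd w)
      + mk.S (fst z - fst w) (snd z - snd w))"
proof -
  define r p where "r = fst z - fst w" and "p = snd z - snd w"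
  have r: "r \<noteq> 0" using ne by (simp add: r_def)
  define f where "f j = of_real (exp (- \<kappa> j * \<bar>r\<bar>) / (2 * \<kappa> j)) * chr (k \<bullet> a2) (k \<bullet> a3) j p" for j
  let ?L = "\<lambda>j. of_int (fst (mode j)) *\<^sub>R dual_vec a2 + of_int (snd (mode j)) *\<^sub>R dual_vec a3"
  let ?t = "\<lambda>K. exp (\<i> * csqrt (of_real (E - (norm (k + K))\<^sup>2)) * of_real \<bar>fst (Phi z) - fst (Phi w)\<bar>)
          / csqrt (of_real (E - (norm (k + K))\<^sup>2)) * exp (\<i> * of_real ((k + K) \<bullet> (snd (Phi z) - snd (Phi w))))"
  have t: "?t (?L j) = - 2 * \<i> * f j" for j
  proof -
    have n: "(norm (k + ?L j))\<^sup>2 = freq k j" by (simp add: freq_eq add.assoc)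
    have sq: "csqrt (of_real (E - (norm (k + ?L j))\<^sup>2)) = \<i> * of_real (\<kappa> j)"
      unfolding n using freq_gt'[of j] by (simp add: \<kappa>_def flip: of_real_diff)
    have e: "exp (\<i> * (\<i> * complex_of_real (\<kappa> j)) * of_real \<bar>fst (Phi z) - fst (Phi w)\<bar>) = of_real (exp (- \<kappa> j * \<bar>r\<bar>))"
      by (simp add: Phi_def r_def flip: exp_of_real mult.assoc)
    show ?thesis
      unfolding sq e inner_dual_Phi f_def chr_def p_def[symmetric] using \<kappa>_positive[of j] by (simp add: field_simps)
  qed
  have split: "f j = (if j = k0 then f k0 else 0) + of_real (mk.co j r) * chr (k \<bullet> a2) (k \<bullet> a3) j p" for j
    by (auto simp: f_def mk.co_def)
  have s1: "summable (\<lambda>j. norm (if j = k0 then f k0 else 0))" by (rule summable_finite[of "{k0}"]) auto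
  have s2: "summable (\<lambda>j. norm (of_real (mk.co j r) * chr (k \<bullet> a2) (k \<bullet> a3) j p))"
    using mk.co_summable[OF r] by (simp add: norm_mult mk.co_nonneg)
  have "norm (norm (f j)) \<le> norm (if j = k0 then f k0 else 0) + norm (of_real (mk.co j r) * chr (k \<bullet> a2) (k \<bullet> a3) j p)" for j
    unfolding real_norm_def abs_norm_cancel by (subst (1) split) (rule norm_triangle_ineq)
  then have sum_f: "summable (\<lambda>j. norm (f j))"
    by (intro summable_comparison_test[OF _ summable_add[OF s1 s2]]) blast
  have "(f has_sum suminf f) UNIV"
    by (rule norm_summable_imp_has_sum[OF sum_f summable_sums[OF summable_norm_cancel[OF sum_f]]])
  then have "((\<lambda>j. ?t (?L j)) has_sum (- 2 * \<i> * suminf f)) UNIV"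
    unfolding t by (rule has_sum_cmult_right)
  then have "(?t has_sum (- 2 * \<i> * suminf f)) (dual_lattice a2 a3)"
    using has_sum_reindex_bij_betw[OF dual_lattice_bij, of ?t] by simp
  then have inf: "infsum ?t (dual_lattice a2 a3) = - 2 * \<i> * suminf f" by (rule infsumI)
  have "suminf f = (\<Sum>j. if j = k0 then f k0 else 0) + mk.S r p"
    unfolding mk.S_def suminf_add[OF summable_norm_cancel[OF s1] summable_norm_cancel[OF s2]]
    by (rule suminf_cong) (rule split)
  also have "(\<Sum>j. if j = k0 then f k0 else 0) = f k0"
    using sums_unique[OF sums_single[of k0 "\<lambda>_. f k0"]] by simp
  finally have sf: "suminf f = f k0 + mk.S r p" .
  have c: "\<i> * of_real (measure lebesgue (brillouin a2 a3) / (8 * pi\<^sup>2)) * (- 2 * \<i>) = of_real (1 / D)"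
    unfolding measure_brillouin using D_pos by (simp add: field_simps)
  have "Gamma_kernel a2 a3 W k E (Phi z) (Phi w)
    = (\<i> * of_real (measure lebesgue (brillouin a2 a3) / (8 * pi\<^sup>2)) * (- 2 * \<i>)) * (of_real (W (Phi z)) * of_real (W (Phi w)) * suminf f)"
    unfolding Gamma_kernel_def inf by (simp only: mult_ac)
  then show ?thesis unfolding c sf by (simp add: f_def r_def p_def)
qed

lemma Gamma_eigenfunction:
  "AE z in tube. Gamma_op a2 a3 W k E (\<lambda>y. of_real (W y) * u y) (Phi z) = of_real (W' z) * u' z / of_real g"
proof -
  interpret td: tube_decomposition "k \<bullet> a2" "k \<bullet> a3" \<kappa> "- {k0}" "sqrt (gap \<delta>)" "(\<Sum>j. lattice_weight j) / sqrt (gap \<delta>) ^ 3"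
    "\<lambda>t. exp (\<kappa> k0 * t) / (2 * \<kappa> k0)" "\<lambda>t. exp (\<kappa> k0 * t) / 2" "\<lambda>t. exp (- \<kappa> k0 * t) / (2 * \<kappa> k0)" "\<lambda>t. - exp (- \<kappa> k0 * t) / 2"
    "(norm k)\<^sup>2 - E" "max (1 / (2 * \<kappa> k0)) (1/2)" k0 u' h
    by (rule decomposition_exists[OF fundamental_solution_k0])
  have G: "td.G0.G (y - x) = exp (- \<kappa> k0 * \<bar>x - y\<bar>) / (2 * \<kappa> k0)" for x y
    unfolding td.G0.G_def by (auto simp: abs_if algebra_simps)
  let ?S = "\<lambda>z w. mk.S (fst z - fst w) (snd z - snd w) * h w"
  let ?G = "\<lambda>z w. of_real (td.G0.G (fst w - fst z)) * (cnj (chr (k \<bullet> a2) (k \<bullet> a3) k0 (snd w)) * h w)"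
  have iG: "integrable tube (?G z)" for z by (rule td.v0_integrable)
  have wn: "AE w in tube. fst w \<noteq> c" for c :: real
  proof -
    have "{c} \<times> UNIV \<in> null_sets tube"
      unfolding null_sets_def tube_def using sets.top[of unit_square]
      by (auto simp: unit_square.emeasure_pair_measure_Times intro!: pair_measureI)
    then show ?thesis by (rule AE_I') auto
  qed
  show ?thesis
    using mk.AE_integrable_Sh[OF td.h_integrable] W_eq td.decomposition
  proof eventually_elim
    case (elim z)
    let ?c = "chr (k \<bullet> a2) (k \<bullet> a3) k0"
    let ?k = "\<lambda>w. of_real (W' z / (D * g)) * (?c (snd z) * ?G z w + ?S z w)"
    have i: "integrable tube ?k" using elim(1) iG by (intro integrable_mult_right Bochner_Integration.integrable_add) auto
    have "AE w in tube. Gamma_kernel a2 a3 W k E (Phi z) (Phi w) * (of_real (W (Phi w)) * u (Phi w)) = ?k w"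
      using wn[of "fst z"] W_eq u_eq
    proof eventually_elim
      case (elim w)
      then have ne: "fst z \<noteq> fst w" by simp
      have "of_real (g * (W' w)\<^sup>2) * u' w = h w" by (simp add: h_def)
      then have hw: "of_real (W' w) * (of_real (W' w) * u' w) = h w / of_real g" using g by (simp add: power2_eq_square field_simps)
      have "Gamma_kernel a2 a3 W k E (Phi z) (Phi w) * (of_real (W (Phi w)) * u (Phi w))
        = of_real (W' z / D) * (of_real (td.G0.G (fst w - fst z)) * (?c (snd z) * cnj (?c (snd w))) + mk.S (fst z - fst w) (snd z - snd w))
          * (of_real (W' w) * (of_real (W' w) * u' w))"
        unfolding Gamma_kernel_series[OF ne] elim(2,3) \<open>W (Phi z) = W' z\<close> G chr_diff by (simp add: mult_ac)
      also have "\<dots> = ?k w" unfolding hw by (simp add: field_simps)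
      finally show ?case .
    qed
    then have "Gamma_op a2 a3 W k E (\<lambda>y. of_real (W y) * u y) (Phi z) = D *\<^sub>R integral\<^sup>L tube ?k"
      unfolding Gamma_op_def using hilb_integral(3)[of ?k] i by auto
    also have "integral\<^sup>L tube ?k = of_real (W' z / (D * g)) * (td.U0 z + mk.F h z)"
    proof -
      have "(\<integral>w. ?c (snd z) * ?G z w + ?S z w \<partial>tube) = ?c (snd z) * (\<integral>w. ?G z w \<partial>tube) + (\<integral>w. ?S z w \<partial>tube)"
        unfolding Bochner_Integration.integral_add[OF integrable_mult_right[OF iG] elim(1)] by (simp only: integral_mult_right_zero)
      then show ?thesis unfolding td.U0_def td.v0_def mk.F_def[OF td.h_integrable] by (simp only: integral_mult_right_zero)
    qed
    also have "td.U0 z + mk.F h z = u' z" using elim(3) by simp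
    finally show ?case using D_pos g by (simp add: scaleR_conv_of_real)
  qed
qed

text \<open>W u is annihilated by 1 - g \<Gamma>, and it is nonzero, as otherwise \<open>h\<close>
  would vanish. The image of W u is zero only almost everywhere, so it is the norm bound on the
  inverse R that makes its value under R vanish, whereas R would have to return W u.\<close>

lemma large_momentum: "k \<in> C_set a2 a3 W g E"
proof -
  let ?M = "hilb a2 a3" and ?A = "\<lambda>f x. f x - of_real g * Gamma_op a2 a3 W k E f x" and ?f = "\<lambda>y. of_real (W y) * u y"
  have fW: "AE z in tube. ?f (Phi z) = of_real (W' z) * u' z" using W_eq u_eq by eventually_elim simp
  have fL: "?f \<in> L2 ?M"
  proof -
    have "AE z in tube. (cmod (?f (Phi z)))\<^sup>2 = (W' z)\<^sup>2 * (cmod (u' z))\<^sup>2"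
      using fW by eventually_elim (simp add: norm_mult power_mult_distrib)
    moreover have "integrable tube (\<lambda>z. (W' z)\<^sup>2 * (cmod (u' z))\<^sup>2)"
    proof (rule Bochner_Integration.integrable_bound)
      show "integrable tube (\<lambda>z. K * (cmod (u' z))\<^sup>2)" using u'_square_integrable by simp
      show "AE z in tube. norm ((W' z)\<^sup>2 * (cmod (u' z))\<^sup>2) \<le> norm (K * (cmod (u' z))\<^sup>2)"
        using W_bound
      proof eventually_elim
        case (elim z)
        have "1 * (W' z)\<^sup>2 \<le> (1 + \<bar>fst z\<bar>) * (W' z)\<^sup>2" by (intro mult_right_mono) auto
        with elim have "(W' z)\<^sup>2 \<le> \<bar>K\<bar>" by linarith
        then show ?case by (simp add: abs_mult mult_right_mono)
      qed
    qed measurable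
    ultimately have "integrable ?M (\<lambda>y. (cmod (?f y))\<^sup>2)"
      using hilb_integral(2)[of "\<lambda>z. (W' z)\<^sup>2 * (cmod (u' z))\<^sup>2"] by simp
    moreover have "?f \<in> borel_measurable ?M" using hilb_integral(1)[OF _ fW] by simp
    ultimately show ?thesis by (simp add: L2_def)
  qed
  have Af: "AE z in tube. ?A ?f (Phi z) = 0"
    using Gamma_eigenfunction fW by eventually_elim (use g in simp)
  have AfL: "?A ?f \<in> L2 ?M" and Af0: "L2norm ?M (?A ?f) = 0"
  proof -
    have z: "AE z in tube. (cmod (?A ?f (Phi z)))\<^sup>2 = 0" using Af by eventually_elim simp
    show "?A ?f \<in> L2 ?M"
      unfolding L2_def using hilb_integral(1)[of "\<lambda>_. 0", OF _ Af] hilb_integral(2)[of "\<lambda>_. 0", OF _ z] by simp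
    show "L2norm ?M (?A ?f) = 0"
      unfolding L2norm_def using hilb_integral(3)[of "\<lambda>_. 0", OF _ z] by simp
  qed
  have "\<not> boundedly_invertible ?M ?A"
  proof
    assume "boundedly_invertible ?M ?A"
    then obtain R where R: "bounded_L2_op ?M R" and inv: "\<forall>f\<in>L2 ?M. ?A f \<in> L2 ?M \<longrightarrow> (AE x in ?M. R (?A f) x = f x)"
      unfolding boundedly_invertible_def by blast
    obtain C where C: "L2norm ?M (R (?A ?f)) \<le> C * L2norm ?M (?A ?f)" and RL: "R (?A ?f) \<in> L2 ?M"
      using R AfL unfolding bounded_L2_op_def by blast
    have "(\<integral>y. (cmod (R (?A ?f) y))\<^sup>2 \<partial>?M) \<le> 0" using C unfolding Af0 by (simp add: L2norm_def)
    then have "(\<integral>y. (cmod (R (?A ?f) y))\<^sup>2 \<partial>?M) = 0" by (intro antisym integral_nonneg_AE) auto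
    then have "AE y in ?M. (cmod (R (?A ?f) y))\<^sup>2 = 0"
      using RL by (subst (asm) integral_nonneg_eq_0_iff_AE) (auto simp: L2_def)
    moreover have "AE y in ?M. R (?A ?f) y = ?f y" by (rule mp[OF bspec[OF inv fL] AfL])
    ultimately have "AE y in ?M. ?f y = 0" by eventually_elim auto
    then have "AE z in tube. ?f (Phi z) = 0" unfolding AE_hilb_iff .
    then have "AE z in tube. h z = 0" using fW by eventually_elim (auto simp: h_def)
    with h_nonzero[OF fundamental_solution_k0] show False by contradiction
  qed
  then show ?thesis using k_brillouin gt by (simp add: C_set_def)
qed

end

end

theorem corollary1p1:
  fixes a2 a3 :: "real^2" and \<delta> E \<eta> :: real and W :: "real \<times> (real^2) \<Rightarrow> real" and I :: "real set"
  assumes "a2 \<noteq> 0" and "a3 \<noteq> 0" and "a2 \<bullet> a3 = 0"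
    and "\<delta> > 0" and "0 < E" and "E < E_thr a2 a3 \<delta>"
    and W_meas: "W \<in> borel_measurable (lebesgue_on (strip a2 a3))"
    and W_bdd: "\<exists>C. AE x in lebesgue_on (strip a2 a3). \<bar>W x\<bar> \<le> C"
    and W_nonneg: "AE x in lebesgue_on (strip a2 a3). W x \<ge> 0"
    and W_nonzero: "\<not> (AE x in lebesgue_on (strip a2 a3). W x = 0)"
    and "\<eta> > 0"
    and W_decay: "\<exists>C. AE x in lebesgue_on (strip a2 a3).
                    \<bar>W x\<bar> \<le> C * (1 + \<bar>fst x\<bar>) powr (- (3 + \<eta>) / 2)"
    and W_C4: "AE x1 in lebesgue. Ck_on 4 (interior (cell a2 a3)) (\<lambda>xl. W (x1, xl)) \<and>
                 (\<exists>U. open U \<and> frontier (cell a2 a3) \<subseteq> U \<and>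
                      (\<forall>xl \<in> U \<inter> cell a2 a3. W (x1, xl) = 0))"
    and "is_interval I" and "\<not> bounded I"
    and W_zero: "AE x in lebesgue_on (strip a2 a3). fst x \<in> I \<longrightarrow> W x = 0"
  shows "\<exists>g0>0. \<forall>g. 0 < g \<and> g < g0 \<longrightarrow>
           (\<forall>k u. guided_state a2 a3 W g E k u \<longrightarrow> k \<in> C_set a2 a3 W g E)"
proof -
  interpret rect_lattice a2 a3 using assms(1-3) by unfold_locales
  obtain W' where W': "W' \<in> borel_measurable tube" "AE z in tube. W (Phi z) = W' z"
    using borel_representative[OF W_meas] by blast
  obtain C where "AE x in hilb a2 a3. \<bar>W x\<bar> \<le> C * (1 + \<bar>fst x\<bar>) powr (- (3 + \<eta>) / 2)"
    using W_decay by blast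
  then have "AE z in tube. \<bar>W' z\<bar> \<le> C * (1 + \<bar>fst z\<bar>) powr (- (3 + \<eta>) / 2)"
    unfolding AE_hilb_iff using W'(2) by eventually_elim (simp add: Phi_def)
  note pot = potential_bounds[OF W'(1) \<open>\<eta> > 0\<close> this]
  obtain k0 where k0: "mode k0 = (0, 0)" using bij_mode by (metis bij_pointE)
  let ?Z = "(\<Sum>j. lattice_weight j) / sqrt (gap \<delta>) ^ 3"
  \<comment> \<open>No constant here depends on \<open>k\<close> or \<open>g\<close>;
    \<open>C\<^sup>2\<close> plays the role of \<open>K\<close>. The absolute value yields B >= 0
    before an instance of \<open>mode_kernel\<close> is at hand, and 1 / (B + 1) is then a positive
    threshold.\<close>
  define B where "B = (\<integral>z. (1 + \<bar>fst z\<bar>) * (W' z)\<^sup>2 \<partial>tube) + C\<^sup>2 * \<bar>mode_kernel.bound (sqrt (gap \<delta>)) ?Z\<bar>"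
  have B: "B \<ge> 0" by (auto simp: B_def intro!: add_nonneg_nonneg integral_nonneg_AE)
  have "k \<in> C_set a2 a3 W g E" if g_bound: "0 < g" "g < 1 / (B + 1)" and gs: "guided_state a2 a3 W g E k u" for g k u
  proof -
    have "u \<in> borel_measurable (hilb a2 a3)" using gs by (simp add: guided_state_def dom_H_def L2_def)
    then obtain u' where u': "u' \<in> borel_measurable tube" "AE z in tube. u (Phi z) = u' z"
      by (rule borel_representative)
    interpret guided_mode a2 a3 W g E \<delta> "C\<^sup>2" k u W' u' k0
      using gs W_meas W' u' k0 assms(4,6) g_bound(1) pot by unfold_locales auto
    have "(norm k)\<^sup>2 > E"
    proof (rule ccontr)
      assume "\<not> ?thesis"
      then have "1 \<le> g * B" using small_coupling mk.bound_nonneg by (simp add: B_def)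
      also have "\<dots> \<le> g * (B + 1)" using g_bound by simp
      also have "\<dots> < 1" using g_bound(2) B by (simp add: field_simps)
      finally show False by simp
    qed
    then show ?thesis by (rule large_momentum)
  qed
  moreover have "1 / (B + 1) > 0" using B by simp
  ultimately show ?thesis by blast
qed

end
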